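(* Every oriented link $L$ in $S^3$ is half grid presentable: there exist a positive integer $n$ and a compatible pair of $n\times 2n$ half grid diagrams $\mathbb{H}_+$, $\mathbb{H}_-$ such that $\mathcal{L}(\mathbb{H}_+,\mathbb{H}_-)=L$ as oriented links (up to isotopy).
   Context: Grid diagram: an $m\times m$ grid of squares, each empty or containing an $X$ or an $O$, such that each row and each column contains exactly one $X$ and exactly one $O$ (in different squares). Its oriented link $\mathcal{L}(\mathbb{G})$ is obtained by joining $X$ to $O$ (oriented from $X$ to $O$) by a segment in each row and $O$ to $X$ (oriented from $O$ to $X$) by a segment in each column, with horizontal segments always crossing over vertical segments. Half grid diagram: an $n\times 2n$ grid ($n$ rows, $2n$ columns) of squares, each empty or containing an $X$ or an $O$, such that each row contains exactly two nonempty squares, one with an $X$ and one with an $O$, and each column contains exactly one nonempty square. Compatibility: two $n\times 2n$ half grid diagrams $\mathbb{H}_+,\mathbb{H}_-$ are compatible if for every $i$ the $i$-th column of $\mathbb{H}_+$ and the $i$-th column of $\mathbb{H}_-$ contain the same symbol. For a compatible pair, let $-\overline{\mathbb{H}_-}$ be obtained from $\mathbb{H}_-$ by flipping it upside down and exchanging all $X$'s and $O$'s; stacking $\mathbb{H}_+$ on top of $-\overline{\mathbb{H}_-}$ gives a $2n\times 2n$ grid diagram, denoted $(\mathbb{H}_+,\mathbb{H}_-)$, with oriented link $\mathcal{L}(\mathbb{H}_+,\mathbb{H}_-)$. *)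

theory Defs
  imports "HOL-Analysis.Analysis"
begin

section \<open>Oriented links and isotopy\<close>

text \<open>
  A component of an oriented link is represented by a simple closed path that traverses it in
  the positive direction; different parametrizations of the same oriented curve are identified
  in \<open>isotopic_links\<close> below.
\<close>

definition oriented_link :: "'a::topological_space set \<Rightarrow> (real \<Rightarrow> 'a) set \<Rightarrow> bool" where
  "oriented_link S K \<longleftrightarrow>
     finite K \<and> K \<noteq> {} \<and>
     (\<forall>\<gamma>\<in>K. simple_path \<gamma> \<and> pathfinish \<gamma> = pathstart \<gamma> \<and> path_image \<gamma> \<subseteq> S) \<and>
     pairwise (\<lambda>\<gamma> \<delta>. disjnt (path_image \<gamma>) (path_image \<delta>)) K"

text \<open>
  Two closed paths differ by an orientation preserving reparametrization of the circle: a change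
  of base point followed by an increasing homeomorphism of the unit interval.
\<close>

definition same_oriented_curve :: "(real \<Rightarrow> 'a::topological_space) \<Rightarrow> (real \<Rightarrow> 'a) \<Rightarrow> bool" where
  "same_oriented_curve \<gamma> \<delta> \<longleftrightarrow>
     (\<exists>a\<in>{0..1}. \<exists>\<phi> :: real \<Rightarrow> real.
        continuous_on {0..1} \<phi> \<and> strict_mono_on {0..1} \<phi> \<and> \<phi> 0 = 0 \<and> \<phi> 1 = 1 \<and>
        (\<forall>t\<in>{0..1}. \<delta> t = shiftpath a \<gamma> (\<phi> t)))"

definition ambient_isotopy :: "'a::topological_space set \<Rightarrow> (real \<Rightarrow> 'a \<Rightarrow> 'a) \<Rightarrow> bool" where
  "ambient_isotopy S H \<longleftrightarrow>
     continuous_on ({0..1} \<times> S) (\<lambda>(t, x). H t x) \<and>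
     (\<forall>t\<in>{0..1}. \<exists>g. homeomorphism S S (H t) g) \<and>
     (\<forall>x\<in>S. H 0 x = x)"

definition isotopic_links ::
  "'a::topological_space set \<Rightarrow> (real \<Rightarrow> 'a) set \<Rightarrow> (real \<Rightarrow> 'a) set \<Rightarrow> bool" where
  "isotopic_links S K K' \<longleftrightarrow>
     (\<exists>H f. ambient_isotopy S H \<and> bij_betw f K K' \<and>
        (\<forall>\<gamma>\<in>K. same_oriented_curve (H 1 \<circ> \<gamma>) (f \<gamma>)))"


section \<open>Polygonal links, and links in the 3-sphere\<close>

fun polyline :: "'a::real_normed_vector list \<Rightarrow> real \<Rightarrow> 'a" where
  "polyline [] = (\<lambda>_. 0)"
| "polyline [a] = linepath a a"
| "polyline [a, b] = linepath a b"
| "polyline (a # b # c # vs) = linepath a b +++ polyline (b # c # vs)"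

definition polygonal_link :: "(real \<Rightarrow> real^3) set \<Rightarrow> bool" where
  "polygonal_link P \<longleftrightarrow> oriented_link UNIV P \<and> (\<forall>\<gamma>\<in>P. \<exists>vs. \<gamma> = polyline vs)"

text \<open>The 3-sphere is the unit sphere of \<open>\<real>\<^sup>3 \<times> \<real> = \<real>\<^sup>4\<close>.\<close>

definition S3 :: "((real^3) \<times> real) set" where
  "S3 = sphere 0 1"

text \<open>Inverse stereographic projection from the north pole \<open>(0, 1)\<close>, which is the only point missed.\<close>

definition to_S3 :: "real^3 \<Rightarrow> (real^3) \<times> real" where
  "to_S3 x = ((2 / ((norm x)\<^sup>2 + 1)) *\<^sub>R x, ((norm x)\<^sup>2 - 1) / ((norm x)\<^sup>2 + 1))"

definition link_in_S3 :: "(real \<Rightarrow> real^3) set \<Rightarrow> (real \<Rightarrow> (real^3) \<times> real) set" where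
  "link_in_S3 K = (\<lambda>\<gamma>. to_S3 \<circ> \<gamma>) ` K"

text \<open>
  As usual in knot theory, links are tame: wild embeddings of circles are excluded by requiring
  the link to be isotopic to a polygonal one. All piecewise linear and all smooth links are tame.
\<close>

definition tame_link_S3 :: "(real \<Rightarrow> (real^3) \<times> real) set \<Rightarrow> bool" where
  "tame_link_S3 L \<longleftrightarrow>
     oriented_link S3 L \<and> (\<exists>P. polygonal_link P \<and> isotopic_links S3 (link_in_S3 P) L)"


section \<open>Grid diagrams\<close>

datatype mark = MarkX | MarkO

text \<open>
  Entry \<open>G i j\<close> is the content of the square in row \<open>i\<close> and column \<open>j\<close>, with \<open>None\<close> for an empty
  square. Rows are numbered from top to bottom and columns from left to right, both from \<open>0\<close>;
  entries outside the grid are irrelevant.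
\<close>

type_synonym grid = "nat \<Rightarrow> nat \<Rightarrow> mark option"

definition grid_diagram :: "nat \<Rightarrow> grid \<Rightarrow> bool" where
  "grid_diagram m G \<longleftrightarrow>
     (\<forall>i<m. \<forall>s. \<exists>!j. j < m \<and> G i j = Some s) \<and>
     (\<forall>j<m. \<forall>s. \<exists>!i. i < m \<and> G i j = Some s)"

definition half_grid_diagram :: "nat \<Rightarrow> grid \<Rightarrow> bool" where
  "half_grid_diagram n H \<longleftrightarrow>
     (\<forall>i<n. \<forall>s. \<exists>!j. j < 2 * n \<and> H i j = Some s) \<and>
     (\<forall>j<2 * n. \<exists>!i. i < n \<and> H i j \<noteq> None)"

definition compatible :: "nat \<Rightarrow> grid \<Rightarrow> grid \<Rightarrow> bool" where
  "compatible n Hp Hm \<longleftrightarrow>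
     (\<forall>j<2 * n. \<forall>s. (\<exists>i<n. Hp i j = Some s) \<longleftrightarrow> (\<exists>i<n. Hm i j = Some s))"

fun swap_mark :: "mark \<Rightarrow> mark" where
  "swap_mark MarkX = MarkO"
| "swap_mark MarkO = MarkX"

text \<open>The half grid diagram turned upside down with \<open>X\<close> and \<open>O\<close> exchanged.\<close>

definition neg_bar :: "nat \<Rightarrow> grid \<Rightarrow> grid" where
  "neg_bar n H = (\<lambda>i j. map_option swap_mark (H (n - 1 - i) j))"

definition stack :: "nat \<Rightarrow> grid \<Rightarrow> grid \<Rightarrow> grid" where
  "stack n Hp Hm = (\<lambda>i j. if i < n then Hp i j else neg_bar n Hm (i - n) j)"

lemma grid_diagram_stack:
  assumes p: "half_grid_diagram n Hp" and m: "half_grid_diagram n Hm" and c: "compatible n Hp Hm"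
  shows "grid_diagram (2 * n) (stack n Hp Hm)"
  unfolding grid_diagram_def
proof (intro conjI allI impI)
  have sw: "map_option swap_mark v = Some s \<longleftrightarrow> v = Some (swap_mark s)" for v s
    by (cases s; cases v) (auto elim: swap_mark.elims)
  {
    fix i s assume i: "i < 2 * n"
    show "\<exists>!j. j < 2 * n \<and> stack n Hp Hm i j = Some s"
    proof (cases "i < n")
      case True
      then show ?thesis using p by (simp add: stack_def half_grid_diagram_def)
    next
      case False
      then have "n - 1 - (i - n) < n" using i by auto
      then show ?thesis using m False unfolding half_grid_diagram_def stack_def neg_bar_def
        by (simp only: if_False sw)
    qed
  next
    fix j s assume j: "j < 2 * n"
    obtain a where a: "a < n" "Hp a j \<noteq> None" and ua: "\<And>i. i < n \<Longrightarrow> Hp i j \<noteq> None \<Longrightarrow> i = a"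
      using p j unfolding half_grid_diagram_def by metis
    obtain b where b: "b < n" "Hm b j \<noteq> None" and ub: "\<And>i. i < n \<Longrightarrow> Hm i j \<noteq> None \<Longrightarrow> i = b"
      using m j unfolding half_grid_diagram_def by metis
    obtain u where u: "Hp a j = Some u" using a by auto
    have ex: "\<exists>i<n. Hm i j = Some u"
      using c j a(1) u unfolding compatible_def by blast
    then have v: "Hm b j = Some u" using ub by (metis option.distinct(1))
    have top: "stack n Hp Hm i j = Some s \<longleftrightarrow> i = a \<and> s = u" if "i < n" for i
      using that u ua by (auto simp: stack_def)
    have bot: "stack n Hp Hm i j = Some s \<longleftrightarrow> i = 2 * n - 1 - b \<and> s \<noteq> u"
      if "\<not> i < n" "i < 2 * n" for i
    proof -
      have e: "stack n Hp Hm i j = Some s \<longleftrightarrow> Hm (n - 1 - (i - n)) j = Some (swap_mark s)"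
        using that(1) by (simp only: stack_def neg_bar_def if_False sw)
      have "n - 1 - (i - n) < n" and k: "n - 1 - (i - n) = b \<longleftrightarrow> i = 2 * n - 1 - b"
        using that b(1) by auto
      then have "Hm (n - 1 - (i - n)) j = Some (swap_mark s)
          \<longleftrightarrow> n - 1 - (i - n) = b \<and> swap_mark s = u"
        using v ub[of "n - 1 - (i - n)"] by (metis option.distinct(1) option.inject)
      moreover have "swap_mark s = u \<longleftrightarrow> s \<noteq> u" by (cases s; cases u) auto
      ultimately show ?thesis using e k by simp
    qed
    show "\<exists>!i. i < 2 * n \<and> stack n Hp Hm i j = Some s"
    proof (cases "s = u")
      case True
      show ?thesis
      proof (rule ex1I[of _ a])
        show "a < 2 * n \<and> stack n Hp Hm a j = Some s" using True top a(1) by auto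
        show "i = a" if "i < 2 * n \<and> stack n Hp Hm i j = Some s" for i
          using that True top bot by (cases "i < n") auto
      qed
    next
      case False
      show ?thesis
      proof (rule ex1I[of _ "2 * n - 1 - b"])
        have "\<not> 2 * n - 1 - b < n" "2 * n - 1 - b < 2 * n" using b(1) by auto
        then show "2 * n - 1 - b < 2 * n \<and> stack n Hp Hm (2 * n - 1 - b) j = Some s"
          using False bot by auto
        show "i = 2 * n - 1 - b" if "i < 2 * n \<and> stack n Hp Hm i j = Some s" for i
          using that False top bot by (cases "i < n") auto
      qed
    qed
  }
qed


section \<open>The oriented link of a grid diagram\<close>

definition mark_col :: "nat \<Rightarrow> grid \<Rightarrow> mark \<Rightarrow> nat \<Rightarrow> nat" where
  "mark_col m G s i = (THE j. j < m \<and> G i j = Some s)"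

definition mark_row :: "nat \<Rightarrow> grid \<Rightarrow> mark \<Rightarrow> nat \<Rightarrow> nat" where
  "mark_row m G s j = (THE i. i < m \<and> G i j = Some s)"

text \<open>
  The row reached from row \<open>i\<close> by following the link from the \<open>X\<close> to the \<open>O\<close> of row \<open>i\<close>, and then
  in the column of that \<open>O\<close> to its \<open>X\<close>.
\<close>

definition next_row :: "nat \<Rightarrow> grid \<Rightarrow> nat \<Rightarrow> nat" where
  "next_row m G i = mark_row m G MarkX (mark_col m G MarkO i)"

text \<open>
  The point at height \<open>z\<close> over the centre of the square in row \<open>i\<close> and column \<open>j\<close>. The first two
  coordinates are those of the plane of the diagram (rows go downwards, hence the sign), and the
  third one points towards the viewer.
\<close>

definition grid_point :: "nat \<Rightarrow> nat \<Rightarrow> real \<Rightarrow> real^3" where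
  "grid_point i j z = vector [real j, - real i, z]"

text \<open>
  Horizontal segments are placed at height \<open>1\<close> and vertical ones at height \<open>0\<close>, so that horizontal
  segments cross over vertical ones. They are connected by segments perpendicular to the plane of
  the diagram over the marked squares. The list below contains the vertices on the way from the
  \<open>X\<close> of row \<open>i\<close> to the \<open>X\<close> of the next row, the latter's vertex at height \<open>1\<close> excluded.
\<close>

definition row_vertices :: "nat \<Rightarrow> grid \<Rightarrow> nat \<Rightarrow> (real^3) list" where
  "row_vertices m G i =
     [grid_point i (mark_col m G MarkX i) 1,
      grid_point i (mark_col m G MarkO i) 1,
      grid_point i (mark_col m G MarkO i) 0,
      grid_point (next_row m G i) (mark_col m G MarkO i) 0]"

definition row_period :: "nat \<Rightarrow> grid \<Rightarrow> nat \<Rightarrow> nat" where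
  "row_period m G i = (LEAST p. p > 0 \<and> (next_row m G ^^ p) i = i)"

definition grid_component :: "nat \<Rightarrow> grid \<Rightarrow> nat \<Rightarrow> real \<Rightarrow> real^3" where
  "grid_component m G i =
     polyline (concat (map (\<lambda>k. row_vertices m G ((next_row m G ^^ k) i)) [0..<row_period m G i])
               @ [grid_point i (mark_col m G MarkX i) 1])"

text \<open>Each component is traversed starting at the least row through which it passes.\<close>

definition grid_link :: "nat \<Rightarrow> grid \<Rightarrow> (real \<Rightarrow> real^3) set" where
  "grid_link m G = {grid_component m G i | i. i < m \<and> (\<forall>k. i \<le> (next_row m G ^^ k) i)}"

definition half_grid_link :: "nat \<Rightarrow> grid \<Rightarrow> grid \<Rightarrow> (real \<Rightarrow> (real^3) \<times> real) set" where
  "half_grid_link n Hp Hm = link_in_S3 (grid_link (2 * n) (stack n Hp Hm))"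

end

theory Submission
  imports Defs
begin

text \<open>
  An isotopy of a polygonal configuration in \<open>\<real>\<^sup>3\<close> through simple ones along straight lines extends to an
  ambient isotopy: for small displacements, which are Lipschitz with a small constant, by extending
  the displacement to a compactly supported Lipschitz map of space, and in general by composition
  of finitely many such steps. It remains to move the polygons of the link through simple
  configurations to a grid.

  After a fine subdivision, each edge is replaced by a staircase: a vertical step to the level of
  the next vertex, followed by a horizontal row. Seen along the second coordinate axis, a row only
  crosses vertical steps. By breaking the rows into pieces of alternating sign one achieves
  that all these steps lie behind the rows of sign \<open>1\<close> and in front of the rows of sign \<open>-1\<close>. Then
  the rows can be pushed far away in the direction of their sign, and the two half spaces
  be turned by a quarter about the axis between them, like a book being opened. The result is a
  grid link in which each vertical segment joins the upper half (rows of sign \<open>1\<close>) to the lower half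
  (rows of sign \<open>-1\<close>), because the signs alternate along the link: its diagram is stacked from two
  half grid diagrams.
\<close>

section \<open>Compactly supported isotopies\<close>

text \<open>A row may pass in front of some vertical steps and behind others, so no single direction
  frees it; hence the breaking into pieces. Each break creates a new vertical step, which could
  obstruct other rows in turn. This is prevented by keeping the pieces of one edge in a band of
  levels narrower than the gaps between the old levels. The alternation of signs serves two ends:
  every obstacle finds a piece pointing the right way, and the two marks of each column fall into
  different halves of the grid. Replacing edges by staircases is safe between edges that are far
  apart, since a fine subdivision makes the change small. Adjacent edges have no positive distance;
  they are controlled by a horizontal direction in which both increase. It exists once the
  horizontal projections of consecutive edges are linearly independent, which a perturbation
  achieves. Every motion interpolates vertices linearly over a fixed index set and permutation, so
  each reduces to checking that all intermediate configurations are simple; unchanged curves are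
  merely subdivided to match the numbers of vertices.\<close>

lemma lipschitz_extension_compact_support:
  fixes f :: "'a::real_normed_vector \<Rightarrow> real"
  assumes "bounded K" "l > 0"
    and lip: "\<And>x y. x \<in> K \<Longrightarrow> y \<in> K \<Longrightarrow> \<bar>f x - f y\<bar> \<le> l * norm (x - y)"
    and bd: "\<And>x. x \<in> K \<Longrightarrow> \<bar>f x\<bar> \<le> M"
  shows "\<exists>g. (\<forall>x y. \<bar>g x - g y\<bar> \<le> l * norm (x - y)) \<and> (\<forall>x\<in>K. g x = f x) \<and>
             (\<exists>R. \<forall>x. norm x \<ge> R \<longrightarrow> g x = 0)"
proof (cases "K = {}")
  case True
  then show ?thesis using assms(2) by (intro exI[of _ "\<lambda>_. 0"]) auto
next
  case False
  then obtain k0 where k0: "k0 \<in> K" by auto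
  obtain r where r: "\<And>x. x \<in> K \<Longrightarrow> norm x \<le> r"
    using assms(1) by (auto simp: bounded_iff)
  \<comment> \<open>McShane's extension: the infimum of the cones of slope \<open>l\<close> standing
    on the graph of \<open>f\<close>.\<close>
  define G where "G x = (INF k\<in>K. f k + l * norm (x - k))" for x
  have bdb: "bdd_below ((\<lambda>k. f k + l * norm (x - k)) ` K)" for x
  proof (rule bdd_belowI2[of _ "-M"])
    fix k assume "k \<in> K"
    then have "- M \<le> f k" using bd[of k] by (simp add: abs_le_iff)
    moreover have "0 \<le> l * norm (x - k)" using assms(2) by auto
    ultimately show "- M \<le> f k + l * norm (x - k)" by linarith
  qed
  have G1: "G x \<le> G y + l * norm (x - y)" for x y
  proof -
    have "G x - l * norm (x - y) \<le> G y"
      unfolding G_def[of y]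
    proof (rule cINF_greatest[OF False])
      fix k assume k: "k \<in> K"
      have "G x \<le> f k + l * norm (x - k)"
        unfolding G_def by (rule cINF_lower[OF bdb k])
      moreover have "norm (x - k) \<le> norm (x - y) + norm (y - k)"
        using norm_triangle_ineq[of "x - y" "y - k"] by simp
      then have "l * norm (x - k) \<le> l * norm (x - y) + l * norm (y - k)"
        using assms(2) by (metis distrib_left mult_le_cancel_left_pos)
      ultimately show "G x - l * norm (x - y) \<le> f k + l * norm (y - k)" by linarith
    qed
    then show ?thesis by linarith
  qed
  have Glip: "\<bar>G x - G y\<bar> \<le> l * norm (x - y)" for x y
    using G1[of x y] G1[of y x] by (simp add: norm_minus_commute)
  have GK: "G x = f x" if x: "x \<in> K" for x
  proof (rule antisym)
    show "G x \<le> f x" using cINF_lower[OF bdb[of x] x] by (simp add: G_def)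
    show "f x \<le> G x" unfolding G_def
    proof (rule cINF_greatest[OF False])
      fix k assume k: "k \<in> K"
      show "f x \<le> f k + l * norm (x - k)" using lip[OF x k] by linarith
    qed
  qed
  \<comment> \<open>A cone of slope \<open>l\<close> that is at least \<open>M\<close> on
    \<open>K\<close> and vanishes far out. Clamping \<open>G\<close> between \<open>- h\<close> and
    \<open>h\<close> makes the support compact without changing the values on \<open>K\<close> or
    the Lipschitz constant.\<close>
  define h where "h x = max 0 (M + l * r - l * norm x)" for x :: 'a
  have hlip: "\<bar>h x - h y\<bar> \<le> l * norm (x - y)" for x y
  proof -
    have "\<bar>norm x - norm y\<bar> \<le> norm (x - y)" by (rule norm_triangle_ineq3)
    then have "l * \<bar>norm x - norm y\<bar> \<le> l * norm (x - y)" using assms(2) by simp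
    then have "\<bar>l * norm x - l * norm y\<bar> \<le> l * norm (x - y)"
      using assms(2) by (metis abs_mult abs_of_pos right_diff_distrib)
    then show ?thesis by (auto simp: h_def max_def)
  qed
  have hK: "M \<le> h x" if "x \<in> K" for x
  proof -
    have "l * norm x \<le> l * r" using r[OF that] assms(2) by simp
    then show ?thesis by (simp add: h_def)
  qed
  define g where "g x = max (- h x) (min (h x) (G x))" for x
  have "\<bar>g x - g y\<bar> \<le> l * norm (x - y)" for x y
    using hlip[of x y] Glip[of x y] by (auto simp: g_def max_def min_def)
  moreover have "g x = f x" if "x \<in> K" for x
    using hK[OF that] bd[OF that] GK[OF that] by (auto simp: g_def max_def min_def)
  moreover have "g x = 0" if "norm x \<ge> (M + l * r) / l" for x
  proof -
    have "M + l * r \<le> l * norm x" using that assms(2) by (simp add: field_simps)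
    then have "h x = 0" by (simp add: h_def)
    then show ?thesis by (simp add: g_def)
  qed
  ultimately show ?thesis by blast
qed

text \<open>Only bijectivity is recorded; continuity of the inverses is recovered from compactness
  after passing to the sphere. The radius is uniform in time, so that the isotopy extends to the
  point at infinity.\<close>

definition cs_isotopy :: "(real \<Rightarrow> 'a::real_normed_vector \<Rightarrow> 'a) \<Rightarrow> bool" where
  "cs_isotopy H \<longleftrightarrow> continuous_on ({0..1} \<times> UNIV) (\<lambda>(t, x). H t x) \<and>
     (\<forall>t\<in>{0..1}. bij (H t)) \<and> (\<forall>x. H 0 x = x) \<and>
     (\<exists>R. \<forall>t\<in>{0..1}. \<forall>x. norm x \<ge> R \<longrightarrow> H t x = x)"

lemma cs_isotopy_compose:
  assumes "cs_isotopy H" "cs_isotopy G"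
  shows "cs_isotopy (\<lambda>t x. G t (H t x))"
proof -
  obtain R S where R: "\<forall>t\<in>{0..1}. \<forall>x. norm x \<ge> R \<longrightarrow> H t x = x"
    and S: "\<forall>t\<in>{0..1}. \<forall>x. norm x \<ge> S \<longrightarrow> G t x = x"
    using assms by (auto simp: cs_isotopy_def)
  have "continuous_on ({0..1} \<times> UNIV) ((\<lambda>(t, x). G t x) \<circ> (\<lambda>p. (fst p, (\<lambda>(t, x). H t x) p)))"
  proof (rule continuous_on_compose)
    show "continuous_on ({0..1} \<times> UNIV) (\<lambda>p. (fst p, (\<lambda>(t, x). H t x) p))"
      using assms(1) by (intro continuous_intros) (auto simp: cs_isotopy_def)
    show "continuous_on ((\<lambda>p. (fst p, (\<lambda>(t, x). H t x) p)) ` ({0..1} \<times> UNIV)) (\<lambda>(t, x). G t x)"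
      by (rule continuous_on_subset[of "{0..1} \<times> UNIV"]) (use assms(2) in \<open>auto simp: cs_isotopy_def\<close>)
  qed
  then have "continuous_on ({0..1} \<times> UNIV) (\<lambda>(t, x). G t (H t x))"
    by (simp add: o_def case_prod_beta)
  moreover have "bij (\<lambda>x. G t (H t x))" if "t \<in> {0..1}" for t
    using bij_comp[of "H t" "G t"] assms that by (simp add: cs_isotopy_def o_def)
  moreover have "\<exists>R. \<forall>t\<in>{0..1}. \<forall>x. norm x \<ge> R \<longrightarrow> G t (H t x) = x"
    by (rule exI[of _ "max R S"]) (use R S in auto)
  ultimately show ?thesis using assms unfolding cs_isotopy_def by simp
qed

text \<open>Solving \<open>x + t *\<^sub>R g x = y\<close> means finding a fixed point of the map
  sending \<open>x\<close> to \<open>y - t *\<^sub>R g x\<close>, a contraction with factor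
  1/2.\<close>

lemma cs_isotopy_of_small_lipschitz:
  fixes g :: "'a::euclidean_space \<Rightarrow> 'a"
  assumes lip: "\<And>x y. norm (g x - g y) \<le> norm (x - y) / 2"
    and supp: "\<And>x. norm x \<ge> R \<Longrightarrow> g x = 0"
  shows "cs_isotopy (\<lambda>t x. x + t *\<^sub>R g x)"
  unfolding cs_isotopy_def
proof (intro conjI ballI)
  have g: "continuous_on UNIV g"
    unfolding continuous_on_iff
  proof (intro ballI allI impI)
    fix x :: 'a and e :: real assume "0 < e"
    then show "\<exists>d>0. \<forall>x'\<in>UNIV. dist x' x < d \<longrightarrow> dist (g x') (g x) < e"
      by (intro exI[of _ e]) (use lip in \<open>auto simp: dist_norm intro: le_less_trans\<close>, smt (verit) field_sum_of_halves lip norm_ge_zero)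
  qed
  have "continuous_on ({0..1::real} \<times> UNIV) (\<lambda>p. snd p + fst p *\<^sub>R g (snd p))"
    by (intro continuous_intros continuous_on_compose2[OF g]) auto
  then show "continuous_on ({0..1} \<times> UNIV) (\<lambda>(t, x). x + t *\<^sub>R g x)"
    by (simp add: case_prod_beta)
  fix t :: real assume t: "t \<in> {0..1}"
  have tl: "norm (t *\<^sub>R g x - t *\<^sub>R g y) \<le> norm (x - y) / 2" for x y
  proof -
    have "norm (t *\<^sub>R g x - t *\<^sub>R g y) = t * norm (g x - g y)"
      using t by (simp flip: scaleR_diff_right)
    also have "\<dots> \<le> norm (g x - g y)" using t by (simp add: mult_left_le_one_le)
    finally show ?thesis using lip[of x y] by linarith
  qed
  show "bij (\<lambda>x. x + t *\<^sub>R g x)"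
  proof (rule bijI)
    show "inj (\<lambda>x. x + t *\<^sub>R g x)"
    proof (rule injI)
      fix x y assume "x + t *\<^sub>R g x = y + t *\<^sub>R g y"
      then have "x - y = t *\<^sub>R g y - t *\<^sub>R g x" by (simp add: algebra_simps)
      then have "norm (x - y) \<le> norm (x - y) / 2" using tl[of y x] by (simp add: norm_minus_commute)
      then show "x = y" by simp
    qed
    show "surj (\<lambda>x. x + t *\<^sub>R g x)"
    proof (rule surjI)
      fix y
      have "\<exists>!x. y - t *\<^sub>R g x = x"
      proof (rule banach_fix_type[of "1/2"])
        show "\<forall>x z. dist (y - t *\<^sub>R g x) (y - t *\<^sub>R g z) \<le> 1 / 2 * dist x z"
          using tl by (auto simp: dist_norm norm_minus_commute)
      qed auto
      then have "\<exists>x. x + t *\<^sub>R g x = y" by (metis diff_add_cancel)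
      then show "(\<lambda>x. x + t *\<^sub>R g x) (SOME x. x + t *\<^sub>R g x = y) = y"
        by (metis (mono_tags, lifting) someI)
    qed
  qed
next
  show "\<exists>R. \<forall>t\<in>{0..1}. \<forall>x. R \<le> norm x \<longrightarrow> x + t *\<^sub>R g x = x" using supp by auto
qed auto

text \<open>Each coordinate of the displacement is extended separately with constant
  \<open>1 / (2 * DIM('a))\<close>, so that the sum over the basis has the constant 1/2 demanded by
  \<open>cs_isotopy_of_small_lipschitz\<close>.\<close>

lemma cs_isotopy_extends_small_displacement:
  fixes \<gamma> \<delta> :: "'t \<Rightarrow> 'a::euclidean_space"
  assumes "bounded (\<gamma> ` T)" "bounded (\<delta> ` T)"
    and sm: "\<And>p q. p \<in> T \<Longrightarrow> q \<in> T \<Longrightarrow>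
        norm ((\<delta> p - \<gamma> p) - (\<delta> q - \<gamma> q)) \<le> norm (\<gamma> p - \<gamma> q) / (2 * DIM('a))"
  shows "\<exists>H. cs_isotopy H \<and> (\<forall>p\<in>T. H 1 (\<gamma> p) = \<delta> p)"
proof -
  define l where "l = 1 / (2 * real DIM('a))"
  have l: "l > 0" by (simp add: l_def)
  define K where "K = \<gamma> ` T"
  \<comment> \<open>\<gamma> may take a value several times, as at common vertices;
    \<open>sm\<close> forces equal displacements there, so any preimage will do.\<close>
  define f where "f x = \<delta> (inv_into T \<gamma> x) - x" for x
  have f: "f (\<gamma> p) = \<delta> p - \<gamma> p" if p: "p \<in> T" for p
  proof -
    let ?q = "inv_into T \<gamma> (\<gamma> p)"
    have q: "?q \<in> T" "\<gamma> ?q = \<gamma> p" using p by (auto intro: inv_into_into f_inv_into_f)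
    have "norm ((\<delta> ?q - \<gamma> ?q) - (\<delta> p - \<gamma> p)) \<le> 0" using sm[OF q(1) p] q(2) by simp
    then show ?thesis using q(2) by (simp add: f_def)
  qed
  obtain M1 M2 where M1: "\<And>p. p \<in> T \<Longrightarrow> norm (\<gamma> p) \<le> M1" and M2: "\<And>p. p \<in> T \<Longrightarrow> norm (\<delta> p) \<le> M2"
    using assms(1,2) unfolding bounded_iff by blast
  have "\<exists>g. (\<forall>x y. \<bar>g x - g y\<bar> \<le> l * norm (x - y)) \<and> (\<forall>x\<in>K. g x = f x \<bullet> b) \<and>
             (\<exists>R. \<forall>x. norm x \<ge> R \<longrightarrow> g x = 0)" if b: "b \<in> Basis" for b
  proof (rule lipschitz_extension_compact_support)
    show "bounded K" using assms(1) by (simp add: K_def)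
    show "l > 0" by (rule l)
    fix x assume "x \<in> K"
    then obtain p where p: "p \<in> T" "x = \<gamma> p" by (auto simp: K_def)
    have "norm (f x) \<le> M2 + M1"
      using M1[OF p(1)] M2[OF p(1)] norm_triangle_ineq4[of "\<delta> p" "\<gamma> p"] f[OF p(1)] p(2) by simp
    then show "\<bar>f x \<bullet> b\<bar> \<le> M2 + M1" using Basis_le_norm[OF b, of "f x"] by linarith
    fix y assume "y \<in> K"
    then obtain q where q: "q \<in> T" "y = \<gamma> q" by (auto simp: K_def)
    have "\<bar>(f x - f y) \<bullet> b\<bar> \<le> norm (f x - f y)" by (rule Basis_le_norm[OF b])
    also have "\<dots> \<le> l * norm (x - y)" using sm[OF p(1) q(1)] f p q by (simp add: l_def)
    finally show "\<bar>f x \<bullet> b - f y \<bullet> b\<bar> \<le> l * norm (x - y)" by (simp add: inner_diff_left)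
  qed
  then obtain g where g1: "\<And>b x y. b \<in> Basis \<Longrightarrow> \<bar>g b x - g b y\<bar> \<le> l * norm (x - y)"
    and g2: "\<And>b x. b \<in> Basis \<Longrightarrow> x \<in> K \<Longrightarrow> g b x = f x \<bullet> b"
    and g3: "\<And>b. b \<in> Basis \<Longrightarrow> \<exists>R. \<forall>x. norm x \<ge> R \<longrightarrow> g b x = 0"
    by metis
  obtain R where R: "\<And>b x. b \<in> Basis \<Longrightarrow> norm x \<ge> R b \<Longrightarrow> g b x = 0" using g3 by metis
  define G where "G x = (\<Sum>b\<in>Basis. g b x *\<^sub>R b)" for x
  have "norm (G x - G y) \<le> norm (x - y) / 2" for x y
  proof -
    have "G x - G y = (\<Sum>b\<in>Basis. (g b x - g b y) *\<^sub>R b)"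
      by (simp add: G_def sum_subtractf scaleR_diff_left)
    also have "norm \<dots> \<le> (\<Sum>b\<in>Basis. norm ((g b x - g b y) *\<^sub>R b))" by (rule norm_sum)
    also have "\<dots> \<le> (\<Sum>b\<in>(Basis::'a set). l * norm (x - y))"
      by (rule sum_mono) (use g1 in auto)
    also have "\<dots> = norm (x - y) / 2" by (simp add: l_def)
    finally show ?thesis .
  qed
  moreover have "G x = 0" if "norm x \<ge> Max (R ` Basis)" for x
    unfolding G_def
  proof (rule sum.neutral, rule ballI)
    fix b :: 'a assume b: "b \<in> Basis"
    then have "R b \<le> norm x" using that by (meson Max_ge dual_order.trans finite_Basis finite_imageI imageI)
    then show "g b x *\<^sub>R b = 0" using R[OF b] by simp
  qed
  ultimately have "cs_isotopy (\<lambda>t x. x + t *\<^sub>R G x)" by (rule cs_isotopy_of_small_lipschitz)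
  moreover have "\<gamma> p + 1 *\<^sub>R G (\<gamma> p) = \<delta> p" if "p \<in> T" for p
  proof -
    have "G (\<gamma> p) = (\<Sum>b\<in>Basis. (f (\<gamma> p) \<bullet> b) *\<^sub>R b)"
      unfolding G_def by (rule sum.cong) (use g2 that in \<open>auto simp: K_def\<close>)
    then show ?thesis using f[OF that] by (simp add: euclidean_representation)
  qed
  ultimately show ?thesis by blast
qed

text \<open>The constant \<open>C\<close> may depend on \<tau>, so no uniform step length is given.
  Instead, the times reachable from each other in both directions form an equivalence relation with
  open classes, and the unit interval is connected.\<close>

lemma cs_isotopy_along_lines:
  fixes \<gamma> \<delta> :: "'t \<Rightarrow> 'a::euclidean_space"
  assumes "bounded (\<gamma> ` T)" "bounded (\<delta> ` T)"
    and C: "\<And>\<tau>. \<tau> \<in> {0..1} \<Longrightarrow> \<exists>C. \<forall>p\<in>T. \<forall>q\<in>T. norm ((\<delta> p - \<gamma> p) - (\<delta> q - \<gamma> q))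
           \<le> C * norm (((1 - \<tau>) *\<^sub>R \<gamma> p + \<tau> *\<^sub>R \<delta> p) - ((1 - \<tau>) *\<^sub>R \<gamma> q + \<tau> *\<^sub>R \<delta> q))"
  shows "\<exists>H. cs_isotopy H \<and> (\<forall>p\<in>T. H 1 (\<gamma> p) = \<delta> p)"
proof -
  define c where "c \<tau> p = (1 - \<tau>) *\<^sub>R \<gamma> p + \<tau> *\<^sub>R \<delta> p" for \<tau> p
  define D where "D p = \<delta> p - \<gamma> p" for p
  have cD: "c b p = c a p + (b - a) *\<^sub>R D p" for a b p
    by (simp add: c_def D_def algebra_simps)
  define J where "J a b \<longleftrightarrow> (\<exists>H. cs_isotopy H \<and> (\<forall>p\<in>T. H 1 (c a p) = c b p))" for a b
  have cb: "bounded (c a ` T)" for a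
  proof -
    obtain M1 M2 where M: "\<And>p. p \<in> T \<Longrightarrow> norm (\<gamma> p) \<le> M1" "\<And>p. p \<in> T \<Longrightarrow> norm (\<delta> p) \<le> M2"
      using assms(1,2) unfolding bounded_iff by blast
    have "norm (c a p) \<le> \<bar>1 - a\<bar> * M1 + \<bar>a\<bar> * M2" if "p \<in> T" for p
      unfolding c_def
      by (rule norm_triangle_le, rule add_mono) (use M[OF that] in \<open>auto intro: mult_left_mono\<close>)
    then show ?thesis unfolding bounded_iff by blast
  qed
  define n where "n = 2 * real DIM('a)"
  have n: "n \<ge> 1" using DIM_positive[where 'a='a] unfolding n_def by linarith
  have step: "J a b" if "\<And>p q. p \<in> T \<Longrightarrow> q \<in> T \<Longrightarrow> \<bar>b - a\<bar> * norm (D p - D q) \<le> norm (c a p - c a q) / n"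
    for a b
    unfolding J_def
  proof (rule cs_isotopy_extends_small_displacement[OF cb cb])
    fix p q assume "p \<in> T" "q \<in> T"
    have "c b p - c a p - (c b q - c a q) = (b - a) *\<^sub>R (D p - D q)"
      by (simp add: cD[of b _ a] algebra_simps)
    then show "norm (c b p - c a p - (c b q - c a q)) \<le> norm (c a p - c a q) / real (2 * DIM('a))"
      using that[OF \<open>p \<in> T\<close> \<open>q \<in> T\<close>] by (simp add: n_def)
  qed
  have "J 0 1 \<and> J 1 0"
  proof (rule connected_equivalence_relation[where S = "{0..1::real}" and R = "\<lambda>x y. J x y \<and> J y x"])
    show "J y x \<and> J x y" if "J x y \<and> J y x" for x y
      using that by auto
    have tr: "J x z" if "J x y" "J y z" for x y z
    proof -
      obtain H where H: "cs_isotopy H" "\<forall>p\<in>T. H 1 (c x p) = c y p"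
        using \<open>J x y\<close> unfolding J_def by auto
      obtain G where G: "cs_isotopy G" "\<forall>p\<in>T. G 1 (c y p) = c z p"
        using \<open>J y z\<close> unfolding J_def by auto
      show ?thesis unfolding J_def
        by (rule exI[of _ "\<lambda>t x. G t (H t x)"]) (use H G cs_isotopy_compose in auto)
    qed
    show "J x z \<and> J z x" if "J x y \<and> J y x" "J y z \<and> J z y" for x y z
      using tr that by blast
    fix a :: real assume a: "a \<in> {0..1}"
    obtain C0 where C0: "\<forall>p\<in>T. \<forall>q\<in>T. norm (D p - D q) \<le> C0 * norm (c a p - c a q)"
      using C[OF a] unfolding c_def D_def by blast
    define C1 where "C1 = max C0 1"
    have C1: "norm (D p - D q) \<le> C1 * norm (c a p - c a q)" if "p \<in> T" "q \<in> T" for p q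
    proof -
      have "C0 * norm (c a p - c a q) \<le> C1 * norm (c a p - c a q)"
        by (rule mult_right_mono) (auto simp: C1_def)
      then show ?thesis using C0 that by force
    qed
    have C1p: "C1 \<ge> 1" by (simp add: C1_def)
    \<comment> \<open>Half of the admissible displacement is left over: it compensates for measuring
      distances at \<open>b\<close> instead of \<open>a\<close> in the step back from
      \<open>b\<close> to \<open>a\<close>.\<close>
    define d where "d = 1 / (2 * C1 * n)"
    have d: "d > 0" using C1p n by (simp add: d_def)
    show "\<exists>S. openin (top_of_set {0..1}) S \<and> a \<in> S \<and> (\<forall>x\<in>S. J a x \<and> J x a)"
    proof (intro exI conjI ballI)
      show "openin (top_of_set {0..1}) ({0..1} \<inter> ball a d)" by (simp add: openin_open_Int)
      show "a \<in> {0..1} \<inter> ball a d" using a d by simp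
      fix b assume "b \<in> {0..1} \<inter> ball a d"
      then have ab: "\<bar>b - a\<bar> < d" by (simp add: dist_real_def abs_minus_commute)
      have key: "\<bar>b - a\<bar> * norm (D p - D q) \<le> norm (c a p - c a q) / (2 * n)" if "p \<in> T" "q \<in> T" for p q
      proof -
        have "\<bar>b - a\<bar> * norm (D p - D q) \<le> d * (C1 * norm (c a p - c a q))"
          by (rule mult_mono) (use ab C1[OF that] d in auto)
        also have "\<dots> = norm (c a p - c a q) / (2 * n)" using C1p by (simp add: d_def)
        finally show ?thesis .
      qed
      show "J a b"
      proof (rule step)
        fix p q assume pq: "p \<in> T" "q \<in> T"
        have "norm (c a p - c a q) / (2 * n) \<le> norm (c a p - c a q) / n"
          using n by (simp add: field_simps)
        then show "\<bar>b - a\<bar> * norm (D p - D q) \<le> norm (c a p - c a q) / n" using key[OF pq] by linarith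
      qed
      show "J b a"
      proof (rule step)
        fix p q assume pq: "p \<in> T" "q \<in> T"
        have "c a p - c a q = (c b p - c b q) - (b - a) *\<^sub>R (D p - D q)"
          by (simp add: cD[of b _ a] algebra_simps)
        then have "norm (c a p - c a q) \<le> norm (c b p - c b q) + \<bar>b - a\<bar> * norm (D p - D q)"
          by (metis norm_scaleR norm_triangle_ineq4 real_norm_def)
        moreover have "norm (c a p - c a q) / (2 * n) \<le> norm (c a p - c a q) / 2"
          using n mult_right_mono[OF n norm_ge_zero, of "c a p - c a q"] by (simp add: field_simps)
        ultimately have "norm (c a p - c a q) / 2 \<le> norm (c b p - c b q)" using key[OF pq] by linarith
        then have "norm (c a p - c a q) / (2 * n) \<le> norm (c b p - c b q) / n"
          using n by (simp add: field_simps)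
        then show "\<bar>a - b\<bar> * norm (D p - D q) \<le> norm (c b p - c b q) / n"
          using key[OF pq] by (simp add: abs_minus_commute)
      qed
    qed
  qed auto
  then show ?thesis by (simp add: J_def c_def)
qed

section \<open>Polygonal configurations\<close>

text \<open>A configuration consists of the edges from \<open>v i\<close> to \<open>v (\<sigma> i)\<close> for \<open>i \<in> I\<close>; its polygons are the
  cycles of the permutation \<open>\<sigma>\<close>.\<close>

definition pt :: "('i \<Rightarrow> 'i) \<Rightarrow> ('i \<Rightarrow> 'a::real_vector) \<Rightarrow> 'i \<Rightarrow> real \<Rightarrow> 'a" where
  "pt \<sigma> v i s = (1 - s) *\<^sub>R v i + s *\<^sub>R v (\<sigma> i)"

text \<open>Edges are half open, so that a vertex shared by consecutive edges counts once, as the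
  start of the later one.\<close>

definition simple_poly :: "'i set \<Rightarrow> ('i \<Rightarrow> 'i) \<Rightarrow> ('i \<Rightarrow> 'a::real_vector) \<Rightarrow> bool" where
  "simple_poly I \<sigma> v \<longleftrightarrow> finite I \<and> bij_betw \<sigma> I I \<and>
     (\<forall>i\<in>I. \<forall>j\<in>I. \<forall>s\<in>{0..<1}. \<forall>t\<in>{0..<1}. pt \<sigma> v i s = pt \<sigma> v j t \<longrightarrow> i = j \<and> s = t)"

lemma simple_polyD:
  assumes "simple_poly I \<sigma> v" "pt \<sigma> v i s = pt \<sigma> v j t" "i \<in> I" "j \<in> I"
    "0 \<le> s" "s < 1" "0 \<le> t" "t < 1"
  shows "i = j \<and> s = t"
proof -
  have "s \<in> {0..<1}" "t \<in> {0..<1}" using assms(5-8) by auto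
  with assms(1-4) show ?thesis unfolding simple_poly_def by blast
qed

lemma pt_0 [simp]: "pt \<sigma> v i 0 = v i" and pt_1 [simp]: "pt \<sigma> v i 1 = v (\<sigma> i)"
  by (simp_all add: pt_def)

lemma pt_fixed: "\<sigma> i = i \<Longrightarrow> pt \<sigma> v i s = v i"
  by (simp add: pt_def algebra_simps)

lemma pt_lincomb: "pt \<sigma> (\<lambda>i. a *\<^sub>R v i + b *\<^sub>R w i) i s = a *\<^sub>R pt \<sigma> v i s + b *\<^sub>R pt \<sigma> w i s"
  by (simp add: pt_def algebra_simps)

lemma pt_diff: "pt \<sigma> (\<lambda>i. v i - w i) i s = pt \<sigma> v i s - pt \<sigma> w i s"
  by (simp add: pt_def algebra_simps)

lemma norm_pt_le:
  assumes "norm (v i) \<le> M" "norm (v (\<sigma> i)) \<le> M" "s \<in> {0..1}"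
  shows "norm (pt \<sigma> v i s) \<le> M"
proof -
  have "norm (pt \<sigma> v i s) \<le> (1 - s) * norm (v i) + s * norm (v (\<sigma> i))"
    unfolding pt_def using assms(3) norm_triangle_ineq[of "(1 - s) *\<^sub>R v i" "s *\<^sub>R v (\<sigma> i)"] by simp
  also have "\<dots> \<le> (1 - s) * M + s * M"
    by (intro add_mono mult_left_mono) (use assms in auto)
  finally show ?thesis by (simp add: algebra_simps)
qed

lemma simple_poly_next_in: "simple_poly I \<sigma> v \<Longrightarrow> i \<in> I \<Longrightarrow> \<sigma> i \<in> I"
  by (auto simp: simple_poly_def bij_betw_def)

lemma simple_poly_next_inj: "simple_poly I \<sigma> v \<Longrightarrow> i \<in> I \<Longrightarrow> j \<in> I \<Longrightarrow> \<sigma> i = \<sigma> j \<Longrightarrow> i = j"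
  by (auto simp: simple_poly_def bij_betw_def inj_on_def)

lemma simple_poly_vertex_inj: "simple_poly I \<sigma> v \<Longrightarrow> i \<in> I \<Longrightarrow> j \<in> I \<Longrightarrow> v i = v j \<Longrightarrow> i = j"
  using simple_polyD[of I \<sigma> v i 0 j 0] by simp

lemma simple_poly_next_ne:
  assumes "simple_poly I \<sigma> v" "i \<in> I"
  shows "\<sigma> i \<noteq> i"
proof
  assume "\<sigma> i = i"
  then have "pt \<sigma> v i 0 = pt \<sigma> v i (1/2)" by (simp add: pt_fixed)
  from simple_polyD[OF assms(1) this assms(2,2)] show False by simp
qed

lemma simple_poly_next2_ne:
  assumes "simple_poly I \<sigma> v" "i \<in> I"
  shows "\<sigma> (\<sigma> i) \<noteq> i"
proof
  assume "\<sigma> (\<sigma> i) = i"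
  then have "pt \<sigma> v i (1/2) = pt \<sigma> v (\<sigma> i) (1/2)" by (simp add: pt_def)
  then have "i = \<sigma> i"
    using simple_polyD[OF assms(1), of i "1/2" "\<sigma> i" "1/2"] simple_poly_next_in[OF assms] assms(2) by simp
  then show False using simple_poly_next_ne[OF assms] by simp
qed

text \<open>A point of a closed edge lies on a half-open one: on the same edge or, if it is the end,
  on the successor. The conditions on the indices keep these half-open edges different.\<close>

lemma simple_poly_nonadjacent_disjoint:
  assumes v: "simple_poly I \<sigma> v" and ij: "i \<in> I" "j \<in> I" "i \<noteq> j" "j \<noteq> \<sigma> i" "i \<noteq> \<sigma> j"
    and st: "s \<in> {0..1}" "t \<in> {0..1}"
  shows "pt \<sigma> v i s \<noteq> pt \<sigma> v j t"
proof
  assume eq: "pt \<sigma> v i s = pt \<sigma> v j t"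
  have half_open: "\<exists>k' r'. k' \<in> I \<and> r' \<in> {0..<1} \<and> pt \<sigma> v k r = pt \<sigma> v k' r' \<and> (k' = k \<or> k' = \<sigma> k)"
    if "k \<in> I" "r \<in> {0..1}" for k r
  proof (cases "r = 1")
    case True
    then show ?thesis using simple_poly_next_in[OF v that(1)]
      by (intro exI[of _ "\<sigma> k"] exI[of _ 0]) auto
  next
    case False
    then show ?thesis using that by (intro exI[of _ k] exI[of _ r]) auto
  qed
  obtain i' s' where i': "i' \<in> I" "s' \<in> {0..<1}" "pt \<sigma> v i s = pt \<sigma> v i' s'" "i' = i \<or> i' = \<sigma> i"
    using half_open[OF ij(1) st(1)] by metis
  obtain j' t' where j': "j' \<in> I" "t' \<in> {0..<1}" "pt \<sigma> v j t = pt \<sigma> v j' t'" "j' = j \<or> j' = \<sigma> j"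
    using half_open[OF ij(2) st(2)] by metis
  have "i' = j'" using simple_polyD[OF v, of i' s' j' t'] i' j' eq by auto
  then show False using i'(4) j'(4) ij simple_poly_next_inj[OF v ij(1,2)] by auto
qed

text \<open>Adjacent edges make an angle, so the distance of points on them is comparable with their
  distance along the polygon.\<close>

lemma simple_poly_pair_bound_adjacent:
  fixes v :: "'i \<Rightarrow> 'a::real_normed_vector"
  assumes v: "simple_poly I \<sigma> v" and i: "i \<in> I"
  shows "\<exists>K>0. \<forall>d M s t. (\<forall>k\<in>I. norm (d k) \<le> M) \<longrightarrow> s \<in> {0..1} \<longrightarrow> t \<in> {0..1} \<longrightarrow>
      norm (pt \<sigma> d i s - pt \<sigma> d (\<sigma> i) t :: 'a) \<le> K * M * norm (pt \<sigma> v i s - pt \<sigma> v (\<sigma> i) t)"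
proof -
  note nx = simple_poly_next_in[OF v]
  define a b where "a = v i - v (\<sigma> i)" and "b = v (\<sigma> i) - v (\<sigma> (\<sigma> i))"
  have dif: "pt \<sigma> v i s - pt \<sigma> v (\<sigma> i) t = (1 - s) *\<^sub>R a + t *\<^sub>R b" for s t
    by (simp add: pt_def a_def b_def algebra_simps)
  have pos: "(1 - \<beta>) *\<^sub>R a + \<beta> *\<^sub>R b \<noteq> 0" if "\<beta> \<in> {0..1}" for \<beta>
  proof (cases "\<beta> = 1")
    case True
    then show ?thesis using simple_poly_vertex_inj[OF v, of "\<sigma> i" "\<sigma> (\<sigma> i)"]
        simple_poly_next_ne[OF v, of "\<sigma> i"] nx i by (auto simp: b_def)
  next
    case False
    then show ?thesis unfolding dif[symmetric]
      using simple_polyD[OF v, of i \<beta> "\<sigma> i" \<beta>] that i nx simple_poly_next_ne[OF v i] by fastforce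
  qed
  \<comment> \<open>The convex combinations of \<open>a\<close> and \<open>b\<close> have a positive
    minimal norm; by homogeneity \<open>low\<close> carries this bound over to all non-negative
    combinations.\<close>
  have "continuous_on {0..1} (\<lambda>\<beta>::real. norm ((1 - \<beta>) *\<^sub>R a + \<beta> *\<^sub>R b))" by (intro continuous_intros)
  from continuous_attains_inf[OF _ _ this] obtain \<beta>0 where \<beta>0: "\<beta>0 \<in> {0..1}"
    and mn: "\<And>\<beta>. \<beta> \<in> {0..1} \<Longrightarrow> norm ((1 - \<beta>0) *\<^sub>R a + \<beta>0 *\<^sub>R b) \<le> norm ((1 - \<beta>) *\<^sub>R a + \<beta> *\<^sub>R b)"
    by auto
  define c where "c = norm ((1 - \<beta>0) *\<^sub>R a + \<beta>0 *\<^sub>R b)"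
  have c: "c > 0" using pos[OF \<beta>0] by (simp add: c_def)
  have low: "c * (p + q) \<le> norm (p *\<^sub>R a + q *\<^sub>R b)" if "p \<ge> 0" "q \<ge> 0" for p q
  proof (cases "p + q = 0")
    case False
    then have pq: "p + q > 0" using that by auto
    have "c \<le> norm ((1 - q / (p + q)) *\<^sub>R a + (q / (p + q)) *\<^sub>R b)"
      unfolding c_def by (rule mn) (use that pq in auto)
    also have "(1 - q / (p + q)) *\<^sub>R a + (q / (p + q)) *\<^sub>R b = (1 / (p + q)) *\<^sub>R (p *\<^sub>R a + q *\<^sub>R b)"
      using pq by (simp add: scaleR_add_right field_simps)
    also have "norm \<dots> = norm (p *\<^sub>R a + q *\<^sub>R b) / (p + q)" using pq by simp
    finally show ?thesis using pq by (simp add: field_simps)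
  qed (use that in auto)
  show ?thesis
  proof (intro exI[of _ "2 / c"] conjI allI impI)
    show "2 / c > 0" using c by simp
    fix d :: "'i \<Rightarrow> 'a" and M s t :: real
    assume d: "\<forall>k\<in>I. norm (d k) \<le> M" and st: "s \<in> {0..1}" "t \<in> {0..1}"
    have M: "0 \<le> M" using d i by (meson norm_ge_zero order_trans)
    have dd: "norm (d k - d (\<sigma> k)) \<le> 2 * M" if "k \<in> I" for k
    proof -
      have "norm (d k) \<le> M" "norm (d (\<sigma> k)) \<le> M" using d that nx[OF that] by auto
      then show ?thesis using norm_triangle_ineq4[of "d k" "d (\<sigma> k)"] by linarith
    qed
    have "pt \<sigma> d i s - pt \<sigma> d (\<sigma> i) t = (1 - s) *\<^sub>R (d i - d (\<sigma> i)) + t *\<^sub>R (d (\<sigma> i) - d (\<sigma> (\<sigma> i)))"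
      by (simp add: pt_def algebra_simps)
    also have "norm \<dots> \<le> (1 - s) * (2 * M) + t * (2 * M)"
    proof (rule norm_triangle_le, rule add_mono)
      show "norm ((1 - s) *\<^sub>R (d i - d (\<sigma> i))) \<le> (1 - s) * (2 * M)"
        using st dd[OF i] by (auto intro: mult_left_mono)
      show "norm (t *\<^sub>R (d (\<sigma> i) - d (\<sigma> (\<sigma> i)))) \<le> t * (2 * M)"
        using st dd[OF nx[OF i]] by (auto intro: mult_left_mono)
    qed
    also have "\<dots> = 2 / c * M * (c * ((1 - s) + t))" using c by (simp add: field_simps)
    also have "\<dots> \<le> 2 / c * M * norm ((1 - s) *\<^sub>R a + t *\<^sub>R b)"
      by (rule mult_left_mono[OF low]) (use st c M in auto)
    finally show "norm (pt \<sigma> d i s - pt \<sigma> d (\<sigma> i) t) \<le> 2 / c * M * norm (pt \<sigma> v i s - pt \<sigma> v (\<sigma> i) t)"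
      by (simp only: dif)
  qed
qed

lemma simple_poly_far_apart:
  fixes v :: "'i \<Rightarrow> 'a::real_normed_vector"
  assumes v: "simple_poly I \<sigma> v" and ij: "i \<in> I" "j \<in> I" "i \<noteq> j" "j \<noteq> \<sigma> i" "i \<noteq> \<sigma> j"
  shows "\<exists>c>0. \<forall>s\<in>{0..1}. \<forall>t\<in>{0..1}. c \<le> norm (pt \<sigma> v i s - pt \<sigma> v j t)"
proof -
  define f where "f z = norm (pt \<sigma> v i (fst z) - pt \<sigma> v j (snd z))" for z
  have "continuous_on ({0..1} \<times> {0..1}) f"
    unfolding f_def pt_def by (intro continuous_intros)
  from continuous_attains_inf[OF _ _ this] obtain z where z: "z \<in> {0..1} \<times> {0..1}"
    and mn: "\<And>y. y \<in> {0..1} \<times> {0..1} \<Longrightarrow> f z \<le> f y" by (auto simp: compact_Times)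
  have "f z > 0" using simple_poly_nonadjacent_disjoint[OF v ij] z by (auto simp: f_def)
  moreover have "f z \<le> norm (pt \<sigma> v i s - pt \<sigma> v j t)" if "s \<in> {0..1}" "t \<in> {0..1}" for s t
    using mn[of "(s, t)"] that by (simp add: f_def)
  ultimately show ?thesis by blast
qed

text \<open>On one edge both sides are proportional to the difference of the parameters; on adjacent
  edges the angle gives the bound; otherwise the distance on the right is bounded below while the
  left side is at most \<open>2 * M\<close>.\<close>

lemma simple_poly_pair_bound:
  fixes v :: "'i \<Rightarrow> 'a::real_normed_vector"
  assumes v: "simple_poly I \<sigma> v" and i: "i \<in> I" and j: "j \<in> I"
  shows "\<exists>K>0. \<forall>d M s t. (\<forall>k\<in>I. norm (d k) \<le> M) \<longrightarrow> s \<in> {0..1} \<longrightarrow> t \<in> {0..1} \<longrightarrow>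
      norm (pt \<sigma> d i s - pt \<sigma> d j t :: 'a) \<le> K * M * norm (pt \<sigma> v i s - pt \<sigma> v j t)"
proof -
  note nx = simple_poly_next_in[OF v]
  consider "i = j" | "j = \<sigma> i" | "i = \<sigma> j" | "i \<noteq> j" "j \<noteq> \<sigma> i" "i \<noteq> \<sigma> j" by blast
  then show ?thesis
  proof cases
    case 1
    have ne: "v i \<noteq> v (\<sigma> i)"
    proof
      assume "v i = v (\<sigma> i)"
      from simple_poly_vertex_inj[OF v i nx[OF i] this] show False
        using simple_poly_next_ne[OF v i] by simp
    qed
    define c where "c = norm (v i - v (\<sigma> i))"
    have c: "c > 0" using ne by (simp add: c_def)
    show ?thesis
    proof (intro exI[of _ "2 / c"] conjI allI impI)
      show "2 / c > 0" using c by simp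
      fix d :: "'i \<Rightarrow> 'a" and M s t :: real
      assume d: "\<forall>k\<in>I. norm (d k) \<le> M"
      have dif: "pt \<sigma> w i s - pt \<sigma> w j t = (t - s) *\<^sub>R (w i - w (\<sigma> i))" for w :: "'i \<Rightarrow> 'a"
        using 1 by (simp add: pt_def algebra_simps)
      have "norm (d i) \<le> M" "norm (d (\<sigma> i)) \<le> M" using d i nx[OF i] by auto
      then have "norm (d i - d (\<sigma> i)) \<le> 2 * M" using norm_triangle_ineq4[of "d i" "d (\<sigma> i)"] by linarith
      then have "\<bar>t - s\<bar> * norm (d i - d (\<sigma> i)) \<le> \<bar>t - s\<bar> * (2 * M)" by (rule mult_left_mono) simp
      then show "norm (pt \<sigma> d i s - pt \<sigma> d j t) \<le> 2 / c * M * norm (pt \<sigma> v i s - pt \<sigma> v j t)"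
      proof -
        have "2 / c * M * (\<bar>t - s\<bar> * c) = \<bar>t - s\<bar> * (2 * M)" using c by simp
        then show ?thesis using \<open>\<bar>t - s\<bar> * norm (d i - d (\<sigma> i)) \<le> \<bar>t - s\<bar> * (2 * M)\<close>
          by (simp add: dif c_def[symmetric])
      qed
    qed
  next
    case 2
    then show ?thesis using simple_poly_pair_bound_adjacent[OF v i] by simp
  next
    case 3
    obtain K where "K > 0" "\<forall>d M s t. (\<forall>k\<in>I. norm (d k) \<le> M) \<longrightarrow> s \<in> {0..1} \<longrightarrow> t \<in> {0..1} \<longrightarrow>
      norm (pt \<sigma> d j s - pt \<sigma> d i t :: 'a) \<le> K * M * norm (pt \<sigma> v j s - pt \<sigma> v i t)"
      using simple_poly_pair_bound_adjacent[OF v j] 3 by auto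
    then show ?thesis by (intro exI[of _ K]) (auto simp: norm_minus_commute)
  next
    case 4
    obtain c where c: "c > 0" "\<And>s t. s\<in>{0..1} \<Longrightarrow> t\<in>{0..1} \<Longrightarrow> c \<le> norm (pt \<sigma> v i s - pt \<sigma> v j t)"
      using simple_poly_far_apart[OF v i j 4] by blast
    show ?thesis
    proof (intro exI[of _ "2 / c"] conjI allI impI)
      show "2 / c > 0" using c by simp
      fix d :: "'i \<Rightarrow> 'a" and M s t :: real
      assume d: "\<forall>k\<in>I. norm (d k) \<le> M" and st: "s \<in> {0..1}" "t \<in> {0..1}"
      have M: "0 \<le> M" using d i by (meson norm_ge_zero order_trans)
      have "norm (pt \<sigma> d i s - pt \<sigma> d j t) \<le> M + M"
        by (rule norm_triangle_le_diff, rule add_mono; rule norm_pt_le) (use d i j nx st in auto)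
      also have "\<dots> = 2 / c * M * c" using c by simp
      also have "\<dots> \<le> 2 / c * M * norm (pt \<sigma> v i s - pt \<sigma> v j t)"
        by (rule mult_left_mono[OF c(2)]) (use st c M in auto)
      finally show "norm (pt \<sigma> d i s - pt \<sigma> d j t) \<le> 2 / c * M * norm (pt \<sigma> v i s - pt \<sigma> v j t)" .
    qed
  qed
qed

text \<open>With \<open>d\<close> the displacement this is the Lipschitz condition of
  \<open>cs_isotopy_along_lines\<close>; with \<open>M\<close> small it shows that simplicity
  survives a perturbation.\<close>

lemma simple_poly_displacement_bound:
  fixes v :: "'i \<Rightarrow> 'a::real_normed_vector"
  assumes v: "simple_poly I \<sigma> v"
  obtains K where "K > 0"
    "\<And>d M i j s t. (\<forall>k\<in>I. norm (d k) \<le> M) \<Longrightarrow> i \<in> I \<Longrightarrow> j \<in> I \<Longrightarrow> s \<in> {0..1} \<Longrightarrow> t \<in> {0..1} \<Longrightarrow>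
      norm (pt \<sigma> d i s - pt \<sigma> d j t :: 'a) \<le> K * M * norm (pt \<sigma> v i s - pt \<sigma> v j t)"
proof -
  have fin: "finite (I \<times> I)" using v by (simp add: simple_poly_def)
  define Q where "Q K z \<longleftrightarrow> (\<forall>d M s t. (\<forall>k\<in>I. norm (d k) \<le> M) \<longrightarrow> s \<in> {0..1} \<longrightarrow> t \<in> {0..1} \<longrightarrow>
      norm (pt \<sigma> d (fst z) s - pt \<sigma> d (snd z) t :: 'a) \<le> K * M * norm (pt \<sigma> v (fst z) s - pt \<sigma> v (snd z) t))" for K z
  have "\<forall>z\<in>I \<times> I. \<exists>K>0. Q K z"
  proof
    fix z assume "z \<in> I \<times> I"
    then show "\<exists>K>0. Q K z"
      using simple_poly_pair_bound[OF v, of "fst z" "snd z"] unfolding Q_def by (auto simp: mem_Times_iff)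
  qed
  then obtain K where K: "\<And>z. z \<in> I \<times> I \<Longrightarrow> K z > 0 \<and> Q (K z) z" by metis
  define K0 where "K0 = (\<Sum>z\<in>I \<times> I. K z) + 1"
  have K0: "K z \<le> K0" if "z \<in> I \<times> I" for z
    using member_le_sum[OF that, of K] K fin by (force simp: K0_def)
  show thesis
  proof (rule that[of K0])
    show "K0 > 0" unfolding K0_def using K by (intro add_nonneg_pos sum_nonneg) force+
    fix d :: "'i \<Rightarrow> 'a" and M i j and s t :: real
    assume d: "\<forall>k\<in>I. norm (d k) \<le> M" and ij: "i \<in> I" "j \<in> I" and st: "s \<in> {0..1}" "t \<in> {0..1}"
    have M: "0 \<le> M" using d ij by (meson norm_ge_zero order_trans)
    have "norm (pt \<sigma> d i s - pt \<sigma> d j t) \<le> K (i, j) * M * norm (pt \<sigma> v i s - pt \<sigma> v j t)"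
      using K[of "(i, j)"] ij d st unfolding Q_def by (metis SigmaI fst_conv snd_conv)
    also have "\<dots> \<le> K0 * M * norm (pt \<sigma> v i s - pt \<sigma> v j t)"
      using K0[of "(i, j)"] ij M by (intro mult_right_mono) auto
    finally show "norm (pt \<sigma> d i s - pt \<sigma> d j t) \<le> K0 * M * norm (pt \<sigma> v i s - pt \<sigma> v j t)" .
  qed
qed

text \<open>Points are matched with equal parameters, so the relation passes to simultaneous
  subdivisions of both configurations, see \<open>isotopic_poly_sub\<close>.\<close>

definition isotopic_poly :: "'i set \<Rightarrow> ('i \<Rightarrow> 'i) \<Rightarrow> ('i \<Rightarrow> 'a::real_normed_vector) \<Rightarrow> ('i \<Rightarrow> 'a) \<Rightarrow> bool" where
  "isotopic_poly I \<sigma> v w \<longleftrightarrow>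
     (\<exists>H. cs_isotopy H \<and> (\<forall>i\<in>I. \<forall>s\<in>{0..1}. H 1 (pt \<sigma> v i s) = pt \<sigma> w i s))"

lemma isotopic_poly_trans [trans]:
  assumes "isotopic_poly I \<sigma> u v" "isotopic_poly I \<sigma> v w"
  shows "isotopic_poly I \<sigma> u w"
proof -
  obtain H where H: "cs_isotopy H" "\<forall>i\<in>I. \<forall>s\<in>{0..1}. H 1 (pt \<sigma> u i s) = pt \<sigma> v i s"
    using assms(1) unfolding isotopic_poly_def by auto
  obtain G where G: "cs_isotopy G" "\<forall>i\<in>I. \<forall>s\<in>{0..1}. G 1 (pt \<sigma> v i s) = pt \<sigma> w i s"
    using assms(2) unfolding isotopic_poly_def by auto
  show ?thesis unfolding isotopic_poly_def
    by (rule exI[of _ "\<lambda>t x. G t (H t x)"]) (use H G cs_isotopy_compose in auto)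
qed

lemma bounded_poly:
  assumes "finite I" "\<And>i. i \<in> I \<Longrightarrow> \<sigma> i \<in> I"
  shows "bounded ((\<lambda>(i, s). pt \<sigma> (v :: 'i \<Rightarrow> 'a::real_normed_vector) i s) ` (I \<times> {0..1}))"
proof -
  have "\<And>i. i \<in> I \<Longrightarrow> norm (v i) \<le> (\<Sum>i\<in>I. norm (v i))"
    using member_le_sum[OF _ _ assms(1), of _ "\<lambda>i. norm (v i)"] by simp
  then show ?thesis unfolding bounded_iff
    by (intro exI[of _ "\<Sum>i\<in>I. norm (v i)"]) (auto intro!: norm_pt_le assms(2))
qed

text \<open>Simplicity at time \<tau> yields the Lipschitz constant at that time, by
  \<open>simple_poly_displacement_bound\<close> for the displacement from \<open>v\<close> to
  \<open>w\<close>.\<close>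

theorem isotopic_poly_along_lines:
  fixes v w :: "'i \<Rightarrow> 'a::euclidean_space"
  assumes simp: "\<And>\<tau>. \<tau> \<in> {0..1} \<Longrightarrow> simple_poly I \<sigma> (\<lambda>i. (1 - \<tau>) *\<^sub>R v i + \<tau> *\<^sub>R w i)"
  shows "isotopic_poly I \<sigma> v w"
proof -
  have fin: "finite I" and nx: "\<And>i. i \<in> I \<Longrightarrow> \<sigma> i \<in> I"
    using simp[of 0] simple_poly_next_in[OF simp[of 0]] by (auto simp: simple_poly_def)
  define \<gamma> \<delta> where "\<gamma> = (\<lambda>(i, s). pt \<sigma> v i s)" and "\<delta> = (\<lambda>(i, s). pt \<sigma> w i s)"
  have "\<exists>H. cs_isotopy H \<and> (\<forall>p\<in>I \<times> {0..1}. H 1 (\<gamma> p) = \<delta> p)"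
  proof (rule cs_isotopy_along_lines)
    show "bounded (\<gamma> ` (I \<times> {0..1}))" "bounded (\<delta> ` (I \<times> {0..1}))"
      unfolding \<gamma>_def \<delta>_def by (rule bounded_poly[OF fin nx]; assumption)+
    fix \<tau> :: real assume \<tau>: "\<tau> \<in> {0..1}"
    define u where "u = (\<lambda>i. (1 - \<tau>) *\<^sub>R v i + \<tau> *\<^sub>R w i)"
    have u: "(1 - \<tau>) *\<^sub>R \<gamma> (i, s) + \<tau> *\<^sub>R \<delta> (i, s) = pt \<sigma> u i s" for i s
      by (simp add: \<gamma>_def \<delta>_def u_def pt_lincomb)
    obtain K where K: "K > 0" "\<And>d M i j s t. (\<forall>k\<in>I. norm (d k) \<le> M) \<Longrightarrow> i \<in> I \<Longrightarrow> j \<in> I \<Longrightarrow> s \<in> {0..1} \<Longrightarrow> t \<in> {0..1} \<Longrightarrow>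
      norm (pt \<sigma> d i s - pt \<sigma> d j t :: 'a) \<le> K * M * norm (pt \<sigma> u i s - pt \<sigma> u j t)"
      by (rule simple_poly_displacement_bound[OF simp[OF \<tau>, folded u_def]]) (rule that)
    define M where "M = (\<Sum>k\<in>I. norm (w k - v k))"
    have M: "\<forall>k\<in>I. norm (w k - v k) \<le> M"
      using member_le_sum[OF _ _ fin, of _ "\<lambda>k. norm (w k - v k)"] by (simp add: M_def)
    have "norm (\<delta> p - \<gamma> p - (\<delta> q - \<gamma> q)) \<le> K * M * norm ((1 - \<tau>) *\<^sub>R \<gamma> p + \<tau> *\<^sub>R \<delta> p - ((1 - \<tau>) *\<^sub>R \<gamma> q + \<tau> *\<^sub>R \<delta> q))"
      if "p \<in> I \<times> {0..1}" "q \<in> I \<times> {0..1}" for p q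
    proof -
      obtain i s j t where "p = (i, s)" "q = (j, t)" by fastforce
      then show ?thesis using K(2)[OF M, of i j s t] that
        by (simp only: u) (simp add: \<gamma>_def \<delta>_def pt_diff)
    qed
    then show "\<exists>C. \<forall>p\<in>I \<times> {0..1}. \<forall>q\<in>I \<times> {0..1}. norm (\<delta> p - \<gamma> p - (\<delta> q - \<gamma> q))
        \<le> C * norm ((1 - \<tau>) *\<^sub>R \<gamma> p + \<tau> *\<^sub>R \<delta> p - ((1 - \<tau>) *\<^sub>R \<gamma> q + \<tau> *\<^sub>R \<delta> q))" by blast
  qed
  then show ?thesis unfolding isotopic_poly_def \<gamma>_def \<delta>_def by auto
qed

lemma simple_poly_perturb:
  fixes v :: "'i \<Rightarrow> 'a::euclidean_space"
  assumes v: "simple_poly I \<sigma> v"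
  shows "\<exists>e>0. \<forall>w. (\<forall>i\<in>I. norm (w i - v i) \<le> e) \<longrightarrow> simple_poly I \<sigma> w"
proof -
  obtain K where K: "K > 0" "\<And>d M i j s t. (\<forall>k\<in>I. norm (d k) \<le> M) \<Longrightarrow> i \<in> I \<Longrightarrow> j \<in> I \<Longrightarrow> s \<in> {0..1} \<Longrightarrow> t \<in> {0..1} \<Longrightarrow>
      norm (pt \<sigma> d i s - pt \<sigma> d j t :: 'a) \<le> K * M * norm (pt \<sigma> v i s - pt \<sigma> v j t)"
    by (rule simple_poly_displacement_bound[OF v]) (rule that)
  show ?thesis
  \<comment> \<open>With this bound a double point of \<open>w\<close> gives two points of
    \<open>v\<close> whose distance is at most half of itself.\<close>
  proof (intro exI[of _ "1 / (2 * K)"] conjI allI impI)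
    show "0 < 1 / (2 * K)" using K by simp
    fix w assume w: "\<forall>i\<in>I. norm (w i - v i) \<le> 1 / (2 * K)"
    show "simple_poly I \<sigma> w"
      unfolding simple_poly_def
    proof (intro conjI ballI impI)
      show "finite I" "bij_betw \<sigma> I I" using v by (auto simp: simple_poly_def)
      fix i j and s t :: real
      assume *: "i \<in> I" "j \<in> I" "s \<in> {0..<1}" "t \<in> {0..<1}" "pt \<sigma> w i s = pt \<sigma> w j t"
      have "norm (pt \<sigma> (\<lambda>k. w k - v k) i s - pt \<sigma> (\<lambda>k. w k - v k) j t)
          \<le> K * (1 / (2 * K)) * norm (pt \<sigma> v i s - pt \<sigma> v j t)"
        by (rule K(2)) (use w * in auto)
      also have "pt \<sigma> (\<lambda>k. w k - v k) i s - pt \<sigma> (\<lambda>k. w k - v k) j t = - (pt \<sigma> v i s - pt \<sigma> v j t)"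
        using * by (simp add: pt_diff)
      finally have "pt \<sigma> v i s = pt \<sigma> v j t" using K(1) by (simp add: norm_minus_commute[of "pt \<sigma> v j t"])
      then show "i = j" "s = t" using simple_polyD[OF v, of i s j t] * by auto
    qed
  qed
qed

section \<open>Traversals and subdivisions\<close>

text \<open>The times at which vertices are passed stay existential: \<open>polyline\<close> spends
  half of the remaining time on each edge but the last, subdivision inserts further times, and the
  oriented curve does not depend on any of this.\<close>

fun traverses :: "('i \<Rightarrow> 'i) \<Rightarrow> ('i \<Rightarrow> 'a::real_vector) \<Rightarrow> (real \<Rightarrow> 'a) \<Rightarrow> 'i list \<Rightarrow> real \<Rightarrow> real \<Rightarrow> bool" where
  "traverses \<sigma> v \<gamma> [] a b \<longleftrightarrow> a = b"
| "traverses \<sigma> v \<gamma> (i # is) a b \<longleftrightarrow>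
     (\<exists>m>a. (\<forall>t\<in>{a..m}. \<gamma> t = pt \<sigma> v i ((t - a) / (m - a))) \<and> traverses \<sigma> v \<gamma> is m b)"

lemma traverses_le: "traverses \<sigma> v \<gamma> is a b \<Longrightarrow> a \<le> b"
proof (induction "is" arbitrary: a)
  case (Cons i "is")
  then obtain m where "m > a" "traverses \<sigma> v \<gamma> is m b" by auto
  then show ?case using Cons.IH[of m] by simp
qed simp

lemma traverses_append:
  "traverses \<sigma> v \<gamma> (xs @ ys) a b \<longleftrightarrow> (\<exists>m. traverses \<sigma> v \<gamma> xs a m \<and> traverses \<sigma> v \<gamma> ys m b)"
  by (induction xs arbitrary: a) auto

lemma traverses_start: "traverses \<sigma> v \<gamma> (i # is) a b \<Longrightarrow> \<gamma> a = v i"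
  by auto

lemma traverses_image:
  assumes "traverses \<sigma> v \<gamma> is a b" "\<And>i s. i \<in> set is \<Longrightarrow> s \<in> {0..1} \<Longrightarrow> \<Phi> (pt \<sigma> v i s) = pt \<sigma> w i s"
  shows "traverses \<sigma> w (\<Phi> \<circ> \<gamma>) is a b"
  using assms
proof (induction "is" arbitrary: a)
  case (Cons i "is")
  from Cons.prems(1) obtain m where m: "m > a" "\<forall>t\<in>{a..m}. \<gamma> t = pt \<sigma> v i ((t - a) / (m - a))"
    "traverses \<sigma> v \<gamma> is m b" by auto
  have "(\<Phi> \<circ> \<gamma>) t = pt \<sigma> w i ((t - a) / (m - a))" if "t \<in> {a..m}" for t
    using m that Cons.prems(2)[of i "(t - a) / (m - a)"] by auto
  moreover have "traverses \<sigma> w (\<Phi> \<circ> \<gamma>) is m b" by (rule Cons.IH[OF m(3)]) (use Cons.prems in auto)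
  ultimately show ?case using m(1) by (subst traverses.simps) blast
qed auto

lemma traverses_affine:
  assumes "traverses \<sigma> v \<gamma> is (c * a + d) (c * b + d)" "c > 0" "\<And>t. t \<in> {a..b} \<Longrightarrow> \<delta> t = \<gamma> (c * t + d)"
  shows "traverses \<sigma> v \<delta> is a b"
  using assms
proof (induction "is" arbitrary: a)
  case (Cons i "is")
  from Cons.prems(1) obtain m where m: "m > c * a + d"
    "\<forall>t\<in>{c * a + d..m}. \<gamma> t = pt \<sigma> v i ((t - (c * a + d)) / (m - (c * a + d)))"
    "traverses \<sigma> v \<gamma> is m (c * b + d)" by auto
  define m' where "m' = (m - d) / c"
  have mm: "m = c * m' + d" using Cons.prems(2) by (simp add: m'_def)
  have am: "a < m'" using m(1) Cons.prems(2) by (simp add: mm)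
  have "m' \<le> b" using traverses_le[OF m(3)] Cons.prems(2) by (simp add: mm)
  have "\<delta> t = pt \<sigma> v i ((t - a) / (m' - a))" if "t \<in> {a..m'}" for t
  proof -
    have "\<delta> t = \<gamma> (c * t + d)" using that \<open>m' \<le> b\<close> Cons.prems(3) by auto
    also have "\<dots> = pt \<sigma> v i ((c * t + d - (c * a + d)) / (m - (c * a + d)))"
      using m(2) that Cons.prems(2) by (auto simp: mm)
    also have "(c * t + d - (c * a + d)) / (m - (c * a + d)) = (c * (t - a)) / (c * (m' - a))"
      by (simp add: mm algebra_simps)
    finally show ?thesis using Cons.prems(2) by simp
  qed
  moreover have "traverses \<sigma> v \<delta> is m' b"
    by (rule Cons.IH) (use m(3) Cons.prems am in \<open>auto simp: mm\<close>)
  ultimately show ?case using am by auto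
qed auto

lemma traverses_polyline:
  assumes "map \<sigma> (i # is) = is @ [j]"
  shows "traverses \<sigma> v (polyline (map v (i # is) @ [v j])) (i # is) 0 1"
  using assms
proof (induction "is" arbitrary: i)
  case Nil
  then show ?case by (auto simp: linepath_def pt_def intro!: exI[of _ 1])
next
  case (Cons k ks)
  let ?p = "polyline (map v (k # ks) @ [v j])"
  have IH: "traverses \<sigma> v ?p (k # ks) 0 1" by (rule Cons.IH) (use Cons.prems in auto)
  have k: "\<sigma> i = k" using Cons.prems by simp
  obtain x xs where xs: "map v ks @ [v j] = x # xs" by (cases "map v ks @ [v j]") auto
  have eq: "polyline (map v (i # k # ks) @ [v j]) = linepath (v i) (v k) +++ ?p"
    using xs by simp
  have st: "?p 0 = v k" by (rule traverses_start[OF IH])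
  have "traverses \<sigma> v (linepath (v i) (v k) +++ ?p) (k # ks) (1/2) 1"
  proof (rule traverses_affine[where c = 2 and d = "-1"])
    show "traverses \<sigma> v ?p (k # ks) (2 * (1 / 2) + - 1) (2 * 1 + - 1)" using IH by simp
    fix t :: real assume "t \<in> {1/2..1}"
    then show "(linepath (v i) (v k) +++ ?p) t = ?p (2 * t + - 1)"
    proof (cases "t = 1/2")
      case True
      show ?thesis unfolding True using st by (simp add: joinpaths_def linepath_def)
    qed (auto simp: joinpaths_def)
  qed simp
  moreover have "(linepath (v i) (v k) +++ ?p) t = pt \<sigma> v i ((t - 0) / (1/2 - 0))" if "t \<in> {0..1/2}" for t
    using that k by (auto simp: joinpaths_def linepath_def pt_def mult.commute)
  ultimately show ?case unfolding eq
    by (subst traverses.simps) (intro exI[of _ "1/2"], auto)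
qed

text \<open>Edge \<open>i\<close> is cut at the parameters \<open>l i 0 < \<dots> < l i (k i)\<close> into the edges \<open>(i, 0), \<dots>, (i, k i - 1)\<close>.\<close>

definition sub_next :: "('i \<Rightarrow> nat) \<Rightarrow> ('i \<Rightarrow> 'i) \<Rightarrow> 'i \<times> nat \<Rightarrow> 'i \<times> nat" where
  "sub_next k \<sigma> = (\<lambda>(i, r). if Suc r < k i then (i, Suc r) else (\<sigma> i, 0))"

definition sub_vertex :: "('i \<Rightarrow> nat \<Rightarrow> real) \<Rightarrow> ('i \<Rightarrow> 'i) \<Rightarrow> ('i \<Rightarrow> 'a::real_vector) \<Rightarrow> 'i \<times> nat \<Rightarrow> 'a" where
  "sub_vertex l \<sigma> v = (\<lambda>(i, r). pt \<sigma> v i (l i r))"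

definition sub_list :: "('i \<Rightarrow> nat) \<Rightarrow> 'i list \<Rightarrow> ('i \<times> nat) list" where
  "sub_list k is = concat (map (\<lambda>i. map (Pair i) [0..<k i]) is)"

definition sub_index :: "('i \<Rightarrow> nat) \<Rightarrow> 'i set \<Rightarrow> ('i \<times> nat) set" where
  "sub_index k I = {(i, r). i \<in> I \<and> r < k i}"

definition subdivision :: "'i set \<Rightarrow> ('i \<Rightarrow> nat) \<Rightarrow> ('i \<Rightarrow> nat \<Rightarrow> real) \<Rightarrow> bool" where
  "subdivision I k l \<longleftrightarrow> (\<forall>i\<in>I. k i > 0 \<and> l i 0 = 0 \<and> l i (k i) = 1 \<and> (\<forall>r<k i. l i r < l i (Suc r)))"

lemma sub_index_alt: "sub_index k I = Sigma I (\<lambda>i. {..<k i})"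
  by (auto simp: sub_index_def)

lemma finite_sub_index: "finite I \<Longrightarrow> finite (sub_index k I)"
  by (auto simp: sub_index_alt)

lemma set_sub_list: "set (sub_list k is) = sub_index k (set is)"
  by (auto simp: sub_list_def sub_index_def)

lemma distinct_sub_list: "distinct is \<Longrightarrow> distinct (sub_list k is)"
  by (induction "is") (auto simp: sub_list_def distinct_map inj_on_def)

lemma sub_list_Cons: "sub_list k (i # is) = map (Pair i) [0..<k i] @ sub_list k is"
  by (simp add: sub_list_def)

lemma subdivision_mono:
  assumes "subdivision I k l" "i \<in> I" "r \<le> s" "s \<le> k i"
  shows "l i r \<le> l i s"
  using assms(3,4)
proof (induction s rule: dec_induct)
  case (step n)
  then have "l i n < l i (Suc n)" using assms(1,2) by (auto simp: subdivision_def)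
  with step show ?case by simp
qed auto

lemma subdivision_strict_mono:
  assumes "subdivision I k l" "i \<in> I" "r < s" "s \<le> k i"
  shows "l i r < l i s"
proof -
  have "l i r < l i (Suc r)" using assms by (auto simp: subdivision_def)
  also have "\<dots> \<le> l i s" by (rule subdivision_mono[OF assms(1,2)]) (use assms in auto)
  finally show ?thesis .
qed

lemma pt_sub:
  assumes "subdivision I k l" "i \<in> I" "\<sigma> i \<in> I" "r < k i"
  shows "pt (sub_next k \<sigma>) (sub_vertex l \<sigma> v) (i, r) s = pt \<sigma> v i ((1 - s) * l i r + s * l i (Suc r))"
proof -
  have "sub_vertex l \<sigma> v (sub_next k \<sigma> (i, r)) = pt \<sigma> v i (l i (Suc r))"
  proof (cases "Suc r < k i")
    case False
    then have "Suc r = k i" using assms(4) by simp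
    then have "l i (Suc r) = 1" "l (\<sigma> i) 0 = 0" using assms by (auto simp: subdivision_def)
    then show ?thesis using False by (simp add: sub_next_def sub_vertex_def)
  qed (simp add: sub_next_def sub_vertex_def)
  moreover have "sub_vertex l \<sigma> v (i, r) = pt \<sigma> v i (l i r)" by (simp add: sub_vertex_def)
  ultimately show ?thesis
    by (simp only: pt_def[of "sub_next k \<sigma>"]) (simp add: pt_def algebra_simps)
qed

lemma bij_betw_sub_next:
  assumes "bij_betw \<sigma> I I" "finite I" "\<And>i. i \<in> I \<Longrightarrow> k i > 0"
  shows "bij_betw (sub_next k \<sigma>) (sub_index k I) (sub_index k I)"
proof -
  have nx: "\<sigma> i \<in> I" if "i \<in> I" for i using assms(1) that by (auto simp: bij_betw_def)
  have "inj_on (sub_next k \<sigma>) (sub_index k I)"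
  proof (rule inj_onI, clarify)
    fix i r j s
    assume *: "(i, r) \<in> sub_index k I" "(j, s) \<in> sub_index k I" "sub_next k \<sigma> (i, r) = sub_next k \<sigma> (j, s)"
    then have lt: "r < k i" "s < k j" "i \<in> I" "j \<in> I" by (auto simp: sub_index_def)
    have inj: "\<sigma> i = \<sigma> j \<Longrightarrow> i = j" using assms(1) lt by (auto simp: bij_betw_def inj_on_def)
    show "i = j \<and> r = s"
      using *(3) lt inj by (cases "Suc r < k i"; cases "Suc s < k j") (auto simp: sub_next_def)
  qed
  moreover have "sub_next k \<sigma> ` sub_index k I \<subseteq> sub_index k I"
    using nx assms(3) by (auto simp: sub_next_def sub_index_def split: if_splits)
  ultimately show ?thesis
    using endo_inj_surj[OF finite_sub_index[OF assms(2)]] unfolding bij_betw_def by blast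
qed

lemma traverses_subdivision:
  assumes "subdivision I k l" "\<And>i. i \<in> I \<Longrightarrow> \<sigma> i \<in> I" "traverses \<sigma> v \<gamma> is a b" "set is \<subseteq> I"
  shows "traverses (sub_next k \<sigma>) (sub_vertex l \<sigma> v) \<gamma> (sub_list k is) a b"
  using assms(3,4)
proof (induction "is" arbitrary: a)
  case Nil
  then show ?case by (simp add: sub_list_def)
next
  case (Cons i "is")
  from Cons.prems(1) obtain m where m: "m > a" "\<forall>t\<in>{a..m}. \<gamma> t = pt \<sigma> v i ((t - a) / (m - a))"
    "traverses \<sigma> v \<gamma> is m b" by auto
  have i: "i \<in> I" using Cons.prems by auto
  have l: "k i > 0" "l i 0 = 0" "l i (k i) = 1" "\<And>r. r < k i \<Longrightarrow> l i r < l i (Suc r)"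
    using assms(1) i by (auto simp: subdivision_def)
  \<comment> \<open>Induction downwards from the end of the edge; \<open>a + l i r * (m - a)\<close>
    is the time at which the cut \<open>l i r\<close> is passed.\<close>
  have "traverses (sub_next k \<sigma>) (sub_vertex l \<sigma> v) \<gamma> (map (Pair i) [r..<k i]) (a + l i r * (m - a)) m"
    if "r \<le> k i" for r
    using that
  proof (induction r rule: inc_induct)
    case base
    then show ?case using l by simp
  next
    case (step r)
    have lr: "l i r < l i (Suc r)" using l step by auto
    have eq: "map (Pair i) [r..<k i] = (i, r) # map (Pair i) [Suc r..<k i]"
      using step by (simp add: upt_conv_Cons)
    define p where "p = a + l i r * (m - a)"
    define q where "q = a + l i (Suc r) * (m - a)"
    have pq: "p < q" using lr m(1) by (simp add: p_def q_def)
    have qp: "q - p = (l i (Suc r) - l i r) * (m - a)" by (simp add: p_def q_def algebra_simps)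
    have l01: "0 \<le> l i r" "l i (Suc r) \<le> 1"
      using subdivision_mono[OF assms(1) i, of 0 r] subdivision_mono[OF assms(1) i, of "Suc r" "k i"] l step by auto
    have "\<gamma> t = pt (sub_next k \<sigma>) (sub_vertex l \<sigma> v) (i, r) ((t - p) / (q - p))" if t: "t \<in> {p..q}" for t
    proof -
      have "a \<le> p" using l01 m by (simp add: p_def)
      have "q \<le> m"
      proof -
        have "0 \<le> m - a" using m(1) by simp
        from mult_right_mono[OF l01(2) this] show ?thesis unfolding q_def by (simp add: algebra_simps)
      qed
      then have g: "\<gamma> t = pt \<sigma> v i ((t - a) / (m - a))" using t \<open>a \<le> p\<close> m by auto
      define s where "s = (t - p) / (q - p)"
      have "t = p + s * (q - p)" using pq by (simp add: s_def)
      then have "t - a = ((1 - s) * l i r + s * l i (Suc r)) * (m - a)"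
        by (simp add: qp) (simp add: p_def algebra_simps)
      then have "(t - a) / (m - a) = (1 - s) * l i r + s * l i (Suc r)" using m by (simp add: field_simps)
      then show ?thesis using pt_sub[OF assms(1) i, of \<sigma> r v s] assms(2)[OF i] step g by (simp add: s_def)
    qed
    then show ?case unfolding eq traverses.simps p_def[symmetric]
      using pq step.IH by (intro exI[of _ q]) (auto simp: q_def)
  qed
  from this[of 0] have "traverses (sub_next k \<sigma>) (sub_vertex l \<sigma> v) \<gamma> (map (Pair i) [0..<k i]) a m"
    using l by simp
  moreover have "traverses (sub_next k \<sigma>) (sub_vertex l \<sigma> v) \<gamma> (sub_list k is) m b"
    using Cons m by auto
  ultimately show ?case by (auto simp: sub_list_Cons traverses_append)
qed

section \<open>Lists running once around a cycle of a permutation\<close>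

definition cycle_list :: "('i \<Rightarrow> 'i) \<Rightarrow> 'i list \<Rightarrow> bool" where
  "cycle_list \<sigma> is \<longleftrightarrow> is \<noteq> [] \<and> distinct is \<and> map \<sigma> is = rotate1 is"

lemma cycle_list_rotate:
  assumes "cycle_list \<sigma> (xs @ ys)"
  shows "cycle_list \<sigma> (ys @ xs)"
proof -
  have eq: "ys @ xs = rotate (length xs) (xs @ ys)" by (simp add: rotate_append)
  have "map \<sigma> (ys @ xs) = rotate (length xs) (map \<sigma> (xs @ ys))" unfolding eq by (rule rotate_map[symmetric])
  also have "\<dots> = rotate1 (ys @ xs)"
    using assms unfolding eq by (simp add: cycle_list_def rotate1_rotate_swap)
  finally show ?thesis using assms by (auto simp: cycle_list_def)
qed

lemma cycle_list_set: "cycle_list \<sigma> is \<Longrightarrow> \<sigma> ` set is = set is"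
  by (metis cycle_list_def image_set set_rotate1)

lemma cycle_list_nth:
  assumes "cycle_list \<sigma> is" "n < length is"
  shows "is ! n = (\<sigma> ^^ n) (hd is)"
  using assms(2)
proof (induction n)
  case 0
  then show ?case by (simp add: hd_conv_nth)
next
  case (Suc n)
  have "\<sigma> (is ! n) = rotate1 is ! n"
    using assms(1) Suc by (metis Suc_lessD cycle_list_def nth_map)
  also have "\<dots> = is ! Suc n" using Suc by (simp add: nth_rotate1)
  finally show ?case using Suc by simp
qed

lemma cycle_list_eqI:
  assumes "cycle_list \<sigma> is" "cycle_list \<sigma> js" "hd is = hd js"
  shows "is = js"
proof -
  have closed: "(\<sigma> ^^ n) (hd ks) \<in> set ks" if "cycle_list \<sigma> ks" for n ks
  proof (induction n)
    case 0
    then show ?case using that by (simp add: cycle_list_def)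
  next
    case (Suc n)
    then show ?case using cycle_list_set[OF that] by auto
  qed
  have sub: "set ks \<subseteq> set ls" if "cycle_list \<sigma> ks" "cycle_list \<sigma> ls" "hd ks = hd ls" for ks ls
  proof
    fix x assume "x \<in> set ks"
    then obtain n where "n < length ks" "x = ks ! n" by (metis in_set_conv_nth)
    then have "x = (\<sigma> ^^ n) (hd ls)" using cycle_list_nth[OF that(1)] that(3) by simp
    then show "x \<in> set ls" using closed[OF that(2)] by simp
  qed
  have "set is = set js" using sub[OF assms] sub[OF assms(2,1)] assms(3) by auto
  then have "length is = length js"
    using assms(1,2) by (metis cycle_list_def distinct_card)
  then show ?thesis
    using cycle_list_nth[OF assms(1)] cycle_list_nth[OF assms(2)] assms(3) by (simp add: list_eq_iff_nth_eq)
qed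

text \<open>Rotated so that both start at a common element, the two lists agree, since the
  permutation determines a cycle from its head.\<close>

lemma cycle_lists_sharing:
  assumes "cycle_list \<sigma> is" "cycle_list \<sigma> js" "set is \<inter> set js \<noteq> {}"
  obtains xs ys where "is = xs @ ys" "js = ys @ xs"
proof -
  obtain x where x: "x \<in> set is" "x \<in> set js" using assms(3) by blast
  obtain as bs where as: "is = as @ x # bs" using x(1) by (auto simp: in_set_conv_decomp)
  obtain cs ds where cs: "js = cs @ x # ds" using x(2) by (auto simp: in_set_conv_decomp)
  have "x # bs @ as = x # ds @ cs"
    by (rule cycle_list_eqI[of \<sigma>])
      (use cycle_list_rotate[of \<sigma> as "x # bs"] cycle_list_rotate[of \<sigma> cs "x # ds"] assms as cs in auto)
  then have eq: "bs @ as = ds @ cs" by simp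
  then obtain us where "bs = ds @ us \<and> cs = us @ as \<or> ds = bs @ us \<and> as = us @ cs"
    by (auto simp: append_eq_append_conv2)
  then show thesis
  proof
    assume "bs = ds @ us \<and> cs = us @ as"
    then show thesis using that[of "as @ x # ds" us] as cs by simp
  next
    assume "ds = bs @ us \<and> as = us @ cs"
    then show thesis using that[of us "cs @ x # bs"] as cs by simp
  qed
qed

lemma cycle_list_sub_list:
  assumes "cycle_list \<sigma> is" "\<And>i. i \<in> set is \<Longrightarrow> k i > 0"
  shows "cycle_list (sub_next k \<sigma>) (sub_list k is)"
proof -
  have blk: "map (sub_next k \<sigma>) (map (Pair i) [0..<k i]) = map (Pair i) [1..<k i] @ [(\<sigma> i, 0)]"
    if "k i > 0" for i
  proof -
    obtain n where n: "k i = Suc n" using \<open>k i > 0\<close> by (cases "k i") auto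
    have "map (sub_next k \<sigma>) (map (Pair i) [0..<n]) = map (Pair i) (map Suc [0..<n])"
      using n by (auto simp: sub_next_def)
    then show ?thesis using n by (simp add: sub_next_def map_Suc_upt)
  qed
  have "map (sub_next k \<sigma>) (sub_list k (x # xs)) = tl (sub_list k (x # xs)) @ [(y, 0)]"
    if "map \<sigma> (x # xs) = xs @ [y]" "\<And>i. i \<in> set (x # xs) \<Longrightarrow> k i > 0" for x xs y
    using that
  proof (induction xs arbitrary: x)
    case Nil
    then show ?case using blk[of x] by (simp add: sub_list_def upt_conv_Cons)
  next
    case (Cons z zs)
    have z: "\<sigma> x = z" using Cons.prems by simp
    have IH: "map (sub_next k \<sigma>) (sub_list k (z # zs)) = tl (sub_list k (z # zs)) @ [(y, 0)]"
      by (rule Cons.IH) (use Cons.prems in auto)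
    have hz: "sub_list k (z # zs) = (z, 0) # tl (sub_list k (z # zs))"
      using Cons.prems(2)[of z] by (simp add: sub_list_Cons upt_conv_Cons)
    have "map (sub_next k \<sigma>) (sub_list k (x # z # zs)) =
        map (Pair x) [1..<k x] @ [(z, 0)] @ tl (sub_list k (z # zs)) @ [(y, 0)]"
      using blk[of x] Cons.prems(2)[of x] z IH by (subst sub_list_Cons) simp
    also have "\<dots> = tl (sub_list k (x # z # zs)) @ [(y, 0)]"
      using Cons.prems(2)[of x] hz by (subst sub_list_Cons) (simp add: upt_conv_Cons)
    finally show ?case .
  qed
  moreover obtain x xs where "is = x # xs" using assms(1) by (cases "is") (auto simp: cycle_list_def)
  ultimately have "map (sub_next k \<sigma>) (sub_list k is) = tl (sub_list k is) @ [(x, 0)]"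
    using assms by (auto simp: cycle_list_def)
  moreover have "sub_list k is = (x, 0) # tl (sub_list k is)"
    using \<open>is = x # xs\<close> assms(2)[of x] by (simp add: sub_list_Cons upt_conv_Cons)
  ultimately show ?thesis using distinct_sub_list assms(1)
    unfolding cycle_list_def by (metis list.distinct(1) rotate1.simps(2) )
qed

section \<open>Reparametrization of closed curves\<close>

lemma glue_strict_mono_continuous:
  fixes f g :: "real \<Rightarrow> real"
  assumes f: "continuous_on {a..m} f" "strict_mono_on {a..m} f"
    and g: "continuous_on {m..b} g" "strict_mono_on {m..b} g"
    and fg: "f m = g m" and "a \<le> m" "m \<le> b"
  defines "h \<equiv> \<lambda>t. if t \<le> m then f t else g t"
  shows "continuous_on {a..b} h" "strict_mono_on {a..b} h"
proof -
  have "{a..b} = {a..m} \<union> {m..b}" using assms by auto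
  moreover have "continuous_on ({a..m} \<union> {m..b}) h" unfolding h_def
    by (rule continuous_on_cases) (use f g fg in auto)
  ultimately show "continuous_on {a..b} h" by simp
  show "strict_mono_on {a..b} h"
  proof (rule strict_mono_onI)
    fix s t assume st: "s \<in> {a..b}" "t \<in> {a..b}" "s < t"
    have fm: "f s \<le> f m" if "s \<le> m"
      using that f(2) st by (cases "s = m") (auto simp: strict_mono_on_def intro: less_imp_le)
    have gm: "g m < g t" if "m < t"
      using that g(2) st by (auto simp: strict_mono_on_def)
    show "h s < h t"
    proof (cases "t \<le> m")
      case True
      then show ?thesis using st strict_mono_onD[OF f(2), of s t] by (simp add: h_def)
    next
      case False
      show ?thesis
      proof (cases "s \<le> m")
        case True
        then show ?thesis using False fm gm fg by (simp add: h_def)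
      next
        case s: False
        then show ?thesis using False st strict_mono_onD[OF g(2), of s t] by (simp add: h_def)
      qed
    qed
  qed
qed

text \<open>For the empty list nothing is known about the values at the single remaining time, so
  equality is claimed on the half-open interval only. For closed curves the value at the end follows
  from that at the start.\<close>

lemma traverses_reparam:
  assumes "traverses \<sigma> v \<gamma> is a b" "traverses \<sigma> v \<delta> is a' b'"
  shows "\<exists>\<phi>. continuous_on {a'..b'} \<phi> \<and> strict_mono_on {a'..b'} \<phi> \<and> \<phi> a' = a \<and> \<phi> b' = b \<and>
             (\<forall>t\<in>{a'..<b'}. \<delta> t = \<gamma> (\<phi> t))"
  using assms
proof (induction "is" arbitrary: a a')
  case Nil
  then show ?case by (intro exI[of _ "\<lambda>_. b"]) (auto simp: strict_mono_on_def)
next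
  case (Cons i "is")
  from Cons.prems(1) obtain m where m: "m > a" "\<forall>t\<in>{a..m}. \<gamma> t = pt \<sigma> v i ((t - a) / (m - a))"
    "traverses \<sigma> v \<gamma> is m b" by auto
  from Cons.prems(2) obtain m' where m': "m' > a'" "\<forall>t\<in>{a'..m'}. \<delta> t = pt \<sigma> v i ((t - a') / (m' - a'))"
    "traverses \<sigma> v \<delta> is m' b'" by auto
  obtain \<psi> where \<psi>: "continuous_on {m'..b'} \<psi>" "strict_mono_on {m'..b'} \<psi>" "\<psi> m' = m" "\<psi> b' = b"
    "\<forall>t\<in>{m'..<b'}. \<delta> t = \<gamma> (\<psi> t)" using Cons.IH[OF m(3) m'(3)] by auto
  define f where "f t = a + (t - a') * ((m - a) / (m' - a'))" for t
  have f: "continuous_on {a'..m'} f" "strict_mono_on {a'..m'} f" "f a' = a" "f m' = \<psi> m'"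
  proof -
    have "(m - a) / (m' - a') > 0" using m(1) m'(1) by simp
    then show "strict_mono_on {a'..m'} f"
      by (intro strict_mono_onI) (simp add: f_def mult_strict_right_mono del: times_divide_eq_right)
    show "f m' = \<psi> m'" using m'(1) \<psi>(3) by (simp add: f_def)
  qed (use m'(1) in \<open>auto simp: f_def intro!: continuous_intros\<close>)
  note gl = glue_strict_mono_continuous[OF f(1,2) \<psi>(1,2) f(4) less_imp_le[OF m'(1)] traverses_le[OF m'(3)]]
  have "\<delta> t = \<gamma> (if t \<le> m' then f t else \<psi> t)" if t: "t \<in> {a'..<b'}" for t
  proof (cases "t \<le> m'")
    case True
    have "a \<le> f t" using t m(1) m'(1) by (simp add: f_def)
    moreover have "f t \<le> f m'" using f(2) True t by (cases "t = m'") (auto simp: strict_mono_on_def intro: less_imp_le)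
    ultimately have "\<gamma> (f t) = pt \<sigma> v i ((f t - a) / (m - a))" using m(2) f(4) \<psi>(3) by auto
    also have "(f t - a) / (m - a) = (t - a') / (m' - a')" using m(1) by (simp add: f_def)
    finally show ?thesis using True m'(2) t by auto
  qed (use \<psi> t in auto)
  moreover have "b' = m' \<Longrightarrow> f m' = b" using f(4) \<psi>(4) by simp
  ultimately show ?case
    using gl f(3) \<psi>(4) m'(1) traverses_le[OF m'(3)]
    by (intro exI[of _ "\<lambda>t. if t \<le> m' then f t else \<psi> t"]) auto
qed

text \<open>The circle unrolled: a change of base point together with an increasing
  reparametrization becomes one increasing function \<psi> with
  \<open>\<psi> 1 = \<psi> 0 + 1\<close>, and such functions compose.\<close>

definition periodic_ext :: "(real \<Rightarrow> 'a) \<Rightarrow> real \<Rightarrow> 'a" where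
  "periodic_ext \<gamma> t = \<gamma> (frac t)"

lemma periodic_ext_add_1 [simp]: "periodic_ext \<gamma> (t + 1) = periodic_ext \<gamma> t"
  by (simp add: periodic_ext_def frac_1_eq)

lemma periodic_ext_diff_int [simp]: "periodic_ext \<gamma> (t - of_int n) = periodic_ext \<gamma> t"
  by (simp add: periodic_ext_def frac_def)

lemma periodic_ext_unit: "\<gamma> 1 = \<gamma> 0 \<Longrightarrow> t \<in> {0..1} \<Longrightarrow> periodic_ext \<gamma> t = \<gamma> t"
  by (cases "t = 1") (auto simp: periodic_ext_def frac_eq)

lemma shiftpath_periodic_ext:
  fixes \<gamma> :: "real \<Rightarrow> 'a::topological_space"
  assumes "\<gamma> 1 = \<gamma> 0" "a \<in> {0..1}" "u \<in> {0..1}"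
  shows "shiftpath a \<gamma> u = periodic_ext \<gamma> (a + u)"
proof (cases "a + u \<le> 1")
  case True
  then show ?thesis using assms periodic_ext_unit[of \<gamma> "a + u"] by (simp add: shiftpath_def)
next
  case False
  then show ?thesis using assms periodic_ext_unit[of \<gamma> "a + u - 1"] periodic_ext_add_1[of \<gamma> "a + u - 1"]
    by (simp add: shiftpath_def)
qed

lemma same_oriented_curve_periodic:
  fixes \<gamma> \<delta> :: "real \<Rightarrow> 'a::topological_space"
  assumes cl: "\<gamma> 1 = \<gamma> 0"
  shows "same_oriented_curve \<gamma> \<delta> \<longleftrightarrow>
    (\<exists>\<psi>. continuous_on {0..1} \<psi> \<and> strict_mono_on {0..1} \<psi> \<and> \<psi> 0 \<in> {0..1} \<and> \<psi> 1 = \<psi> 0 + 1 \<and>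
         (\<forall>t\<in>{0..1}. \<delta> t = periodic_ext \<gamma> (\<psi> t)))" (is "?L \<longleftrightarrow> ?R")
proof
  assume ?L
  then obtain a \<phi> where a: "a \<in> {0..1}" and \<phi>: "continuous_on {0..1} \<phi>" "strict_mono_on {0..1} \<phi>"
    "\<phi> 0 = 0" "\<phi> 1 = 1" "\<forall>t\<in>{0..1}. \<delta> t = shiftpath a \<gamma> (\<phi> t)"
    unfolding same_oriented_curve_def by blast
  have "\<phi> t \<in> {0..1}" if "t \<in> {0..1}" for t
    using strict_mono_on_leD[OF \<phi>(2), of 0 t] strict_mono_on_leD[OF \<phi>(2), of t 1] that \<phi>(3,4) by auto
  then have "\<delta> t = periodic_ext \<gamma> (a + \<phi> t)" if "t \<in> {0..1}" for t
    using \<phi>(5) that shiftpath_periodic_ext[of \<gamma> a "\<phi> t", OF cl a] by simp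
  then show ?R using a \<phi> by (intro exI[of _ "\<lambda>t. a + \<phi> t"])
      (auto intro!: continuous_intros strict_mono_onI dest: strict_mono_onD)
next
  assume ?R
  then obtain \<psi> where \<psi>: "continuous_on {0..1} \<psi>" "strict_mono_on {0..1} \<psi>" "\<psi> 0 \<in> {0..1}" "\<psi> 1 = \<psi> 0 + 1"
    "\<forall>t\<in>{0..1}. \<delta> t = periodic_ext \<gamma> (\<psi> t)" by blast
  have "\<psi> t - \<psi> 0 \<in> {0..1}" if "t \<in> {0..1}" for t
    using strict_mono_on_leD[OF \<psi>(2), of 0 t] strict_mono_on_leD[OF \<psi>(2), of t 1] that \<psi>(4) by auto
  then have "\<delta> t = shiftpath (\<psi> 0) \<gamma> (\<psi> t - \<psi> 0)" if "t \<in> {0..1}" for t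
    using \<psi>(5) that shiftpath_periodic_ext[of \<gamma> "\<psi> 0" "\<psi> t - \<psi> 0", OF cl \<psi>(3)] by simp
  then show ?L unfolding same_oriented_curve_def using \<psi>
    by (intro bexI[of _ "\<psi> 0"] exI[of _ "\<lambda>t. \<psi> t - \<psi> 0"])
      (auto intro!: continuous_intros strict_mono_onI dest: strict_mono_onD)
qed

lemma same_oriented_curve_periodicI:
  fixes \<gamma> \<delta> :: "real \<Rightarrow> 'a::topological_space"
  assumes cl: "\<gamma> 1 = \<gamma> 0" and \<psi>: "continuous_on {0..1} \<psi>" "strict_mono_on {0..1} \<psi>" "\<psi> 1 = \<psi> 0 + 1"
    "\<And>t. t \<in> {0..1} \<Longrightarrow> \<delta> t = periodic_ext \<gamma> (\<psi> t)"
  shows "same_oriented_curve \<gamma> \<delta>"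
  unfolding same_oriented_curve_periodic[OF cl]
proof (intro exI conjI)
  let ?n = "of_int \<lfloor>\<psi> 0\<rfloor>"
  show "continuous_on {0..1} (\<lambda>t. \<psi> t - ?n)" by (intro continuous_intros \<psi>)
  show "strict_mono_on {0..1} (\<lambda>t. \<psi> t - ?n)" using \<psi>(2) by (auto simp: strict_mono_on_def)
  show "\<psi> 0 - ?n \<in> {0..1}" using floor_correct[of "\<psi> 0"] by simp linarith
qed (use \<psi> in auto)

lemma same_oriented_curve_trans:
  fixes \<gamma> \<delta> \<epsilon> :: "real \<Rightarrow> 'a::topological_space"
  assumes cl: "\<gamma> 1 = \<gamma> 0" and "same_oriented_curve \<gamma> \<delta>" "same_oriented_curve \<delta> \<epsilon>"
  shows "same_oriented_curve \<gamma> \<epsilon>"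
proof -
  obtain f where f: "continuous_on {0..1} f" "strict_mono_on {0..1} f" "f 1 = f 0 + 1"
    "\<forall>t\<in>{0..1}. \<delta> t = periodic_ext \<gamma> (f t)"
    using assms(2) unfolding same_oriented_curve_periodic[OF cl] by blast
  have cl': "\<delta> 1 = \<delta> 0" using f(3,4) by simp
  obtain g where g: "continuous_on {0..1} g" "strict_mono_on {0..1} g" "g 0 \<in> {0..1}" "g 1 = g 0 + 1"
    "\<forall>t\<in>{0..1}. \<epsilon> t = periodic_ext \<delta> (g t)"
    using assms(3) unfolding same_oriented_curve_periodic[OF cl'] by blast
  \<comment> \<open>\<open>g\<close> takes values up to 2, so \<open>f\<close> is continued over a
    second period.\<close>
  define h where "h t = (if t \<le> 1 then f t else f (t - 1) + 1)" for t
  have sh: "continuous_on {1..2} (\<lambda>t. f (t - 1) + 1)" "strict_mono_on {1..2} (\<lambda>t. f (t - 1) + 1)"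
    by (intro continuous_intros continuous_on_compose2[OF f(1)]; auto)
      (use f(2) in \<open>auto simp: strict_mono_on_def\<close>)
  have "f 1 = f (1 - 1) + 1" using f(3) by simp
  note gl = glue_strict_mono_continuous[OF f(1,2) sh this, folded h_def, simplified]
  have pe: "periodic_ext \<delta> t = periodic_ext \<gamma> (h t)" if t: "t \<in> {0..2}" for t
  proof (cases "t \<le> 1")
    case True
    then show ?thesis using f(4) t periodic_ext_unit[of \<delta> t, OF cl'] by (simp add: h_def)
  next
    case False
    then show ?thesis
      using f(4) t periodic_ext_unit[of \<delta> "t - 1", OF cl'] periodic_ext_add_1[of \<delta> "t - 1"] by (simp add: h_def)
  qed
  have g02: "g t \<in> {0..2}" if "t \<in> {0..1}" for t
    using strict_mono_on_leD[OF g(2), of 0 t] strict_mono_on_leD[OF g(2), of t 1] that g(3,4) by auto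
  show ?thesis
  proof (rule same_oriented_curve_periodicI[OF cl])
    show "continuous_on {0..1} (\<lambda>t. h (g t))"
      by (rule continuous_on_compose2[OF gl(1) g(1)]) (use g02 in auto)
    show "strict_mono_on {0..1} (\<lambda>t. h (g t))"
      by (intro strict_mono_onI strict_mono_onD[OF gl(2)] strict_mono_onD[OF g(2)]) (use g02 in auto)
    show "h (g 1) = h (g 0) + 1"
      using g(3,4) f(3) by (auto simp: h_def)
    show "\<epsilon> t = periodic_ext \<gamma> (h (g t))" if "t \<in> {0..1}" for t
      using g(5) pe[OF g02[OF that]] that by simp
  qed
qed

lemma same_oriented_curve_image:
  assumes "same_oriented_curve \<gamma> \<delta>"
  shows "same_oriented_curve (F \<circ> \<gamma>) (F \<circ> \<delta>)"
proof -
  obtain a \<phi> where *: "a \<in> {0..1}" "continuous_on {0..1} \<phi>" "strict_mono_on {0..1} \<phi>"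
    "\<phi> 0 = 0" "\<phi> 1 = 1" "\<forall>t\<in>{0..1}. \<delta> t = shiftpath a \<gamma> (\<phi> t)"
    using assms unfolding same_oriented_curve_def by blast
  have "(F \<circ> \<delta>) t = shiftpath a (F \<circ> \<gamma>) (\<phi> t)" if "t \<in> {0..1}" for t
    using *(6) that by (simp add: shiftpath_def)
  with * show ?thesis unfolding same_oriented_curve_def by blast
qed

text \<open>The edge lists are \<open>xs @ ys\<close> and \<open>ys @ xs\<close>. The
  reparametrizations of the two blocks are glued after raising the one for \<open>xs\<close> by a
  full period.\<close>

lemma traverses_same_cycle:
  fixes \<gamma> \<delta> :: "real \<Rightarrow> 'a::real_normed_vector"
  assumes "traverses \<sigma> v \<gamma> is 0 1" "traverses \<sigma> v \<delta> js 0 1" "cycle_list \<sigma> is" "cycle_list \<sigma> js"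
    and "set is \<inter> set js \<noteq> {}" and cl: "\<gamma> 1 = \<gamma> 0" "\<delta> 1 = \<delta> 0"
  shows "same_oriented_curve \<gamma> \<delta>"
proof -
  obtain xs ys where xy: "is = xs @ ys" "js = ys @ xs" using cycle_lists_sharing[OF assms(3-5)] .
  obtain m where m: "traverses \<sigma> v \<gamma> xs 0 m" "traverses \<sigma> v \<gamma> ys m 1"
    using assms(1) xy by (auto simp: traverses_append)
  obtain n where n: "traverses \<sigma> v \<delta> ys 0 n" "traverses \<sigma> v \<delta> xs n 1"
    using assms(2) xy by (auto simp: traverses_append)
  obtain f where f: "continuous_on {0..n} f" "strict_mono_on {0..n} f" "f 0 = m" "f n = 1"
    "\<forall>t\<in>{0..<n}. \<delta> t = \<gamma> (f t)" using traverses_reparam[OF m(2) n(1)] by blast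
  obtain g where g: "continuous_on {n..1} g" "strict_mono_on {n..1} g" "g n = 0" "g 1 = m"
    "\<forall>t\<in>{n..<1}. \<delta> t = \<gamma> (g t)" using traverses_reparam[OF m(1) n(2)] by blast
  have mn: "0 \<le> n" "n \<le> 1" "0 \<le> m" "m \<le> 1" using m n traverses_le by blast+
  have g': "continuous_on {n..1} (\<lambda>t. g t + 1)" "strict_mono_on {n..1} (\<lambda>t. g t + 1)"
    using g(2) by (auto intro!: continuous_intros g(1) simp: strict_mono_on_def)
  define h where "h t = (if t \<le> n then f t else g t + 1)" for t
  have "f n = g n + 1" using f g by simp
  note gl = glue_strict_mono_continuous[OF f(1,2) g' this mn(1,2), folded h_def]
  have h01: "h 0 = m" "h 1 = m + 1"
    using f(3,4) g(3,4) mn by (auto simp: h_def)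
  have *: "\<delta> t = periodic_ext \<gamma> (h t)" if t: "t \<in> {0..<1}" for t
  proof (cases "t < n")
    case True
    have "f t \<in> {0..1}"
      using strict_mono_on_leD[OF f(2), of 0 t] strict_mono_on_leD[OF f(2), of t n] t True f(3,4) mn by auto
    then show ?thesis using True f(5) t periodic_ext_unit[of \<gamma> "f t", OF cl(1)] by (simp add: h_def)
  next
    case False
    have "g t \<in> {0..1}"
      using strict_mono_on_leD[OF g(2), of n t] strict_mono_on_leD[OF g(2), of t 1] t False g(3,4) mn by auto
    then have "periodic_ext \<gamma> (g t + 1) = \<delta> t"
      using False g(5) t periodic_ext_unit[of \<gamma> "g t", OF cl(1)] by simp
    moreover have "h t = g t + 1" using False f(4) g(3) by (auto simp: h_def)
    ultimately show ?thesis by simp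
  qed
  show ?thesis
  proof (rule same_oriented_curve_periodicI[OF cl(1)])
    show "continuous_on {0..1} h" "strict_mono_on {0..1} h" "h 1 = h 0 + 1" using gl h01 by auto
    fix t :: real assume "t \<in> {0..1}"
    then show "\<delta> t = periodic_ext \<gamma> (h t)"
      using *[of t] *[of 0] cl(2) h01 periodic_ext_add_1[of \<gamma> m] by (cases "t = 1") auto
  qed
qed

section \<open>Transfer to the 3-sphere\<close>

definition from_S3 :: "(real^3) \<times> real \<Rightarrow> real^3" where
  "from_S3 p = (1 / (1 - snd p)) *\<^sub>R fst p"

lemma S3_iff: "p \<in> S3 \<longleftrightarrow> (norm (fst p))\<^sup>2 + (snd p)\<^sup>2 = 1"
proof -
  have "norm p = sqrt ((norm (fst p))\<^sup>2 + (snd p)\<^sup>2)" by (cases p) (simp add: norm_Pair)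
  then show ?thesis by (auto simp: S3_def)
qed

lemma S3_snd_less_1:
  assumes "p \<in> S3" "p \<noteq> (0, 1)"
  shows "snd p < 1"
proof (rule ccontr)
  assume "\<not> snd p < 1"
  then have "1 \<le> snd p" by simp
  then have "1 \<le> (snd p)\<^sup>2" by (simp add: one_le_power)
  then have "(norm (fst p))\<^sup>2 = 0" "(snd p)\<^sup>2 = 1"
    using assms(1) zero_le_power2[of "norm (fst p)"] unfolding S3_iff by linarith+
  then have "fst p = 0" "snd p = 1" using \<open>1 \<le> snd p\<close> by (auto simp: power2_eq_1_iff)
  then show False using assms(2) by (cases p) auto
qed

lemma norm_sq_add_1_pos: "(norm x)\<^sup>2 + 1 > (0::real)"
  by (simp add: add_nonneg_pos)

lemma to_S3_in_S3: "to_S3 x \<in> S3"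
proof -
  define n where "n = (norm x)\<^sup>2"
  have n: "n + 1 \<noteq> 0" using norm_sq_add_1_pos[of x] by (simp add: n_def)
  have "(norm (fst (to_S3 x)))\<^sup>2 = (2 / (n + 1))\<^sup>2 * n"
    by (simp add: to_S3_def n_def power_mult_distrib power_divide)
  moreover have "snd (to_S3 x) = (n - 1) / (n + 1)" by (simp add: to_S3_def n_def)
  ultimately have "(norm (fst (to_S3 x)))\<^sup>2 + (snd (to_S3 x))\<^sup>2 = (4 * n + (n - 1)\<^sup>2) / (n + 1)\<^sup>2"
    by (simp add: power_divide add_divide_distrib)
  also have "4 * n + (n - 1)\<^sup>2 = (n + 1)\<^sup>2" by (simp add: power2_eq_square algebra_simps)
  finally show ?thesis using n by (simp add: S3_iff)
qed

lemma to_S3_snd: "1 - snd (to_S3 x) = 2 / ((norm x)\<^sup>2 + 1)"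
  using norm_sq_add_1_pos[of x] by (simp add: to_S3_def field_simps)

lemma to_S3_not_north: "to_S3 x \<noteq> (0, 1)"
  using to_S3_snd[of x] norm_sq_add_1_pos[of x] by auto

lemma from_to_S3 [simp]: "from_S3 (to_S3 x) = x"
proof -
  define n where "n = (norm x)\<^sup>2 + 1"
  have "n > 0" using norm_sq_add_1_pos[of x] by (simp add: n_def)
  have "from_S3 (to_S3 x) = (1 / (2 / n) * (2 / n)) *\<^sub>R x"
    unfolding from_S3_def to_S3_snd n_def[symmetric] by (simp add: to_S3_def n_def)
  also have "1 / (2 / n) * (2 / n) = 1" using \<open>n > 0\<close> by simp
  finally show ?thesis by simp
qed

lemma norm_from_S3:
  assumes "p \<in> S3" "p \<noteq> (0, 1)"
  shows "(norm (from_S3 p))\<^sup>2 = (1 + snd p) / (1 - snd p)"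
proof -
  have w: "1 - snd p > 0" using S3_snd_less_1[OF assms] by simp
  have "(norm (from_S3 p))\<^sup>2 = (norm (fst p))\<^sup>2 / (1 - snd p)\<^sup>2"
    by (simp add: from_S3_def power_mult_distrib power_divide)
  also have "(norm (fst p))\<^sup>2 = (1 - snd p) * (1 + snd p)"
    using assms(1) unfolding S3_iff by (simp add: power2_eq_square algebra_simps)
  finally show ?thesis using w by (simp add: power2_eq_square)
qed

lemma to_from_S3:
  assumes "p \<in> S3" "p \<noteq> (0, 1)"
  shows "to_S3 (from_S3 p) = p"
proof -
  have w: "1 - snd p > 0" using S3_snd_less_1[OF assms] by simp
  have n1: "(norm (from_S3 p))\<^sup>2 + 1 = 2 / (1 - snd p)"
    unfolding norm_from_S3[OF assms] using w by (simp add: field_simps)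
  have n2: "(norm (from_S3 p))\<^sup>2 - 1 = 2 * snd p / (1 - snd p)"
    unfolding norm_from_S3[OF assms] using w by (simp add: field_simps)
  show ?thesis using w unfolding to_S3_def n1 n2 by (cases p) (simp add: from_S3_def)
qed

lemma continuous_on_to_S3: "continuous_on A to_S3"
  unfolding to_S3_def by (intro continuous_intros ballI) (metis less_irrefl norm_sq_add_1_pos)+

lemma compact_S3: "compact S3"
  by (simp add: S3_def)

definition lift_S3 :: "(real \<Rightarrow> real^3 \<Rightarrow> real^3) \<Rightarrow> real \<Rightarrow> (real^3) \<times> real \<Rightarrow> (real^3) \<times> real" where
  "lift_S3 H t p = (if p = (0, 1) then p else to_S3 (H t (from_S3 p)))"

lemma lift_S3_to_S3: "lift_S3 H t (to_S3 x) = to_S3 (H t x)"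
  using to_S3_not_north[of x] by (simp add: lift_S3_def)

text \<open>Off the pole continuity comes from the formula, and on a polar cap the map is the
  identity; these two open sets cover the sphere.\<close>

lemma ambient_isotopy_lift_S3:
  assumes H: "cs_isotopy H"
  shows "ambient_isotopy S3 (lift_S3 H)"
proof -
  obtain R0 where R0: "\<And>t x. t \<in> {0..1} \<Longrightarrow> norm x \<ge> R0 \<Longrightarrow> H t x = x"
    using H unfolding cs_isotopy_def by blast
  define R where "R = max R0 0"
  have R: "R \<ge> 0" "\<And>t x. t \<in> {0..1} \<Longrightarrow> norm x \<ge> R \<Longrightarrow> H t x = x"
    using R0 by (auto simp: R_def)
  \<comment> \<open>The height at which the sphere of radius \<open>R\<close> lands under
    \<open>to_S3\<close>; above it the isotopy is at rest.\<close>
  define c where "c = (R\<^sup>2 - 1) / (R\<^sup>2 + 1)"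
  define D :: "(real \<times> (real^3) \<times> real) set" where "D = {0..1} \<times> S3"
  define U where "U = D \<inter> {q. snd q \<noteq> (0, 1)}"
  define V where "V = D \<inter> {q. snd (snd q) > c}"
  have R1: "R\<^sup>2 + 1 > 0" by (simp add: add_nonneg_pos)
  have c1: "c < 1" unfolding c_def using R1 by (simp add: field_simps)
  have UV: "U \<union> V = D" unfolding U_def V_def using c1 by auto
  have oU: "openin (top_of_set D) U" unfolding U_def
    by (rule openin_open_Int) (intro open_Collect_neq continuous_intros)
  have oV: "openin (top_of_set D) V" unfolding V_def
    by (rule openin_open_Int) (intro open_Collect_less continuous_intros)
  have cU: "continuous_on U (\<lambda>(t, p). lift_S3 H t p)"
  proof -
    have "continuous_on U (\<lambda>q. from_S3 (snd q))"
      unfolding from_S3_def by (intro continuous_intros) (auto simp: U_def D_def dest!: S3_snd_less_1)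
    then have f: "continuous_on U (\<lambda>q. (fst q, from_S3 (snd q)))" by (intro continuous_intros)
    have g: "continuous_on ({0..1} \<times> UNIV) (\<lambda>(t, x). H t x)" using H by (simp add: cs_isotopy_def)
    have "continuous_on U (\<lambda>q. (\<lambda>(t, x). H t x) (fst q, from_S3 (snd q)))"
      by (rule continuous_on_compose2[OF g f]) (auto simp: U_def D_def)
    then have "continuous_on U (\<lambda>q. to_S3 ((\<lambda>(t, x). H t x) (fst q, from_S3 (snd q))))"
      by (rule continuous_on_compose2[OF continuous_on_to_S3]) auto
    then show ?thesis
      by (rule continuous_on_eq) (auto simp: lift_S3_def U_def)
  qed
  have cV: "continuous_on V (\<lambda>(t, p). lift_S3 H t p)"
  proof -
    have "lift_S3 H t p = p" if "(t, p) \<in> V" for t p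
    proof (cases "p = (0, 1)")
      case False
      have tp: "t \<in> {0..1}" "p \<in> S3" "c < snd p" using that by (auto simp: V_def D_def)
      have w: "1 - snd p > 0" using S3_snd_less_1[OF tp(2) False] by simp
      have "R\<^sup>2 - 1 < snd p * (R\<^sup>2 + 1)" using tp(3) R1 by (simp add: c_def pos_divide_less_eq)
      then have "R\<^sup>2 * (1 - snd p) \<le> 1 + snd p" by (simp add: algebra_simps)
      then have "R\<^sup>2 \<le> (norm (from_S3 p))\<^sup>2"
        unfolding norm_from_S3[OF tp(2) False] using w by (simp add: field_simps)
      then have "R \<le> norm (from_S3 p)" by (rule power2_le_imp_le) simp
      then show ?thesis using R(2)[OF tp(1)] to_from_S3[OF tp(2) False] by (simp add: lift_S3_def)
    qed (simp add: lift_S3_def)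
    then have "continuous_on V (\<lambda>(t, p). lift_S3 H t p) \<longleftrightarrow> continuous_on V snd"
      by (intro continuous_on_cong) auto
    then show ?thesis by (simp add: continuous_on_snd)
  qed
  have cD: "continuous_on ({0..1} \<times> S3) (\<lambda>(t, p). lift_S3 H t p)"
    using continuous_on_Un_local_open[of U V "\<lambda>(t, p). lift_S3 H t p"] oU oV cU cV UV by (simp add: D_def)
  have "\<exists>g. homeomorphism S3 S3 (lift_S3 H t) g" if t: "t \<in> {0..1}" for t
  proof (rule homeomorphism_compact[OF compact_S3])
    have "continuous_on S3 (\<lambda>p. (\<lambda>(t, p). lift_S3 H t p) (t, p))"
      by (rule continuous_on_compose2[OF cD]) (use t in \<open>auto intro!: continuous_intros\<close>)
    then show "continuous_on S3 (lift_S3 H t)" by simp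
    have b: "bij (H t)" using H t by (simp add: cs_isotopy_def)
    show "inj_on (lift_S3 H t) S3"
    proof (rule inj_onI)
      fix p q assume pq: "p \<in> S3" "q \<in> S3" "lift_S3 H t p = lift_S3 H t q"
      show "p = q"
      proof (cases "p = (0, 1) \<or> q = (0, 1)")
        case True
        then show ?thesis using pq(3) to_S3_not_north
          by (metis lift_S3_def)
      next
        case False
        then have "to_S3 (H t (from_S3 p)) = to_S3 (H t (from_S3 q))" using pq(3) by (simp add: lift_S3_def)
        then have "H t (from_S3 p) = H t (from_S3 q)" by (metis from_to_S3)
        then have "from_S3 p = from_S3 q" using b by (auto dest: bij_is_inj injD)
        then show ?thesis using to_from_S3 pq(1,2) False by metis
      qed
    qed
    show "lift_S3 H t ` S3 = S3"
    proof
      show "lift_S3 H t ` S3 \<subseteq> S3" using to_S3_in_S3 by (auto simp: lift_S3_def)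
      show "S3 \<subseteq> lift_S3 H t ` S3"
      proof
        fix p assume p: "p \<in> S3"
        show "p \<in> lift_S3 H t ` S3"
        proof (cases "p = (0, 1)")
          case True
          then show ?thesis using p by (intro image_eqI[of _ _ p]) (auto simp: lift_S3_def)
        next
          case False
          obtain x where "H t x = from_S3 p" using b by (metis bij_pointE)
          then show ?thesis
            using to_from_S3[OF p False] to_S3_in_S3 by (intro image_eqI[of _ _ "to_S3 x"]) (auto simp: lift_S3_to_S3)
        qed
      qed
    qed
  qed
  moreover have "lift_S3 H 0 p = p" if "p \<in> S3" for p
    using H to_from_S3[OF that] by (auto simp: lift_S3_def cs_isotopy_def)
  ultimately show ?thesis using cD unfolding ambient_isotopy_def by blast
qed

section \<open>Inverting and composing ambient isotopies\<close>

lemma ambient_isotopy_inverse: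
  fixes S :: "'a::t2_space set"
  assumes H: "ambient_isotopy S H" and S: "compact S"
  obtains G where "ambient_isotopy S G" "\<And>t x. t \<in> {0..1} \<Longrightarrow> x \<in> S \<Longrightarrow> G t (H t x) = x"
proof -
  \<comment> \<open>Keeping the time as a coordinate turns the whole isotopy into one continuous
    bijection of a compact space, so the inverses depend continuously on time as well.\<close>
  define F where "F = (\<lambda>(t, x). (t, H t x))"
  have hom: "\<exists>g. homeomorphism S S (H t) g" if "t \<in> {0..1}" for t
    using H that unfolding ambient_isotopy_def by blast
  then obtain h where h: "\<And>t. t \<in> {0..1} \<Longrightarrow> homeomorphism S S (H t) (h t)" by metis
  have hh: "H t x \<in> S" "h t x \<in> S" "h t (H t x) = x" "H t (h t x) = x" if "t \<in> {0..1}" "x \<in> S" for t x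
    using h[OF that(1)] that(2) unfolding homeomorphism_def by auto
  have cF: "continuous_on ({0..1} \<times> S) F"
  proof -
    have "continuous_on ({0..1} \<times> S) (\<lambda>q. (fst q, (\<lambda>(t, x). H t x) q))"
      using H by (intro continuous_intros) (auto simp: ambient_isotopy_def)
    then show ?thesis by (simp add: F_def case_prod_beta')
  qed
  have inv: "(\<lambda>(t, x). (t, h t x)) (F q) = q" if "q \<in> {0..1} \<times> S" for q
    using that hh by (auto simp: F_def)
  have im: "F ` ({0..1} \<times> S) = {0..1} \<times> S"
  proof
    show "{0..1} \<times> S \<subseteq> F ` ({0..1} \<times> S)"
    proof clarify
      fix t :: real and x assume "t \<in> {0..1}" "x \<in> S"
      then show "(t, x) \<in> F ` ({0..1} \<times> S)"
        using hh by (intro image_eqI[of _ _ "(t, h t x)"]) (auto simp: F_def)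
    qed
  qed (use hh in \<open>auto simp: F_def\<close>)
  have "continuous_on (F ` ({0..1} \<times> S)) (\<lambda>(t, x). (t, h t x))"
    by (rule continuous_on_inv[OF cF]) (use S inv in \<open>auto simp: compact_Times\<close>)
  then have "continuous_on ({0..1} \<times> S) (\<lambda>q. snd ((\<lambda>(t, x). (t, h t x)) q))"
    unfolding im by (rule continuous_on_snd)
  then have "continuous_on ({0..1} \<times> S) (\<lambda>(t, x). h t x)" by (simp add: case_prod_beta')
  moreover have "\<exists>g. homeomorphism S S (h t) g" if "t \<in> {0..1}" for t
    using h[OF that] homeomorphism_symD by blast
  moreover have "h 0 x = x" if "x \<in> S" for x
    using H hh(3)[of 0 x] that by (simp add: ambient_isotopy_def)
  ultimately have "ambient_isotopy S h" unfolding ambient_isotopy_def by blast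
  then show thesis using that hh by blast
qed

lemma ambient_isotopy_compose:
  assumes H: "ambient_isotopy S H" and G: "ambient_isotopy S G"
  shows "ambient_isotopy S (\<lambda>t x. G t (H t x))"
proof -
  have hs: "H t x \<in> S" if "t \<in> {0..1}" "x \<in> S" for t x
    using H that unfolding ambient_isotopy_def homeomorphism_def by blast
  have f: "continuous_on ({0..1} \<times> S) (\<lambda>q. (fst q, (\<lambda>(t, x). H t x) q))"
    using H by (intro continuous_intros) (auto simp: ambient_isotopy_def)
  have g: "continuous_on ({0..1} \<times> S) (\<lambda>(t, x). G t x)" using G by (simp add: ambient_isotopy_def)
  have "continuous_on ({0..1} \<times> S) (\<lambda>q. (\<lambda>(t, x). G t x) (fst q, (\<lambda>(t, x). H t x) q))"
    by (rule continuous_on_compose2[OF g f]) (use hs in auto)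
  then have "continuous_on ({0..1} \<times> S) (\<lambda>(t, x). G t (H t x))" by (simp add: case_prod_beta')
  moreover have "\<exists>g. homeomorphism S S (\<lambda>x. G t (H t x)) g" if t: "t \<in> {0..1}" for t
  proof -
    obtain h g where "homeomorphism S S (H t) h" "homeomorphism S S (G t) g"
      using H G t unfolding ambient_isotopy_def by blast
    from homeomorphism_compose[OF this] show ?thesis by (auto simp: o_def)
  qed
  ultimately show ?thesis using H G unfolding ambient_isotopy_def by simp
qed

lemma isotopic_links_trans:
  fixes S :: "'a::topological_space set"
  assumes "isotopic_links S K K'" "isotopic_links S K' K''" and cl: "\<And>\<gamma>. \<gamma> \<in> K \<Longrightarrow> \<gamma> 1 = \<gamma> 0"
  shows "isotopic_links S K K''"
proof -
  obtain H f where H: "ambient_isotopy S H" "bij_betw f K K'" "\<forall>\<gamma>\<in>K. same_oriented_curve (H 1 \<circ> \<gamma>) (f \<gamma>)"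
    using assms(1) unfolding isotopic_links_def by blast
  obtain G g where G: "ambient_isotopy S G" "bij_betw g K' K''" "\<forall>\<gamma>\<in>K'. same_oriented_curve (G 1 \<circ> \<gamma>) (g \<gamma>)"
    using assms(2) unfolding isotopic_links_def by blast
  show ?thesis unfolding isotopic_links_def
  proof (intro exI conjI ballI)
    show "ambient_isotopy S (\<lambda>t x. G t (H t x))" by (rule ambient_isotopy_compose[OF H(1) G(1)])
    show "bij_betw (g \<circ> f) K K''" by (rule bij_betw_trans[OF H(2) G(2)])
    fix \<gamma> assume \<gamma>: "\<gamma> \<in> K"
    have "same_oriented_curve (G 1 \<circ> (H 1 \<circ> \<gamma>)) (G 1 \<circ> f \<gamma>)"
      by (rule same_oriented_curve_image) (use H \<gamma> in auto)
    moreover have "same_oriented_curve (G 1 \<circ> f \<gamma>) (g (f \<gamma>))"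
      using G(3) H(2) \<gamma> by (auto simp: bij_betw_def)
    ultimately have "same_oriented_curve (G 1 \<circ> (H 1 \<circ> \<gamma>)) (g (f \<gamma>))"
      by (rule same_oriented_curve_trans[rotated]) (simp add: cl[OF \<gamma>])
    then show "same_oriented_curve ((\<lambda>x. G 1 (H 1 x)) \<circ> \<gamma>) ((g \<circ> f) \<gamma>)" by (simp add: o_def)
  qed
qed

text \<open>\<open>H\<close> carries the curves of \<open>P\<close> to those of \<open>K\<close>, as
  the later constructions lead from the polygonal link to the grid link. The goal asks for the
  opposite direction, which \<open>ambient_isotopy_inverse\<close> provides.\<close>

lemma isotopic_links_S3_of_cs_isotopy:
  assumes H: "cs_isotopy H" and f: "bij_betw f K P"
    and same: "\<And>\<gamma>. \<gamma> \<in> K \<Longrightarrow> same_oriented_curve \<gamma> (H 1 \<circ> f \<gamma>)"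
  shows "isotopic_links S3 (link_in_S3 K) (link_in_S3 P)"
proof -
  obtain G where G: "ambient_isotopy S3 G" "\<And>t x. t \<in> {0..1} \<Longrightarrow> x \<in> S3 \<Longrightarrow> G t (lift_S3 H t x) = x"
    by (rule ambient_isotopy_inverse[OF ambient_isotopy_lift_S3[OF H] compact_S3]) (rule that)
  define r where "r \<gamma> = from_S3 \<circ> \<gamma>" for \<gamma> :: "real \<Rightarrow> (real^3) \<times> real"
  have r: "r (to_S3 \<circ> \<gamma>) = \<gamma>" for \<gamma> by (simp add: r_def fun_eq_iff)
  have inj: "inj_on (\<lambda>\<gamma>. to_S3 \<circ> \<gamma>) A" for A :: "(real \<Rightarrow> real^3) set"
  proof (rule inj_onI)
    fix a b :: "real \<Rightarrow> real^3" assume "to_S3 \<circ> a = to_S3 \<circ> b"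
    then have "r (to_S3 \<circ> a) = r (to_S3 \<circ> b)" by simp
    then show "a = b" by (simp only: r)
  qed
  show ?thesis unfolding isotopic_links_def
  proof (intro exI conjI ballI)
    have "bij_betw r (link_in_S3 K) K"
      unfolding link_in_S3_def by (rule bij_betw_byWitness[where f' = "\<lambda>\<gamma>. to_S3 \<circ> \<gamma>"]) (auto simp: r)
    moreover have "bij_betw (\<lambda>\<gamma>. to_S3 \<circ> \<gamma>) P (link_in_S3 P)"
      unfolding link_in_S3_def by (rule inj_on_imp_bij_betw[OF inj])
    ultimately show "bij_betw ((\<lambda>\<gamma>. to_S3 \<circ> \<gamma>) \<circ> f \<circ> r) (link_in_S3 K) (link_in_S3 P)"
      using f bij_betw_trans by (metis comp_assoc)
    show "ambient_isotopy S3 G" by fact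
    fix \<gamma> assume "\<gamma> \<in> link_in_S3 K"
    then obtain g where g: "g \<in> K" "\<gamma> = to_S3 \<circ> g" by (auto simp: link_in_S3_def)
    have "same_oriented_curve (G 1 \<circ> (to_S3 \<circ> g)) (G 1 \<circ> (to_S3 \<circ> (H 1 \<circ> f g)))"
      by (intro same_oriented_curve_image same g)
    moreover have "G 1 \<circ> (to_S3 \<circ> (H 1 \<circ> f g)) = to_S3 \<circ> f g"
      using G(2)[of 1, OF _ to_S3_in_S3] by (simp add: fun_eq_iff lift_S3_to_S3)
    ultimately show "same_oriented_curve (G 1 \<circ> \<gamma>) (((\<lambda>\<gamma>. to_S3 \<circ> \<gamma>) \<circ> f \<circ> r) \<gamma>)"
      by (simp add: g r)
  qed
qed

text \<open>All stages have four edges per index: a vertical step and the thirds of a row at first,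
  then spine, tooth, row and tooth, and finally the four segments behind
  \<open>row_vertices\<close>, up to a shift by two. One index set thus carries all motions.\<close>

abbreviation quad_index :: "'c set \<Rightarrow> ('c \<times> nat) set" where
  "quad_index \<equiv> sub_index (\<lambda>_. 4)"

abbreviation quad_next :: "('c \<Rightarrow> 'c) \<Rightarrow> 'c \<times> nat \<Rightarrow> 'c \<times> nat" where
  "quad_next \<equiv> sub_next (\<lambda>_. 4)"

section \<open>Boxes and combs\<close>

definition quad :: "('c \<Rightarrow> 'a) \<Rightarrow> ('c \<Rightarrow> 'a) \<Rightarrow> ('c \<Rightarrow> 'a) \<Rightarrow> ('c \<Rightarrow> 'a) \<Rightarrow> 'c \<times> nat \<Rightarrow> 'a" where
  "quad E F G D = (\<lambda>(c, q). if q = 0 then E c else if q = 1 then F c else if q = 2 then G c else D c)"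

lemma pt_quad:
  "pt (quad_next \<sigma>) (quad E F G D) (c, 0) s = (1 - s) *\<^sub>R E c + s *\<^sub>R F c"
  "pt (quad_next \<sigma>) (quad E F G D) (c, Suc 0) s = (1 - s) *\<^sub>R F c + s *\<^sub>R G c"
  "pt (quad_next \<sigma>) (quad E F G D) (c, 2) s = (1 - s) *\<^sub>R G c + s *\<^sub>R D c"
  "pt (quad_next \<sigma>) (quad E F G D) (c, 3) s = (1 - s) *\<^sub>R D c + s *\<^sub>R E (\<sigma> c)"
  by (simp_all add: pt_def quad_def sub_next_def)

lemma pt_nth: "pt \<sigma> (v :: _ \<Rightarrow> real^3) i s $ k = (1 - s) * v i $ k + s * v (\<sigma> i) $ k"
  by (simp add: pt_def)

lemma quad_lincomb:
  "(\<lambda>i. a *\<^sub>R quad E F G D i + b *\<^sub>R quad E' F' G' D' i) =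
   quad (\<lambda>c. a *\<^sub>R E c + b *\<^sub>R E' c) (\<lambda>c. a *\<^sub>R F c + b *\<^sub>R F' c)
        (\<lambda>c. a *\<^sub>R G c + b *\<^sub>R G' c) (\<lambda>c. a *\<^sub>R D c + b *\<^sub>R D' c)"
  by (auto simp: quad_def fun_eq_iff)

lemma simple_quadI:
  assumes "finite C" "bij_betw \<sigma> C C"
    and inj: "\<And>a b c d s t. c \<in> C \<Longrightarrow> d \<in> C \<Longrightarrow> a \<le> b \<Longrightarrow> b < 4 \<Longrightarrow> 0 \<le> s \<Longrightarrow> s < 1 \<Longrightarrow> 0 \<le> t \<Longrightarrow> t < 1 \<Longrightarrow>
      pt (quad_next \<sigma>) v (c, a) s = pt (quad_next \<sigma>) v (d, b) t \<Longrightarrow> c = d \<and> a = b \<and> s = t"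
  shows "simple_poly (quad_index C) (quad_next \<sigma>) v"
  unfolding simple_poly_def
proof (intro conjI ballI impI)
  show "finite (quad_index C)" by (rule finite_sub_index[OF assms(1)])
  show "bij_betw (quad_next \<sigma>) (quad_index C) (quad_index C)"
    by (rule bij_betw_sub_next[OF assms(2,1)]) simp
  fix i j and s t :: real
  assume *: "i \<in> quad_index C" "j \<in> quad_index C" "s \<in> {0..<1}" "t \<in> {0..<1}"
    "pt (quad_next \<sigma>) v i s = pt (quad_next \<sigma>) v j t"
  obtain c a d b where ij: "i = (c, a)" "j = (d, b)" by (cases i, cases j) auto
  have "c = d \<and> a = b \<and> s = t"
  proof (cases "a \<le> b")
    case True
    then show ?thesis using inj[of c d a b s t] * ij by (simp add: sub_index_def)
  next
    case False
    then have "d = c \<and> b = a \<and> t = s" using inj[of d c b a t s] * ij by (simp add: sub_index_def)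
    then show ?thesis by simp
  qed
  then show "i = j" "s = t" using ij by auto
qed

lemma le_less_4_cases:
  assumes "a \<le> b" "b < (4::nat)"
  obtains "a = 0" "b = 0" | "a = 0" "b = 1" | "a = 0" "b = 2" | "a = 0" "b = 3"
    | "a = 1" "b = 1" | "a = 1" "b = 2" | "a = 1" "b = 3" | "a = 2" "b = 2" | "a = 2" "b = 3" | "a = 3" "b = 3"
proof -
  have "b \<in> {0, 1, 2, 3}" "a \<in> {0, 1, 2, 3}" using assms by auto
  then show thesis using assms that by auto
qed

lemma segment_inj:
  fixes a b s t :: real
  assumes "(1 - s) * a + s * b = (1 - t) * a + t * b" "a \<noteq> b"
  shows "s = t"
proof -
  have "(s - t) * (b - a) = 0" using assms(1) by (simp add: algebra_simps)
  then show ?thesis using assms(2) by simp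
qed

text \<open>Edges 0, 1 and 3 lie in planes of constant first coordinate, and edge 2, the row, is
  parallel to the first axis. Projected along that axis, the row of \<open>j\<close> is the point
  \<open>(p2 j, p3 j)\<close>: the conditions \<open>a0\<close>, \<open>a1\<close>,
  \<open>a3\<close> keep it off the planar edges, and \<open>b0\<close>, \<open>b01\<close>,
  \<open>b03\<close>, \<open>b13\<close> deal with planar edges in one plane.\<close>

lemma simple_box:
  fixes x e2 e3 f2 f3 p2 p3 :: "'c \<Rightarrow> real"
  assumes C: "finite C" "bij_betw \<sigma> C C" and x: "inj_on x C" and nf: "\<And>c. c \<in> C \<Longrightarrow> \<sigma> c \<noteq> c"
    and pinj: "\<And>c d. c \<in> C \<Longrightarrow> d \<in> C \<Longrightarrow> p2 c = p2 d \<Longrightarrow> p3 c = p3 d \<Longrightarrow> c = d"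
    and a0: "\<And>c j s. c \<in> C \<Longrightarrow> j \<in> C \<Longrightarrow> 0 \<le> s \<Longrightarrow> s < 1 \<Longrightarrow>
      p2 j = (1 - s) * e2 c + s * f2 c \<Longrightarrow> p3 j = (1 - s) * e3 c + s * f3 c \<Longrightarrow> False"
    and a1: "\<And>c j s. c \<in> C \<Longrightarrow> j \<in> C \<Longrightarrow> 0 \<le> s \<Longrightarrow> s < 1 \<Longrightarrow>
      p2 j = (1 - s) * f2 c + s * p2 c \<Longrightarrow> p3 j = (1 - s) * f3 c + s * p3 c \<Longrightarrow> False"
    and a3: "\<And>c j s. c \<in> C \<Longrightarrow> j \<in> C \<Longrightarrow> 0 \<le> s \<Longrightarrow> s < 1 \<Longrightarrow>
      p2 j = (1 - s) * p2 c + s * e2 (\<sigma> c) \<Longrightarrow> p3 j = (1 - s) * p3 c + s * e3 (\<sigma> c) \<Longrightarrow> j = c \<and> s = 0"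
    and b0: "\<And>c. c \<in> C \<Longrightarrow> e2 c \<noteq> f2 c \<or> e3 c \<noteq> f3 c"
    and b01: "\<And>c s t. c \<in> C \<Longrightarrow> 0 \<le> s \<Longrightarrow> s < 1 \<Longrightarrow> 0 \<le> t \<Longrightarrow> t < 1 \<Longrightarrow>
      (1 - s) * e2 c + s * f2 c = (1 - t) * f2 c + t * p2 c \<Longrightarrow>
      (1 - s) * e3 c + s * f3 c = (1 - t) * f3 c + t * p3 c \<Longrightarrow> False"
    and b03: "\<And>c s t. c \<in> C \<Longrightarrow> 0 \<le> s \<Longrightarrow> s < 1 \<Longrightarrow> 0 \<le> t \<Longrightarrow> t < 1 \<Longrightarrow>
      (1 - s) * e2 (\<sigma> c) + s * f2 (\<sigma> c) = (1 - t) * p2 c + t * e2 (\<sigma> c) \<Longrightarrow>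
      (1 - s) * e3 (\<sigma> c) + s * f3 (\<sigma> c) = (1 - t) * p3 c + t * e3 (\<sigma> c) \<Longrightarrow> False"
    and b13: "\<And>c s t. c \<in> C \<Longrightarrow> 0 \<le> s \<Longrightarrow> s < 1 \<Longrightarrow> 0 \<le> t \<Longrightarrow> t < 1 \<Longrightarrow>
      (1 - s) * f2 (\<sigma> c) + s * p2 (\<sigma> c) = (1 - t) * p2 c + t * e2 (\<sigma> c) \<Longrightarrow>
      (1 - s) * f3 (\<sigma> c) + s * p3 (\<sigma> c) = (1 - t) * p3 c + t * e3 (\<sigma> c) \<Longrightarrow> False"
  shows "simple_poly (quad_index C) (quad_next \<sigma>)
    (quad (\<lambda>c. vector [x c, e2 c, e3 c] :: real^3) (\<lambda>c. vector [x c, f2 c, f3 c])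
          (\<lambda>c. vector [x c, p2 c, p3 c]) (\<lambda>c. vector [x (\<sigma> c), p2 c, p3 c]))" (is "simple_poly _ _ ?v")
proof (rule simple_quadI[OF C])
  fix a b c d and s t :: real
  assume cd: "c \<in> C" "d \<in> C" and ab: "a \<le> b" "b < 4" and st: "0 \<le> s" "s < 1" "0 \<le> t" "t < 1"
    and eq: "pt (quad_next \<sigma>) ?v (c, a) s = pt (quad_next \<sigma>) ?v (d, b) t"
  have nx: "\<sigma> c \<in> C" "\<sigma> d \<in> C" using C(2) cd by (auto simp: bij_betw_def)
  have xi: "c = d" if "c \<in> C" "d \<in> C" "x c = x d" for c d using x that by (auto simp: inj_on_def)
  have si: "c = d" if "c \<in> C" "d \<in> C" "\<sigma> c = \<sigma> d" for c d using C(2) that by (auto simp: bij_betw_def inj_on_def)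
  have const: "(1 - r) * y + r * y = y" for r y :: real by (simp add: algebra_simps)
  note e = arg_cong[OF eq, where f = "\<lambda>v. v $ 1"] arg_cong[OF eq, where f = "\<lambda>v. v $ 2"]
    arg_cong[OF eq, where f = "\<lambda>v. v $ 3"]
  show "c = d \<and> a = b \<and> s = t"
    using ab
  proof (cases rule: le_less_4_cases)
    case 1
    note e' = e[unfolded 1 pt_quad, simplified, unfolded const]
    have "c = d" using xi cd e' by simp
    moreover have "s = t" using b0[OF cd(1)] segment_inj e' \<open>c = d\<close> by blast
    ultimately show ?thesis using 1 by simp
  next
    case 2
    note e' = e[unfolded 2 One_nat_def pt_quad, simplified, unfolded const]
    have "c = d" using xi cd e' by simp
    then show ?thesis using b01[OF cd(1) st] e' by simp
  next
    case 3
    note e' = e[unfolded 3 pt_quad, simplified, unfolded const]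
    show ?thesis using a0[OF cd st(1,2)] e' by simp
  next
    case 4
    note e' = e[unfolded 4 pt_quad, simplified, unfolded const]
    have "c = \<sigma> d" using xi cd nx e' by simp
    then show ?thesis using b03[OF cd(2) st] e' by simp
  next
    case 5
    note e' = e[unfolded 5 One_nat_def pt_quad, simplified, unfolded const]
    have "c = d" using xi cd e' by simp
    moreover have "f2 c \<noteq> p2 c \<or> f3 c \<noteq> p3 c" using a1[OF cd(1) cd(1), of 0] by auto
    then have "s = t" using segment_inj e' \<open>c = d\<close> by blast
    ultimately show ?thesis using 5 by simp
  next
    case 6
    note e' = e[unfolded 6 One_nat_def pt_quad, simplified, unfolded const]
    show ?thesis using a1[OF cd st(1,2)] e' by simp
  next
    case 7
    note e' = e[unfolded 7 One_nat_def pt_quad, simplified, unfolded const]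
    have "c = \<sigma> d" using xi cd nx e' by simp
    then show ?thesis using b13[OF cd(2) st] e' by simp
  next
    case 8
    note e' = e[unfolded 8 pt_quad, simplified, unfolded const]
    have "c = d" using pinj cd e' by simp
    moreover have "x c \<noteq> x (\<sigma> c)" using xi[OF cd(1) nx(1)] nf[OF cd(1)] by auto
    then have "s = t" using segment_inj e'(1) \<open>c = d\<close> by blast
    ultimately show ?thesis using 8 by simp
  next
    case 9
    note e' = e[unfolded 9 pt_quad, simplified, unfolded const]
    have "c = d \<and> t = 0" using a3[OF cd(2,1) st(3,4)] e' by simp
    then have "(1 - s) * x c + s * x (\<sigma> c) = (1 - 1) * x c + 1 * x (\<sigma> c)" using e' by simp
    moreover have "x c \<noteq> x (\<sigma> c)" using xi[OF cd(1) nx(1)] nf[OF cd(1)] by auto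
    ultimately have "s = 1" by (rule segment_inj)
    then show ?thesis using st by simp
  next
    case 10
    note e' = e[unfolded 10 pt_quad, simplified, unfolded const]
    have "c = d" using xi[OF nx] si[OF cd] e' by simp
    moreover have "p2 c \<noteq> e2 (\<sigma> c) \<or> p3 c \<noteq> e3 (\<sigma> c)" using a0[OF nx(1) cd(1), of 0] by auto
    then have "s = t" using segment_inj e' \<open>c = d\<close> by blast
    ultimately show ?thesis using 10 by simp
  qed
qed

text \<open>Spines lie at height 0 and rows at height 1. Seen along the first axis all edges are
  parallel to the two remaining axes, and the distinct values of \<open>Y\<close> settle every
  condition of \<open>simple_box\<close>.\<close>

lemma simple_comb:
  fixes x Y e2 :: "'c \<Rightarrow> real"
  assumes C: "finite C" "bij_betw \<sigma> C C" and x: "inj_on x C" and nf: "\<And>c. c \<in> C \<Longrightarrow> \<sigma> c \<noteq> c"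
    and Y: "inj_on Y C" and e2: "\<And>c. c \<in> C \<Longrightarrow> e2 (\<sigma> c) = Y c"
  shows "simple_poly (quad_index C) (quad_next \<sigma>)
    (quad (\<lambda>c. vector [x c, e2 c, 0] :: real^3) (\<lambda>c. vector [x c, Y c, 0])
          (\<lambda>c. vector [x c, Y c, 1]) (\<lambda>c. vector [x (\<sigma> c), Y c, 1]))"
proof (rule simple_box[OF C x nf])
  have Yi: "c = d" if "c \<in> C" "d \<in> C" "Y c = Y d" for c d using Y that by (auto simp: inj_on_def)
  have nx: "\<sigma> c \<in> C" if "c \<in> C" for c using C(2) that by (auto simp: bij_betw_def)
  have pre: "\<exists>d\<in>C. c = \<sigma> d" if "c \<in> C" for c using C(2) that by (auto simp: bij_betw_def)
  have Yn: "Y (\<sigma> c) \<noteq> Y c" if "c \<in> C" for c using Yi[OF nx] nf that by metis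
  have const: "(1 - r) * y + r * y = y" for r y :: real by (simp add: algebra_simps)
  show ef: "e2 c \<noteq> Y c \<or> (0::real) \<noteq> 0" if "c \<in> C" for c
  proof -
    obtain d where "d \<in> C" "c = \<sigma> d" using pre \<open>c \<in> C\<close> by auto
    then show ?thesis using e2 Yn by metis
  qed
  show "c = d" if "c \<in> C" "d \<in> C" "Y c = Y d" for c d using Yi that by blast
  show "j = c \<and> s = 0" if "c \<in> C" "j \<in> C" "Y j = (1 - s) * Y c + s * e2 (\<sigma> c)"
    "1 = (1 - s) * 1 + s * 0" for c j and s :: real
    using that e2 Yi by (simp add: const)
  show False if "c \<in> C" "0 \<le> s" "s < 1" "0 \<le> t" "t < 1" "(1 - s) * e2 c + s * Y c = (1 - t) * Y c + t * Y c"
    "(1 - s) * 0 + s * 0 = (1 - t) * 0 + t * 1" for c and s t :: real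
  proof -
    have "(1 - s) * (e2 c - Y c) = 0" using that(6) unfolding const by (simp add: algebra_simps)
    then show False using ef that by simp
  qed
  show False if "c \<in> C" "0 \<le> s" "s < 1" "0 \<le> t" "t < 1"
    "(1 - s) * Y (\<sigma> c) + s * Y (\<sigma> c) = (1 - t) * Y c + t * e2 (\<sigma> c)" for c and s t :: real
    using that(6) Yn[OF that(1)] e2[OF that(1)] unfolding const by (simp add: const)
qed auto

section \<open>Inequalities for opening the book\<close>

lemma sign_cases:
  fixes s s' :: real
  assumes "s = 1 \<or> s = -1" "s' = 1 \<or> s' = -1"
  obtains "s' = s" "s * s = 1" | "s' = - s" "s * s = 1"
  using assms by auto

lemma sum_squares_weighted_pos:
  fixes r \<tau> b :: real
  assumes "0 \<le> r" "r + \<tau> = 1" "b > 0"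
  shows "r * r * b + \<tau> * \<tau> > 0"
proof (cases "r = 0")
  case True
  then show ?thesis using assms by simp
next
  case False
  then have "r * r * b > 0" using assms by simp
  then show ?thesis by (simp add: add_pos_nonneg)
qed

lemma sign_bound:
  fixes s y B :: real
  assumes "s = 1 \<or> s = -1" "\<bar>y\<bar> < B"
  shows "s * y < B" "- B < s * y"
  using assms by auto

text \<open>The following inequalities say that, while the comb is being opened, every tooth end stays
  strictly on the outer side of the broken line formed by the spine.\<close>

context
  fixes r \<tau> B K y zc zs zj u s s' :: real
  assumes r: "0 \<le> r" "0 \<le> \<tau>" "r + \<tau> = 1" and y: "\<bar>y\<bar> < B"
    and z: "zc < K" "zs < K" "zj < K" and u: "0 \<le> u" "u < 1"
    and s: "s = 1 \<or> s = -1" and s': "s' = 1 \<or> s' = -1"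
begin

lemma open_comb_avoid_spine:
  assumes e1: "s' * (r * B + \<tau> * (K - zj)) = (1 - u) * (r * y - \<tau> * s * (K - zc)) + u * (r * y + \<tau> * s * (K - zs))"
    and e2: "r * zj + \<tau> = (1 - u) * (r * zc) + u * (r * zs)"
  shows False
  using s s'
proof (cases rule: sign_cases)
  case 1
  \<comment> \<open>Scalar product of both equations with \<open>(s' * r, \<tau>)\<close>, the
    normal of the turning half plane on the side \<open>s'\<close>. The left side is the gap between
    the row and that half plane, the right side is not positive.\<close>
  have "r * r * (B - s * y) + \<tau> * \<tau> = - (2 * (\<tau> * r * ((1 - u) * (K - zc))))"
    using e1 e2 1 by algebra
  moreover have "0 \<le> \<tau> * r * ((1 - u) * (K - zc))" using r z u by simp
  ultimately show False using sum_squares_weighted_pos[OF r(1,3), of "B - s * y"] sign_bound[OF s y] by simp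
next
  case 2
  have "r * r * (B + s * y) + \<tau> * \<tau> = - (2 * (\<tau> * r * (u * (K - zs))))"
    using e1 e2 2 by algebra
  moreover have "0 \<le> \<tau> * r * (u * (K - zs))" using r z u by simp
  ultimately show False using sum_squares_weighted_pos[OF r(1,3), of "B + s * y"] sign_bound[OF s y] by simp
qed

lemma open_comb_avoid_tooth:
  assumes e1: "s' * (r * B + \<tau> * (K - zj)) = (1 - u) * (r * y + \<tau> * s * (K - zs)) + u * (s * (r * B + \<tau> * (K - zs)))"
    and e2: "r * zj + \<tau> = (1 - u) * (r * zs) + u * (r * zs + \<tau>)"
  shows False
  using s s'
proof (cases rule: sign_cases)
  case 1
  have "(1 - u) * (r * r * (B - s * y) + \<tau> * \<tau>) = 0"
    using e1 e2 1 by algebra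
  then show False using sum_squares_weighted_pos[OF r(1,3), of "B - s * y"] sign_bound[OF s y] u by simp
next
  case 2
  have "r * ((1 - u) * (B + s * y) + 2 * u * B) + \<tau> * ((K - zj) + (K - zs)) = 0"
    using e1 2 by algebra
  moreover have "(1 - u) * (B + s * y) > 0" using sign_bound[OF s y] u by simp
  moreover have "2 * u * B \<ge> 0" using y u by simp
  ultimately show False
  proof (cases "r = 0")
    case False
    then have "r * ((1 - u) * (B + s * y) + 2 * u * B) > 0"
      using r(1) add_pos_nonneg[OF \<open>(1 - u) * (B + s * y) > 0\<close> \<open>2 * u * B \<ge> 0\<close>] by (intro mult_pos_pos) auto
    moreover have "\<tau> * ((K - zj) + (K - zs)) \<ge> 0" using r z by simp
    ultimately show False using \<open>r * _ + _ = 0\<close> by linarith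
  qed (use r z in auto)
qed

lemma open_comb_avoid_previous_tooth:
  assumes e1: "s' * (r * B + \<tau> * (K - zj)) = (1 - u) * (s * (r * B + \<tau> * (K - zs))) + u * (r * y - \<tau> * (- s) * (K - zs))"
    and e2: "r * zj + \<tau> = (1 - u) * (r * zs + \<tau>) + u * (r * zs)"
  shows "u = 0 \<and> zj = zs"
  using s s'
proof (cases rule: sign_cases)
  case 1
  have "u * (r * r * (B - s * y) + \<tau> * \<tau>) = 0" using e1 e2 1 by algebra
  then have u0: "u = 0" using sum_squares_weighted_pos[OF r(1,3), of "B - s * y"] sign_bound[OF s y] by simp
  have "\<tau> * (zj - zs) = 0" "r * (zj - zs) = 0" using e1 e2 1 u0 by algebra+
  then show ?thesis using u0 r by auto
next
  case 2
  have "r * ((1 - u) * (2 * B) + u * (B + s * y)) + \<tau> * ((K - zj) + (K - zs)) = 0"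
    using e1 2 by algebra
  moreover have "(1 - u) * (2 * B) > 0" using y u by simp
  moreover have "u * (B + s * y) \<ge> 0" using sign_bound[OF s y] u by simp
  ultimately show ?thesis
  proof (cases "r = 0")
    case False
    then have "r * ((1 - u) * (2 * B) + u * (B + s * y)) > 0"
      using r(1) add_pos_nonneg[OF \<open>(1 - u) * (2 * B) > 0\<close> \<open>u * (B + s * y) \<ge> 0\<close>] by (intro mult_pos_pos) auto
    moreover have "\<tau> * ((K - zj) + (K - zs)) \<ge> 0" using r z by simp
    ultimately show ?thesis using \<open>r * _ + _ = 0\<close> by linarith
  qed (use r z in auto)
qed

lemma open_comb_spine_tooth:
  assumes t: "0 \<le> t" and ne: "zc \<noteq> zs"
    and e1: "(1 - u) * (r * y - \<tau> * s * (K - zc)) + u * (r * y + \<tau> * s * (K - zs)) =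
      (1 - t) * (r * y + \<tau> * s * (K - zs)) + t * (s * (r * B + \<tau> * (K - zs)))"
    and e2: "(1 - u) * (r * zc) + u * (r * zs) = (1 - t) * (r * zs) + t * (r * zs + \<tau>)"
  shows False
proof -
  have ss: "s * s = 1" using s by auto
  \<comment> \<open>The second coordinates alone give a vanishing sum of two non-negative terms,
    which forces \<open>\<tau> = 0\<close>; the third coordinates then exclude that case.\<close>
  have sum: "t * (r * (B - s * y)) + \<tau> * ((1 - u) * ((K - zc) + (K - zs))) = 0"
    using e1 ss by algebra
  have p: "(1 - u) * ((K - zc) + (K - zs)) > 0" using z u by simp
  have "t * (r * (B - s * y)) \<ge> 0" using t r sign_bound[OF s y] by simp
  then have "\<tau> * ((1 - u) * ((K - zc) + (K - zs))) \<le> 0" using sum by linarith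
  then have \<tau>0: "\<tau> = 0" using p r(2) by (metis less_le mult_pos_pos not_less)
  then have "(1 - u) * (zc - zs) = 0" using e2 r(3) by algebra
  then show False using ne u by simp
qed

lemma open_comb_spine_previous_tooth:
  assumes t: "0 \<le> t" "t < 1"
    and e1: "(1 - u) * (r * y - \<tau> * (- s) * (K - zs)) + u * (r * y + \<tau> * (- s) * (K - zj)) =
      (1 - t) * (s * (r * B + \<tau> * (K - zs))) + t * (r * y - \<tau> * (- s) * (K - zs))"
    and e2: "(1 - u) * (r * zs) + u * (r * zj) = (1 - t) * (r * zs + \<tau>) + t * (r * zs)"
  shows False
proof -
  have ss: "s * s = 1" using s by auto
  have sum: "r * ((1 - t) * (B - s * y)) + \<tau> * (u * ((K - zs) + (K - zj))) = 0"
    using e1 ss by algebra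
  have p: "(1 - t) * (B - s * y) > 0" using t sign_bound[OF s y] by simp
  have "\<tau> * (u * ((K - zs) + (K - zj))) \<ge> 0" using z u r by simp
  then have "r * ((1 - t) * (B - s * y)) \<le> 0" using sum by linarith
  then have r0: "r = 0" using p r(1) by (metis less_le mult_pos_pos not_less)
  then have "(1 - t) = 0" using e2 r(3) by algebra
  then show False using t by simp
qed

lemma open_comb_teeth:
  assumes t: "0 \<le> t" "t < 1"
    and e1: "(1 - u) * (r * y + \<tau> * (- s) * (K - zj)) + u * ((- s) * (r * B + \<tau> * (K - zj))) =
      (1 - t) * (s * (r * B + \<tau> * (K - zs))) + t * (r * y - \<tau> * (- s) * (K - zs))"
  shows False
proof -
  have ss: "s * s = 1" using s by auto
  have sum: "r * ((1 - t) * (B - s * y) + u * (B + s * y)) + \<tau> * ((K - zs) + (K - zj)) = 0"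
    using e1 ss by algebra
  have p: "(1 - t) * (B - s * y) + u * (B + s * y) > 0"
    using t u sign_bound[OF s y] by (simp add: add_pos_nonneg)
  have q: "(K - zs) + (K - zj) > 0" using z by simp
  have "r * ((1 - t) * (B - s * y) + u * (B + s * y)) \<ge> 0" "\<tau> * ((K - zs) + (K - zj)) \<ge> 0"
    using p q r by simp_all
  then have "r * ((1 - t) * (B - s * y) + u * (B + s * y)) = 0" "\<tau> * ((K - zs) + (K - zj)) = 0"
    using sum by linarith+
  then have "r = 0" "\<tau> = 0" using p q by auto
  then show False using r by simp
qed

end

text \<open>Time 0 is the pushed comb, time 1 the opened one: a level \<open>z\<close> on the side
  \<open>sg\<close> goes to \<open>sg * (K - z)\<close>, its signed distance from an axis above all
  levels, and the depth turns into the height, 0 on spines and 1 on rows. Linear interpolation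
  stands in for the rotation of the half planes, so that \<open>isotopic_poly_along_lines\<close>
  applies.\<close>

lemma simple_open_comb:
  fixes x y z sg :: "'c \<Rightarrow> real"
  assumes C: "finite C" "bij_betw \<sigma> C C" and x: "inj_on x C" and z: "inj_on z C"
    and nf: "\<And>c. c \<in> C \<Longrightarrow> \<sigma> c \<noteq> c"
    and sg: "\<And>c. c \<in> C \<Longrightarrow> sg c = 1 \<or> sg c = -1" "\<And>c. c \<in> C \<Longrightarrow> sg (\<sigma> c) = - sg c"
    and y: "\<And>c. c \<in> C \<Longrightarrow> \<bar>y c\<bar> < B" and K: "\<And>c. c \<in> C \<Longrightarrow> z c < K" and \<tau>: "0 \<le> \<tau>" "\<tau> \<le> 1"
  shows "simple_poly (quad_index C) (quad_next \<sigma>)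
    (quad (\<lambda>c. vector [x c, (1 - \<tau>) * y c - \<tau> * sg c * (K - z c), (1 - \<tau>) * z c] :: real^3)
          (\<lambda>c. vector [x c, (1 - \<tau>) * y c + \<tau> * sg c * (K - z (\<sigma> c)), (1 - \<tau>) * z (\<sigma> c)])
          (\<lambda>c. vector [x c, sg c * ((1 - \<tau>) * B + \<tau> * (K - z (\<sigma> c))), (1 - \<tau>) * z (\<sigma> c) + \<tau>])
          (\<lambda>c. vector [x (\<sigma> c), sg c * ((1 - \<tau>) * B + \<tau> * (K - z (\<sigma> c))), (1 - \<tau>) * z (\<sigma> c) + \<tau>]))"
proof (rule simple_box[OF C x nf])
  have r: "0 \<le> 1 - \<tau>" "0 \<le> \<tau>" "1 - \<tau> + \<tau> = 1" using \<tau> by auto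
  have nx: "\<sigma> c \<in> C" if "c \<in> C" for c using C(2) that by (auto simp: bij_betw_def)
  have si: "c = d" if "c \<in> C" "d \<in> C" "\<sigma> c = \<sigma> d" for c d using C(2) that by (auto simp: bij_betw_def inj_on_def)
  have zi: "c = d" if "c \<in> C" "d \<in> C" "z c = z d" for c d using z that by (auto simp: inj_on_def)
  have zn: "z c \<noteq> z (\<sigma> c)" if "c \<in> C" for c using zi[OF that nx[OF that]] nf[OF that] by auto
  let ?p2 = "\<lambda>c. sg c * ((1 - \<tau>) * B + \<tau> * (K - z (\<sigma> c)))"
  let ?p3 = "\<lambda>c. (1 - \<tau>) * z (\<sigma> c) + \<tau>"
  show "c = d" if "c \<in> C" "d \<in> C" "?p2 c = ?p2 d" "?p3 c = ?p3 d" for c d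
  proof (rule si[OF that(1,2)], rule zi)
    have eq: "(1 - \<tau>) * (z (\<sigma> c) - z (\<sigma> d)) = 0" using that(4) by (simp add: algebra_simps)
    show "z (\<sigma> c) = z (\<sigma> d)"
    proof (cases "\<tau> = 1")
      case True
      then have "sg c * (K - z (\<sigma> c)) = sg d * (K - z (\<sigma> d))" using that(3) by simp
      then show ?thesis using sg(1)[OF that(1)] sg(1)[OF that(2)] K[OF nx[OF that(1)]] K[OF nx[OF that(2)]] by auto
    qed (use eq in auto)
  qed (use nx that in auto)
  show False if "c \<in> C" "j \<in> C" "0 \<le> u" "u < 1"
    "?p2 j = (1 - u) * ((1 - \<tau>) * y c - \<tau> * sg c * (K - z c)) + u * ((1 - \<tau>) * y c + \<tau> * sg c * (K - z (\<sigma> c)))"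
    "?p3 j = (1 - u) * ((1 - \<tau>) * z c) + u * ((1 - \<tau>) * z (\<sigma> c))" for c j u
    by (rule open_comb_avoid_spine[OF r y[OF that(1)] K[OF that(1)] K[OF nx[OF that(1)]] K[OF nx[OF that(2)]]
          that(3,4) sg(1)[OF that(1)] sg(1)[OF that(2)] that(5,6)])
  show False if "c \<in> C" "j \<in> C" "0 \<le> u" "u < 1"
    "?p2 j = (1 - u) * ((1 - \<tau>) * y c + \<tau> * sg c * (K - z (\<sigma> c))) + u * ?p2 c"
    "?p3 j = (1 - u) * ((1 - \<tau>) * z (\<sigma> c)) + u * ?p3 c" for c j u
    by (rule open_comb_avoid_tooth[OF r y[OF that(1)] K[OF that(1)] K[OF nx[OF that(1)]] K[OF nx[OF that(2)]]
          that(3,4) sg(1)[OF that(1)] sg(1)[OF that(2)] that(5,6)])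
  show "j = c \<and> u = 0" if "c \<in> C" "j \<in> C" "0 \<le> u" "u < 1"
    "?p2 j = (1 - u) * ?p2 c + u * ((1 - \<tau>) * y (\<sigma> c) - \<tau> * sg (\<sigma> c) * (K - z (\<sigma> c)))"
    "?p3 j = (1 - u) * ?p3 c + u * ((1 - \<tau>) * z (\<sigma> c))" for c j u
    using open_comb_avoid_previous_tooth[OF r y[OF nx[OF that(1)]] K[OF that(1)] K[OF nx[OF that(1)]] K[OF nx[OF that(2)]]
          that(3,4) sg(1)[OF that(1)] sg(1)[OF that(2)] that(5)[unfolded sg(2)[OF that(1)]] that(6)]
      zi[OF nx[OF that(2)] nx[OF that(1)]] si[OF that(2,1)] by blast
  show "(1 - \<tau>) * y c - \<tau> * sg c * (K - z c) \<noteq> (1 - \<tau>) * y c + \<tau> * sg c * (K - z (\<sigma> c)) \<or>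
      (1 - \<tau>) * z c \<noteq> (1 - \<tau>) * z (\<sigma> c)" if "c \<in> C" for c
  proof (cases "\<tau> = 1")
    case True
    have "(K - z c) + (K - z (\<sigma> c)) \<noteq> 0" using K[OF that] K[OF nx[OF that]] by simp
    then show ?thesis using True sg(1)[OF that] by auto
  qed (use zn[OF that] in auto)
  show False if "c \<in> C" "0 \<le> u" "u < 1" "0 \<le> t" "t < 1"
    "(1 - u) * ((1 - \<tau>) * y c - \<tau> * sg c * (K - z c)) + u * ((1 - \<tau>) * y c + \<tau> * sg c * (K - z (\<sigma> c))) =
     (1 - t) * ((1 - \<tau>) * y c + \<tau> * sg c * (K - z (\<sigma> c))) + t * ?p2 c"
    "(1 - u) * ((1 - \<tau>) * z c) + u * ((1 - \<tau>) * z (\<sigma> c)) = (1 - t) * ((1 - \<tau>) * z (\<sigma> c)) + t * ?p3 c" for c u t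
    by (rule open_comb_spine_tooth[OF r y[OF that(1)] K[OF that(1)] K[OF nx[OF that(1)]] K[OF nx[OF that(1)]]
          that(2,3) sg(1)[OF that(1)] sg(1)[OF that(1)] that(4) zn[OF that(1)] that(6,7)])
  show False if "c \<in> C" "0 \<le> u" "u < 1" "0 \<le> t" "t < 1"
    "(1 - u) * ((1 - \<tau>) * y (\<sigma> c) - \<tau> * sg (\<sigma> c) * (K - z (\<sigma> c))) +
        u * ((1 - \<tau>) * y (\<sigma> c) + \<tau> * sg (\<sigma> c) * (K - z (\<sigma> (\<sigma> c)))) =
     (1 - t) * ?p2 c + t * ((1 - \<tau>) * y (\<sigma> c) - \<tau> * sg (\<sigma> c) * (K - z (\<sigma> c)))"
    "(1 - u) * ((1 - \<tau>) * z (\<sigma> c)) + u * ((1 - \<tau>) * z (\<sigma> (\<sigma> c))) = (1 - t) * ?p3 c + t * ((1 - \<tau>) * z (\<sigma> c))" for c u t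
    by (rule open_comb_spine_previous_tooth[OF r y[OF nx[OF that(1)]] K[OF that(1)] K[OF nx[OF that(1)]] K[OF nx[OF nx[OF that(1)]]]
          that(2,3) sg(1)[OF that(1)] sg(1)[OF that(1)] that(4,5) that(6)[unfolded sg(2)[OF that(1)]] that(7)])
  show False if "c \<in> C" "0 \<le> u" "u < 1" "0 \<le> t" "t < 1"
    "(1 - u) * ((1 - \<tau>) * y (\<sigma> c) + \<tau> * sg (\<sigma> c) * (K - z (\<sigma> (\<sigma> c)))) + u * ?p2 (\<sigma> c) =
     (1 - t) * ?p2 c + t * ((1 - \<tau>) * y (\<sigma> c) - \<tau> * sg (\<sigma> c) * (K - z (\<sigma> c)))" for c u t
    by (rule open_comb_teeth[OF r y[OF nx[OF that(1)]] K[OF that(1)] K[OF nx[OF that(1)]] K[OF nx[OF nx[OF that(1)]]]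
          that(2,3) sg(1)[OF that(1)] sg(1)[OF that(1)] that(4,5) that(6)[unfolded sg(2)[OF that(1)]]])
qed

section \<open>Pushing rows aside\<close>

text \<open>Position along a row at time \<tau>, with \<open>r\<close> standing for
  \<open>1 - \<tau>\<close>; \<open>row_h\<close> is the outward push there. Together they form a
  trapezoid whose sides develop from the outer thirds of the row into perpendicular teeth.\<close>

definition row_x :: "real \<Rightarrow> nat \<Rightarrow> real \<Rightarrow> real" where
  "row_x r q s = (if q = 1 then s * (r / 3) else if q = 2 then (1 - s) * (r / 3) + s * (1 - r / 3)
     else (1 - s) * (1 - r / 3) + s)"

definition row_h :: "real \<Rightarrow> real \<Rightarrow> real \<Rightarrow> nat \<Rightarrow> real \<Rightarrow> real" where
  "row_h \<tau> b b' q s = (if q = 1 then s * (\<tau> * b) else if q = 2 then (1 - s) * (\<tau> * b) + s * (\<tau> * b')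
     else (1 - s) * (\<tau> * b'))"

context
  fixes r \<tau> b b' :: real
  assumes r: "0 \<le> r" "0 \<le> \<tau>" "r + \<tau> = 1" and b: "b > 0" "b' > 0"
begin

lemma row_h_nonneg: "0 \<le> s \<Longrightarrow> s < 1 \<Longrightarrow> 0 \<le> row_h \<tau> b b' q s"
  using r b by (simp add: row_h_def)

lemma row_x_bounds:
  assumes "0 \<le> s" "s < 1"
  shows "0 \<le> row_x r q s" "row_x r q s \<le> 1"
proof -
  have r1: "r \<le> 1" using r by simp
  have cv: "0 \<le> (1 - s) * a + s * b \<and> (1 - s) * a + s * b \<le> 1" if "0 \<le> a" "a \<le> 1" "0 \<le> b" "b \<le> 1" for a b
  proof -
    have "(1 - s) * a \<le> (1 - s) * 1" "s * b \<le> s * 1" by (rule mult_left_mono; use that assms in auto)+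
    then have "(1 - s) * a + s * b \<le> (1 - s) * 1 + s * 1" by (rule add_mono)
    then show ?thesis using that assms by simp
  qed
  show "0 \<le> row_x r q s" "row_x r q s \<le> 1"
    using cv[of 0 "r / 3"] cv[of "r / 3" "1 - r / 3"] cv[of "1 - r / 3" 1] r r1 by (auto simp: row_x_def)
qed

lemma row_end:
  assumes "0 \<le> s" "s < 1" "row_x r q s = 1" "row_h \<tau> b b' q s = 0" "1 \<le> q" "q < 4"
  shows False
proof -
  have r1: "r \<le> 1" using r by simp
  have "q = 1 \<or> q = 2 \<or> q = 3" using assms by auto
  then show False
  proof (elim disjE)
    assume q: "q = 1"
    have "s * (r / 3) \<le> 1 * (1 / 3)" by (rule mult_mono) (use assms r r1 in auto)
    then show False using assms(3) q by (simp add: row_x_def)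
  next
    assume q: "q = 2"
    have "(1 - s) * (1 - r / 3) + s * (r / 3) = 0" using assms(3) q by (simp add: row_x_def algebra_simps)
    moreover have "(1 - s) * (1 - r / 3) > 0" "s * (r / 3) \<ge> 0" using assms r r1 by auto
    ultimately show False by linarith
  next
    assume q: "q = 3"
    have "(1 - s) * (\<tau> * b') = 0" using assms(4) q by (simp add: row_h_def)
    then have "\<tau> = 0" using b assms by simp
    moreover have "(1 - s) * r = 0" using assms(3) q by (simp add: row_x_def algebra_simps)
    ultimately show False using r assms by simp
  qed
qed

text \<open>The trapezoid has no double points: for \<open>r > 0\<close> the position along the row
  is strictly increasing, and for \<open>r = 0\<close>, where it stands still on the sides, the push
  changes instead.\<close>

lemma row_inj:
  assumes "1 \<le> p" "p \<le> q" "q < 4" and st: "0 \<le> s" "s < 1" "0 \<le> t" "t < 1"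
    and x: "row_x r p s = row_x r q t" and h: "row_h \<tau> b b' p s = row_h \<tau> b b' q t"
  shows "p = q \<and> s = t"
proof -
  have r1: "r \<le> 1" "1 - 2 * r / 3 > 0" using r by auto
  have "p = 1 \<and> q = 1 \<or> p = 1 \<and> q = 2 \<or> p = 1 \<and> q = 3 \<or> p = 2 \<and> q = 2 \<or> p = 2 \<and> q = 3 \<or> p = 3 \<and> q = 3"
    using assms(1-3) by auto
  then show ?thesis
  proof (elim disjE conjE)
    assume pq: "p = 1" "q = 1"
    have "(s - t) * r = 0" "(s - t) * (\<tau> * b) = 0" using x h pq by (simp_all add: row_x_def row_h_def algebra_simps)
    then show ?thesis using pq r b by auto
  next
    assume pq: "p = 1" "q = 2"
    have eq: "(1 - s) * (r / 3) + t * (1 - 2 * r / 3) = 0" using x pq by (simp add: row_x_def field_simps)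
    moreover have "0 \<le> (1 - s) * (r / 3)" "0 \<le> t * (1 - 2 * r / 3)" using st r r1 by auto
    ultimately have "(1 - s) * (r / 3) = 0" "t * (1 - 2 * r / 3) = 0" by linarith+
    then have "r = 0" "t = 0" using st r1 by auto
    then show ?thesis using h pq r b st by (simp add: row_h_def)
  next
    assume pq: "p = 1" "q = 3"
    have "s * (r / 3) \<le> 1 * (1 / 3)" by (rule mult_mono) (use st r r1 in auto)
    moreover have "(1 - t) * (r / 3) \<le> 1 * (1 / 3)" by (rule mult_mono) (use st r r1 in auto)
    moreover have "s * (r / 3) = 1 - (1 - t) * (r / 3)" using x pq by (simp add: row_x_def algebra_simps)
    ultimately show ?thesis by linarith
  next
    assume pq: "p = 2" "q = 2"
    have "(s - t) * (1 - 2 * r / 3) = 0" using x pq by (simp add: row_x_def field_simps)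
    then show ?thesis using pq r1 by simp
  next
    assume pq: "p = 2" "q = 3"
    have "(1 - s) * (1 - 2 * r / 3) + t * (r / 3) = 0" using x pq by (simp add: row_x_def field_simps)
    moreover have "(1 - s) * (1 - 2 * r / 3) > 0" "t * (r / 3) \<ge> 0" using st r r1 by auto
    ultimately show ?thesis by linarith
  next
    assume pq: "p = 3" "q = 3"
    have "(s - t) * r = 0" using x pq by (simp add: row_x_def field_simps)
    moreover have "(s - t) * (\<tau> * b') = 0" using h pq by (auto simp: row_h_def)
    ultimately show ?thesis using pq r b by auto
  qed
qed

end

text \<open>Rows have pairwise distinct levels, so only a vertical step \<open>c\<close> can meet a
  row \<open>d\<close>. The row has been moved there by \<open>sg d * h\<close> with
  \<open>h \<ge> 0\<close>, away from the step, which by \<open>good\<close> lies strictly on the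
  other side.\<close>

lemma simple_push_rows:
  fixes x y z sg :: "'c \<Rightarrow> real"
  assumes C: "finite C" "bij_betw \<sigma> C C" and x: "inj_on x C" and z: "inj_on z C"
    and nf: "\<And>c. c \<in> C \<Longrightarrow> \<sigma> c \<noteq> c"
    and sg: "\<And>c. c \<in> C \<Longrightarrow> sg c = 1 \<or> sg c = -1"
    and y: "\<And>c. c \<in> C \<Longrightarrow> \<bar>y c\<bar> < B" and \<tau>: "0 \<le> \<tau>" "\<tau> \<le> 1"
    and good: "\<And>d c. d \<in> C \<Longrightarrow> c \<in> C \<Longrightarrow> 0 < (x c - x d) * (x (\<sigma> d) - x c) \<Longrightarrow>
      0 < (z (\<sigma> d) - z c) * (z (\<sigma> c) - z (\<sigma> d)) \<Longrightarrow>
      0 < sg d * (y d + (x c - x d) / (x (\<sigma> d) - x d) * (y (\<sigma> d) - y d) - y c)"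
  shows "simple_poly (quad_index C) (quad_next \<sigma>)
    (quad (\<lambda>c. vector [x c, y c, z c] :: real^3) (\<lambda>c. vector [x c, y c, z (\<sigma> c)])
      (\<lambda>c. vector [x c + (1 - \<tau>) * ((x (\<sigma> c) - x c) / 3),
                   y c + (1 - \<tau>) * ((y (\<sigma> c) - y c) / 3) + \<tau> * (sg c * B - y c), z (\<sigma> c)])
      (\<lambda>c. vector [x (\<sigma> c) - (1 - \<tau>) * ((x (\<sigma> c) - x c) / 3),
                   y (\<sigma> c) - (1 - \<tau>) * ((y (\<sigma> c) - y c) / 3) + \<tau> * (sg c * B - y (\<sigma> c)), z (\<sigma> c)]))"
    (is "simple_poly _ _ ?v")
proof (rule simple_quadI[OF C])
  define r where "r = 1 - \<tau>"
  have r: "0 \<le> r" "0 \<le> \<tau>" "r + \<tau> = 1" using \<tau> by (auto simp: r_def)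
  have nx: "\<sigma> c \<in> C" if "c \<in> C" for c using C(2) that by (auto simp: bij_betw_def)
  have si: "c = d" if "c \<in> C" "d \<in> C" "\<sigma> c = \<sigma> d" for c d using C(2) that by (auto simp: bij_betw_def inj_on_def)
  have xi: "c = d" if "c \<in> C" "d \<in> C" "x c = x d" for c d using x that by (auto simp: inj_on_def)
  have zi: "c = d" if "c \<in> C" "d \<in> C" "z c = z d" for c d using z that by (auto simp: inj_on_def)
  have xn: "x (\<sigma> c) - x c \<noteq> 0" if "c \<in> C" for c using xi[OF nx[OF that] that] nf[OF that] by auto
  have zn: "z c \<noteq> z (\<sigma> c)" if "c \<in> C" for c using zi[OF that nx[OF that]] nf[OF that] by auto
  define b b' where "b c = B - sg c * y c" and "b' c = B - sg c * y (\<sigma> c)" for c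
  have bp: "b c > 0" "b' c > 0" if "c \<in> C" for c
    using sg[OF that] y[OF that] y[OF nx[OF that]] by (auto simp: b_def b'_def)
  have sb: "sg c * b c = sg c * B - y c" "sg c * b' c = sg c * B - y (\<sigma> c)" if "c \<in> C" for c
    using sg[OF that] by (auto simp: b_def b'_def)
  have row: "pt (quad_next \<sigma>) ?v (c, q) s $ 1 = x c + row_x r q s * (x (\<sigma> c) - x c)"
    "pt (quad_next \<sigma>) ?v (c, q) s $ 2 =
        y c + row_x r q s * (y (\<sigma> c) - y c) + sg c * row_h \<tau> (b c) (b' c) q s"
    "pt (quad_next \<sigma>) ?v (c, q) s $ 3 = z (\<sigma> c)" if c: "c \<in> C" and q: "1 \<le> q" "q < 4" for c q s
  proof -
    have qq: "q = 1 \<or> q = 2 \<or> q = 3" using q by auto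
    then show "pt (quad_next \<sigma>) ?v (c, q) s $ 1 = x c + row_x r q s * (x (\<sigma> c) - x c)"
      by (elim disjE) (simp_all add: pt_quad row_x_def r_def field_simps)
    show "pt (quad_next \<sigma>) ?v (c, q) s $ 3 = z (\<sigma> c)"
      using qq by (elim disjE) (simp_all add: pt_quad algebra_simps)
    have e: "sg c * (k * (\<tau> * b c)) = k * (\<tau> * (sg c * B - y c))"
      "sg c * (k * (\<tau> * b' c)) = k * (\<tau> * (sg c * B - y (\<sigma> c)))" for k
      unfolding sb[OF c, symmetric] by simp_all
    show "pt (quad_next \<sigma>) ?v (c, q) s $ 2 =
        y c + row_x r q s * (y (\<sigma> c) - y c) + sg c * row_h \<tau> (b c) (b' c) q s"
      using qq
    proof (elim disjE)
      assume "q = 1"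
      then show ?thesis by (simp add: pt_quad row_x_def row_h_def e) (simp add: r_def field_simps)
    next
      assume "q = 2"
      then show ?thesis by (simp add: pt_quad row_x_def row_h_def distrib_left e) (simp add: r_def field_simps)
    next
      assume "q = 3"
      then show ?thesis by (simp add: pt_quad row_x_def row_h_def e) (simp add: r_def field_simps)
    qed
  qed
  fix p q c d and s t :: real
  assume cd: "c \<in> C" "d \<in> C" and pq: "p \<le> q" "q < 4" and st: "0 \<le> s" "s < 1" "0 \<le> t" "t < 1"
    and eq: "pt (quad_next \<sigma>) ?v (c, p) s = pt (quad_next \<sigma>) ?v (d, q) t"
  have const: "(1 - r) * y + r * y = y" for r y :: real by (simp add: algebra_simps)
  consider "p = 0" "q = 0" | "p = 0" "1 \<le> q" | "1 \<le> p" using pq by linarith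
  then show "c = d \<and> p = q \<and> s = t"
  proof cases
    case 1
    note e = eq[unfolded 1 pt_quad]
    have "x c = x d" using arg_cong[OF e, of "\<lambda>v. v $ 1"] by (simp add: const)
    then have "c = d" using xi cd by blast
    moreover have "(1 - s) * z c + s * z (\<sigma> c) = (1 - t) * z c + t * z (\<sigma> c)"
      using arg_cong[OF e, of "\<lambda>v. v $ 3"] \<open>c = d\<close> by simp
    then have "s = t" using zn[OF cd(1)] by (rule segment_inj)
    ultimately show ?thesis using 1 by simp
  next
    case 2
    define \<xi> where "\<xi> = row_x r q t"
    define h where "h = row_h \<tau> (b d) (b' d) q t"
    note e = eq[unfolded 2(1) pt_quad]
    have e1: "x c = x d + \<xi> * (x (\<sigma> d) - x d)"
      using arg_cong[OF e, of "\<lambda>v. v $ 1"] row(1)[OF cd(2) 2(2) pq(2), of t] by (simp add: const \<xi>_def)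
    have e2: "y c = y d + \<xi> * (y (\<sigma> d) - y d) + sg d * h"
      using arg_cong[OF e, of "\<lambda>v. v $ 2"] row(2)[OF cd(2) 2(2) pq(2), of t] by (simp add: const \<xi>_def h_def)
    have e3: "(1 - s) * z c + s * z (\<sigma> c) = z (\<sigma> d)"
      using arg_cong[OF e, of "\<lambda>v. v $ 3"] row(3)[OF cd(2) 2(2) pq(2), of t] by simp
    have \<xi>: "0 \<le> \<xi>" "\<xi> \<le> 1" unfolding \<xi>_def by (rule row_x_bounds[OF r bp[OF cd(2)] st(3,4)])+
    have h: "0 \<le> h" unfolding h_def by (rule row_h_nonneg[OF r bp[OF cd(2)] st(3,4)])
    \<comment> \<open>Contacts at the ends of the row could only come from the steps adjacent to it;
      they are excluded first, which makes the inequalities required by \<open>good\<close>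
      strict.\<close>
    have "\<xi> \<noteq> 0"
    proof
      assume "\<xi> = 0"
      then have "c = d" using e1 xi cd by simp
      then have "(1 - s) * (z c - z (\<sigma> c)) = 0" using e3 by (simp add: algebra_simps)
      then show False using st zn[OF cd(1)] by simp
    qed
    have end_ne: "c \<noteq> \<sigma> d"
    proof
      assume cs: "c = \<sigma> d"
      then have "(1 - \<xi>) * (x (\<sigma> d) - x d) = 0" using e1 by (simp add: algebra_simps)
      then have "\<xi> = 1" using xn[OF cd(2)] by simp
      moreover have "sg d * h = 0" using e2 cs \<open>\<xi> = 1\<close> by simp
      then have "h = 0" using sg[OF cd(2)] by auto
      ultimately show False
        using row_end[OF r bp[OF cd(2)] st(3,4) _ _ 2(2) pq(2)] by (simp add: \<xi>_def h_def)
    qed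
    then have "\<xi> \<noteq> 1" using e1 xi[OF cd(1) nx[OF cd(2)]] by auto
    have "s \<noteq> 0" using e3 zi[OF cd(1) nx[OF cd(2)]] end_ne by auto
    have "(x c - x d) * (x (\<sigma> d) - x c) = \<xi> * (1 - \<xi>) * ((x (\<sigma> d) - x d) * (x (\<sigma> d) - x d))"
      unfolding e1 by (simp add: algebra_simps)
    also have "\<dots> > 0"
    proof (rule mult_pos_pos[OF mult_pos_pos])
      show "(x (\<sigma> d) - x d) * (x (\<sigma> d) - x d) > 0"
        using xn[OF cd(2)] not_real_square_gt_zero by blast
    qed (use \<xi> \<open>\<xi> \<noteq> 0\<close> \<open>\<xi> \<noteq> 1\<close> in auto)
    finally have o1: "(x c - x d) * (x (\<sigma> d) - x c) > 0" .
    have "(z (\<sigma> d) - z c) * (z (\<sigma> c) - z (\<sigma> d)) = s * (1 - s) * ((z (\<sigma> c) - z c) * (z (\<sigma> c) - z c))"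
      unfolding e3[symmetric] by (simp add: algebra_simps)
    also have "\<dots> > 0"
    proof (rule mult_pos_pos[OF mult_pos_pos])
      have "z (\<sigma> c) - z c \<noteq> 0" using zn[OF cd(1)] by simp
      then show "(z (\<sigma> c) - z c) * (z (\<sigma> c) - z c) > 0"
        using not_real_square_gt_zero by blast
    qed (use st \<open>s \<noteq> 0\<close> in auto)
    finally have o2: "(z (\<sigma> d) - z c) * (z (\<sigma> c) - z (\<sigma> d)) > 0" .
    have "(x c - x d) / (x (\<sigma> d) - x d) = \<xi>" using e1 xn[OF cd(2)] by simp
    then have "0 < sg d * (y d + \<xi> * (y (\<sigma> d) - y d) - y c)" using good[OF cd(2,1) o1 o2] by simp
    also have "\<dots> = - (sg d * sg d) * h" unfolding e2 by (simp add: algebra_simps)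
    also have "\<dots> \<le> 0" using sg[OF cd(2)] h by auto
    finally show ?thesis by simp
  next
    case 3
    have q1: "1 \<le> q" "p < 4" using 3 pq by auto
    note R = row[OF cd(1) 3 q1(2), of s, unfolded eq, symmetric] and S = row[OF cd(2) q1(1) pq(2), of t]
    have "z (\<sigma> c) = z (\<sigma> d)" by (rule trans[OF R(3) S(3)])
    then have "c = d" using zi[OF nx[OF cd(1)] nx[OF cd(2)]] si[OF cd] by blast
    have "row_x r p s * (x (\<sigma> c) - x c) = row_x r q t * (x (\<sigma> c) - x c)"
      using trans[OF R(1) S(1)] \<open>c = d\<close> by simp
    then have x: "row_x r p s = row_x r q t" using xn[OF cd(1)] by simp
    have "sg c * row_h \<tau> (b c) (b' c) p s = sg c * row_h \<tau> (b c) (b' c) q t"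
      using trans[OF R(2) S(2)] \<open>c = d\<close> x by simp
    then have "row_h \<tau> (b c) (b' c) p s = row_h \<tau> (b c) (b' c) q t" using sg[OF cd(1)] by auto
    from row_inj[OF r bp[OF cd(1)] 3 pq st x this] show ?thesis using \<open>c = d\<close> by simp
  qed
qed

section \<open>Staircases\<close>

text \<open>From \<open>c\<close> on to \<open>c'\<close>, the polygons of \<open>u\<close> and \<open>A\<close> both increase in one horizontal direction
  \<open>w\<close>; so do their convex combinations, which therefore have no double points there.\<close>

definition near_on :: "('c \<Rightarrow> 'c) \<Rightarrow> ('c \<Rightarrow> real^3) \<Rightarrow> ('c \<Rightarrow> real^3) \<Rightarrow> 'c \<Rightarrow> 'c \<Rightarrow> bool" where
  "near_on \<sigma> u A c c' \<longleftrightarrow> (\<exists>w m. w $ 3 = 0 \<and> c' = (\<sigma> ^^ m) c \<and>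
     (\<forall>k\<le>m. 0 < w \<bullet> (u (\<sigma> ((\<sigma> ^^ k) c)) - u ((\<sigma> ^^ k) c)) \<and>
            0 < w \<bullet> (A (\<sigma> ((\<sigma> ^^ k) c)) - A ((\<sigma> ^^ k) c))))"

text \<open>A vertical step to the level of the next vertex is followed by a horizontal row, which is cut
  into thirds because its middle third is pushed aside later.\<close>

definition staircase :: "('c \<Rightarrow> 'c) \<Rightarrow> ('c \<Rightarrow> real^3) \<Rightarrow> 'c \<times> nat \<Rightarrow> real^3" where
  "staircase \<sigma> A = quad A (\<lambda>c. vector [A c $ 1, A c $ 2, A (\<sigma> c) $ 3])
     (\<lambda>c. vector [A c $ 1 + (A (\<sigma> c) $ 1 - A c $ 1) / 3, A c $ 2 + (A (\<sigma> c) $ 2 - A c $ 2) / 3, A (\<sigma> c) $ 3])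
     (\<lambda>c. vector [A (\<sigma> c) $ 1 - (A (\<sigma> c) $ 1 - A c $ 1) / 3, A (\<sigma> c) $ 2 - (A (\<sigma> c) $ 2 - A c $ 2) / 3, A (\<sigma> c) $ 3])"

text \<open>Cut into quarters, the original polygon has as many vertices as its staircase, so that
  the two can be interpolated.\<close>

abbreviation quarters :: "('c \<Rightarrow> 'c) \<Rightarrow> ('c \<Rightarrow> real^3) \<Rightarrow> 'c \<times> nat \<Rightarrow> real^3" where
  "quarters \<equiv> sub_vertex (\<lambda>_ q. real q / 4)"

definition stair_x :: "nat \<Rightarrow> real \<Rightarrow> real" where
  "stair_x q s = (if q = 0 then 0 else (real q - 1 + s) / 3)"

lemma inner_horizontal: "w $ 3 = 0 \<Longrightarrow> w \<bullet> v = w $ 1 * v $ 1 + w $ 2 * (v $ 2 :: real)" for w v :: "real^3"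
  by (simp add: inner_vec_def sum_3)

lemma inner_staircase:
  assumes "w $ 3 = 0" "q < 4"
  shows "w \<bullet> pt (quad_next \<sigma>) (staircase \<sigma> A) (c, q) s = w \<bullet> A c + stair_x q s * (w \<bullet> (A (\<sigma> c) - A c))"
proof -
  have "q = 0 \<or> q = 1 \<or> q = 2 \<or> q = 3" using assms by auto
  then show ?thesis
    by (elim disjE) (simp_all add: staircase_def pt_quad inner_horizontal[OF assms(1)] stair_x_def algebra_simps
        add_divide_distrib diff_divide_distrib)
qed

lemma pt_quarters:
  assumes "q < 4"
  shows "pt (quad_next \<sigma>) (quarters \<sigma> u) (c, q) s = pt \<sigma> u c ((real q + s) / 4)"
proof -
  have "pt (quad_next \<sigma>) (quarters \<sigma> u) (c, q) s = pt \<sigma> u c ((1 - s) * (real q / 4) + s * (real (Suc q) / 4))"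
    by (rule pt_sub[where I = UNIV]) (use assms in \<open>auto simp: subdivision_def divide_strict_right_mono\<close>)
  also have "(1 - s) * (real q / 4) + s * (real (Suc q) / 4) = (real q + s) / 4"
    by (simp add: field_simps)
  finally show ?thesis .
qed

lemma inner_pt: "w \<bullet> pt \<sigma> u c s = w \<bullet> u c + s * (w \<bullet> (u (\<sigma> c) - u c))"
  by (simp add: pt_def inner_diff_right inner_add_right algebra_simps)

lemma nat_add_fraction_eq:
  fixes s t :: real
  assumes eq: "real p + s = real q + t" and st: "0 \<le> s" "s < 1" "0 \<le> t" "t < 1"
  shows "p = q \<and> s = t"
proof -
  have "real p < real (q + 1)" "real q < real (p + 1)" using eq st by auto
  then have "p < q + 1" "q < p + 1" by (simp_all only: of_nat_less_iff)
  then show ?thesis using eq by simp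
qed

text \<open>Points more than \<open>2 * \<delta>\<close> apart cannot meet, as each moves by at most
  \<delta>. For distinct edges related by \<open>near_on\<close>, the coordinate along
  \<open>w\<close> is larger on the later edge at every time. Within one edge it is strictly
  increasing before time 1; at time 1 it stands still on the vertical step, where the third
  coordinate decides.\<close>

lemma simple_staircase_interpolation:
  fixes u A :: "'c \<Rightarrow> real^3"
  assumes C: "finite C" "bij_betw \<sigma> C C" and zn: "\<And>c. c \<in> C \<Longrightarrow> A c $ 3 \<noteq> A (\<sigma> c) $ 3"
    and close: "\<And>i. i \<in> quad_index C \<Longrightarrow> norm (staircase \<sigma> A i - quarters \<sigma> u i) \<le> \<delta>"
    and dich: "\<And>c d. c \<in> C \<Longrightarrow> d \<in> C \<Longrightarrow> near_on \<sigma> u A c d \<or> near_on \<sigma> u A d c \<or>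
      (\<forall>s\<in>{0..1}. \<forall>t\<in>{0..1}. 2 * \<delta> < norm (pt \<sigma> u c s - pt \<sigma> u d t))"
    and \<tau>: "0 \<le> \<tau>" "\<tau> \<le> 1"
  shows "simple_poly (quad_index C) (quad_next \<sigma>) (\<lambda>i. (1 - \<tau>) *\<^sub>R quarters \<sigma> u i + \<tau> *\<^sub>R staircase \<sigma> A i)"
    (is "simple_poly _ _ ?v")
proof (rule simple_quadI[OF C])
  have nx: "\<sigma> c \<in> C" if "c \<in> C" for c using C(2) that by (auto simp: bij_betw_def)
  let ?P = "\<lambda>c q s. pt (quad_next \<sigma>) ?v (c, q) s"
  have P: "?P c q s = (1 - \<tau>) *\<^sub>R pt \<sigma> u c ((real q + s) / 4) + \<tau> *\<^sub>R pt (quad_next \<sigma>) (staircase \<sigma> A) (c, q) s"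
    if "q < 4" for c q s
    unfolding pt_lincomb pt_quarters[OF that] ..
  define e where "e w c = (1 - \<tau>) * (w \<bullet> u c) + \<tau> * (w \<bullet> A c)" for w c
  have wP: "w \<bullet> ?P c q s = e w c + (1 - \<tau>) * ((real q + s) / 4) * (w \<bullet> (u (\<sigma> c) - u c))
      + \<tau> * stair_x q s * (w \<bullet> (A (\<sigma> c) - A c))" if "w $ 3 = 0" "q < 4" for w c q s
  proof -
    have arith: "(1 - \<tau>) * (a + k * f) + \<tau> * (b + g * h) = ((1 - \<tau>) * a + \<tau> * b) + (1 - \<tau>) * k * f + \<tau> * g * h"
      for a b f g h k by (simp add: algebra_simps)
    show ?thesis
      unfolding P[OF that(2)] inner_add_right inner_scaleR_right inner_staircase[OF that] inner_pt[of w \<sigma> u] e_def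
      by (rule arith)
  qed
  have sx: "0 \<le> stair_x q s" "stair_x q s < 1" if "q < 4" "0 \<le> s" "s < 1" for q s
    using that by (auto simp: stair_x_def)
  have near_False: False if nr: "near_on \<sigma> u A c d" and "c \<noteq> d" and eq: "?P c p s = ?P d q t"
    and pq: "p < 4" "q < 4" and st: "0 \<le> s" "s < 1" "0 \<le> t" "t < 1" for c d p q s t
  proof -
    obtain w m where w: "w $ 3 = 0" "d = (\<sigma> ^^ m) c"
      and pos: "\<And>k. k \<le> m \<Longrightarrow> 0 < w \<bullet> (u (\<sigma> ((\<sigma> ^^ k) c)) - u ((\<sigma> ^^ k) c))"
        "\<And>k. k \<le> m \<Longrightarrow> 0 < w \<bullet> (A (\<sigma> ((\<sigma> ^^ k) c)) - A ((\<sigma> ^^ k) c))"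
      using nr unfolding near_on_def by blast
    have step: "e w ((\<sigma> ^^ k) c) < e w ((\<sigma> ^^ Suc k) c)" if "k \<le> m" for k
    proof -
      have "e w ((\<sigma> ^^ Suc k) c) - e w ((\<sigma> ^^ k) c) =
        (1 - \<tau>) * (w \<bullet> (u (\<sigma> ((\<sigma> ^^ k) c)) - u ((\<sigma> ^^ k) c))) + \<tau> * (w \<bullet> (A (\<sigma> ((\<sigma> ^^ k) c)) - A ((\<sigma> ^^ k) c)))"
        by (simp add: e_def inner_diff_right algebra_simps)
      also have "\<dots> > 0"
      proof (cases "\<tau> = 0")
        case True
        then show ?thesis using pos[OF that] by simp
      next
        case False
        then have "\<tau> * (w \<bullet> (A (\<sigma> ((\<sigma> ^^ k) c)) - A ((\<sigma> ^^ k) c))) > 0" using pos[OF that] \<tau> by simp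
        moreover have "(1 - \<tau>) * (w \<bullet> (u (\<sigma> ((\<sigma> ^^ k) c)) - u ((\<sigma> ^^ k) c))) \<ge> 0"
          using pos(1)[OF that] \<tau> by simp
        ultimately show ?thesis by linarith
      qed
      finally show ?thesis by simp
    qed
    have m: "m \<noteq> 0" using w(2) \<open>c \<noteq> d\<close> by (metis funpow_0)
    have mono: "e w ((\<sigma> ^^ 1) c) \<le> e w ((\<sigma> ^^ Suc k) c)" if "Suc k \<le> m" for k
      using that
    proof (induction k)
      case (Suc k)
      then show ?case using step[of "Suc k"] by simp
    qed simp
    have "e w (\<sigma> c) \<le> e w d" using mono[of "m - 1"] m w(2) by simp
    moreover have "e w d \<le> w \<bullet> ?P d q t"
    proof -
      have "0 \<le> (1 - \<tau>) * ((real q + t) / 4) * (w \<bullet> (u (\<sigma> d) - u d))"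
        "0 \<le> \<tau> * stair_x q t * (w \<bullet> (A (\<sigma> d) - A d))"
        using pos[of m] w(2) \<tau> st sx[OF pq(2) st(3,4)] by auto
      then show ?thesis unfolding wP[OF w(1) pq(2)] by linarith
    qed
    moreover have "w \<bullet> ?P c p s < e w (\<sigma> c)"
    proof -
      have p0: "0 < w \<bullet> (u (\<sigma> c) - u c)" "0 < w \<bullet> (A (\<sigma> c) - A c)" using pos[of 0] by auto
      have f: "(real p + s) / 4 < 1" using pq st by auto
      have "e w (\<sigma> c) - w \<bullet> ?P c p s = (1 - \<tau>) * ((1 - (real p + s) / 4) * (w \<bullet> (u (\<sigma> c) - u c))) +
         \<tau> * ((1 - stair_x p s) * (w \<bullet> (A (\<sigma> c) - A c)))"
      proof -
        have arith: "((1 - \<tau>) * a' + \<tau> * b') - ((1 - \<tau>) * a + \<tau> * b + (1 - \<tau>) * k * (a' - a) + \<tau> * g * (b' - b))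
          = (1 - \<tau>) * ((1 - k) * (a' - a)) + \<tau> * ((1 - g) * (b' - b))" for a b a' b' k g
          by (simp add: algebra_simps)
        show ?thesis unfolding wP[OF w(1) pq(1)] e_def inner_diff_right by (rule arith)
      qed
      also have "\<dots> > 0"
      proof (cases "\<tau> = 0")
        case True
        then show ?thesis using p0 f by simp
      next
        case False
        then have "\<tau> * ((1 - stair_x p s) * (w \<bullet> (A (\<sigma> c) - A c))) > 0"
          using p0 \<tau> sx[OF pq(1) st(1,2)] by simp
        moreover have "(1 - \<tau>) * ((1 - (real p + s) / 4) * (w \<bullet> (u (\<sigma> c) - u c))) \<ge> 0"
          using p0 f \<tau> by simp
        ultimately show ?thesis by linarith
      qed
      finally show ?thesis by simp
    qed
    ultimately show False using eq by simp
  qed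
  have close_pt: "norm (?P c q s - pt \<sigma> u c ((real q + s) / 4)) \<le> \<delta>" if "c \<in> C" "q < 4" "0 \<le> s" "s < 1" for c q s
  proof -
    have i: "(c, q) \<in> quad_index C" "quad_next \<sigma> (c, q) \<in> quad_index C"
      using that nx by (auto simp: sub_index_def sub_next_def)
    have "?P c q s - pt \<sigma> u c ((real q + s) / 4) =
      \<tau> *\<^sub>R pt (quad_next \<sigma>) (\<lambda>i. staircase \<sigma> A i - quarters \<sigma> u i) (c, q) s"
      unfolding P[OF that(2)] pt_diff pt_quarters[OF that(2)] by (simp add: algebra_simps)
    also have "norm \<dots> = \<tau> * norm (pt (quad_next \<sigma>) (\<lambda>i. staircase \<sigma> A i - quarters \<sigma> u i) (c, q) s)"
      using \<tau> by simp
    also have "\<dots> \<le> 1 * \<delta>"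
      by (intro mult_mono norm_pt_le close i) (use \<tau> that in auto)
    finally show ?thesis by simp
  qed
  fix p q c d and s t :: real
  assume cd: "c \<in> C" "d \<in> C" and pq: "p \<le> q" "q < 4" and st: "0 \<le> s" "s < 1" "0 \<le> t" "t < 1"
    and eq: "?P c p s = ?P d q t"
  have p4: "p < 4" using pq by simp
  have nfar: "\<not> (\<forall>s\<in>{0..1}. \<forall>t\<in>{0..1}. 2 * \<delta> < norm (pt \<sigma> u c s - pt \<sigma> u d t))"
  proof
    assume far: "\<forall>s\<in>{0..1}. \<forall>t\<in>{0..1}. 2 * \<delta> < norm (pt \<sigma> u c s - pt \<sigma> u d t)"
    let ?a = "pt \<sigma> u c ((real p + s) / 4)" and ?b = "pt \<sigma> u d ((real q + t) / 4)"
    have "2 * \<delta> < norm (?a - ?b)" using far p4 pq st by auto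
    also have "?a - ?b = (?P d q t - ?b) - (?P c p s - ?a)" using eq by simp
    also have "norm \<dots> \<le> \<delta> + \<delta>"
      by (rule norm_triangle_le_diff, rule add_mono; rule close_pt) (use cd pq p4 st in auto)
    finally show False by simp
  qed
  then have nr: "near_on \<sigma> u A c d \<or> near_on \<sigma> u A d c" using dich[OF cd] by blast
  have "c = d" using nr near_False[of c d p s q t] near_False[of d c q t p s] eq p4 pq st by metis
  then obtain w where w: "w $ 3 = 0" "0 < w \<bullet> (u (\<sigma> c) - u c)" "0 < w \<bullet> (A (\<sigma> c) - A c)"
    using nr unfolding near_on_def by (metis funpow_0 le0)
  define U where "U = w \<bullet> (u (\<sigma> c) - u c)"
  define W where "W = w \<bullet> (A (\<sigma> c) - A c)"
  have UW: "U > 0" "W > 0" using w by (auto simp: U_def W_def)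
  have val: "(1 - \<tau>) * ((real p + s) / 4) * U + \<tau> * stair_x p s * W = (1 - \<tau>) * ((real q + t) / 4) * U + \<tau> * stair_x q t * W"
    using wP[OF w(1) p4, of c s] wP[OF w(1) pq(2), of c t] eq \<open>c = d\<close> by (simp add: U_def W_def)
  have z0: "(1 - k) * A c $ 3 + k * A (\<sigma> c) $ 3 = (1 - l) * A c $ 3 + l * A (\<sigma> c) $ 3 \<Longrightarrow> k = l" for k l
    by (rule segment_inj) (use zn[OF cd(1)] in auto)
  show "c = d \<and> p = q \<and> s = t"
  proof (cases "\<tau> = 1")
    case True
    then have sxe: "stair_x p s = stair_x q t" using val UW by simp
    have z3: "?P c p s $ 3 = ?P c q t $ 3" using eq \<open>c = d\<close> by simp
    show ?thesis
    proof (cases "p = 0")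
      case p: True
      have "q = 0 \<or> q = 1 \<and> t = 0"
        using sxe st pq by (cases "q = 0") (auto simp: stair_x_def p)
      then show ?thesis
      proof
        assume q: "q = 0"
        have "s = t" by (rule z0) (use z3 in \<open>simp add: P p q True staircase_def pt_quad\<close>)
        then show ?thesis using p q \<open>c = d\<close> by simp
      next
        assume q: "q = 1 \<and> t = 0"
        have "pt (quad_next \<sigma>) (staircase \<sigma> A) (c, 0) s $ 3 = staircase \<sigma> A (c, 1) $ 3"
          using z3 q by (simp add: P p True)
        then have "(1 - s) * A c $ 3 + s * A (\<sigma> c) $ 3 = (1 - 1) * A c $ 3 + 1 * A (\<sigma> c) $ 3"
          unfolding staircase_def pt_quad by (simp add: quad_def)
        then have "s = 1" by (rule z0)
        then show ?thesis using st by simp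
      qed
    next
      case False
      then have "real p + s = real q + t" using sxe pq by (simp add: stair_x_def split: if_splits)
      then have "p = q \<and> s = t" by (rule nat_add_fraction_eq) (use st in auto)
      then show ?thesis using \<open>c = d\<close> by simp
    qed
  next
    case False
    then have \<tau>1: "1 - \<tau> > 0" using \<tau> by simp
    have mono: "k + a \<le> l + b \<Longrightarrow> stair_x k a \<le> stair_x l b" if "0 \<le> a" "a < 1" "0 \<le> b" "b < 1" for k l and a b :: real
      using that by (auto simp: stair_x_def)
    have "\<not> real p + s < real q + t"
    proof
      assume lt: "real p + s < real q + t"
      have "(1 - \<tau>) * ((real p + s) / 4) * U < (1 - \<tau>) * ((real q + t) / 4) * U"
        using lt \<tau>1 UW by (intro mult_strict_right_mono mult_strict_left_mono) auto
      moreover have "\<tau> * stair_x p s * W \<le> \<tau> * stair_x q t * W"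
        using mono[of s t p q] st lt \<tau> UW by (intro mult_right_mono mult_left_mono) auto
      ultimately show False using val by linarith
    qed
    moreover have "\<not> real q + t < real p + s"
    proof
      assume lt: "real q + t < real p + s"
      have "(1 - \<tau>) * ((real q + t) / 4) * U < (1 - \<tau>) * ((real p + s) / 4) * U"
        using lt \<tau>1 UW by (intro mult_strict_right_mono mult_strict_left_mono) auto
      moreover have "\<tau> * stair_x q t * W \<le> \<tau> * stair_x p s * W"
        using mono[of t s q p] st lt \<tau> UW by (intro mult_right_mono mult_left_mono) auto
      ultimately show False using val by linarith
    qed
    ultimately have "real p + s = real q + t" by argo
    then have "p = q \<and> s = t" by (rule nat_add_fraction_eq) (use st in auto)
    then show ?thesis using \<open>c = d\<close> by simp
  qed
qed

section \<open>Levelled staircases\<close>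

text \<open>One index after the other: each choice has to avoid only the finitely many values used
  so far.\<close>

lemma finite_choice_disjoint:
  fixes vals :: "'b \<Rightarrow> 'y \<Rightarrow> 'z set"
  assumes "finite R" "finite Z0"
    and ex: "\<And>b Z. b \<in> R \<Longrightarrow> finite Z \<Longrightarrow> \<exists>y. Q b y \<and> finite (vals b y) \<and> vals b y \<inter> Z = {}"
  shows "\<exists>f. (\<forall>b\<in>R. Q b (f b) \<and> finite (vals b (f b)) \<and> vals b (f b) \<inter> Z0 = {}) \<and>
    (\<forall>b\<in>R. \<forall>c\<in>R. b \<noteq> c \<longrightarrow> vals b (f b) \<inter> vals c (f c) = {})"
  using assms(1) ex
proof (induction R)
  case (insert b R)
  obtain f where f: "\<forall>b\<in>R. Q b (f b) \<and> finite (vals b (f b)) \<and> vals b (f b) \<inter> Z0 = {}"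
    "\<forall>b\<in>R. \<forall>c\<in>R. b \<noteq> c \<longrightarrow> vals b (f b) \<inter> vals c (f c) = {}"
    using insert.IH insert.prems by force
  have "finite (Z0 \<union> (\<Union>c\<in>R. vals c (f c)))" using assms(2) insert.hyps(1) f(1) by auto
  from insert.prems[OF _ this, of b] obtain y where y: "Q b y" "finite (vals b y)"
    "vals b y \<inter> (Z0 \<union> (\<Union>c\<in>R. vals c (f c))) = {}" by auto
  have ne: "c \<noteq> b" if "c \<in> R" for c using insert.hyps(2) that by auto
  show ?case
  proof (intro exI[of _ "f(b := y)"] conjI ballI impI)
    fix c assume "c \<in> insert b R"
    then show "Q c ((f(b := y)) c)" "finite (vals c ((f(b := y)) c))" "vals c ((f(b := y)) c) \<inter> Z0 = {}"
      using f(1) y ne by auto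
    fix d assume "d \<in> insert b R" "c \<noteq> d"
    then show "vals c ((f(b := y)) c) \<inter> vals d ((f(b := y)) d) = {}"
    proof -
      consider "c = b" "d \<in> R" "d \<noteq> b" | "d = b" "c \<in> R" "c \<noteq> b" | "c \<in> R" "d \<in> R" "c \<noteq> b" "d \<noteq> b"
        using \<open>c \<in> insert b R\<close> \<open>d \<in> insert b R\<close> \<open>c \<noteq> d\<close> ne by blast
      then show ?thesis
      proof cases
        case 1
        then have "vals b y \<inter> vals d (f d) = {}" using y(3) by blast
        then show ?thesis using 1 by simp
      next
        case 2
        then have "vals b y \<inter> vals c (f c) = {}" using y(3) by blast
        then show ?thesis using 2 by (simp add: Int_commute)
      next
        case 3
        then show ?thesis using f(2) \<open>c \<noteq> d\<close> by simp
      qed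
    qed
  qed
qed simp

lemma interval_avoid_finite:
  fixes a b :: real
  assumes "a < b" "finite Z"
  shows "\<exists>x. a < x \<and> x < b \<and> x \<notin> Z"
proof -
  have "infinite ({a<..<b} - Z)" using assms by (simp add: infinite_Ioo)
  then obtain x where "x \<in> {a<..<b} - Z" by (metis finite.emptyI equals0I)
  then show ?thesis by auto
qed

lemma perturb_to_injective:
  fixes f :: "'c \<Rightarrow> real"
  assumes "finite S" "e > 0"
  shows "\<exists>g. inj_on g S \<and> (\<forall>c\<in>S. \<bar>g c - f c\<bar> < e)"
proof -
  have "\<exists>g. (\<forall>b\<in>S. \<bar>g b - f b\<bar> < e \<and> finite {g b} \<and> {g b} \<inter> {} = {}) \<and>
    (\<forall>b\<in>S. \<forall>c\<in>S. b \<noteq> c \<longrightarrow> {g b} \<inter> {g c} = {})"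
  proof (rule finite_choice_disjoint[OF assms(1)])
    fix b and Z :: "real set" assume "finite Z"
    then obtain x where "f b - e < x" "x < f b + e" "x \<notin> Z"
      using interval_avoid_finite[of "f b - e" "f b + e" Z] assms(2) by auto
    then show "\<exists>y. \<bar>y - f b\<bar> < e \<and> finite {y} \<and> {y} \<inter> Z = {}" by (intro exI[of _ x]) auto
  qed simp
  then obtain g where g: "\<forall>b\<in>S. \<bar>g b - f b\<bar> < e" "\<forall>b\<in>S. \<forall>c\<in>S. b \<noteq> c \<longrightarrow> g b \<noteq> g c" by auto
  then show ?thesis by (intro exI[of _ g]) (auto simp: inj_on_def)
qed

text \<open>Used with \<open>P s\<close> telling on which side of an edge the obstacle over its point \<open>s\<close> lies: piece number \<open>r\<close>
  of the edge will be pushed in the direction \<open>(-1)\<^sup>r\<close>.\<close>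

lemma alternating_breakpoints:
  fixes S :: "real set"
  assumes "finite S" "finite Z" "b > 0" "\<forall>s\<in>S. 0 < s \<and> s < b"
  shows "\<exists>m l. m > 0 \<and> l 0 = 0 \<and> l (2 * m) = b \<and> (\<forall>r<2 * m. l r < l (Suc r)) \<and>
     (\<forall>r. 0 < r \<and> r < 2 * m \<longrightarrow> l r \<notin> Z) \<and>
     (\<forall>s\<in>S. \<exists>r<2 * m. l r < s \<and> s < l (Suc r) \<and> (even r \<longleftrightarrow> P s))"
  using assms(1,3,4)
proof (induction S arbitrary: b rule: finite_linorder_max_induct)
  case empty
  obtain x where x: "0 < x" "x < b" "x \<notin> Z" using interval_avoid_finite[OF empty(1) assms(2)] by auto
  \<comment> \<open>Even without obstacles the edge is cut in two, since the number of pieces has to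
    be even.\<close>
  define l where "l r = (if r = 0 then 0 else if r = 1 then x else b)" for r :: nat
  show ?case
    by (rule exI[of _ 1], rule exI[of _ l]) (use x in \<open>auto simp: l_def less_Suc_eq numeral_2_eq_2\<close>)
next
  case (insert s S)
  have s: "0 < s" "s < b" using insert.prems by auto
  \<comment> \<open>The largest obstacle \<open>s\<close> is split off: the induction hypothesis
    serves the part up to \<open>a\<close>, which contains all the others.\<close>
  have "\<exists>a. 0 < a \<and> a < s \<and> (\<forall>t\<in>S. t < a) \<and> a \<notin> Z"
  proof -
    define M where "M = Max (insert 0 S)"
    have "M < s" using insert.hyps s by (auto simp: M_def)
    then obtain a where "M < a" "a < s" "a \<notin> Z" using interval_avoid_finite[OF _ assms(2)] by auto
    moreover have "0 \<le> M" "\<forall>t\<in>S. t \<le> M" using insert.hyps(1) by (auto simp: M_def)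
    ultimately show ?thesis by (intro exI[of _ a]) auto
  qed
  then obtain a where a: "0 < a" "a < s" "\<forall>t\<in>S. t < a" "a \<notin> Z" by blast
  obtain m l where ml: "m > 0" "l 0 = 0" "l (2 * m) = a" "\<forall>r<2 * m. l r < l (Suc r)"
    "\<forall>r. 0 < r \<and> r < 2 * m \<longrightarrow> l r \<notin> Z"
    "\<forall>s\<in>S. \<exists>r<2 * m. l r < s \<and> s < l (Suc r) \<and> (even r \<longleftrightarrow> P s)"
    using insert.IH[of a] a insert.prems by auto
  \<comment> \<open>Two pieces are added, from \<open>a\<close> to \<open>x\<close> with an even
    number and from \<open>x\<close> to \<open>b\<close> with an odd one; \<open>x\<close> goes to
    the side of \<open>s\<close> that puts \<open>s\<close> into the piece of the required
    parity.\<close>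
  obtain x where x: "a < x" "x < b" "x \<notin> Z" "if P s then s < x else x < s"
  proof (cases "P s")
    case True
    obtain x where "s < x" "x < b" "x \<notin> Z" using interval_avoid_finite[OF s(2) assms(2)] by auto
    then show thesis using that[of x] a True by simp
  next
    case False
    obtain x where "a < x" "x < s" "x \<notin> Z" using interval_avoid_finite[OF a(2) assms(2)] by auto
    then show thesis using that[of x] s False by simp
  qed
  define l' where "l' r = (if r \<le> 2 * m then l r else if r = Suc (2 * m) then x else b)" for r
  show ?case
  proof (rule exI[of _ "Suc m"], rule exI[of _ l'], intro conjI ballI allI impI)
    show "l' 0 = 0" using ml(2) by (simp add: l'_def)
    show "l' (2 * Suc m) = b" by (simp add: l'_def)
  next
    fix r assume "r < 2 * Suc m"
    then have "r < 2 * m \<or> r = 2 * m \<or> r = Suc (2 * m)" by auto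
    then show "l' r < l' (Suc r)"
    proof (elim disjE)
      assume "r < 2 * m"
      moreover from this have "l r < l (Suc r)" using ml(4) by blast
      ultimately show ?thesis by (simp add: l'_def)
    next
      assume "r = 2 * m"
      then show ?thesis using ml(3) x(1) by (simp add: l'_def)
    next
      assume "r = Suc (2 * m)"
      then show ?thesis using x(2) by (simp add: l'_def)
    qed
  next
    fix r assume r: "0 < r \<and> r < 2 * Suc m"
    then have "r < 2 * m \<or> r = 2 * m \<or> r = Suc (2 * m)" by auto
    then show "l' r \<notin> Z"
    proof (elim disjE)
      assume "r < 2 * m"
      moreover from this have "l r \<notin> Z" using ml(5) r by blast
      ultimately show ?thesis by (simp add: l'_def)
    next
      assume "r = 2 * m"
      then show ?thesis using ml(3) a(4) by (simp add: l'_def)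
    next
      assume "r = Suc (2 * m)"
      then show ?thesis using x(3) by (simp add: l'_def)
    qed
  next
    fix t assume t: "t \<in> insert s S"
    show "\<exists>r<2 * Suc m. l' r < t \<and> t < l' (Suc r) \<and> (even r \<longleftrightarrow> P t)"
    proof (cases "t = s")
      case True
      show ?thesis
      proof (cases "P s")
        case p: True
        then show ?thesis using True x(4) a(2) ml(3) by (intro exI[of _ "2 * m"]) (simp add: l'_def)
      next
        case False
        then show ?thesis using True x(4) s by (intro exI[of _ "Suc (2 * m)"]) (simp add: l'_def)
      qed
    next
      case False
      then obtain r where "r < 2 * m" "l r < t" "t < l (Suc r)" "even r \<longleftrightarrow> P t" using ml(6) t by auto
      then show ?thesis by (intro exI[of _ r]) (simp add: l'_def)
    qed
  qed simp
qed

section \<open>Edges that follow one another, and their subdivisions\<close>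

definition linked :: "('c \<Rightarrow> 'c) \<Rightarrow> 'c set \<Rightarrow> 'c \<Rightarrow> 'c \<Rightarrow> bool" where
  "linked \<sigma> T c d \<longleftrightarrow> c \<in> T \<and> (\<lambda>a b. b = \<sigma> a \<and> b \<in> T)\<^sup>*\<^sup>* c d"

lemma linked_funpow:
  assumes "linked \<sigma> T c d"
  shows "\<exists>m. d = (\<sigma> ^^ m) c \<and> (\<forall>k\<le>m. (\<sigma> ^^ k) c \<in> T)"
proof -
  have "(\<lambda>a b. b = \<sigma> a \<and> b \<in> T)\<^sup>*\<^sup>* c d" "c \<in> T" using assms by (auto simp: linked_def)
  then show ?thesis
  proof (induction rule: rtranclp_induct)
    case base
    then show ?case by (intro exI[of _ 0]) auto
  next
    case (step a b)
    then obtain m where m: "a = (\<sigma> ^^ m) c" "\<forall>k\<le>m. (\<sigma> ^^ k) c \<in> T" by blast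
    then show ?case using step.hyps(2) by (intro exI[of _ "Suc m"]) (auto simp: le_Suc_eq)
  qed
qed

lemma near_on_linked:
  assumes "linked \<sigma> T c d" "w $ 3 = 0"
    "\<And>c. c \<in> T \<Longrightarrow> 0 < w \<bullet> (u (\<sigma> c) - u c) \<and> 0 < w \<bullet> (A (\<sigma> c) - A c)"
  shows "near_on \<sigma> u A c d"
  using linked_funpow[OF assms(1)] assms(2,3) unfolding near_on_def by metis

lemma linked_sub_within:
  assumes "i \<in> T" "r \<le> s" "s < k i"
  shows "(\<lambda>a b. b = sub_next k \<sigma> a \<and> b \<in> sub_index k T)\<^sup>*\<^sup>* (i, r) (i, s)"
  using assms(2,3)
proof (induction s rule: dec_induct)
  case (step s)
  then have "(\<lambda>a b. b = sub_next k \<sigma> a \<and> b \<in> sub_index k T) (i, s) (i, Suc s)"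
    using assms(1) by (simp add: sub_next_def sub_index_def)
  moreover have "(\<lambda>a b. b = sub_next k \<sigma> a \<and> b \<in> sub_index k T)\<^sup>*\<^sup>* (i, r) (i, s)" using step by simp
  ultimately show ?case by (rule rtranclp.rtrancl_into_rtrancl[rotated])
qed simp

text \<open>The relation mentions no positions, so it survives repeated subdivision; only afterwards
  does \<open>near_on_linked\<close> bring in the vertices. Pieces of one edge have to be compared
  by their numbers.\<close>

lemma linked_sub:
  assumes "linked \<sigma> T i j" "\<And>i. i \<in> T \<Longrightarrow> k i > 0" "r < k i" "s < k j" "i \<noteq> j \<or> r \<le> s"
  shows "linked (sub_next k \<sigma>) (sub_index k T) (i, r) (j, s)"
proof -
  have iT: "i \<in> T" and path: "(\<lambda>a b. b = \<sigma> a \<and> b \<in> T)\<^sup>*\<^sup>* i j" using assms(1) by (auto simp: linked_def)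
  have "(\<lambda>a b. b = sub_next k \<sigma> a \<and> b \<in> sub_index k T)\<^sup>*\<^sup>* (i, r) (j, s)"
    using path assms(4,5)
  proof (induction arbitrary: s rule: rtranclp_induct)
    case base
    then show ?case using linked_sub_within[OF iT] by blast
  next
    case (step a b)
    have aT: "a \<in> T" using step.hyps(1) iT by (induction rule: rtranclp_induct) auto
    have b: "b = \<sigma> a" "b \<in> T" using step.hyps by auto
    have ka: "k a > 0" "k b > 0" using assms(2) aT b by auto
    have "(\<lambda>a b. b = sub_next k \<sigma> a \<and> b \<in> sub_index k T)\<^sup>*\<^sup>* (i, r) (a, k a - 1)"
      by (rule step.IH) (use ka assms(3) in auto)
    moreover have "(\<lambda>a b. b = sub_next k \<sigma> a \<and> b \<in> sub_index k T) (a, k a - 1) (b, 0)"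
      using ka b by (simp add: sub_next_def sub_index_def)
    ultimately have "(\<lambda>a b. b = sub_next k \<sigma> a \<and> b \<in> sub_index k T)\<^sup>*\<^sup>* (i, r) (b, 0)"
      by (rule rtranclp.rtrancl_into_rtrancl)
    also have "(\<lambda>a b. b = sub_next k \<sigma> a \<and> b \<in> sub_index k T)\<^sup>*\<^sup>* (b, 0) (b, s)"
      by (rule linked_sub_within) (use b step.prems in auto)
    finally show ?case .
  qed
  then show ?thesis using iT assms(3) by (simp add: linked_def sub_index_def)
qed

lemma linked_sub_either:
  assumes "linked \<sigma> T i j \<or> linked \<sigma> T j i" "\<And>i. i \<in> T \<Longrightarrow> k i > 0" "r < k i" "s < k j"
  shows "linked (sub_next k \<sigma>) (sub_index k T) (i, r) (j, s) \<or> linked (sub_next k \<sigma>) (sub_index k T) (j, s) (i, r)"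
  using linked_sub[of \<sigma> T i j k r s] linked_sub[of \<sigma> T j i k s r] assms nat_le_linear by metis

lemma sub_vertex_next:
  assumes "subdivision I k l" "i \<in> I" "\<sigma> i \<in> I" "r < k i"
  shows "sub_vertex l \<sigma> v (sub_next k \<sigma> (i, r)) = pt \<sigma> v i (l i (Suc r))"
  using pt_sub[where \<sigma> = \<sigma> and r = r and i = i and v = v and s = 1, OF assms] by simp

lemma isotopic_poly_sub:
  assumes "isotopic_poly I \<sigma> v w" "subdivision I k l" "\<And>i. i \<in> I \<Longrightarrow> \<sigma> i \<in> I"
  shows "isotopic_poly (sub_index k I) (sub_next k \<sigma>) (sub_vertex l \<sigma> v) (sub_vertex l \<sigma> w)"
proof -
  obtain H where H: "cs_isotopy H" "\<forall>i\<in>I. \<forall>s\<in>{0..1}. H 1 (pt \<sigma> v i s) = pt \<sigma> w i s"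
    using assms(1) unfolding isotopic_poly_def by auto
  have "H 1 (pt (sub_next k \<sigma>) (sub_vertex l \<sigma> v) p s) = pt (sub_next k \<sigma>) (sub_vertex l \<sigma> w) p s"
    if "p \<in> sub_index k I" "s \<in> {0..1}" for p s
  proof -
    obtain i r where p: "p = (i, r)" "i \<in> I" "r < k i" using \<open>p \<in> _\<close> by (auto simp: sub_index_def)
    have l: "0 \<le> l i r" "l i (Suc r) \<le> 1" "l i r \<le> l i (Suc r)"
      using subdivision_mono[OF assms(2) p(2), of 0 r] subdivision_mono[OF assms(2) p(2), of "Suc r" "k i"]
        subdivision_mono[OF assms(2) p(2), of r "Suc r"] assms(2) p by (auto simp: subdivision_def)
    have "(1 - s) * l i r + s * l i (Suc r) \<le> (1 - s) * 1 + s * 1"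
      by (intro add_mono mult_left_mono) (use l that in auto)
    moreover have "0 \<le> (1 - s) * l i r + s * l i (Suc r)" using l that by auto
    ultimately have "(1 - s) * l i r + s * l i (Suc r) \<in> {0..1}" by simp
    then show ?thesis
      unfolding p(1) pt_sub[where \<sigma> = \<sigma> and i = i and r = r, OF assms(2) p(2) assms(3)[OF p(2)] p(3)] using H(2) p(2) by blast
  qed
  then show ?thesis using H(1) unfolding isotopic_poly_def by blast
qed

text \<open>The vertices are displaced by multiples of points on the parabola
  \<open>(k, k\<^sup>2)\<close>. The determinant of two consecutive projected edges is then a
  quadratic polynomial in \<epsilon> with nonzero leading coefficient, so it vanishes for finitely
  many \<epsilon> only.\<close>

lemma generic_perturbation:
  fixes v :: "'i \<Rightarrow> real^3"
  assumes v: "simple_poly I \<sigma> v"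
  shows "\<exists>w. simple_poly I \<sigma> w \<and> isotopic_poly I \<sigma> v w \<and>
    (\<forall>i\<in>I. (w (\<sigma> i) $ 1 - w i $ 1) * (w (\<sigma> (\<sigma> i)) $ 2 - w (\<sigma> i) $ 2) \<noteq>
           (w (\<sigma> i) $ 2 - w i $ 2) * (w (\<sigma> (\<sigma> i)) $ 1 - w (\<sigma> i) $ 1))"
proof -
  have fin: "finite I" using v by (simp add: simple_poly_def)
  obtain k0 :: "'i \<Rightarrow> nat" where k0: "inj_on k0 I" using finite_imp_inj_to_nat_seg[OF fin] by auto
  define k where "k i = real (k0 i)" for i
  have kd: "k i \<noteq> k j" if "i \<in> I" "j \<in> I" "i \<noteq> j" for i j using k0 that by (auto simp: k_def inj_on_def)
  define q :: "'i \<Rightarrow> real^3" where "q i = vector [k i, (k i)\<^sup>2, 0]" for i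
  obtain e where e: "e > 0" "\<And>w. (\<forall>i\<in>I. norm (w i - v i) \<le> e) \<Longrightarrow> simple_poly I \<sigma> w"
    using simple_poly_perturb[OF v] by auto
  define Q where "Q = (\<Sum>i\<in>I. norm (q i)) + 1"
  have Q: "Q > 0" "\<And>i. i \<in> I \<Longrightarrow> norm (q i) \<le> Q"
    unfolding Q_def using member_le_sum[OF _ _ fin, of _ "\<lambda>i. norm (q i)"]
    by (auto intro!: add_nonneg_pos sum_nonneg add_increasing2)
  define u where "u \<epsilon> i = v i + \<epsilon> *\<^sub>R q i" for \<epsilon> i
  have us: "simple_poly I \<sigma> (u \<epsilon>)" if "0 \<le> \<epsilon>" "\<epsilon> \<le> e / Q" for \<epsilon>
  proof (rule e(2), rule ballI)
    fix i assume "i \<in> I"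
    have "norm (u \<epsilon> i - v i) = \<epsilon> * norm (q i)" using that by (simp add: u_def)
    also have "\<dots> \<le> (e / Q) * Q" by (rule mult_mono) (use that Q \<open>i \<in> I\<close> in auto)
    finally show "norm (u \<epsilon> i - v i) \<le> e" using Q by simp
  qed
  define d0 where "d0 i = (v (\<sigma> i) $ 1 - v i $ 1) * (v (\<sigma> (\<sigma> i)) $ 2 - v (\<sigma> i) $ 2) -
     (v (\<sigma> i) $ 2 - v i $ 2) * (v (\<sigma> (\<sigma> i)) $ 1 - v (\<sigma> i) $ 1)" for i
  define d1 where "d1 i = (v (\<sigma> i) $ 1 - v i $ 1) * ((k (\<sigma> (\<sigma> i)))\<^sup>2 - (k (\<sigma> i))\<^sup>2) +
     (k (\<sigma> i) - k i) * (v (\<sigma> (\<sigma> i)) $ 2 - v (\<sigma> i) $ 2) -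
     (v (\<sigma> i) $ 2 - v i $ 2) * (k (\<sigma> (\<sigma> i)) - k (\<sigma> i)) -
     ((k (\<sigma> i))\<^sup>2 - (k i)\<^sup>2) * (v (\<sigma> (\<sigma> i)) $ 1 - v (\<sigma> i) $ 1)" for i
  \<comment> \<open>A Vandermonde determinant in \<open>k\<close> at three consecutive vertices,
    which are distinct because no cycle of a simple configuration has length 1 or 2.\<close>
  define d2 where "d2 i = (k (\<sigma> i) - k i) * (k (\<sigma> (\<sigma> i)) - k (\<sigma> i)) * (k (\<sigma> (\<sigma> i)) - k i)" for i
  have det: "(u \<epsilon> (\<sigma> i) $ 1 - u \<epsilon> i $ 1) * (u \<epsilon> (\<sigma> (\<sigma> i)) $ 2 - u \<epsilon> (\<sigma> i) $ 2) -
     (u \<epsilon> (\<sigma> i) $ 2 - u \<epsilon> i $ 2) * (u \<epsilon> (\<sigma> (\<sigma> i)) $ 1 - u \<epsilon> (\<sigma> i) $ 1) = poly [:d0 i, d1 i, d2 i:] \<epsilon>" for \<epsilon> i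
    by (simp add: u_def q_def d0_def d1_def d2_def power2_eq_square algebra_simps)
  have "finite {\<epsilon>. poly [:d0 i, d1 i, d2 i:] \<epsilon> = 0}" if "i \<in> I" for i
  proof (rule poly_roots_finite)
    have i: "\<sigma> i \<in> I" "\<sigma> (\<sigma> i) \<in> I" "\<sigma> i \<noteq> i" "\<sigma> (\<sigma> i) \<noteq> \<sigma> i" "\<sigma> (\<sigma> i) \<noteq> i"
      using simple_poly_next_in[OF v] simple_poly_next_ne[OF v] simple_poly_next2_ne[OF v] that by auto
    have "d2 i \<noteq> 0" using kd[OF i(1) that] kd[OF i(2,1)] kd[OF i(2) that] i by (auto simp: d2_def)
    then show "[:d0 i, d1 i, d2 i:] \<noteq> 0" by simp
  qed
  then have "finite (\<Union>i\<in>I. {\<epsilon>. poly [:d0 i, d1 i, d2 i:] \<epsilon> = 0})" using fin by auto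
  from interval_avoid_finite[OF _ this, of 0 "e / Q"] obtain \<epsilon> where \<epsilon>: "0 < \<epsilon>" "\<epsilon> < e / Q"
    "\<epsilon> \<notin> (\<Union>i\<in>I. {\<epsilon>. poly [:d0 i, d1 i, d2 i:] \<epsilon> = 0})" using e(1) Q(1) by auto
  show ?thesis
  proof (intro exI[of _ "u \<epsilon>"] conjI ballI)
    show "simple_poly I \<sigma> (u \<epsilon>)" using us \<epsilon> by simp
    show "isotopic_poly I \<sigma> v (u \<epsilon>)"
    proof (rule isotopic_poly_along_lines)
      fix \<tau> :: real assume \<tau>: "\<tau> \<in> {0..1}"
      have "(\<lambda>i. (1 - \<tau>) *\<^sub>R v i + \<tau> *\<^sub>R u \<epsilon> i) = u (\<tau> * \<epsilon>)"
        by (simp add: u_def fun_eq_iff algebra_simps)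
      moreover have "\<tau> * \<epsilon> \<le> 1 * \<epsilon>" by (rule mult_right_mono) (use \<tau> \<epsilon> in auto)
      then have "\<tau> * \<epsilon> \<le> e / Q" using \<epsilon>(2) by linarith
      ultimately show "simple_poly I \<sigma> (\<lambda>i. (1 - \<tau>) *\<^sub>R v i + \<tau> *\<^sub>R u \<epsilon> i)"
        using us[of "\<tau> * \<epsilon>"] \<tau> \<epsilon>(1) by simp
    qed
    fix i assume "i \<in> I"
    then have "poly [:d0 i, d1 i, d2 i:] \<epsilon> \<noteq> 0" using \<epsilon>(3) by auto
    then show "(u \<epsilon> (\<sigma> i) $ 1 - u \<epsilon> i $ 1) * (u \<epsilon> (\<sigma> (\<sigma> i)) $ 2 - u \<epsilon> (\<sigma> i) $ 2) \<noteq>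
           (u \<epsilon> (\<sigma> i) $ 2 - u \<epsilon> i $ 2) * (u \<epsilon> (\<sigma> (\<sigma> i)) $ 1 - u \<epsilon> (\<sigma> i) $ 1)"
      using det[of \<epsilon> i] by auto
  qed
qed

text \<open>The number 11 is \<open>3 * 3 + 1 + 1\<close>: each of the three coordinates of the
  staircase is off from \<open>A c\<close> by at most \<open>3 * m\<close>, and \<open>A c\<close>
  and the quarter point are off from \<open>u c\<close> by at most \<open>m\<close> each.\<close>

lemma staircase_close:
  assumes "norm (A c - u c) \<le> m" "norm (A (\<sigma> c) - u (\<sigma> c)) \<le> m" "norm (u (\<sigma> c) - u c) \<le> m" "q < 4"
  shows "norm (staircase \<sigma> A (c, q) - quarters \<sigma> u (c, q)) \<le> 11 * m"
proof -
  have "A (\<sigma> c) - A c = (A (\<sigma> c) - u (\<sigma> c)) + (u (\<sigma> c) - u c) - (A c - u c)" by simp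
  also have "norm \<dots> \<le> (m + m) + m"
    by (intro norm_triangle_le_diff add_mono norm_triangle_le assms)
  finally have AA: "norm (A (\<sigma> c) - A c) \<le> 3 * m" by simp
  have third: "\<bar>a + (b - a) / 3 - a\<bar> \<le> \<bar>b - a\<bar>" "\<bar>b - (b - a) / 3 - a\<bar> \<le> \<bar>b - a\<bar>" for a b :: real
  proof -
    have le: "\<bar>p * d\<bar> \<le> \<bar>d\<bar>" if "0 \<le> p" "p \<le> 1" for p d :: real
      using that by (simp add: abs_mult mult_left_le_one_le)
    have eq: "a + (b - a) / 3 - a = 1 / 3 * (b - a)" by simp
    show "\<bar>a + (b - a) / 3 - a\<bar> \<le> \<bar>b - a\<bar>" unfolding eq by (rule le) auto
    have eq: "b - (b - a) / 3 - a = 2 / 3 * (b - a)" by (simp add: field_simps)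
    show "\<bar>b - (b - a) / 3 - a\<bar> \<le> \<bar>b - a\<bar>" unfolding eq by (rule le) auto
  qed
  have comp: "\<bar>staircase \<sigma> A (c, q) $ k - A c $ k\<bar> \<le> \<bar>A (\<sigma> c) $ k - A c $ k\<bar>" for k
  proof -
    consider "q = 0" | "q = 1" | "q = 2" | "q = 3" using assms(4) by linarith
    then have "\<forall>k. \<bar>staircase \<sigma> A (c, q) $ k - A c $ k\<bar> \<le> \<bar>A (\<sigma> c) $ k - A c $ k\<bar>"
    proof cases
      case 1
      then show ?thesis by (simp add: staircase_def quad_def)
    next
      case 2
      then show ?thesis unfolding forall_3 by (simp add: staircase_def quad_def)
    next
      case 3
      have "staircase \<sigma> A (c, q) = vector [A c $ 1 + (A (\<sigma> c) $ 1 - A c $ 1) / 3,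
          A c $ 2 + (A (\<sigma> c) $ 2 - A c $ 2) / 3, A (\<sigma> c) $ 3]"
        using 3 by (simp add: staircase_def quad_def)
      then show ?thesis unfolding forall_3 by (simp only: vector_3) (intro conjI third order_refl)
    next
      case 4
      have "staircase \<sigma> A (c, q) = vector [A (\<sigma> c) $ 1 - (A (\<sigma> c) $ 1 - A c $ 1) / 3,
          A (\<sigma> c) $ 2 - (A (\<sigma> c) $ 2 - A c $ 2) / 3, A (\<sigma> c) $ 3]"
        using 4 by (simp add: staircase_def quad_def)
      then show ?thesis unfolding forall_3 by (simp only: vector_3) (intro conjI third order_refl)
    qed
    then show ?thesis by blast
  qed
  have "norm (staircase \<sigma> A (c, q) - A c) \<le> (\<Sum>k\<in>UNIV. \<bar>(staircase \<sigma> A (c, q) - A c) $ k\<bar>)"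
    by (rule norm_le_l1_cart)
  also have "\<dots> \<le> (\<Sum>k\<in>(UNIV :: 3 set). 3 * m)"
  proof (rule sum_mono)
    fix k :: 3
    have "\<bar>(staircase \<sigma> A (c, q) - A c) $ k\<bar> \<le> \<bar>(A (\<sigma> c) - A c) $ k\<bar>" using comp by simp
    also have "\<dots> \<le> norm (A (\<sigma> c) - A c)" by (rule component_le_norm_cart)
    finally show "\<bar>(staircase \<sigma> A (c, q) - A c) $ k\<bar> \<le> 3 * m" using AA by simp
  qed
  also have "\<dots> = 9 * m" by simp
  finally have 1: "norm (staircase \<sigma> A (c, q) - A c) \<le> 9 * m" .
  have "quarters \<sigma> u (c, q) - u c = (real q / 4) *\<^sub>R (u (\<sigma> c) - u c)"
    by (simp add: sub_vertex_def pt_def algebra_simps)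
  then have "norm (quarters \<sigma> u (c, q) - u c) = (real q / 4) * norm (u (\<sigma> c) - u c)" by simp
  also have "\<dots> \<le> 1 * m" by (rule mult_mono) (use assms in auto)
  finally have 2: "norm (quarters \<sigma> u (c, q) - u c) \<le> m" by simp
  have "staircase \<sigma> A (c, q) - quarters \<sigma> u (c, q) =
     (staircase \<sigma> A (c, q) - A c) + (A c - u c) - (quarters \<sigma> u (c, q) - u c)" by simp
  also have "norm \<dots> \<le> (9 * m + m) + m"
    by (intro norm_triangle_le_diff add_mono norm_triangle_le 1 2 assms)
  finally show ?thesis by simp
qed

text \<open>A crossing, seen along the second axis, with equal depths would be a double point of the
  staircase: a point of the row of \<open>d\<close> would coincide with the point of the vertical
  step of \<open>c\<close> at the level of that row.\<close>

lemma staircase_obstacle: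
  assumes s: "simple_poly (quad_index C) (quad_next \<sigma>) (staircase \<sigma> A)" and cd: "c \<in> C" "d \<in> C"
    and x: "0 < (A c $ 1 - A d $ 1) * (A (\<sigma> d) $ 1 - A c $ 1)"
    and z: "0 < (A (\<sigma> d) $ 3 - A c $ 3) * (A (\<sigma> c) $ 3 - A (\<sigma> d) $ 3)"
  shows "A d $ 2 + (A c $ 1 - A d $ 1) / (A (\<sigma> d) $ 1 - A d $ 1) * (A (\<sigma> d) $ 2 - A d $ 2) \<noteq> A c $ 2"
proof
  assume eq: "A d $ 2 + (A c $ 1 - A d $ 1) / (A (\<sigma> d) $ 1 - A d $ 1) * (A (\<sigma> d) $ 2 - A d $ 2) = A c $ 2"
  have fr: "\<exists>k. 0 < k \<and> k < 1 \<and> p - a = k * (b - a)" if "0 < (p - a) * (b - p)" for a b p :: real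
  proof -
    from that have "(0 < p - a \<and> 0 < b - p) \<or> (p - a < 0 \<and> b - p < 0)" by (simp only: zero_less_mult_iff)
    then show ?thesis
    proof
      assume "0 < p - a \<and> 0 < b - p"
      then show ?thesis by (intro exI[of _ "(p - a) / (b - a)"]) (simp add: pos_divide_less_eq)
    next
      assume 2: "p - a < 0 \<and> b - p < 0"
      have "p - a = (a - p) / (a - b) * (b - a)"
      proof -
        have "(a - p) / (a - b) * (a - b) = a - p" using 2 by simp
        then show ?thesis by (metis minus_diff_eq mult_minus_right)
      qed
      then show ?thesis using 2 by (intro exI[of _ "(a - p) / (a - b)"]) (simp add: pos_divide_less_eq)
    qed
  qed
  obtain k where k: "0 < k" "k < 1" "A c $ 1 - A d $ 1 = k * (A (\<sigma> d) $ 1 - A d $ 1)" using fr[OF x] by blast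
  obtain t where t: "0 < t" "t < 1" "A (\<sigma> d) $ 3 - A c $ 3 = t * (A (\<sigma> c) $ 3 - A c $ 3)" using fr[OF z] by blast
  have dx: "A (\<sigma> d) $ 1 - A d $ 1 \<noteq> 0" using x k(3) by auto
  have y: "A c $ 2 = A d $ 2 + k * (A (\<sigma> d) $ 2 - A d $ 2)" using eq k(3) dx by simp
  \<comment> \<open>The third of the row that contains the point at the fraction \<open>k\<close>,
    and the parameter there.\<close>
  have "\<exists>q s. 1 \<le> q \<and> q < 4 \<and> 0 \<le> s \<and> s < 1 \<and> 3 * k = real q - 1 + s"
  proof -
    consider "3 * k < 1" | "1 \<le> 3 * k" "3 * k < 2" | "2 \<le> 3 * k" by linarith
    then show ?thesis
    proof cases
      case 1
      then show ?thesis using k by (intro exI[of _ 1] exI[of _ "3 * k"]) auto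
    next
      case 2
      then show ?thesis using k by (intro exI[of _ 2] exI[of _ "3 * k - 1"]) auto
    next
      case 3
      then show ?thesis using k by (intro exI[of _ 3] exI[of _ "3 * k - 2"]) auto
    qed
  qed
  then obtain q s where q: "1 \<le> q" "q < 4" "0 \<le> s" "s < 1" "3 * k = real q - 1 + s" by blast
  have kk: "k = (real q - 1 + s) / 3" using q(5) by simp
  have "pt (quad_next \<sigma>) (staircase \<sigma> A) (d, q) s = vector [A c $ 1, A c $ 2, A (\<sigma> d) $ 3]"
  proof -
    have "q = 1 \<or> q = 2 \<or> q = 3" using q by auto
    moreover have "A c $ 1 = A d $ 1 + k * (A (\<sigma> d) $ 1 - A d $ 1)" using k(3) by simp
    ultimately show ?thesis
      unfolding vec_eq_iff forall_3 y
      by (elim disjE) (simp_all add: staircase_def pt_quad kk field_simps)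
  qed
  moreover have "pt (quad_next \<sigma>) (staircase \<sigma> A) (c, 0) t = vector [A c $ 1, A c $ 2, A (\<sigma> d) $ 3]"
    unfolding vec_eq_iff forall_3 using t(3) by (simp add: staircase_def pt_quad algebra_simps)
  ultimately have "(d, q) = (c, 0) \<and> s = t"
    using simple_polyD[OF s, of "(d, q)" s "(c, 0)" t] cd q t by (simp add: sub_index_def)
  then show False using q by simp
qed

lemma pt_sub_ex:
  assumes "subdivision I k l" "i \<in> I" "\<sigma> i \<in> I" "r < k i" "s \<in> {0..1}"
  shows "\<exists>s'\<in>{0..1}. pt (sub_next k \<sigma>) (sub_vertex l \<sigma> v) (i, r) s = pt \<sigma> v i s'"
proof -
  have l: "0 \<le> l i r" "l i (Suc r) \<le> 1" "l i r \<le> l i (Suc r)"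
    using subdivision_mono[OF assms(1,2), of 0 r] subdivision_mono[OF assms(1,2), of "Suc r" "k i"]
      subdivision_mono[OF assms(1,2), of r "Suc r"] assms by (auto simp: subdivision_def)
  have "(1 - s) * l i r + s * l i (Suc r) \<le> (1 - s) * 1 + s * 1"
    by (intro add_mono mult_left_mono) (use l assms(5) in auto)
  moreover have "0 \<le> (1 - s) * l i r + s * l i (Suc r)" using l assms(5) by auto
  ultimately have "(1 - s) * l i r + s * l i (Suc r) \<in> {0..1}" by simp
  then show ?thesis
    using pt_sub[where \<sigma> = \<sigma> and i = i and r = r and v = v and s = s, OF assms(1-4)] by blast
qed

lemma pt_minus_pt: "pt \<sigma> v i a - pt \<sigma> v i b = (a - b) *\<^sub>R (v (\<sigma> i) - v i)"
  by (simp add: pt_def algebra_simps)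

text \<open>The horizontal direction \<open>w i\<close> in which the adjacent edges \<open>i\<close> and \<open>\<sigma> i\<close> both increase controls pairs
  of pieces of these edges; pieces of non-adjacent edges are separated by \<open>far\<close>.\<close>

locale fine_subdivision =
  fixes I :: "'i set" and \<sigma> :: "'i \<Rightarrow> 'i" and v :: "'i \<Rightarrow> real^3" and N :: nat and m e W :: real
    and w :: "'i \<Rightarrow> real^3" and A0 :: "'i \<times> nat \<Rightarrow> real^3"
  assumes fin: "finite I" and bij: "bij_betw \<sigma> I I"
    and w3: "w i $ 3 = 0" and wW: "i \<in> I \<Longrightarrow> norm (w i) \<le> W" and W: "W > 0"
    and wu: "i \<in> I \<Longrightarrow> w i \<bullet> (v (\<sigma> i) - v i) = 1" "i \<in> I \<Longrightarrow> w i \<bullet> (v (\<sigma> (\<sigma> i)) - v (\<sigma> i)) = 1"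
    and far: "i \<in> I \<Longrightarrow> j \<in> I \<Longrightarrow> i \<noteq> j \<Longrightarrow> j \<noteq> \<sigma> i \<Longrightarrow> i \<noteq> \<sigma> j \<Longrightarrow> s \<in> {0..1} \<Longrightarrow> t \<in> {0..1} \<Longrightarrow>
       2 * (11 * m) < norm (pt \<sigma> v i s - pt \<sigma> v j t)"
    and N: "N > 0" and m: "m > 0" and short: "i \<in> I \<Longrightarrow> norm (v (\<sigma> i) - v i) \<le> m / 4 * N"
    and e: "e > 0" "e \<le> m / 8" "8 * N * W * e \<le> 1"
    and A0: "c \<in> sub_index (\<lambda>_. N) I \<Longrightarrow> norm (A0 c - sub_vertex (\<lambda>_ j. real j / real N) \<sigma> v c) \<le> 2 * e"
begin

abbreviation "C0 \<equiv> sub_index (\<lambda>_. N) I"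
abbreviation "\<sigma>0 \<equiv> sub_next (\<lambda>_. N) \<sigma>"
abbreviation "u0 \<equiv> sub_vertex (\<lambda>_ j. real j / real N) \<sigma> v"

lemma next_in: "i \<in> I \<Longrightarrow> \<sigma> i \<in> I" using bij by (auto simp: bij_betw_def)

lemma subdivision0: "subdivision I (\<lambda>_. N) (\<lambda>_ j. real j / real N)"
  using N by (auto simp: subdivision_def divide_strict_right_mono)

lemma finite_C0: "finite C0" by (rule finite_sub_index[OF fin])

lemma bij_C0: "bij_betw \<sigma>0 C0 C0" by (rule bij_betw_sub_next[OF bij fin N])

lemma next_in0: "c \<in> C0 \<Longrightarrow> \<sigma>0 c \<in> C0" using bij_C0 by (auto simp: bij_betw_def)

lemma u0_step: "(i, j) \<in> C0 \<Longrightarrow> u0 (\<sigma>0 (i, j)) - u0 (i, j) = (1 / N) *\<^sub>R (v (\<sigma> i) - v i)"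
proof -
  assume "(i, j) \<in> C0"
  then have ij: "i \<in> I" "j < N" by (auto simp: sub_index_def)
  have "u0 (\<sigma>0 (i, j)) = pt \<sigma> v i (real (Suc j) / real N)"
    by (rule sub_vertex_next[where \<sigma> = \<sigma> and i = i and r = j, OF subdivision0 ij(1) next_in[OF ij(1)] ij(2)])
  moreover have "u0 (i, j) = pt \<sigma> v i (real j / real N)" by (simp add: sub_vertex_def)
  moreover have "real (Suc j) / real N - real j / real N = 1 / real N" by (simp flip: diff_divide_distrib)
  ultimately show ?thesis by (simp only: pt_minus_pt)
qed

lemma u0_short: "c \<in> C0 \<Longrightarrow> norm (u0 (\<sigma>0 c) - u0 c) \<le> m / 4"
proof (cases c)
  case (Pair i j)
  assume c: "c \<in> C0"
  then have "i \<in> I" using Pair by (auto simp: sub_index_def)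
  have "norm (u0 (\<sigma>0 c) - u0 c) = norm (v (\<sigma> i) - v i) / N" using u0_step[of i j] c Pair by simp
  also have "\<dots> \<le> m / 4" using short[OF \<open>i \<in> I\<close>] N by (simp add: pos_divide_le_eq)
  finally show ?thesis .
qed

lemma w_u0:
  assumes "i \<in> I" "c \<in> C0" "fst c = i \<or> fst c = \<sigma> i"
  shows "w i \<bullet> (u0 (\<sigma>0 c) - u0 c) = 1 / N"
proof (cases c)
  case (Pair k j)
  have "u0 (\<sigma>0 c) - u0 c = (1 / N) *\<^sub>R (v (\<sigma> k) - v k)" using u0_step[of k j] assms(2) Pair by simp
  moreover have "w i \<bullet> (v (\<sigma> k) - v k) = 1" using assms(3) wu[OF assms(1)] Pair by auto
  ultimately show ?thesis by simp
qed

lemma w_A0: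
  assumes "i \<in> I" "c \<in> C0" "fst c = i \<or> fst c = \<sigma> i"
  shows "w i \<bullet> (A0 (\<sigma>0 c) - A0 c) > 0"
proof -
  have eq: "w i \<bullet> (A0 (\<sigma>0 c) - A0 c) = 1 / N + w i \<bullet> (A0 (\<sigma>0 c) - u0 (\<sigma>0 c)) - w i \<bullet> (A0 c - u0 c)"
    unfolding w_u0[OF assms, symmetric] by (simp add: inner_diff_right)
  have b: "\<bar>w i \<bullet> (A0 d - u0 d)\<bar> \<le> W * (2 * e)" if "d \<in> C0" for d
  proof -
    have "\<bar>w i \<bullet> (A0 d - u0 d)\<bar> \<le> norm (w i) * norm (A0 d - u0 d)" by (rule Cauchy_Schwarz_ineq2)
    also have "\<dots> \<le> W * (2 * e)" by (rule mult_mono) (use wW[OF assms(1)] A0[OF that] W in auto)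
    finally show ?thesis .
  qed
  \<comment> \<open>Moving both ends by at most \<open>2 * e\<close> changes the coordinate along
    \<open>w i\<close> by at most \<open>4 * W * e\<close>, which is at most half of the increment
    \<open>1 / N\<close>.\<close>
  have "4 * W * e < 1 / N" using e(3) N by (simp add: field_simps)
  then show ?thesis using eq b[OF assms(2)] b[OF next_in0[OF assms(2)]] by linarith
qed

text \<open>Monotonicity is tested in horizontal directions only. So the pieces of \<open>A\<close>
  have to keep the horizontal directions of the edges of \<open>A0\<close>, whereas their levels may
  be chosen afresh as long as \<open>A\<close> stays within \<open>m\<close> of the polygon.\<close>

context
  fixes k :: "'i \<times> nat \<Rightarrow> nat" and l :: "'i \<times> nat \<Rightarrow> nat \<Rightarrow> real" and A :: "('i \<times> nat) \<times> nat \<Rightarrow> real^3"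
  assumes sub: "subdivision C0 k l"
    and close: "\<And>c. c \<in> sub_index k C0 \<Longrightarrow> norm (A c - sub_vertex l \<sigma>0 u0 c) \<le> m"
    and horiz: "\<And>b h. b \<in> C0 \<Longrightarrow> h < k b \<Longrightarrow> \<exists>q>0. \<forall>w. w $ 3 = 0 \<longrightarrow>
      w \<bullet> (A (sub_next k \<sigma>0 (b, h)) - A (b, h)) = q * (w \<bullet> (A0 (\<sigma>0 b) - A0 b))"
    and zne: "\<And>c. c \<in> sub_index k C0 \<Longrightarrow> A c $ 3 \<noteq> A (sub_next k \<sigma>0 c) $ 3"
begin

abbreviation "C1 \<equiv> sub_index k C0"
abbreviation "\<sigma>1 \<equiv> sub_next k \<sigma>0"
abbreviation "u1 \<equiv> sub_vertex l \<sigma>0 u0"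

lemma k_pos: "b \<in> C0 \<Longrightarrow> k b > 0" using sub by (auto simp: subdivision_def)

lemma bij_C1: "bij_betw \<sigma>1 C1 C1" by (rule bij_betw_sub_next[OF bij_C0 finite_C0 k_pos])

lemma u1_step: "b \<in> C0 \<Longrightarrow> h < k b \<Longrightarrow> u1 (\<sigma>1 (b, h)) - u1 (b, h) = (l b (Suc h) - l b h) *\<^sub>R (u0 (\<sigma>0 b) - u0 b)"
proof -
  assume b: "b \<in> C0" "h < k b"
  have "u1 (\<sigma>1 (b, h)) = pt \<sigma>0 u0 b (l b (Suc h))"
    by (rule sub_vertex_next[where \<sigma> = \<sigma>0 and i = b and r = h, OF sub b(1) next_in0[OF b(1)] b(2)])
  moreover have "u1 (b, h) = pt \<sigma>0 u0 b (l b h)" by (simp add: sub_vertex_def)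
  ultimately show ?thesis by (simp only: pt_minus_pt)
qed

text \<open>Pieces of one edge or of two adjacent ones both lie on a pair \<open>n\<close>,
  \<open>\<sigma> n\<close>, along which \<open>w n\<close> increases; pieces of all other edges are
  covered by \<open>far\<close>.\<close>

lemma dichotomy:
  assumes "c \<in> C1" "d \<in> C1"
  shows "near_on \<sigma>1 u1 A c d \<or> near_on \<sigma>1 u1 A d c \<or>
      (\<forall>s\<in>{0..1}. \<forall>t\<in>{0..1}. 2 * (11 * m) < norm (pt \<sigma>1 u1 c s - pt \<sigma>1 u1 d t))"
proof -
  obtain i a h where c: "c = ((i, a), h)" "i \<in> I" "a < N" "h < k (i, a)" "(i, a) \<in> C0"
    using assms(1) by (auto simp: sub_index_def)
  obtain j b g where d: "d = ((j, b), g)" "j \<in> I" "b < N" "g < k (j, b)" "(j, b) \<in> C0"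
    using assms(2) by (auto simp: sub_index_def)
  show ?thesis
  proof (cases "i = j \<or> j = \<sigma> i \<or> i = \<sigma> j")
    case True
    have "\<exists>n\<in>I. linked \<sigma> {n, \<sigma> n} i j \<or> linked \<sigma> {n, \<sigma> n} j i"
    proof -
      have "linked \<sigma> {p, \<sigma> p} p p" "linked \<sigma> {p, \<sigma> p} p (\<sigma> p)" for p
        by (auto simp: linked_def intro: r_into_rtranclp)
      then show ?thesis using True c(2) d(2) by metis
    qed
    then obtain n where n: "n \<in> I" "linked \<sigma> {n, \<sigma> n} i j \<or> linked \<sigma> {n, \<sigma> n} j i" by blast
    let ?T = "sub_index (\<lambda>_. N) {n, \<sigma> n}"
    have TC: "?T \<subseteq> C0" using n(1) next_in by (auto simp: sub_index_def)
    have "linked \<sigma>0 ?T (i, a) (j, b) \<or> linked \<sigma>0 ?T (j, b) (i, a)"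
      by (rule linked_sub_either[OF n(2)]) (use N c d in auto)
    then have lk: "linked \<sigma>1 (sub_index k ?T) c d \<or> linked \<sigma>1 (sub_index k ?T) d c"
      unfolding c(1) d(1) by (rule linked_sub_either) (use k_pos TC c d in auto)
    have pos: "0 < w n \<bullet> (u1 (\<sigma>1 p) - u1 p) \<and> 0 < w n \<bullet> (A (\<sigma>1 p) - A p)" if p: "p \<in> sub_index k ?T" for p
    proof -
      obtain b h where bh: "p = (b, h)" "b \<in> ?T" "h < k b" using p by (auto simp: sub_index_def)
      have b: "b \<in> C0" "fst b = n \<or> fst b = \<sigma> n" using bh(2) TC by (auto simp: sub_index_def)
      have "l b h < l b (Suc h)" using sub b(1) bh(3) by (auto simp: subdivision_def)
      then have "0 < w n \<bullet> (u1 (\<sigma>1 p) - u1 p)"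
        unfolding bh(1) u1_step[OF b(1) bh(3)] using w_u0[OF n(1) b] N by simp
      moreover obtain q where "q > 0" "w n \<bullet> (A (\<sigma>1 (b, h)) - A (b, h)) = q * (w n \<bullet> (A0 (\<sigma>0 b) - A0 b))"
        using horiz[OF b(1) bh(3)] w3[of n] by blast
      then have "0 < w n \<bullet> (A (\<sigma>1 p) - A p)" using w_A0[OF n(1) b] bh(1) by simp
      ultimately show ?thesis by blast
    qed
    show ?thesis
      using lk near_on_linked[where \<sigma> = \<sigma>1 and u = u1 and A = A and w = "w n", OF _ w3 pos] by blast
  next
    case False
    have "2 * (11 * m) < norm (pt \<sigma>1 u1 c s - pt \<sigma>1 u1 d t)" if st: "s \<in> {0..1}" "t \<in> {0..1}" for s t
    proof -
      obtain s' where "s' \<in> {0..1}" "pt \<sigma>1 u1 c s = pt \<sigma>0 u0 (i, a) s'"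
        using pt_sub_ex[where \<sigma> = \<sigma>0 and i = "(i, a)" and r = h and v = u0, OF sub c(5) next_in0[OF c(5)] c(4) st(1)] c(1) by auto
      moreover obtain s'' where "s'' \<in> {0..1}" "pt \<sigma>0 u0 (i, a) s' = pt \<sigma> v i s''"
        using pt_sub_ex[where \<sigma> = \<sigma> and i = i and r = a and v = v, OF subdivision0 c(2) next_in[OF c(2)] c(3) \<open>s' \<in> {0..1}\<close>] by auto
      moreover obtain t' where "t' \<in> {0..1}" "pt \<sigma>1 u1 d t = pt \<sigma>0 u0 (j, b) t'"
        using pt_sub_ex[where \<sigma> = \<sigma>0 and i = "(j, b)" and r = g and v = u0, OF sub d(5) next_in0[OF d(5)] d(4) st(2)] d(1) by auto
      moreover obtain t'' where "t'' \<in> {0..1}" "pt \<sigma>0 u0 (j, b) t' = pt \<sigma> v j t''"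
        using pt_sub_ex[where \<sigma> = \<sigma> and i = j and r = b and v = v, OF subdivision0 d(2) next_in[OF d(2)] d(3) \<open>t' \<in> {0..1}\<close>] by auto
      ultimately show ?thesis using far[OF c(2) d(2)] False by simp
    qed
    then show ?thesis by blast
  qed
qed

lemma simple_levelling:
  assumes "0 \<le> \<tau>" "\<tau> \<le> 1"
  shows "simple_poly (quad_index C1) (quad_next \<sigma>1) (\<lambda>i. (1 - \<tau>) *\<^sub>R quarters \<sigma>1 u1 i + \<tau> *\<^sub>R staircase \<sigma>1 A i)"
proof (rule simple_staircase_interpolation[where \<delta> = "11 * m"])
  show "finite C1" by (rule finite_sub_index[OF finite_C0])
  show "bij_betw \<sigma>1 C1 C1" by (rule bij_C1)
  fix i assume "i \<in> quad_index C1"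
  then obtain b h q where i: "i = ((b, h), q)" "b \<in> C0" "h < k b" "q < 4" "(b, h) \<in> C1"
    by (auto simp: sub_index_def)
  have nx: "\<sigma>1 (b, h) \<in> C1" using bij_C1 i(5) by (auto simp: bij_betw_def)
  have l: "l b h \<le> l b (Suc h)" "0 \<le> l b h" "l b (Suc h) \<le> 1"
    using subdivision_mono[OF sub i(2), of 0 h] subdivision_mono[OF sub i(2), of "Suc h" "k b"] sub i
    by (auto simp: subdivision_def less_imp_le)
  have "norm (u1 (\<sigma>1 (b, h)) - u1 (b, h)) = (l b (Suc h) - l b h) * norm (u0 (\<sigma>0 b) - u0 b)"
    unfolding u1_step[OF i(2,3)] using l by simp
  also have "\<dots> \<le> 1 * (m / 4)" by (rule mult_mono) (use l u0_short[OF i(2)] in auto)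
  finally have "norm (u1 (\<sigma>1 (b, h)) - u1 (b, h)) \<le> m" using m by simp
  then show "norm (staircase \<sigma>1 A i - quarters \<sigma>1 u1 i) \<le> 11 * m"
    unfolding i(1) by (intro staircase_close close i nx)
qed (use zne dichotomy assms in auto)

lemma isotopic_levelling: "isotopic_poly (quad_index C1) (quad_next \<sigma>1) (quarters \<sigma>1 u1) (staircase \<sigma>1 A)"
  by (rule isotopic_poly_along_lines) (use simple_levelling in auto)

lemma simple_levelled: "simple_poly (quad_index C1) (quad_next \<sigma>1) (staircase \<sigma>1 A)"
  using simple_levelling[of 1] by simp

end

text \<open>The refinement with one piece per edge shows that the staircase of \<open>A0\<close>
  itself is simple. The depths at its crossings therefore differ, and breakpoints can be chosen
  according to the side on which each obstacle lies.\<close>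

lemma base_obstacle:
  assumes zi: "inj_on (\<lambda>c. A0 c $ 3) C0" and nf: "\<And>i. i \<in> I \<Longrightarrow> \<sigma> i \<noteq> i" and cd: "c \<in> C0" "d \<in> C0"
    and x: "0 < (A0 c $ 1 - A0 d $ 1) * (A0 (\<sigma>0 d) $ 1 - A0 c $ 1)"
    and z: "0 < (A0 (\<sigma>0 d) $ 3 - A0 c $ 3) * (A0 (\<sigma>0 c) $ 3 - A0 (\<sigma>0 d) $ 3)"
  shows "A0 d $ 2 + (A0 c $ 1 - A0 d $ 1) / (A0 (\<sigma>0 d) $ 1 - A0 d $ 1) * (A0 (\<sigma>0 d) $ 2 - A0 d $ 2) \<noteq> A0 c $ 2"
proof -
  let ?k = "\<lambda>_. Suc 0" and ?l = "\<lambda>_ r. real r" and ?A = "\<lambda>c. A0 (fst c)"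
  have nx: "sub_next ?k \<sigma>0 (b, h) = (\<sigma>0 b, 0)" for b h by (simp add: sub_next_def)
  have nf0: "\<sigma>0 b \<noteq> b" if "b \<in> C0" for b
    using that nf N by (auto simp: sub_next_def sub_index_def split: if_splits)
  have "simple_poly (quad_index (sub_index ?k C0)) (quad_next (sub_next ?k \<sigma>0)) (staircase (sub_next ?k \<sigma>0) ?A)"
  proof (rule simple_levelled[of ?k ?l])
    show "subdivision C0 ?k ?l" by (auto simp: subdivision_def)
    show "norm (?A c - sub_vertex ?l \<sigma>0 u0 c) \<le> m" if "c \<in> sub_index ?k C0" for c
      using that A0 e m by (force simp: sub_index_def[of ?k] sub_vertex_def[of ?l])
    show "\<exists>q>0. \<forall>w. w $ 3 = 0 \<longrightarrow> w \<bullet> (?A (sub_next ?k \<sigma>0 (b, h)) - ?A (b, h)) = q * (w \<bullet> (A0 (\<sigma>0 b) - A0 b))" for b h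
      by (rule exI[of _ 1]) (simp add: nx)
    show "?A c $ 3 \<noteq> ?A (sub_next ?k \<sigma>0 c) $ 3" if "c \<in> sub_index ?k C0" for c
    proof (cases c)
      case (Pair b h)
      then have "b \<in> C0" using that by (auto simp: sub_index_def[of ?k])
      then have "A0 b $ 3 \<noteq> A0 (\<sigma>0 b) $ 3" using inj_onD[OF zi _ _ next_in0] nf0 by metis
      then show ?thesis using Pair by (simp add: nx)
    qed
  qed
  from staircase_obstacle[OF this, of "(c, 0)" "(d, 0)"] show ?thesis
    using cd x z by (simp add: nx sub_index_def[of ?k])
qed

end

section \<open>Alternating signs on a refined staircase\<close>

lemma finite_gap:
  fixes f :: "'c \<Rightarrow> real"
  assumes "finite S" "inj_on f S" "e > 0"
  shows "\<exists>\<epsilon>>0. \<epsilon> \<le> e \<and> (\<forall>b\<in>S. \<forall>c\<in>S. b \<noteq> c \<longrightarrow> \<epsilon> \<le> \<bar>f b - f c\<bar>)"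
proof -
  define D where "D = (\<lambda>(b, c). \<bar>f b - f c\<bar>) ` {p \<in> S \<times> S. fst p \<noteq> snd p}"
  have D: "finite D" using assms(1) by (simp add: D_def)
  have pos: "\<And>x. x \<in> insert e D \<Longrightarrow> 0 < x" using assms(2,3) by (auto simp: D_def inj_on_def)
  show ?thesis
  proof (intro exI[of _ "Min (insert e D)"] conjI ballI impI)
    show "Min (insert e D) > 0" using pos D by (subst Min_gr_iff) auto
    show "Min (insert e D) \<le> e" using D by simp
    fix b c assume "b \<in> S" "c \<in> S" "b \<noteq> c"
    then have "\<bar>f b - f c\<bar> \<in> D" by (force simp: D_def)
    then show "Min (insert e D) \<le> \<bar>f b - f c\<bar>" using D by (intro Min_le) auto
  qed
qed

lemma strictly_between_affine:
  fixes a d p q r :: real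
  assumes "0 < ((a + r * d) - (a + p * d)) * ((a + q * d) - (a + r * d))" "p < q"
  shows "p < r \<and> r < q"
proof -
  have "((a + r * d) - (a + p * d)) * ((a + q * d) - (a + r * d)) = (r - p) * (q - r) * (d * d)"
    by (simp add: algebra_simps)
  then have "0 < (r - p) * (q - r) * (d * d)" using assms by simp
  then have "0 < (r - p) * (q - r)"
    using zero_le_square[of d] by (metis mult_nonpos_nonneg not_le)
  then show ?thesis using assms(2) by (auto simp: zero_less_mult_iff)
qed

text \<open>When the row of \<open>d\<close> passes the vertical edge of \<open>c\<close>, this edge lies behind the row, as seen in the
  direction \<open>sg d\<close> of the second coordinate. So each row can be pushed in its direction \<open>sg d\<close> without
  meeting a vertical edge.\<close>

definition levelled :: "'c set \<Rightarrow> ('c \<Rightarrow> 'c) \<Rightarrow> ('c \<Rightarrow> real^3) \<Rightarrow> ('c \<Rightarrow> real) \<Rightarrow> bool" where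
  "levelled C \<sigma> A sg \<longleftrightarrow> finite C \<and> bij_betw \<sigma> C C \<and>
     inj_on (\<lambda>c. A c $ 1) C \<and> inj_on (\<lambda>c. A c $ 3) C \<and>
     (\<forall>c\<in>C. (sg c = 1 \<or> sg c = -1) \<and> sg (\<sigma> c) = - sg c) \<and>
     (\<forall>d\<in>C. \<forall>c\<in>C. 0 < (A c $ 1 - A d $ 1) * (A (\<sigma> d) $ 1 - A c $ 1) \<longrightarrow>
        0 < (A (\<sigma> d) $ 3 - A c $ 3) * (A (\<sigma> c) $ 3 - A (\<sigma> d) $ 3) \<longrightarrow>
        0 < sg d * (A d $ 2 + (A c $ 1 - A d $ 1) / (A (\<sigma> d) $ 1 - A d $ 1) * (A (\<sigma> d) $ 2 - A d $ 2) - A c $ 2))"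

text \<open>Each edge is broken into an even number of pieces of alternating sign, such that every vertical
  edge obstructing it meets a piece of the appropriate sign. The pieces of the edge \<open>b\<close> get distinct
  levels in a narrow band above the level of the end of \<open>b\<close>, so no new obstacles arise.\<close>

lemma (in fine_subdivision) levelled_refinement:
  assumes xi: "inj_on (\<lambda>c. A0 c $ 1) C0" and zi: "inj_on (\<lambda>c. A0 c $ 3) C0"
    and y0: "\<And>c. c \<in> C0 \<Longrightarrow> A0 c $ 2 = u0 c $ 2"
    and x0: "\<And>c. c \<in> C0 \<Longrightarrow> \<bar>A0 c $ 1 - u0 c $ 1\<bar> \<le> e" and z0: "\<And>c. c \<in> C0 \<Longrightarrow> \<bar>A0 c $ 3 - u0 c $ 3\<bar> \<le> e"
    and nf: "\<And>i. i \<in> I \<Longrightarrow> \<sigma> i \<noteq> i"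
  shows "\<exists>k l A sg. subdivision C0 k l \<and> levelled (sub_index k C0) (sub_next k \<sigma>0) A sg \<and>
    isotopic_poly (quad_index (sub_index k C0)) (quad_next (sub_next k \<sigma>0))
      (quarters (sub_next k \<sigma>0) (sub_vertex l \<sigma>0 u0)) (staircase (sub_next k \<sigma>0) A)"
proof -
  define x y z where "x c = A0 c $ 1" and "y c = A0 c $ 2" and "z c = A0 c $ 3" for c
  have xI: "b = c" if "b \<in> C0" "c \<in> C0" "x b = x c" for b c using xi that by (auto simp: x_def inj_on_def)
  have sI: "b = c" if "b \<in> C0" "c \<in> C0" "\<sigma>0 b = \<sigma>0 c" for b c
    using bij_C0 that by (auto simp: bij_betw_def inj_on_def)
  have nf0: "\<sigma>0 b \<noteq> b" if "b \<in> C0" for b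
    using that nf N by (auto simp: sub_next_def sub_index_def split: if_splits)
  have dx: "x (\<sigma>0 b) - x b \<noteq> 0" if "b \<in> C0" for b
    using xI[OF next_in0[OF that] that] nf0[OF that] by auto
  \<comment> \<open>Levels of different vertices are at least \<epsilon> apart, so the half-open
    bands of width \<epsilon> above them are disjoint, which is \<open>band\<close>.\<close>
  obtain \<epsilon> where \<epsilon>: "\<epsilon> > 0" "\<epsilon> \<le> e" "\<And>b c. b \<in> C0 \<Longrightarrow> c \<in> C0 \<Longrightarrow> b \<noteq> c \<Longrightarrow> \<epsilon> \<le> \<bar>z b - z c\<bar>"
    using finite_gap[OF finite_C0 zi e(1)] unfolding z_def by blast
  have band: "b = c" "s = t" if "b \<in> C0" "c \<in> C0" "z b + s = z c + t" "0 \<le> s" "s < \<epsilon>" "0 \<le> t" "t < \<epsilon>" for b c s t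
  proof -
    show "b = c" using \<epsilon>(3)[OF that(1,2)] that(3-7) by fastforce
    then show "s = t" using that(3) by simp
  qed
  \<comment> \<open>The parameter on the edge \<open>b\<close> at which its first coordinate is that
    of the vertical step of \<open>j\<close>.\<close>
  define \<xi> where "\<xi> b j = (x j - x b) / (x (\<sigma>0 b) - x b)" for b j
  define obst where "obst b j \<longleftrightarrow> j \<in> C0 \<and> 0 < (x j - x b) * (x (\<sigma>0 b) - x j) \<and>
      0 < (z (\<sigma>0 b) - z j) * (z (\<sigma>0 j) - z (\<sigma>0 b))" for b j
  define Y where "Y b j = y b + \<xi> b j * (y (\<sigma>0 b) - y b) - y j" for b j
  have Y0: "Y b j \<noteq> 0" if "b \<in> C0" "obst b j" for b j
    using base_obstacle[OF zi nf, of j b] that unfolding Y_def \<xi>_def obst_def x_def y_def z_def by simp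
  have x\<xi>: "x j = x b + \<xi> b j * (x (\<sigma>0 b) - x b)" if "b \<in> C0" for b j
    using dx[OF that] by (simp add: \<xi>_def)
  have \<xi>01: "0 < \<xi> b j \<and> \<xi> b j < 1" if "b \<in> C0" "0 < (x j - x b) * (x (\<sigma>0 b) - x j)" for b j
    using strictly_between_affine[of "x b" "\<xi> b j" "x (\<sigma>0 b) - x b" 0 1] that x\<xi>[OF that(1), of j] by simp
  \<comment> \<open>Sides are attached to parameters, as \<open>alternating_breakpoints\<close>
    requires. Different obstacles of \<open>b\<close> have different parameters because first
    coordinates are distinct.\<close>
  define P where "P b s \<longleftrightarrow> (\<exists>j. obst b j \<and> \<xi> b j = s \<and> 0 < Y b j)" for b s
  have P: "P b (\<xi> b j) \<longleftrightarrow> 0 < Y b j" if "b \<in> C0" "obst b j" for b j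
  proof -
    have "j' = j" if "obst b j'" "\<xi> b j' = \<xi> b j" for j'
      using x\<xi>[OF \<open>b \<in> C0\<close>, of j] x\<xi>[OF \<open>b \<in> C0\<close>, of j'] that \<open>obst b j\<close> xI[of j' j] by (simp add: obst_def)
    then show ?thesis using that unfolding P_def by blast
  qed
  define Q where "Q b p \<longleftrightarrow> fst p > 0 \<and> snd p 0 = 0 \<and> snd p (2 * fst p) = 1 \<and>
     (\<forall>r<2 * fst p. snd p r < snd p (Suc r)) \<and>
     (\<forall>s\<in>\<xi> b ` {j. obst b j}. \<exists>r<2 * fst p. snd p r < s \<and> s < snd p (Suc r) \<and> (even r \<longleftrightarrow> P b s))"
     for b and p :: "nat \<times> (nat \<Rightarrow> real)"
  \<comment> \<open>First coordinates of the new vertices on \<open>b\<close>; the simultaneous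
    choice below makes them avoid the old vertices and the new vertices on other edges.\<close>
  define vals where "vals b p = (\<lambda>r. x b + snd p r * (x (\<sigma>0 b) - x b)) ` {r. 0 < r \<and> r < 2 * fst p}"
    for b and p :: "nat \<times> (nat \<Rightarrow> real)"
  have fin_obst: "finite {j. obst b j}" for b by (rule finite_subset[OF _ finite_C0]) (auto simp: obst_def)
  have choice: "\<exists>p. Q b p \<and> finite (vals b p) \<and> vals b p \<inter> Z = {}" if b: "b \<in> C0" and Z: "finite Z" for b Z
  proof -
    have in01: "\<forall>s\<in>\<xi> b ` {j. obst b j}. 0 < s \<and> s < 1"
      using \<xi>01[OF b] by (auto simp: obst_def)
    obtain n l where nl: "n > 0" "l 0 = 0" "l (2 * n) = 1" "\<forall>r<2 * n. l r < l (Suc r)"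
      "\<forall>r. 0 < r \<and> r < 2 * n \<longrightarrow> l r \<notin> (\<lambda>t. (t - x b) / (x (\<sigma>0 b) - x b)) ` Z"
      "\<forall>s\<in>\<xi> b ` {j. obst b j}. \<exists>r<2 * n. l r < s \<and> s < l (Suc r) \<and> (even r \<longleftrightarrow> P b s)"
      using alternating_breakpoints[OF finite_imageI[OF fin_obst[of b], of "\<xi> b"]
          finite_imageI[OF Z, of "\<lambda>t. (t - x b) / (x (\<sigma>0 b) - x b)"] zero_less_one in01, of "P b"]
      by (elim exE conjE)
    have "x b + l r * (x (\<sigma>0 b) - x b) \<notin> Z" if "0 < r" "r < 2 * n" for r
    proof
      assume "x b + l r * (x (\<sigma>0 b) - x b) \<in> Z"
      then have "(x b + l r * (x (\<sigma>0 b) - x b) - x b) / (x (\<sigma>0 b) - x b) \<in> (\<lambda>t. (t - x b) / (x (\<sigma>0 b) - x b)) ` Z"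
        by (rule imageI)
      moreover have "(x b + l r * (x (\<sigma>0 b) - x b) - x b) / (x (\<sigma>0 b) - x b) = l r" using dx[OF b] by simp
      ultimately show False using nl(5) that by auto
    qed
    then show ?thesis using nl by (intro exI[of _ "(n, l)"]) (auto simp: Q_def vals_def)
  qed
  have "\<exists>f. (\<forall>b\<in>C0. Q b (f b) \<and> finite (vals b (f b)) \<and> vals b (f b) \<inter> x ` C0 = {}) \<and>
      (\<forall>b\<in>C0. \<forall>c\<in>C0. b \<noteq> c \<longrightarrow> vals b (f b) \<inter> vals c (f c) = {})"
    by (rule finite_choice_disjoint[OF finite_C0 finite_imageI[OF finite_C0]]) (rule choice)
  then
  obtain f where f0: "\<forall>b\<in>C0. Q b (f b) \<and> finite (vals b (f b)) \<and> vals b (f b) \<inter> x ` C0 = {}"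
    "\<forall>b\<in>C0. \<forall>c\<in>C0. b \<noteq> c \<longrightarrow> vals b (f b) \<inter> vals c (f c) = {}" by (elim exE conjE)
  have f: "Q b (f b) \<and> vals b (f b) \<inter> x ` C0 = {}"
    "c \<in> C0 \<Longrightarrow> b \<noteq> c \<Longrightarrow> vals b (f b) \<inter> vals c (f c) = {}" if "b \<in> C0" for b c
    using f0 that by blast+
  define k where "k b = 2 * fst (f b)" for b
  define l where "l b = snd (f b)" for b
  have kl: "k b > 0" "even (k b)" "l b 0 = 0" "l b (k b) = 1" "\<And>r. r < k b \<Longrightarrow> l b r < l b (Suc r)" if "b \<in> C0" for b
    using f(1)[OF that] by (auto simp: Q_def k_def l_def)
  have part: "\<exists>r<k b. l b r < \<xi> b j \<and> \<xi> b j < l b (Suc r) \<and> (even r \<longleftrightarrow> 0 < Y b j)" if "b \<in> C0" "obst b j" for b j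
  proof -
    have "\<forall>s\<in>\<xi> b ` {j. obst b j}. \<exists>r<k b. l b r < s \<and> s < l b (Suc r) \<and> (even r \<longleftrightarrow> P b s)"
      using f(1)[OF that(1)] by (simp add: Q_def k_def l_def)
    moreover have "\<xi> b j \<in> \<xi> b ` {j. obst b j}" using that(2) by simp
    ultimately show ?thesis using P[OF that] by blast
  qed
  have sub: "subdivision C0 k l" using kl by (auto simp: subdivision_def)
  let ?C = "sub_index k C0" and ?s = "sub_next k \<sigma>0"
  \<comment> \<open>Within the band the levels descend to that of the end of \<open>b\<close>,
    reached at \<open>h = k b\<close>. The value 0 at \<open>h = 0\<close> makes the old vertex
    \<open>b\<close> fit the same pattern, with the band of \<open>b\<close> itself.\<close>
  define th where "th b h = (if h = 0 then 0 else \<epsilon> * real (k b - h) / real (k b))" for b h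
  define zz where "zz b h = (if h = 0 then z b else z (\<sigma>0 b) + th b h)" for b h
  define A where "A = (\<lambda>(b, h). vector [x b + l b h * (x (\<sigma>0 b) - x b), y b + l b h * (y (\<sigma>0 b) - y b), zz b h] :: real^3)"
  \<comment> \<open>The number of pieces is even, so the parity also alternates from the last piece
    of an edge to the first piece of the next.\<close>
  define sg :: "('i \<times> nat) \<times> nat \<Rightarrow> real" where "sg = (\<lambda>(b, h). if even h then 1 else -1)"
  have th: "0 \<le> th b h" "th b h < \<epsilon>" "0 < h \<Longrightarrow> h < k b \<Longrightarrow> 0 < th b h" if "b \<in> C0" for b h
  proof -
    have "real (k b - h) / real (k b) < 1" if "h \<noteq> 0" using that kl(1)[OF \<open>b \<in> C0\<close>] by auto
    then have "\<epsilon> * (real (k b - h) / real (k b)) < \<epsilon> * 1" if "h \<noteq> 0" using that \<epsilon>(1) by (intro mult_strict_left_mono) auto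
    then show "th b h < \<epsilon>" using \<epsilon>(1) by (simp add: th_def)
  qed (use \<epsilon>(1) kl(1)[OF that] in \<open>auto simp: th_def\<close>)
  have Anext: "A (?s (b, h)) $ 1 = x b + l b (Suc h) * (x (\<sigma>0 b) - x b)"
    "A (?s (b, h)) $ 2 = y b + l b (Suc h) * (y (\<sigma>0 b) - y b)"
    "A (?s (b, h)) $ 3 = z (\<sigma>0 b) + th b (Suc h)" if "b \<in> C0" "h < k b" for b h
  proof -
    have "Suc h = k b" if "\<not> Suc h < k b" using that \<open>h < k b\<close> by simp
    moreover have "l b (k b) = 1" "l (\<sigma>0 b) 0 = 0" "th b (k b) = 0"
      using kl[OF that(1)] kl[OF next_in0[OF that(1)]] by (auto simp: th_def)
    ultimately show "A (?s (b, h)) $ 1 = x b + l b (Suc h) * (x (\<sigma>0 b) - x b)"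
      "A (?s (b, h)) $ 2 = y b + l b (Suc h) * (y (\<sigma>0 b) - y b)"
      "A (?s (b, h)) $ 3 = z (\<sigma>0 b) + th b (Suc h)"
      by (cases "Suc h < k b"; simp add: sub_next_def A_def zz_def)+
  qed
  have A: "A (b, h) $ 1 = x b + l b h * (x (\<sigma>0 b) - x b)" "A (b, h) $ 2 = y b + l b h * (y (\<sigma>0 b) - y b)"
    "A (b, h) $ 3 = zz b h" for b h by (simp_all add: A_def)
  have Cin: "\<exists>b h. c = (b, h) \<and> b \<in> C0 \<and> h < k b" if "c \<in> ?C" for c using that by (auto simp: sub_index_def)
  have z_ne: "zz b h \<noteq> z (\<sigma>0 b) + th b (Suc h)" if "b \<in> C0" "h < k b" for b h
  proof (cases "h = 0")
    case True
    then show ?thesis using band(1)[OF that(1) next_in0[OF that(1)], of 0 "th b (Suc h)"] \<epsilon>(1) th[OF that(1), of "Suc h"] nf0[OF that(1)]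
      by (auto simp: zz_def)
  next
    case False
    define X where "X = real (k b - Suc h)"
    have "real (k b - h) = X + 1" using that(2) by (simp add: X_def of_nat_diff)
    then have "th b h = \<epsilon> * (X + 1) / real (k b)" using False by (simp only: th_def if_False)
    moreover have "th b (Suc h) = \<epsilon> * X / real (k b)" by (simp add: th_def X_def)
    ultimately have "th b h - th b (Suc h) = \<epsilon> / real (k b)" by (simp add: add_divide_distrib distrib_left)
    then show ?thesis using False \<epsilon>(1) kl(1)[OF that(1)] by (auto simp: zz_def)
  qed
  have iso: "isotopic_poly (quad_index ?C) (quad_next ?s) (quarters ?s (sub_vertex l \<sigma>0 u0)) (staircase ?s A)"
  proof (rule isotopic_levelling[OF sub])
    show "\<exists>q>0. \<forall>w. w $ 3 = 0 \<longrightarrow> w \<bullet> (A (?s (b, h)) - A (b, h)) = q * (w \<bullet> (A0 (\<sigma>0 b) - A0 b))"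
      if "b \<in> C0" "h < k b" for b h
      using kl(5)[OF that]
      by (intro exI[of _ "l b (Suc h) - l b h"])
        (auto simp: inner_horizontal Anext[OF that] A x_def y_def algebra_simps)
    show "A c $ 3 \<noteq> A (?s c) $ 3" if "c \<in> ?C" for c
      using Cin[OF that] z_ne Anext(3) A(3) by auto
    show "norm (A c - sub_vertex l \<sigma>0 u0 c) \<le> m" if c: "c \<in> ?C" for c
    proof -
      obtain b h where bh: "c = (b, h)" "b \<in> C0" "h < k b" using Cin[OF c] by blast
      let ?d = "A c - sub_vertex l \<sigma>0 u0 c"
      have u: "sub_vertex l \<sigma>0 u0 (b, h) $ j = u0 b $ j + l b h * (u0 (\<sigma>0 b) $ j - u0 b $ j)" for j
      proof -
        have "sub_vertex l \<sigma>0 u0 (b, h) = pt \<sigma>0 u0 b (l b h)" by (simp add: sub_vertex_def)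
        then show ?thesis by (simp only: pt_nth) (simp add: algebra_simps)
      qed
      have l01: "0 \<le> l b h" "l b h \<le> 1"
        using subdivision_mono[OF sub bh(2), of 0 h] subdivision_mono[OF sub bh(2), of h "k b"] kl[OF bh(2)] bh(3) by auto
      have nb: "\<sigma>0 b \<in> C0" by (rule next_in0[OF bh(2)])
      have "?d $ 1 = (1 - l b h) * (A0 b $ 1 - u0 b $ 1) + l b h * (A0 (\<sigma>0 b) $ 1 - u0 (\<sigma>0 b) $ 1)"
        unfolding vector_minus_component bh(1) u A x_def by (simp add: algebra_simps)
      also have "\<bar>\<dots>\<bar> \<le> (1 - l b h) * e + l b h * e"
      proof (rule order_trans[OF abs_triangle_ineq], rule add_mono)
        show "\<bar>(1 - l b h) * (A0 b $ 1 - u0 b $ 1)\<bar> \<le> (1 - l b h) * e"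
          using l01 x0[OF bh(2)] by (simp add: abs_mult mult_left_mono)
        show "\<bar>l b h * (A0 (\<sigma>0 b) $ 1 - u0 (\<sigma>0 b) $ 1)\<bar> \<le> l b h * e"
          using l01 x0[OF nb] by (simp add: abs_mult mult_left_mono)
      qed
      finally have d1: "\<bar>?d $ 1\<bar> \<le> e" by (simp add: algebra_simps)
      have d2: "?d $ 2 = 0"
        unfolding vector_minus_component bh(1) u A y_def using y0[OF bh(2)] y0[OF nb] by simp
      \<comment> \<open>A new vertex has the level of the end of \<open>b\<close> up to the band,
        wherever on \<open>b\<close> it sits; this costs at most the length of the edge,
        \<open>m / 4\<close>.\<close>
      have d3: "\<bar>?d $ 3\<bar> \<le> 2 * e + m / 4"
      proof (cases "h = 0")
        case True
        then have "?d $ 3 = A0 b $ 3 - u0 b $ 3"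
          unfolding vector_minus_component bh(1) u A zz_def z_def using kl[OF bh(2)] by simp
        then show ?thesis using z0[OF bh(2)] e m by simp
      next
        case False
        then have "?d $ 3 = (A0 (\<sigma>0 b) $ 3 - u0 (\<sigma>0 b) $ 3) + th b h + (1 - l b h) * (u0 (\<sigma>0 b) - u0 b) $ 3"
          unfolding vector_minus_component bh(1) u A zz_def z_def by (simp add: algebra_simps)
        also have "\<bar>\<dots>\<bar> \<le> e + e + m / 4"
        proof (rule order_trans[OF abs_triangle_ineq], rule add_mono, rule order_trans[OF abs_triangle_ineq], rule add_mono)
          show "\<bar>A0 (\<sigma>0 b) $ 3 - u0 (\<sigma>0 b) $ 3\<bar> \<le> e" by (rule z0[OF nb])
          show "\<bar>th b h\<bar> \<le> e" using th[OF bh(2), of h] \<epsilon>(2) by simp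
          have "\<bar>(u0 (\<sigma>0 b) - u0 b) $ 3\<bar> \<le> m / 4"
            using component_le_norm_cart[of "u0 (\<sigma>0 b) - u0 b" 3] u0_short[OF bh(2)] by linarith
          then have "(1 - l b h) * \<bar>(u0 (\<sigma>0 b) - u0 b) $ 3\<bar> \<le> 1 * (m / 4)"
            by (intro mult_mono) (use l01 in auto)
          then show "\<bar>(1 - l b h) * (u0 (\<sigma>0 b) - u0 b) $ 3\<bar> \<le> m / 4" using l01 by (simp add: abs_mult)
        qed
        finally show ?thesis by simp
      qed
      have "norm ?d \<le> (\<Sum>j\<in>UNIV. \<bar>?d $ j\<bar>)" by (rule norm_le_l1_cart)
      also have "\<dots> = \<bar>?d $ 1\<bar> + \<bar>?d $ 2\<bar> + \<bar>?d $ 3\<bar>" by (rule sum_3)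
      also have "\<dots> \<le> m" using d1 d2 d3 e(2) m by simp
      finally show ?thesis .
    qed
  qed
  have lev: "levelled ?C ?s A sg"
    unfolding levelled_def
  proof (intro conjI ballI impI)
    show "finite ?C" by (rule finite_sub_index[OF finite_C0])
    show "bij_betw ?s ?C ?C" by (rule bij_betw_sub_next[OF bij_C0 finite_C0]) (rule kl)
    have vals: "A (b, h) $ 1 \<in> vals b (f b)" if "0 < h" "h < k b" for b h
      using that by (auto simp: A vals_def k_def l_def)
    have zero: "A (b, 0) $ 1 = x b" if "b \<in> C0" for b using kl[OF that] by (simp add: A)
    show "inj_on (\<lambda>c. A c $ 1) ?C"
    proof (rule inj_onI)
      fix c d assume cd: "c \<in> ?C" "d \<in> ?C" "A c $ 1 = A d $ 1"
      obtain b h where c: "c = (b, h)" "b \<in> C0" "h < k b" using Cin[OF cd(1)] by blast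
      obtain b' h' where d: "d = (b', h')" "b' \<in> C0" "h' < k b'" using Cin[OF cd(2)] by blast
      show "c = d"
      proof (cases "h = 0 \<or> h' = 0")
        case True
        have "h = 0 \<and> h' = 0"
        proof (rule ccontr)
          assume "\<not> (h = 0 \<and> h' = 0)"
          then consider "h = 0" "0 < h'" | "0 < h" "h' = 0" using True by blast
          then show False
          proof cases
            case 1
            then have "x b \<in> vals b' (f b')" using vals[of h' b'] d cd(3) zero[OF c(2)] c(1) by simp
            then show False using f(1)[OF d(2)] c(2) by blast
          next
            case 2
            then have "x b' \<in> vals b (f b)" using vals[of h b] c cd(3) zero[OF d(2)] d(1) by simp
            then show False using f(1)[OF c(2)] d(2) by blast
          qed
        qed
        then show ?thesis using c d cd(3) zero[OF c(2)] zero[OF d(2)] xI[OF c(2) d(2)] by simp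
      next
        case False
        then have "A c $ 1 \<in> vals b (f b) \<inter> vals b' (f b')" using vals[of h b] vals[of h' b'] c d cd(3) by simp
        then have bb: "b = b'" using f(2)[OF c(2) d(2)] by blast
        then have "l b h = l b h'" using cd(3) c(1) d(1) dx[OF c(2)] by (simp add: A)
        then have "h = h'"
          using subdivision_strict_mono[OF sub c(2), of h h'] subdivision_strict_mono[OF sub c(2), of h' h] c d bb
          by (metis less_imp_le less_irrefl linorder_neqE_nat)
        then show ?thesis using c d bb by simp
      qed
    qed
    show "inj_on (\<lambda>c. A c $ 3) ?C"
    proof (rule inj_onI)
      fix c d assume cd: "c \<in> ?C" "d \<in> ?C" "A c $ 3 = A d $ 3"
      obtain b h where c: "c = (b, h)" "b \<in> C0" "h < k b" using Cin[OF cd(1)] by blast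
      obtain b' h' where d: "d = (b', h')" "b' \<in> C0" "h' < k b'" using Cin[OF cd(2)] by blast
      \<comment> \<open>The old vertex whose band contains the level of the vertex
        \<open>(b, h)\<close>.\<close>
      define p where "p b h = (if h = 0 then b else \<sigma>0 b)" for b and h :: nat
      have zp: "zz b h = z (p b h) + th b h" "p b h \<in> C0" if "b \<in> C0" for b h
        using next_in0[OF that] that by (auto simp: zz_def p_def th_def)
      have eq: "z (p b h) + th b h = z (p b' h') + th b' h'"
        using cd(3) c d zp by (simp add: A)
      note bd = band[OF zp(2)[OF c(2)] zp(2)[OF d(2)] eq th(1,2)[OF c(2)] th(1,2)[OF d(2)]]
      have h0: "h = 0 \<longleftrightarrow> h' = 0"
        using bd(2) th(3)[OF c(2) _ c(3)] th(3)[OF d(2) _ d(3)] by (cases "h = 0"; cases "h' = 0") (auto simp: th_def)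
      then have bb: "b = b'" using bd(1) sI[OF c(2) d(2)] by (auto simp: p_def split: if_splits)
      have "h = h'"
      proof (cases "h = 0")
        case False
        then have "\<epsilon> * real (k b - h) / real (k b) = \<epsilon> * real (k b - h') / real (k b)" using bd(2) h0 bb by (simp add: th_def)
        then have "real (k b - h) = real (k b - h')" using \<epsilon>(1) kl(1)[OF c(2)] by simp
        then show ?thesis using c(3) d(3) bb by simp
      qed (use h0 in simp)
      then show "c = d" using c d bb by simp
    qed
    fix d assume dC: "d \<in> ?C"
    obtain b h where d: "d = (b, h)" "b \<in> C0" "h < k b" using Cin[OF dC] by blast
    show "sg d = 1 \<or> sg d = - 1" by (auto simp: sg_def split: prod.split)
    show "sg (?s d) = - sg d"
    proof (cases "Suc h < k b")
      case False
      then have "Suc h = k b" using d(3) by simp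
      then have "odd h" using kl(2)[OF d(2)] by (metis even_Suc)
      then show ?thesis using False by (simp add: sg_def sub_next_def d(1))
    qed (simp add: sg_def sub_next_def d(1))
    fix c assume cC: "c \<in> ?C"
      and ox: "0 < (A c $ 1 - A d $ 1) * (A (?s d) $ 1 - A c $ 1)"
      and oz: "0 < (A (?s d) $ 3 - A c $ 3) * (A (?s c) $ 3 - A (?s d) $ 3)"
    obtain b' g where c: "c = (b', g)" "b' \<in> C0" "g < k b'" using Cin[OF cC] by blast
    have nb: "\<sigma>0 b \<in> C0" "\<sigma>0 b' \<in> C0" using next_in0 c(2) d(2) by auto
    define lev_z where "lev_z = z (\<sigma>0 b) + th b (Suc h)"
    note thd = th(1,2)[OF d(2), of "Suc h"] and thc = th(1,2)[OF c(2), of g] th(1,2)[OF c(2), of "Suc g"]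
    have oz': "0 < (lev_z - zz b' g) * (z (\<sigma>0 b') + th b' (Suc g) - lev_z)"
      using oz by (simp add: c d Anext A lev_z_def)
    have ox': "0 < (A c $ 1 - (x b + l b h * (x (\<sigma>0 b) - x b))) * (x b + l b (Suc h) * (x (\<sigma>0 b) - x b) - A c $ 1)"
      using ox by (simp add: d Anext A)
    have lh: "l b h < l b (Suc h)" by (rule kl(5)[OF d(2,3)])
    have on_row: "l b h < r \<and> r < l b (Suc h)" if "A c $ 1 = x b + r * (x (\<sigma>0 b) - x b)" for r
      using strictly_between_affine[OF ox'[unfolded that] lh] .
    have l01: "0 \<le> l b h" "l b (Suc h) \<le> 1"
      using subdivision_mono[OF sub d(2), of 0 h] subdivision_mono[OF sub d(2), of "Suc h" "k b"] kl[OF d(2)] d(3) by auto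
    \<comment> \<open>Only the first step of an edge leaves a band. A later one could obstruct only
      rows of its own edge, but its first coordinate is a breakpoint there and never interior to a
      row.\<close>
    have g0: "g = 0"
    proof (rule ccontr)
      assume "g \<noteq> 0"
      then have "0 < (lev_z - (z (\<sigma>0 b') + th b' g)) * (z (\<sigma>0 b') + th b' (Suc g) - lev_z)" using oz' by (simp add: zz_def)
      then have "0 < lev_z - z (\<sigma>0 b')" "lev_z - z (\<sigma>0 b') < \<epsilon>" using thc by (auto simp: zero_less_mult_iff)
      then have "\<sigma>0 b = \<sigma>0 b'"
        using band(1)[OF nb, of "th b (Suc h)" "lev_z - z (\<sigma>0 b')"] thd by (simp add: lev_z_def)
      then have bb: "b = b'" by (rule sI[OF d(2) c(2)])
      then have "l b h < l b g \<and> l b g < l b (Suc h)" by (intro on_row) (simp add: c A)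
      moreover have "l b g \<le> l b h \<or> l b (Suc h) \<le> l b g"
        using subdivision_mono[OF sub d(2), of g h] subdivision_mono[OF sub d(2), of "Suc h" g] c(3) d(3) bb
        by (cases "g \<le> h") auto
      ultimately show False by linarith
    qed
    have Ac: "A c $ 1 = x b'" "A c $ 2 = y b'" using g0 kl(3)[OF c(2)] by (simp_all add: c A)
    have ne1: "\<sigma>0 b \<noteq> b'"
    proof
      assume "\<sigma>0 b = b'"
      then have "A c $ 1 = x b + 1 * (x (\<sigma>0 b) - x b)" using Ac by simp
      from on_row[OF this] show False using l01 by simp
    qed
    have ne2: "\<sigma>0 b \<noteq> \<sigma>0 b'"
    proof
      assume "\<sigma>0 b = \<sigma>0 b'"
      then have "b = b'" by (rule sI[OF d(2) c(2)])
      then have "A c $ 1 = x b + 0 * (x (\<sigma>0 b) - x b)" using Ac by simp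
      from on_row[OF this] show False using l01 by simp
    qed
    have \<xi>r: "l b h < \<xi> b b' \<and> \<xi> b b' < l b (Suc h)"
      by (rule on_row) (use Ac x\<xi>[OF d(2), of b'] in simp)
    \<comment> \<open>The levels involved were raised by less than \<epsilon> and the old ones
      differ by at least \<epsilon>, so the obstacle was present before the refinement.\<close>
    have "obst b b'"
      unfolding obst_def
    proof (intro conjI)
      show "b' \<in> C0" by (rule c)
      have "(x b' - x b) * (x (\<sigma>0 b) - x b') = \<xi> b b' * (1 - \<xi> b b') * ((x (\<sigma>0 b) - x b) * (x (\<sigma>0 b) - x b))"
        using x\<xi>[OF d(2), of b'] by algebra
      also have "\<dots> > 0"
      proof (rule mult_pos_pos[OF mult_pos_pos])
        show "0 < (x (\<sigma>0 b) - x b) * (x (\<sigma>0 b) - x b)" using dx[OF d(2)] not_real_square_gt_zero by blast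
      qed (use \<xi>r l01 in auto)
      finally show "0 < (x b' - x b) * (x (\<sigma>0 b) - x b')" .
      have "\<epsilon> \<le> \<bar>z (\<sigma>0 b) - z b'\<bar>" "\<epsilon> \<le> \<bar>z (\<sigma>0 b) - z (\<sigma>0 b')\<bar>"
        using \<epsilon>(3)[OF nb(1) c(2) ne1] \<epsilon>(3)[OF nb ne2] by auto
      moreover have "(0 < lev_z - z b' \<and> 0 < z (\<sigma>0 b') + th b' 1 - lev_z) \<or> (lev_z - z b' < 0 \<and> z (\<sigma>0 b') + th b' 1 - lev_z < 0)"
        using oz' g0 by (simp add: zz_def zero_less_mult_iff)
      moreover have "0 \<le> th b' 1" "th b' 1 < \<epsilon>" using thc g0 by auto
      ultimately show "0 < (z (\<sigma>0 b) - z b') * (z (\<sigma>0 b') - z (\<sigma>0 b))"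
        unfolding zero_less_mult_iff lev_z_def using thd by linarith
    qed
    from part[OF d(2) this] obtain r where r: "r < k b" "l b r < \<xi> b b'" "\<xi> b b' < l b (Suc r)" "even r \<longleftrightarrow> 0 < Y b b'" by blast
    \<comment> \<open>The breakpoints put the obstacle strictly inside one piece of the right
      parity, and by \<open>\<xi>r\<close> it is strictly inside the piece \<open>h\<close>.\<close>
    have "r = h"
    proof (rule ccontr)
      assume "r \<noteq> h"
      then have "l b (Suc r) \<le> l b h \<or> l b (Suc h) \<le> l b r"
        using subdivision_mono[OF sub d(2), of "Suc r" h] subdivision_mono[OF sub d(2), of "Suc h" r] r(1) d(3)
        by (cases "r < h") auto
      then show False using \<xi>r r by linarith
    qed
    then have sgY: "0 < sg d * Y b b'"
      using r(4) Y0[OF d(2) \<open>obst b b'\<close>] by (auto simp: sg_def d(1))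
    define q where "q = l b (Suc h) - l b h"
    have q: "q > 0" using lh by (simp add: q_def)
    have "A c $ 1 - A d $ 1 = (\<xi> b b' - l b h) * (x (\<sigma>0 b) - x b)"
      using Ac x\<xi>[OF d(2), of b'] by (simp add: d A algebra_simps)
    moreover have "A (?s d) $ 1 - A d $ 1 = q * (x (\<sigma>0 b) - x b)" "A (?s d) $ 2 - A d $ 2 = q * (y (\<sigma>0 b) - y b)"
      using d by (simp_all add: Anext A q_def algebra_simps)
    ultimately have "A d $ 2 + (A c $ 1 - A d $ 1) / (A (?s d) $ 1 - A d $ 1) * (A (?s d) $ 2 - A d $ 2) - A c $ 2
       = A d $ 2 + (\<xi> b b' - l b h) * (y (\<sigma>0 b) - y b) - y b'"
      using q dx[OF d(2)] Ac by simp
    also have "\<dots> = Y b b'" by (simp add: d A Y_def algebra_simps)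
    finally show "0 < sg d * (A d $ 2 + (A c $ 1 - A d $ 1) / (A (?s d) $ 1 - A d $ 1) * (A (?s d) $ 2 - A d $ 2) - A c $ 2)"
      using sgY by simp
  qed
  show ?thesis using sub lev iso by blast
qed

section \<open>From a polygonal link to a comb\<close>

lemma vector_3_lincomb:
  "a *\<^sub>R (vector [x, y, z] :: real^3) + b *\<^sub>R vector [x', y', z'] = vector [a * x + b * x', a * y + b * y', a * z + b * z']"
  by (simp add: vec_eq_iff forall_3)

lemma simple_poly_uniformly_far:
  fixes v :: "'i \<Rightarrow> real^3"
  assumes v: "simple_poly I \<sigma> v"
  shows "\<exists>\<rho>>0. \<forall>i\<in>I. \<forall>j\<in>I. i \<noteq> j \<longrightarrow> j \<noteq> \<sigma> i \<longrightarrow> i \<noteq> \<sigma> j \<longrightarrow>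
    (\<forall>s\<in>{0..1}. \<forall>t\<in>{0..1}. \<rho> \<le> norm (pt \<sigma> v i s - pt \<sigma> v j t))"
proof -
  define S where "S = {p \<in> I \<times> I. fst p \<noteq> snd p \<and> snd p \<noteq> \<sigma> (fst p) \<and> fst p \<noteq> \<sigma> (snd p)}"
  have fin: "finite S" using v by (auto simp: S_def simple_poly_def)
  have "\<forall>p\<in>S. \<exists>c>0. \<forall>s\<in>{0..1}. \<forall>t\<in>{0..1}. c \<le> norm (pt \<sigma> v (fst p) s - pt \<sigma> v (snd p) t)"
    using simple_poly_far_apart[OF v] by (auto simp: S_def)
  then obtain c where c: "\<forall>p\<in>S. c p > 0 \<and> (\<forall>s\<in>{0..1}. \<forall>t\<in>{0..1}. c p \<le> norm (pt \<sigma> v (fst p) s - pt \<sigma> v (snd p) t))"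
    by metis
  define \<rho> where "\<rho> = Min (insert 1 (c ` S))"
  have "\<rho> > 0" using c fin by (simp add: \<rho>_def)
  moreover have "\<rho> \<le> norm (pt \<sigma> v i s - pt \<sigma> v j t)"
    if "i \<in> I" "j \<in> I" "i \<noteq> j" "j \<noteq> \<sigma> i" "i \<noteq> \<sigma> j" "s \<in> {0..1}" "t \<in> {0..1}" for i j s t
  proof -
    have p: "(i, j) \<in> S" using that by (simp add: S_def)
    then have "\<rho> \<le> c (i, j)" using fin by (simp add: \<rho>_def)
    also have "\<dots> \<le> norm (pt \<sigma> v i s - pt \<sigma> v j t)" using c p that by force
    finally show ?thesis .
  qed
  ultimately show ?thesis by blast
qed

theorem levelled_presentation:
  fixes v :: "'i \<Rightarrow> real^3"
  assumes v: "simple_poly I \<sigma> v"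
  shows "\<exists>N k l A sg. N > 0 \<and> subdivision (sub_index (\<lambda>_. N) I) k l \<and>
    levelled (sub_index k (sub_index (\<lambda>_. N) I)) (sub_next k (sub_next (\<lambda>_. N) \<sigma>)) A sg \<and>
    isotopic_poly (quad_index (sub_index k (sub_index (\<lambda>_. N) I))) (quad_next (sub_next k (sub_next (\<lambda>_. N) \<sigma>)))
      (quarters (sub_next k (sub_next (\<lambda>_. N) \<sigma>))
        (sub_vertex l (sub_next (\<lambda>_. N) \<sigma>) (sub_vertex (\<lambda>_ j. real j / real N) \<sigma> v)))
      (staircase (sub_next k (sub_next (\<lambda>_. N) \<sigma>)) A)"
proof -
  obtain v' where v': "simple_poly I \<sigma> v'" "isotopic_poly I \<sigma> v v'"
    and gen: "\<forall>i\<in>I. (v' (\<sigma> i) $ 1 - v' i $ 1) * (v' (\<sigma> (\<sigma> i)) $ 2 - v' (\<sigma> i) $ 2) \<noteq>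
           (v' (\<sigma> i) $ 2 - v' i $ 2) * (v' (\<sigma> (\<sigma> i)) $ 1 - v' (\<sigma> i) $ 1)"
    using generic_perturbation[OF v] by blast
  have fin: "finite I" and bij: "bij_betw \<sigma> I I" using v by (auto simp: simple_poly_def)
  define a1 a2 b1 b2 where "a1 i = v' (\<sigma> i) $ 1 - v' i $ 1" and "a2 i = v' (\<sigma> i) $ 2 - v' i $ 2"
    and "b1 i = v' (\<sigma> (\<sigma> i)) $ 1 - v' (\<sigma> i) $ 1" and "b2 i = v' (\<sigma> (\<sigma> i)) $ 2 - v' (\<sigma> i) $ 2" for i
  define det where "det i = a1 i * b2 i - a2 i * b1 i" for i
  have det: "det i \<noteq> 0" if "i \<in> I" for i using gen that by (auto simp: det_def a1_def a2_def b1_def b2_def)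
  \<comment> \<open>Cramer's rule for the two conditions that \<open>w i\<close> has scalar product
    1 with the edge \<open>i\<close> and with the edge \<open>\<sigma> i\<close>.\<close>
  define w :: "'i \<Rightarrow> real^3" where "w i = vector [(b2 i - a2 i) / det i, (a1 i - b1 i) / det i, 0]" for i
  have w3: "w i $ 3 = 0" for i by (simp add: w_def)
  have wu: "w i \<bullet> (v' (\<sigma> i) - v' i) = 1" "w i \<bullet> (v' (\<sigma> (\<sigma> i)) - v' (\<sigma> i)) = 1" if "i \<in> I" for i
  proof -
    have "w i \<bullet> (v' (\<sigma> i) - v' i) = ((b2 i - a2 i) * a1 i + (a1 i - b1 i) * a2 i) / det i"
      unfolding inner_horizontal[OF w3] by (simp add: w_def a1_def a2_def add_divide_distrib)
    also have "(b2 i - a2 i) * a1 i + (a1 i - b1 i) * a2 i = det i" by (simp add: det_def algebra_simps)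
    finally show "w i \<bullet> (v' (\<sigma> i) - v' i) = 1" using det[OF that] by simp
    have "w i \<bullet> (v' (\<sigma> (\<sigma> i)) - v' (\<sigma> i)) = ((b2 i - a2 i) * b1 i + (a1 i - b1 i) * b2 i) / det i"
      unfolding inner_horizontal[OF w3] by (simp add: w_def b1_def b2_def add_divide_distrib)
    also have "(b2 i - a2 i) * b1 i + (a1 i - b1 i) * b2 i = det i" by (simp add: det_def algebra_simps)
    finally show "w i \<bullet> (v' (\<sigma> (\<sigma> i)) - v' (\<sigma> i)) = 1" using det[OF that] by simp
  qed
  obtain \<rho> where \<rho>: "\<rho> > 0" "\<forall>i\<in>I. \<forall>j\<in>I. i \<noteq> j \<longrightarrow> j \<noteq> \<sigma> i \<longrightarrow> i \<noteq> \<sigma> j \<longrightarrow>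
    (\<forall>s\<in>{0..1}. \<forall>t\<in>{0..1}. \<rho> \<le> norm (pt \<sigma> v' i s - pt \<sigma> v' j t))"
    using simple_poly_uniformly_far[OF v'(1)] by blast
  \<comment> \<open>Chosen so that \<open>22 * m < \<rho>\<close>: each of two staircase pieces may
    deviate from the polygon by \<open>11 * m\<close>.\<close>
  define m where "m = \<rho> / 40"
  have m: "m > 0" "2 * (11 * m) < \<rho>" using \<rho>(1) by (auto simp: m_def)
  define W where "W = (\<Sum>i\<in>I. norm (w i)) + 1"
  have W: "W > 0" "\<And>i. i \<in> I \<Longrightarrow> norm (w i) \<le> W"
    unfolding W_def using member_le_sum[OF _ _ fin, of _ "\<lambda>i. norm (w i)"]
    by (auto intro!: add_nonneg_pos sum_nonneg add_increasing2)
  define L where "L = (\<Sum>i\<in>I. norm (v' (\<sigma> i) - v' i))"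
  have L: "norm (v' (\<sigma> i) - v' i) \<le> L" if "i \<in> I" for i
    unfolding L_def using member_le_sum[OF that _ fin, of "\<lambda>i. norm (v' (\<sigma> i) - v' i)"] by simp
  obtain N0 :: nat where N0: "4 * L / m < real N0" using reals_Archimedean2 by blast
  define N where "N = Suc N0"
  have N: "N > 0" "L \<le> m / 4 * N"
  proof -
    have "4 * L < m * real N0" using N0 m(1) by (simp add: pos_divide_less_eq mult.commute)
    also have "\<dots> \<le> m * real N" using m(1) by (simp add: N_def)
    finally show "L \<le> m / 4 * N" by simp
  qed (simp add: N_def)
  \<comment> \<open>The first bound helps to keep the refinement within \<open>m\<close> of the
    polygon, the second keeps the perturbed edges increasing along \<open>w\<close>.\<close>
  define e where "e = min (m / 8) (1 / (8 * N * W))"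
  have e: "e > 0" "e \<le> m / 8" "8 * N * W * e \<le> 1"
  proof -
    have "8 * real N * W > 0" using N(1) W(1) by simp
    moreover have "e \<le> 1 / (8 * N * W)" by (simp add: e_def)
    ultimately show "8 * N * W * e \<le> 1" by (simp add: pos_le_divide_eq mult.commute)
  qed (use m N(1) W(1) in \<open>auto simp: e_def\<close>)
  let ?C0 = "sub_index (\<lambda>_. N) I" and ?s0 = "sub_next (\<lambda>_. N) \<sigma>"
  let ?u = "sub_vertex (\<lambda>_ j. real j / real N) \<sigma>"
  have fC0: "finite ?C0" by (rule finite_sub_index[OF fin])
  obtain gx where gx: "inj_on gx ?C0" "\<forall>c\<in>?C0. \<bar>gx c - ?u v' c $ 1\<bar> < e"
    using perturb_to_injective[OF fC0 e(1), of "\<lambda>c. ?u v' c $ 1"] by blast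
  obtain gz where gz: "inj_on gz ?C0" "\<forall>c\<in>?C0. \<bar>gz c - ?u v' c $ 3\<bar> < e"
    using perturb_to_injective[OF fC0 e(1), of "\<lambda>c. ?u v' c $ 3"] by blast
  \<comment> \<open>The depth stays as it is; only the two coordinates visible along the second axis
    have to be made distinct.\<close>
  define A0 :: "'i \<times> nat \<Rightarrow> real^3" where "A0 c = vector [gx c, ?u v' c $ 2, gz c]" for c
  interpret fine_subdivision I \<sigma> v' N m e W w A0
  proof
    show "norm (A0 c - ?u v' c) \<le> 2 * e" if "c \<in> ?C0" for c
    proof -
      have "norm (A0 c - ?u v' c) \<le> (\<Sum>j\<in>UNIV. \<bar>(A0 c - ?u v' c) $ j\<bar>)" by (rule norm_le_l1_cart)
      also have "\<dots> = \<bar>gx c - ?u v' c $ 1\<bar> + \<bar>gz c - ?u v' c $ 3\<bar>" by (simp add: sum_3 A0_def)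
      also have "\<dots> \<le> 2 * e" using gx(2) gz(2) that by fastforce
      finally show ?thesis .
    qed
    show "norm (v' (\<sigma> i) - v' i) \<le> m / 4 * real N" if "i \<in> I" for i using L[OF that] N(2) by linarith
    show "2 * (11 * m) < norm (pt \<sigma> v' i s - pt \<sigma> v' j t)"
      if "i \<in> I" "j \<in> I" "i \<noteq> j" "j \<noteq> \<sigma> i" "i \<noteq> \<sigma> j" "s \<in> {0..1}" "t \<in> {0..1}" for i j s t
      using \<rho>(2) that m(2) by force
  qed (use fin bij w3 W wu N m e in auto)
  have "\<exists>k l A sg. subdivision ?C0 k l \<and> levelled (sub_index k ?C0) (sub_next k ?s0) A sg \<and>
    isotopic_poly (quad_index (sub_index k ?C0)) (quad_next (sub_next k ?s0))
      (quarters (sub_next k ?s0) (sub_vertex l ?s0 (?u v'))) (staircase (sub_next k ?s0) A)"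
  proof (rule levelled_refinement)
    show "inj_on (\<lambda>c. A0 c $ 1) ?C0" "inj_on (\<lambda>c. A0 c $ 3) ?C0" using gx(1) gz(1) by (simp_all add: A0_def)
    show "\<sigma> i \<noteq> i" if "i \<in> I" for i by (rule simple_poly_next_ne[OF v that])
  qed (use gx(2) gz(2) in \<open>auto simp: A0_def less_imp_le\<close>)
  then obtain k l A sg where kl: "subdivision ?C0 k l" "levelled (sub_index k ?C0) (sub_next k ?s0) A sg"
    and iso: "isotopic_poly (quad_index (sub_index k ?C0)) (quad_next (sub_next k ?s0))
      (quarters (sub_next k ?s0) (sub_vertex l ?s0 (?u v'))) (staircase (sub_next k ?s0) A)" by blast
  \<comment> \<open>The perturbation from \<open>v\<close> to \<open>v'\<close> is carried through
    all three subdivisions, so that the isotopy starts at the given polygon.\<close>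
  have "isotopic_poly ?C0 ?s0 (?u v) (?u v')"
    by (rule isotopic_poly_sub[OF v'(2) subdivision0 next_in])
  then have "isotopic_poly (sub_index k ?C0) (sub_next k ?s0) (sub_vertex l ?s0 (?u v)) (sub_vertex l ?s0 (?u v'))"
    by (rule isotopic_poly_sub[OF _ kl(1) next_in0])
  then have "isotopic_poly (quad_index (sub_index k ?C0)) (quad_next (sub_next k ?s0))
      (quarters (sub_next k ?s0) (sub_vertex l ?s0 (?u v))) (quarters (sub_next k ?s0) (sub_vertex l ?s0 (?u v')))"
  proof (rule isotopic_poly_sub)
    show "subdivision (sub_index k ?C0) (\<lambda>_. 4) (\<lambda>_ q. real q / 4)"
      by (auto simp: subdivision_def divide_strict_right_mono)
    have "bij_betw (sub_next k ?s0) (sub_index k ?C0) (sub_index k ?C0)" using kl(2) by (simp add: levelled_def)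
    then show "sub_next k ?s0 c \<in> sub_index k ?C0" if "c \<in> sub_index k ?C0" for c
      using that by (auto simp: bij_betw_def)
  qed
  from isotopic_poly_trans[OF this iso] N(1) kl show ?thesis by blast
qed

section \<open>Combs with prescribed orders of rows and columns\<close>

lemma convex_comb_strict_order:
  fixes f g :: "'c \<Rightarrow> real"
  assumes "inj_on f C" "\<And>c d. c \<in> C \<Longrightarrow> d \<in> C \<Longrightarrow> f c < f d \<Longrightarrow> g c < g d" "0 \<le> \<tau>" "\<tau> \<le> 1"
  shows "inj_on (\<lambda>c. (1 - \<tau>) * f c + \<tau> * g c) C"
proof (rule inj_onI, rule ccontr)
  fix c d assume cd: "c \<in> C" "d \<in> C" "(1 - \<tau>) * f c + \<tau> * g c = (1 - \<tau>) * f d + \<tau> * g d" "c \<noteq> d"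
  have lt: "(1 - \<tau>) * f c + \<tau> * g c < (1 - \<tau>) * f d + \<tau> * g d" if "f c < f d" "g c < g d" for c d
  proof (cases "\<tau> = 1")
    case False
    then have "(1 - \<tau>) * f c < (1 - \<tau>) * f d" using that assms(4) by simp
    moreover have "\<tau> * g c \<le> \<tau> * g d" using that assms(3) by (simp add: mult_left_mono)
    ultimately show ?thesis by linarith
  qed (use that in simp)
  have "f c \<noteq> f d" using assms(1) cd by (auto simp: inj_on_def)
  then consider "f c < f d" | "f d < f c" by linarith
  then show False
    using lt[of c d] lt[of d c] assms(2)[OF cd(1,2)] assms(2)[OF cd(2,1)] cd(3) by cases force+
qed

text \<open>Spine \<open>c\<close> runs at height \<open>0\<close> from the row of the predecessor of \<open>c\<close> to the row of \<open>c\<close>, and the row of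
  \<open>c\<close> at height \<open>1\<close> from there to spine \<open>\<sigma> c\<close>: this is the link of a grid diagram with arbitrary real
  coordinates.\<close>

definition comb :: "('c \<Rightarrow> 'c) \<Rightarrow> 'c set \<Rightarrow> ('c \<Rightarrow> real) \<Rightarrow> ('c \<Rightarrow> real) \<Rightarrow> 'c \<times> nat \<Rightarrow> real^3" where
  "comb \<sigma> C x Y = quad (\<lambda>c. vector [x c, Y (inv_into C \<sigma> c), 0]) (\<lambda>c. vector [x c, Y c, 0])
     (\<lambda>c. vector [x c, Y c, 1]) (\<lambda>c. vector [x (\<sigma> c), Y c, 1])"

lemma isotopic_poly_cong:
  assumes "isotopic_poly I \<sigma> v w" "\<And>i. i \<in> I \<Longrightarrow> v i = v' i" "\<And>i. i \<in> I \<Longrightarrow> w i = w' i" "\<And>i. i \<in> I \<Longrightarrow> \<sigma> i \<in> I"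
  shows "isotopic_poly I \<sigma> v' w'"
proof -
  have "pt \<sigma> v i s = pt \<sigma> v' i s" "pt \<sigma> w i s = pt \<sigma> w' i s" if "i \<in> I" for i s
    using assms(2-4) that by (simp_all add: pt_def)
  then show ?thesis using assms(1) unfolding isotopic_poly_def by metis
qed

text \<open>A comb is simple as soon as its rows and its columns have distinct coordinates, and
  interpolation between coordinates in the same order keeps them distinct. So real coordinates can
  later be replaced by ranks.\<close>

lemma isotopic_comb_rescale:
  fixes x x' Y Y' :: "'c \<Rightarrow> real"
  assumes C: "finite C" "bij_betw \<sigma> C C" and nf: "\<And>c. c \<in> C \<Longrightarrow> \<sigma> c \<noteq> c"
    and x: "inj_on x C" "\<And>c d. c \<in> C \<Longrightarrow> d \<in> C \<Longrightarrow> x c < x d \<Longrightarrow> x' c < x' d"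
    and Y: "inj_on Y C" "\<And>c d. c \<in> C \<Longrightarrow> d \<in> C \<Longrightarrow> Y c < Y d \<Longrightarrow> Y' c < Y' d"
  shows "isotopic_poly (quad_index C) (quad_next \<sigma>) (comb \<sigma> C x Y) (comb \<sigma> C x' Y')"
proof (rule isotopic_poly_along_lines)
  fix \<tau> :: real assume \<tau>: "\<tau> \<in> {0..1}"
  let ?x = "\<lambda>c. (1 - \<tau>) * x c + \<tau> * x' c" and ?Y = "\<lambda>c. (1 - \<tau>) * Y c + \<tau> * Y' c"
  have "simple_poly (quad_index C) (quad_next \<sigma>) (comb \<sigma> C ?x ?Y)"
    unfolding comb_def
  proof (rule simple_comb[OF C _ nf])
    show "inj_on ?x C" by (rule convex_comb_strict_order[OF x]) (use \<tau> in auto)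
    show "inj_on ?Y C" by (rule convex_comb_strict_order[OF Y]) (use \<tau> in auto)
    show "(1 - \<tau>) * Y (inv_into C \<sigma> (\<sigma> c)) + \<tau> * Y' (inv_into C \<sigma> (\<sigma> c)) = ?Y c" if "c \<in> C" for c
      using C(2) that by (simp add: bij_betw_def inv_into_f_f)
  qed
  moreover have "(\<lambda>i. (1 - \<tau>) *\<^sub>R comb \<sigma> C x Y i + \<tau> *\<^sub>R comb \<sigma> C x' Y' i) = comb \<sigma> C ?x ?Y"
    unfolding comb_def quad_lincomb vector_3_lincomb by simp
  ultimately show "simple_poly (quad_index C) (quad_next \<sigma>) (\<lambda>i. (1 - \<tau>) *\<^sub>R comb \<sigma> C x Y i + \<tau> *\<^sub>R comb \<sigma> C x' Y' i)"
    by simp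
qed

lemma levelled_isotopic_comb:
  fixes A :: "'c \<Rightarrow> real^3"
  assumes lev: "levelled C \<sigma> A sg"
  shows "\<exists>x Y. inj_on x C \<and> inj_on Y C \<and> (\<forall>c\<in>C. Y c > 0 \<longleftrightarrow> sg c = 1) \<and>
    isotopic_poly (quad_index C) (quad_next \<sigma>) (staircase \<sigma> A) (comb \<sigma> C x Y)"
proof -
  define x y z where "x c = A c $ 1" and "y c = A c $ 2" and "z c = A c $ 3" for c
  have C: "finite C" "bij_betw \<sigma> C C" and xi: "inj_on x C" and zi: "inj_on z C"
    and sg: "\<And>c. c \<in> C \<Longrightarrow> sg c = 1 \<or> sg c = -1" "\<And>c. c \<in> C \<Longrightarrow> sg (\<sigma> c) = - sg c"
    and good: "\<And>d c. d \<in> C \<Longrightarrow> c \<in> C \<Longrightarrow> 0 < (x c - x d) * (x (\<sigma> d) - x c) \<Longrightarrow>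
      0 < (z (\<sigma> d) - z c) * (z (\<sigma> c) - z (\<sigma> d)) \<Longrightarrow>
      0 < sg d * (y d + (x c - x d) / (x (\<sigma> d) - x d) * (y (\<sigma> d) - y d) - y c)"
    using lev unfolding levelled_def x_def y_def z_def by blast+
  have nx: "\<sigma> c \<in> C" if "c \<in> C" for c using C(2) that by (auto simp: bij_betw_def)
  have nf: "\<sigma> c \<noteq> c" if "c \<in> C" for c using sg[OF that] by auto
  define B where "B = (\<Sum>c\<in>C. \<bar>y c\<bar>) + 1"
  have B: "\<bar>y c\<bar> < B" if "c \<in> C" for c
    using member_le_sum[OF that _ C(1), of "\<lambda>c. \<bar>y c\<bar>"] by (simp add: B_def)
  define K where "K = (\<Sum>c\<in>C. \<bar>z c\<bar>) + 1"
  have K: "z c < K" if "c \<in> C" for c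
    using member_le_sum[OF that _ C(1), of "\<lambda>c. \<bar>z c\<bar>"] by (simp add: K_def)
  define pushed where "pushed = quad (\<lambda>c. vector [x c, y c, z c] :: real^3) (\<lambda>c. vector [x c, y c, z (\<sigma> c)])
     (\<lambda>c. vector [x c, sg c * B, z (\<sigma> c)]) (\<lambda>c. vector [x (\<sigma> c), sg c * B, z (\<sigma> c)])"
  \<comment> \<open>Signed distance of the row from the axis at level \<open>K\<close>. As
    \<open>K\<close> exceeds all levels, the sign is that of \<open>sg c\<close>.\<close>
  define Y where "Y c = sg c * (K - z (\<sigma> c))" for c
  have qn: "quad_next \<sigma> i \<in> quad_index C" if "i \<in> quad_index C" for i
    using that nx by (auto simp: sub_index_def sub_next_def)
  have "isotopic_poly (quad_index C) (quad_next \<sigma>) (staircase \<sigma> A) pushed"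
  proof (rule isotopic_poly_along_lines)
    fix \<tau> :: real assume \<tau>: "\<tau> \<in> {0..1}"
    have eta: "A c = vector [x c, y c, z c]" for c by (simp add: vec_eq_iff forall_3 x_def y_def z_def)
    have "(\<lambda>i. (1 - \<tau>) *\<^sub>R staircase \<sigma> A i + \<tau> *\<^sub>R pushed i) =
      quad (\<lambda>c. vector [x c, y c, z c] :: real^3) (\<lambda>c. vector [x c, y c, z (\<sigma> c)])
      (\<lambda>c. vector [x c + (1 - \<tau>) * ((x (\<sigma> c) - x c) / 3),
                   y c + (1 - \<tau>) * ((y (\<sigma> c) - y c) / 3) + \<tau> * (sg c * B - y c), z (\<sigma> c)])
      (\<lambda>c. vector [x (\<sigma> c) - (1 - \<tau>) * ((x (\<sigma> c) - x c) / 3),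
                   y (\<sigma> c) - (1 - \<tau>) * ((y (\<sigma> c) - y c) / 3) + \<tau> * (sg c * B - y (\<sigma> c)), z (\<sigma> c)])"
    proof -
      have "staircase \<sigma> A = quad (\<lambda>c. vector [x c, y c, z c]) (\<lambda>c. vector [x c, y c, z (\<sigma> c)])
         (\<lambda>c. vector [x c + (x (\<sigma> c) - x c) / 3, y c + (y (\<sigma> c) - y c) / 3, z (\<sigma> c)])
         (\<lambda>c. vector [x (\<sigma> c) - (x (\<sigma> c) - x c) / 3, y (\<sigma> c) - (y (\<sigma> c) - y c) / 3, z (\<sigma> c)])"
        unfolding staircase_def by (simp only: eta[symmetric] x_def[symmetric] y_def[symmetric] z_def[symmetric])
      then show ?thesis
        unfolding pushed_def by (simp only: quad_lincomb vector_3_lincomb) (simp add: algebra_simps)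
    qed
    then show "simple_poly (quad_index C) (quad_next \<sigma>) (\<lambda>i. (1 - \<tau>) *\<^sub>R staircase \<sigma> A i + \<tau> *\<^sub>R pushed i)"
    proof (rule ssubst)
      show "simple_poly (quad_index C) (quad_next \<sigma>)
        (quad (\<lambda>c. vector [x c, y c, z c] :: real^3) (\<lambda>c. vector [x c, y c, z (\<sigma> c)])
        (\<lambda>c. vector [x c + (1 - \<tau>) * ((x (\<sigma> c) - x c) / 3),
                     y c + (1 - \<tau>) * ((y (\<sigma> c) - y c) / 3) + \<tau> * (sg c * B - y c), z (\<sigma> c)])
        (\<lambda>c. vector [x (\<sigma> c) - (1 - \<tau>) * ((x (\<sigma> c) - x c) / 3),
                     y (\<sigma> c) - (1 - \<tau>) * ((y (\<sigma> c) - y c) / 3) + \<tau> * (sg c * B - y (\<sigma> c)), z (\<sigma> c)]))"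
        by (rule simple_push_rows[where \<sigma> = \<sigma>]) (use C xi zi nf sg(1) B good \<tau> in auto)
    qed
  qed
  also have "isotopic_poly (quad_index C) (quad_next \<sigma>) pushed (comb \<sigma> C x Y)"
  proof (rule isotopic_poly_cong[OF _ refl _ qn])
    define opened where "opened = quad (\<lambda>c. vector [x c, - sg c * (K - z c), 0] :: real^3) (\<lambda>c. vector [x c, Y c, 0])
       (\<lambda>c. vector [x c, Y c, 1]) (\<lambda>c. vector [x (\<sigma> c), Y c, 1])"
    show "isotopic_poly (quad_index C) (quad_next \<sigma>) pushed opened"
    proof (rule isotopic_poly_along_lines)
      fix \<tau> :: real assume \<tau>: "\<tau> \<in> {0..1}"
      have "(\<lambda>i. (1 - \<tau>) *\<^sub>R pushed i + \<tau> *\<^sub>R opened i) =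
        quad (\<lambda>c. vector [x c, (1 - \<tau>) * y c - \<tau> * sg c * (K - z c), (1 - \<tau>) * z c] :: real^3)
          (\<lambda>c. vector [x c, (1 - \<tau>) * y c + \<tau> * sg c * (K - z (\<sigma> c)), (1 - \<tau>) * z (\<sigma> c)])
          (\<lambda>c. vector [x c, sg c * ((1 - \<tau>) * B + \<tau> * (K - z (\<sigma> c))), (1 - \<tau>) * z (\<sigma> c) + \<tau>])
          (\<lambda>c. vector [x (\<sigma> c), sg c * ((1 - \<tau>) * B + \<tau> * (K - z (\<sigma> c))), (1 - \<tau>) * z (\<sigma> c) + \<tau>])"
        unfolding pushed_def opened_def Y_def
        by (simp only: quad_lincomb vector_3_lincomb) (simp add: algebra_simps)
      then show "simple_poly (quad_index C) (quad_next \<sigma>) (\<lambda>i. (1 - \<tau>) *\<^sub>R pushed i + \<tau> *\<^sub>R opened i)"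
      proof (rule ssubst)
        show "simple_poly (quad_index C) (quad_next \<sigma>)
          (quad (\<lambda>c. vector [x c, (1 - \<tau>) * y c - \<tau> * sg c * (K - z c), (1 - \<tau>) * z c] :: real^3)
            (\<lambda>c. vector [x c, (1 - \<tau>) * y c + \<tau> * sg c * (K - z (\<sigma> c)), (1 - \<tau>) * z (\<sigma> c)])
            (\<lambda>c. vector [x c, sg c * ((1 - \<tau>) * B + \<tau> * (K - z (\<sigma> c))), (1 - \<tau>) * z (\<sigma> c) + \<tau>])
            (\<lambda>c. vector [x (\<sigma> c), sg c * ((1 - \<tau>) * B + \<tau> * (K - z (\<sigma> c))), (1 - \<tau>) * z (\<sigma> c) + \<tau>]))"
          by (rule simple_open_comb[where \<sigma> = \<sigma>]) (use C xi zi nf sg B K \<tau> in auto)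
      qed
    qed
    fix i assume "i \<in> quad_index C"
    then obtain c q where i: "i = (c, q)" "c \<in> C" by (auto simp: sub_index_def)
    obtain d where d: "d \<in> C" "c = \<sigma> d" using C(2) i(2) by (auto simp: bij_betw_def)
    have "inv_into C \<sigma> c = d" using C(2) d by (simp add: bij_betw_def inv_into_f_f)
    \<comment> \<open>Because signs alternate, spine \<open>c\<close> starts at the row of its
      predecessor, on the other side of the axis from its end.\<close>
    moreover have "Y d = - sg c * (K - z c)" using sg(2)[OF d(1)] d(2) by (simp add: Y_def)
    ultimately show "opened i = comb \<sigma> C x Y i" by (simp add: i(1) opened_def comb_def quad_def)
  qed
  finally have iso: "isotopic_poly (quad_index C) (quad_next \<sigma>) (staircase \<sigma> A) (comb \<sigma> C x Y)" .
  have Ypos: "Y c > 0 \<longleftrightarrow> sg c = 1" if "c \<in> C" for c using sg(1)[OF that] K[OF nx[OF that]] by (auto simp: Y_def)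
  have "inj_on Y C"
  proof (rule inj_onI)
    fix c d assume cd: "c \<in> C" "d \<in> C" "Y c = Y d"
    then have "sg c = sg d" using Ypos[OF cd(1)] Ypos[OF cd(2)] sg(1)[OF cd(1)] sg(1)[OF cd(2)] by auto
    then have "z (\<sigma> c) = z (\<sigma> d)" using cd(3) sg(1)[OF cd(2)] by (auto simp: Y_def)
    then have "\<sigma> c = \<sigma> d" using inj_onD[OF zi] nx cd by blast
    then show "c = d" using C(2) cd by (auto simp: bij_betw_def inj_on_def)
  qed
  then show ?thesis using iso Ypos xi by blast
qed

section \<open>Configurations presenting a link\<close>

lemma traverses_end: "traverses \<sigma> v \<gamma> (is @ [i]) a b \<Longrightarrow> \<gamma> b = v (\<sigma> i)"
  by (auto simp: traverses_append)

lemma traverses_cycle_closed: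
  assumes "traverses \<sigma> v \<gamma> is a b" "cycle_list \<sigma> is"
  shows "\<gamma> b = \<gamma> a"
proof -
  obtain i js where i: "is = i # js" using assms(2) by (cases "is") (auto simp: cycle_list_def)
  obtain j ks where j: "is = ks @ [j]" using assms(2) by (cases "is" rule: rev_cases) (auto simp: cycle_list_def)
  have "last (map \<sigma> is) = last (rotate1 is)" using assms(2) by (simp add: cycle_list_def)
  moreover have "last (map \<sigma> is) = \<sigma> j" by (simp add: j)
  moreover have "last (rotate1 is) = i" by (simp add: i)
  ultimately have "\<sigma> j = i" by simp
  then show ?thesis using traverses_start[of \<sigma> v \<gamma> i js a b] traverses_end[of \<sigma> v \<gamma> ks j a b] assms(1) i j by metis
qed

lemma traverses_polyline_cycle:
  assumes "cycle_list \<sigma> is"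
  shows "traverses \<sigma> v (polyline (map v is @ [v (hd is)])) is 0 1"
proof -
  obtain i js where i: "is = i # js" using assms by (cases "is") (auto simp: cycle_list_def)
  show ?thesis unfolding i list.sel(1)
    by (rule traverses_polyline) (use assms in \<open>simp add: cycle_list_def i\<close>)
qed

text \<open>Distinct points of the half-open edges are passed at distinct times. This is how
  injectivity of a simple closed path becomes injectivity of the configuration.\<close>

lemma traverses_parameter:
  assumes "traverses \<sigma> v \<gamma> is a b" "distinct is"
  shows "\<exists>\<tau>. inj_on \<tau> (set is \<times> {0..<1}) \<and>
    (\<forall>p\<in>set is \<times> {0..<1}. \<tau> p \<in> {a..<b} \<and> \<gamma> (\<tau> p) = pt \<sigma> v (fst p) (snd p))"
  using assms
proof (induction "is" arbitrary: a)
  case (Cons i "is")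
  from Cons.prems(1) obtain m where m: "m > a" "\<forall>t\<in>{a..m}. \<gamma> t = pt \<sigma> v i ((t - a) / (m - a))"
    "traverses \<sigma> v \<gamma> is m b" by auto
  have mb: "m \<le> b" by (rule traverses_le[OF m(3)])
  obtain \<tau> where \<tau>: "inj_on \<tau> (set is \<times> {0..<1})"
    "\<forall>p\<in>set is \<times> {0..<1}. \<tau> p \<in> {m..<b} \<and> \<gamma> (\<tau> p) = pt \<sigma> v (fst p) (snd p)"
    using Cons.IH[OF m(3)] Cons.prems(2) by auto
  define f where "f p = (if fst p = i then a + snd p * (m - a) else \<tau> p)" for p
  have fi: "f (i, s) \<in> {a..<m} \<and> \<gamma> (f (i, s)) = pt \<sigma> v i s" if s: "s \<in> {0..<1}" for s
  proof -
    have "s * (m - a) < 1 * (m - a)" using s m(1) by (intro mult_strict_right_mono) auto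
    moreover have "0 \<le> s * (m - a)" using s m(1) by simp
    ultimately have "f (i, s) \<in> {a..<m}" unfolding f_def fst_conv snd_conv atLeastLessThan_iff by simp
    moreover from this have "\<gamma> (f (i, s)) = pt \<sigma> v i ((f (i, s) - a) / (m - a))" using m(2) by simp
    moreover have "(f (i, s) - a) / (m - a) = s" using m(1) by (simp add: f_def)
    ultimately show ?thesis by simp
  qed
  have ft: "f (j, s) \<in> {m..<b} \<and> \<gamma> (f (j, s)) = pt \<sigma> v j s \<and> f (j, s) = \<tau> (j, s)"
    if "j \<in> set is" "s \<in> {0..<1}" for j s
    using \<tau>(2) that Cons.prems(2) by (auto simp: f_def)
  have "inj_on f (set (i # is) \<times> {0..<1})"
  proof (rule inj_onI)
    fix p q assume pq: "p \<in> set (i # is) \<times> {0..<1}" "q \<in> set (i # is) \<times> {0..<1}" "f p = f q"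
    obtain j s k t where e: "p = (j, s)" "q = (k, t)" by (cases p, cases q)
    have st: "s \<in> {0..<1}" "t \<in> {0..<1}" using pq e by auto
    consider "j = i" "k = i" | "j = i" "k \<in> set is" | "j \<in> set is" "k = i" | "j \<in> set is" "k \<in> set is"
      using pq e by auto
    then show "p = q"
    proof cases
      case 1
      then show ?thesis using pq(3) m(1) by (simp add: e f_def)
    next
      case 2
      then show ?thesis using fi[OF st(1)] ft[OF 2(2) st(2)] pq(3) by (simp add: e)
    next
      case 3
      then show ?thesis using fi[OF st(2)] ft[OF 3(1) st(1)] pq(3) by (simp add: e)
    next
      case 4
      then have "\<tau> (j, s) = \<tau> (k, t)" using ft[OF 4(1) st(1)] ft[OF 4(2) st(2)] pq(3) by (simp add: e)
      then show ?thesis using inj_onD[OF \<tau>(1), of "(j, s)" "(k, t)"] 4 st by (simp add: e)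
    qed
  qed
  moreover have "f p \<in> {a..<b} \<and> \<gamma> (f p) = pt \<sigma> v (fst p) (snd p)" if p: "p \<in> set (i # is) \<times> {0..<1}" for p
  proof -
    obtain j s where e: "p = (j, s)" by (cases p)
    have s: "s \<in> {0..<1}" using p e by auto
    consider "j = i" | "j \<in> set is" using p e by auto
    then show ?thesis
    proof cases
      case 1
      then show ?thesis using fi[OF s] mb by (auto simp: e)
    next
      case 2
      then show ?thesis using ft[OF 2 s] m(1) by (auto simp: e)
    qed
  qed
  ultimately show ?case by blast
qed simp

text \<open>The polygons into which the configuration decomposes are the curves in \<open>K\<close>.\<close>

definition presents :: "'i set \<Rightarrow> ('i \<Rightarrow> 'i) \<Rightarrow> ('i \<Rightarrow> 'a::real_normed_vector) \<Rightarrow> (real \<Rightarrow> 'a) set \<Rightarrow> bool" where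
  "presents I \<sigma> v K \<longleftrightarrow> (\<exists>l. (\<forall>\<gamma>\<in>K. cycle_list \<sigma> (l \<gamma>) \<and> traverses \<sigma> v \<gamma> (l \<gamma>) 0 1) \<and>
     (\<Union>\<gamma>\<in>K. set (l \<gamma>)) = I \<and> pairwise (\<lambda>\<gamma> \<delta>. disjnt (set (l \<gamma>)) (set (l \<delta>))) K)"

lemma presents_closed: "presents I \<sigma> v K \<Longrightarrow> \<gamma> \<in> K \<Longrightarrow> \<gamma> 1 = \<gamma> 0"
  unfolding presents_def using traverses_cycle_closed by blast

lemma presents_subdivision:
  assumes K: "presents I \<sigma> v K" and k: "subdivision I k l" and nx: "\<And>i. i \<in> I \<Longrightarrow> \<sigma> i \<in> I"
  shows "presents (sub_index k I) (sub_next k \<sigma>) (sub_vertex l \<sigma> v) K"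
proof -
  obtain L where L: "\<forall>\<gamma>\<in>K. cycle_list \<sigma> (L \<gamma>) \<and> traverses \<sigma> v \<gamma> (L \<gamma>) 0 1"
     "(\<Union>\<gamma>\<in>K. set (L \<gamma>)) = I" "pairwise (\<lambda>\<gamma> \<delta>. disjnt (set (L \<gamma>)) (set (L \<delta>))) K"
    using K unfolding presents_def by blast
  have kp: "k i > 0" if "i \<in> I" for i using k that by (simp add: subdivision_def)
  have "cycle_list (sub_next k \<sigma>) (sub_list k (L \<gamma>))" if "\<gamma> \<in> K" for \<gamma>
    by (rule cycle_list_sub_list) (use L that kp in blast)+
  moreover have "traverses (sub_next k \<sigma>) (sub_vertex l \<sigma> v) \<gamma> (sub_list k (L \<gamma>)) 0 1" if "\<gamma> \<in> K" for \<gamma>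
    by (rule traverses_subdivision[OF k nx]) (use L that in blast)+
  moreover have "(\<Union>\<gamma>\<in>K. set (sub_list k (L \<gamma>))) = sub_index k I"
    unfolding set_sub_list using L(2) by (auto simp: sub_index_def)
  moreover have "pairwise (\<lambda>\<gamma> \<delta>. disjnt (set (sub_list k (L \<gamma>))) (set (sub_list k (L \<delta>)))) K"
    unfolding set_sub_list using L(3) by (auto simp: sub_index_def pairwise_def disjnt_iff)
  ultimately show ?thesis unfolding presents_def by (intro exI[of _ "\<lambda>\<gamma>. sub_list k (L \<gamma>)"]) blast
qed

text \<open>Both sets of curves correspond to the cycles of the same permutation, which gives the
  bijection; curves running through the same cycle differ by base point and parametrization
  only.\<close>

lemma presents_match:
  assumes K: "presents I \<sigma> v K" and Q: "presents I \<sigma> w Q"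
    and \<Phi>: "\<And>i s. i \<in> I \<Longrightarrow> s \<in> {0..1} \<Longrightarrow> \<Phi> (pt \<sigma> w i s) = pt \<sigma> v i s"
  shows "\<exists>f. bij_betw f K Q \<and> (\<forall>\<gamma>\<in>K. same_oriented_curve \<gamma> (\<Phi> \<circ> f \<gamma>))"
proof -
  obtain L where L: "\<And>\<gamma>. \<gamma> \<in> K \<Longrightarrow> cycle_list \<sigma> (L \<gamma>)" "\<And>\<gamma>. \<gamma> \<in> K \<Longrightarrow> traverses \<sigma> v \<gamma> (L \<gamma>) 0 1"
     "(\<Union>\<gamma>\<in>K. set (L \<gamma>)) = I" "pairwise (\<lambda>\<gamma> \<delta>. disjnt (set (L \<gamma>)) (set (L \<delta>))) K"
    using K unfolding presents_def by blast
  obtain M where M: "\<And>\<gamma>. \<gamma> \<in> Q \<Longrightarrow> cycle_list \<sigma> (M \<gamma>)" "\<And>\<gamma>. \<gamma> \<in> Q \<Longrightarrow> traverses \<sigma> w \<gamma> (M \<gamma>) 0 1"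
     "(\<Union>\<gamma>\<in>Q. set (M \<gamma>)) = I" "pairwise (\<lambda>\<gamma> \<delta>. disjnt (set (M \<gamma>)) (set (M \<delta>))) Q"
    using Q unfolding presents_def by blast
  have share: "set (L \<gamma>) = set (M \<delta>)" if "\<gamma> \<in> K" "\<delta> \<in> Q" "set (L \<gamma>) \<inter> set (M \<delta>) \<noteq> {}" for \<gamma> \<delta>
    using cycle_lists_sharing[OF L(1)[OF that(1)] M(1)[OF that(2)] that(3)] by (metis set_append sup_commute)
  have ne: "set (L \<gamma>) \<noteq> {}" if "\<gamma> \<in> K" for \<gamma> using L(1)[OF that] by (simp add: cycle_list_def)
  have neM: "set (M \<gamma>) \<noteq> {}" if "\<gamma> \<in> Q" for \<gamma> using M(1)[OF that] by (simp add: cycle_list_def)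
  have "\<forall>\<gamma>\<in>K. \<exists>\<delta>\<in>Q. set (L \<gamma>) = set (M \<delta>)"
  proof
    fix \<gamma> assume g: "\<gamma> \<in> K"
    obtain i where i: "i \<in> set (L \<gamma>)" using ne[OF g] by (metis all_not_in_conv)
    then obtain \<delta> where "\<delta> \<in> Q" "i \<in> set (M \<delta>)" using L(3) M(3) g by blast
    then show "\<exists>\<delta>\<in>Q. set (L \<gamma>) = set (M \<delta>)" using share[OF g] i by blast
  qed
  then obtain f where f: "\<And>\<gamma>. \<gamma> \<in> K \<Longrightarrow> f \<gamma> \<in> Q" "\<And>\<gamma>. \<gamma> \<in> K \<Longrightarrow> set (L \<gamma>) = set (M (f \<gamma>))" by metis
  have "inj_on f K"
  proof (rule inj_onI, rule ccontr)
    fix \<gamma> \<delta> assume gd: "\<gamma> \<in> K" "\<delta> \<in> K" "f \<gamma> = f \<delta>" "\<gamma> \<noteq> \<delta>"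
    then have "disjnt (set (L \<gamma>)) (set (L \<delta>))" using L(4) by (simp add: pairwise_def)
    then show False using f(2)[OF gd(1)] f(2)[OF gd(2)] gd(3) ne[OF gd(1)] by (simp add: disjnt_def)
  qed
  moreover have "\<delta> \<in> f ` K" if d: "\<delta> \<in> Q" for \<delta>
  proof -
    obtain i where i: "i \<in> set (M \<delta>)" using neM[OF d] by (metis all_not_in_conv)
    then obtain \<gamma> where g: "\<gamma> \<in> K" "i \<in> set (L \<gamma>)" using L(3) M(3) d by blast
    have "\<not> disjnt (set (M \<delta>)) (set (M (f \<gamma>)))" using i g f(2)[OF g(1)] by (auto simp: disjnt_iff)
    then have "\<delta> = f \<gamma>" using M(4) d f(1)[OF g(1)] by (auto simp: pairwise_def)
    then show ?thesis using g(1) by blast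
  qed
  ultimately have "bij_betw f K Q" using f(1) by (auto simp: bij_betw_def)
  moreover have "same_oriented_curve \<gamma> (\<Phi> \<circ> f \<gamma>)" if g: "\<gamma> \<in> K" for \<gamma>
  proof (rule traverses_same_cycle[OF L(2)[OF g] _ L(1)[OF g] M(1)[OF f(1)[OF g]]])
    show t: "traverses \<sigma> v (\<Phi> \<circ> f \<gamma>) (M (f \<gamma>)) 0 1"
      by (rule traverses_image[OF M(2)[OF f(1)[OF g]]]) (use M(3) f(1)[OF g] \<Phi> in blast)
    show "set (L \<gamma>) \<inter> set (M (f \<gamma>)) \<noteq> {}" using f(2)[OF g] ne[OF g] by simp
    show "\<gamma> 1 = \<gamma> 0" by (rule traverses_cycle_closed[OF L(2)[OF g] L(1)[OF g]])
    show "(\<Phi> \<circ> f \<gamma>) 1 = (\<Phi> \<circ> f \<gamma>) 0" by (rule traverses_cycle_closed[OF t M(1)[OF f(1)[OF g]]])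
  qed
  ultimately show ?thesis by blast
qed

text \<open>A \<open>polyline\<close> through at most one vertex is constant and so not simple. The
  values at 0 and 1 are read off from a traversal with successor function \<open>Suc\<close> on the
  positions in the list.\<close>

lemma closed_polyline_vertices:
  assumes "simple_path (polyline vs)" "pathfinish (polyline vs) = pathstart (polyline vs)"
  shows "length vs > 1 \<and> vs = map (nth vs) [0..<length vs - 1] @ [vs ! 0]"
proof -
  have const: "\<not> simple_path (\<lambda>_. a)" for a :: 'a
  proof
    assume "simple_path (\<lambda>_::real. a)"
    then have "\<forall>x\<in>{0..1}. \<forall>y\<in>{0..1::real}. x = y \<or> x = 0 \<and> y = 1 \<or> x = 1 \<and> y = 0"
      by (auto simp: simple_path_def loop_free_def)
    from this[rule_format, of 0 "1/2"] show False by simp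
  qed
  have len: "length vs > 1"
  proof (rule ccontr)
    assume "\<not> length vs > 1"
    then consider "vs = []" | a where "vs = [a]" by (cases vs rule: polyline.cases) auto
    then show False
    proof cases
      case 1
      then show False using assms(1) const[of 0] by simp
    next
      case 2
      have "linepath a a = (\<lambda>_. a)" by (auto simp: linepath_def algebra_simps)
      then show False using assms(1) const[of a] 2 by simp
    qed
  qed
  define n where "n = length vs - 1"
  have n: "n > 0" "length vs = Suc n" using len by (auto simp: n_def)
  have vs: "vs = map (nth vs) [0..<n] @ [vs ! n]" using n(2) by (metis map_nth upt_Suc_append map_append list.map zero_le)
  have up: "[0..<n] = 0 # [1..<n]" using n(1) by (simp add: upt_conv_Cons)
  have t: "traverses Suc (nth vs) (polyline (map (nth vs) (0 # [1..<n]) @ [vs ! n])) (0 # [1..<n]) 0 1"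
  proof (rule traverses_polyline)
    have "map Suc (0 # [1..<n]) = [1..<Suc n]" unfolding up[symmetric] by (simp only: map_Suc_upt One_nat_def)
    then show "map Suc (0 # [1..<n]) = [1..<n] @ [n]" using n(1) by simp
  qed
  then have t': "traverses Suc (nth vs) (polyline vs) [0..<n] 0 1" using vs up by metis
  have "polyline vs 0 = vs ! 0" using t' up by (metis traverses_start)
  moreover have "[0..<n] = [0..<n - 1] @ [n - 1]" using n(1) by (metis Suc_diff_1 upt_Suc_append zero_le)
  then have "polyline vs 1 = vs ! n" using t' traverses_end[of Suc "nth vs" "polyline vs" "[0..<n - 1]" "n - 1" 0 1] n(1) by simp
  ultimately have "vs ! n = vs ! 0" using assms(2) by (simp add: pathstart_def pathfinish_def)
  then show ?thesis using vs len by (simp add: n_def)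
qed

lemma polygonal_link_presentation:
  assumes P: "polygonal_link P"
  shows "\<exists>(I :: ((real \<Rightarrow> real^3) \<times> nat) set) \<sigma> v. simple_poly I \<sigma> v \<and> presents I \<sigma> v P \<and> I \<noteq> {}"
proof -
  have fin: "finite P" and Pne: "P \<noteq> {}" and sp: "\<And>\<gamma>. \<gamma> \<in> P \<Longrightarrow> simple_path \<gamma>"
    and cl: "\<And>\<gamma>. \<gamma> \<in> P \<Longrightarrow> pathfinish \<gamma> = pathstart \<gamma>"
    and dj: "pairwise (\<lambda>\<gamma> \<delta>. disjnt (path_image \<gamma>) (path_image \<delta>)) P"
    and poly: "\<And>\<gamma>. \<gamma> \<in> P \<Longrightarrow> \<exists>vs. \<gamma> = polyline vs"
    using P unfolding polygonal_link_def oriented_link_def by blast+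
  obtain V where V: "\<And>\<gamma>. \<gamma> \<in> P \<Longrightarrow> \<gamma> = polyline (V \<gamma>)" using poly by metis
  define n where "n \<gamma> = length (V \<gamma>) - 1" for \<gamma>
  have n: "n \<gamma> > 0" "V \<gamma> = map (nth (V \<gamma>)) [0..<n \<gamma>] @ [V \<gamma> ! 0]" if "\<gamma> \<in> P" for \<gamma>
    using closed_polyline_vertices[of "V \<gamma>"] sp[OF that] cl[OF that] V[OF that] by (auto simp: n_def)
  define I where "I = sub_index n P"
  \<comment> \<open>With each curve as its own successor, \<open>sub_next\<close> is the cyclic
    successor on the numbers of its vertices.\<close>
  define \<sigma> where "\<sigma> = sub_next n (id :: (real \<Rightarrow> real^3) \<Rightarrow> _)"
  define v where "v = (\<lambda>(\<gamma>, k). V \<gamma> ! k)"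
  define l where "l \<gamma> = sub_list n [\<gamma>]" for \<gamma> :: "real \<Rightarrow> real^3"
  have cyc: "cycle_list \<sigma> (l \<gamma>)" if "\<gamma> \<in> P" for \<gamma>
    unfolding \<sigma>_def l_def by (rule cycle_list_sub_list) (use n(1) that in \<open>auto simp: cycle_list_def\<close>)
  have tr: "traverses \<sigma> v \<gamma> (l \<gamma>) 0 1" if "\<gamma> \<in> P" for \<gamma>
  proof -
    have l: "l \<gamma> = map (Pair \<gamma>) [0..<n \<gamma>]" by (simp add: l_def sub_list_def)
    have "hd (l \<gamma>) = (\<gamma>, 0)" using n(1)[OF that] by (simp add: l upt_conv_Cons)
    then have "map v (l \<gamma>) @ [v (hd (l \<gamma>))] = V \<gamma>" using n(2)[OF that] by (simp add: l v_def o_def)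
    then show ?thesis using traverses_polyline_cycle[OF cyc[OF that], of v] V[OF that] by simp
  qed
  have sl: "set (l \<gamma>) = sub_index n {\<gamma>}" for \<gamma> by (simp add: l_def set_sub_list)
  have pres: "presents I \<sigma> v P" unfolding presents_def
    by (intro exI[of _ l] conjI ballI cyc tr) (auto simp: sl I_def sub_index_def pairwise_def disjnt_iff)
  have "\<exists>\<tau>. inj_on \<tau> (set (l \<gamma>) \<times> {0..<1}) \<and>
    (\<forall>p\<in>set (l \<gamma>) \<times> {0..<1}. \<tau> p \<in> {0..<1} \<and> \<gamma> (\<tau> p) = pt \<sigma> v (fst p) (snd p))" if "\<gamma> \<in> P" for \<gamma>
    by (rule traverses_parameter[OF tr[OF that]]) (use cyc[OF that] in \<open>simp add: cycle_list_def\<close>)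
  then obtain \<tau> where \<tau>: "\<And>\<gamma>. \<gamma> \<in> P \<Longrightarrow> inj_on (\<tau> \<gamma>) (set (l \<gamma>) \<times> {0..<1})"
    "\<And>\<gamma> p. \<gamma> \<in> P \<Longrightarrow> p \<in> set (l \<gamma>) \<times> {0..<1} \<Longrightarrow> \<tau> \<gamma> p \<in> {0..<1} \<and> \<gamma> (\<tau> \<gamma> p) = pt \<sigma> v (fst p) (snd p)"
    by metis
  have "simple_poly I \<sigma> v" unfolding simple_poly_def
  proof (intro conjI ballI impI)
    show "finite I" unfolding I_def by (rule finite_sub_index[OF fin])
    show "bij_betw \<sigma> I I" unfolding I_def \<sigma>_def by (rule bij_betw_sub_next) (use fin n(1) in auto)
    fix i j s t assume ij: "i \<in> I" "j \<in> I" "s \<in> {0..<1::real}" "t \<in> {0..<1::real}" "pt \<sigma> v i s = pt \<sigma> v j t"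
    define \<gamma> \<delta> where "\<gamma> = fst i" and "\<delta> = fst j"
    have gd: "\<gamma> \<in> P" "\<delta> \<in> P" and p: "(i, s) \<in> set (l \<gamma>) \<times> {0..<1}" "(j, t) \<in> set (l \<delta>) \<times> {0..<1}"
      using ij by (auto simp: I_def sl sub_index_def \<gamma>_def \<delta>_def)
    note T = \<tau>(2)[OF gd(1) p(1)] \<tau>(2)[OF gd(2) p(2)]
    have eq: "\<gamma> (\<tau> \<gamma> (i, s)) = \<delta> (\<tau> \<delta> (j, t))" using T ij(5) by simp
    then have "\<not> disjnt (path_image \<gamma>) (path_image \<delta>)"
      using T unfolding disjnt_iff path_image_def by (metis atLeastAtMost_iff atLeastLessThan_iff image_eqI less_imp_le)
    then have same: "\<gamma> = \<delta>" using dj gd unfolding pairwise_def by blast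
    have "\<tau> \<gamma> (i, s) = \<tau> \<gamma> (j, t)"
      using sp[OF gd(1)] eq T same unfolding simple_path_def loop_free_def by fastforce
    then have "(i, s) = (j, t)" using inj_onD[OF \<tau>(1)[OF gd(1)] _ p(1)] p(2) same by simp
    then show "i = j" "s = t" by auto
  qed
  moreover have "I \<noteq> {}" using Pne n(1) by (auto simp: I_def sub_index_def)
  ultimately show ?thesis using pres by blast
qed

section \<open>The half grid diagram of a comb\<close>

definition orbit_list :: "('c \<Rightarrow> 'c) \<Rightarrow> 'c \<Rightarrow> 'c list" where
  "orbit_list \<sigma> c = map (\<lambda>k. (\<sigma> ^^ k) c) [0..<(LEAST p. p > 0 \<and> (\<sigma> ^^ p) c = c)]"

lemma cycle_list_orbit_list:
  assumes C: "finite C" "bij_betw \<sigma> C C" and c: "c \<in> C"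
  shows "cycle_list \<sigma> (orbit_list \<sigma> c)" "hd (orbit_list \<sigma> c) = c"
proof -
  have bij: "bij_betw (\<sigma> ^^ k) C C" for k by (rule bij_betw_funpow[OF C(2)])
  have in_C: "(\<sigma> ^^ k) c \<in> C" for k using bij[of k] c by (auto simp: bij_betw_def)
  have period: "(\<sigma> ^^ (j - i)) c = c" if "i < j" "(\<sigma> ^^ i) c = (\<sigma> ^^ j) c" for i j
  proof -
    have "(\<sigma> ^^ i) ((\<sigma> ^^ (j - i)) c) = (\<sigma> ^^ j) c" using that(1) by (simp flip: funpow_add comp_apply[of "\<sigma> ^^ i"])
    then show ?thesis using inj_onD[OF bij_betw_imp_inj_on[OF bij[of i]] _ in_C c] that(2) by simp
  qed
  define p where "p = (LEAST p. p > 0 \<and> (\<sigma> ^^ p) c = c)"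
  have "\<not> inj (\<lambda>k. (\<sigma> ^^ k) c)"
    using finite_subset[OF _ C(1), of "range (\<lambda>k. (\<sigma> ^^ k) c)"] in_C range_inj_infinite by blast
  then obtain i j where "i \<noteq> j" "(\<sigma> ^^ i) c = (\<sigma> ^^ j) c" by (auto simp: inj_on_def)
  then have "\<exists>p>0. (\<sigma> ^^ p) c = c" using period[of i j] period[of j i] by (metis linorder_neqE_nat zero_less_diff)
  then have p: "p > 0" "(\<sigma> ^^ p) c = c" unfolding p_def by (metis (mono_tags, lifting) LeastI_ex)+
  have least: "p \<le> q" if "q > 0" "(\<sigma> ^^ q) c = c" for q unfolding p_def by (rule Least_le) (use that in simp)
  have ol: "orbit_list \<sigma> c = map (\<lambda>k. (\<sigma> ^^ k) c) [0..<p]" by (simp add: orbit_list_def p_def)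
  have "inj_on (\<lambda>k. (\<sigma> ^^ k) c) {0..<p}"
  proof (rule linorder_inj_onI)
    fix i j :: nat assume ij: "i < j" "i \<in> {0..<p}" "j \<in> {0..<p}"
    show "(\<sigma> ^^ i) c \<noteq> (\<sigma> ^^ j) c"
    proof
      assume "(\<sigma> ^^ i) c = (\<sigma> ^^ j) c"
      then have "p \<le> j - i" using least[of "j - i"] period[OF ij(1)] ij(1) by simp
      then show False using ij by simp
    qed
  qed auto
  then have dist: "distinct (orbit_list \<sigma> c)" by (simp add: ol distinct_map)
  obtain m where m: "p = Suc m" using p(1) by (cases p) auto
  have "map \<sigma> (orbit_list \<sigma> c) = map (\<lambda>k. (\<sigma> ^^ k) c) (map Suc [0..<p])" by (simp add: ol)
  also have "\<dots> = map (\<lambda>k. (\<sigma> ^^ k) c) [1..<p] @ [c]" using p m by (simp add: map_Suc_upt)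
  also have "\<dots> = rotate1 (orbit_list \<sigma> c)" using m by (simp add: ol upt_conv_Cons del: upt_Suc)
  finally show "cycle_list \<sigma> (orbit_list \<sigma> c)" using p(1) dist by (simp add: cycle_list_def ol)
  show "hd (orbit_list \<sigma> c) = c" using p(1) by (simp add: ol upt_conv_Cons)
qed

section \<open>The grid diagram of a comb with integer coordinates\<close>

locale comb_diagram =
  fixes C :: "'c set" and \<sigma> :: "'c \<Rightarrow> 'c" and n :: nat and \<kappa> \<rho> :: "'c \<Rightarrow> nat"
  assumes finite_C: "finite C" and bij: "bij_betw \<sigma> C C"
    and cols: "bij_betw \<kappa> C {..<2 * n}" and rows: "bij_betw \<rho> C {..<2 * n}"
    and alternating: "\<And>c. c \<in> C \<Longrightarrow> \<rho> (\<sigma> c) < n \<longleftrightarrow> \<not> \<rho> c < n"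
begin

text \<open>This is the whole diagram with \<open>2 * n\<close> rows, of which
  \<open>half_grid_diagram n\<close> sees the upper half. Row \<open>\<rho> c\<close> runs from
  column \<open>\<kappa> c\<close> to column \<open>\<kappa> (\<sigma> c)\<close>, hence the places
  of the marks.\<close>

definition upper :: grid where
  "upper i j = (if \<exists>c\<in>C. \<rho> c = i \<and> \<kappa> c = j then Some MarkX
     else if \<exists>c\<in>C. \<rho> c = i \<and> \<kappa> (\<sigma> c) = j then Some MarkO else None)"

text \<open>The lower half read upwards with exchanged marks, so that \<open>neg_bar\<close>
  restores it; see \<open>stack_eq\<close>.\<close>

definition lower :: grid where
  "lower i j = map_option swap_mark (upper (2 * n - 1 - i) j)"

lemma next_in: "c \<in> C \<Longrightarrow> \<sigma> c \<in> C"
  using bij by (auto simp: bij_betw_def)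

lemma next_inj: "c \<in> C \<Longrightarrow> d \<in> C \<Longrightarrow> \<sigma> c = \<sigma> d \<longleftrightarrow> c = d"
  using bij by (auto simp: bij_betw_def inj_on_def)

lemma next_ne: "c \<in> C \<Longrightarrow> \<sigma> c \<noteq> c"
  using alternating[of c] by auto

lemma row_eq: "c \<in> C \<Longrightarrow> d \<in> C \<Longrightarrow> \<rho> c = \<rho> d \<longleftrightarrow> c = d"
  using rows by (auto simp: bij_betw_def inj_on_def)

lemma col_eq: "c \<in> C \<Longrightarrow> d \<in> C \<Longrightarrow> \<kappa> c = \<kappa> d \<longleftrightarrow> c = d"
  using cols by (auto simp: bij_betw_def inj_on_def)

lemma row_less: "c \<in> C \<Longrightarrow> \<rho> c < 2 * n"
  using rows by (auto simp: bij_betw_def)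

lemma col_less: "c \<in> C \<Longrightarrow> \<kappa> c < 2 * n"
  using cols by (auto simp: bij_betw_def)

lemma row_obtain: assumes "i < 2 * n" obtains c where "c \<in> C" "i = \<rho> c"
  using rows assms by (auto simp: bij_betw_def)

lemma col_obtain: assumes "j < 2 * n" obtains c where "c \<in> C" "j = \<kappa> c"
  using cols assms by (auto simp: bij_betw_def)

lemma prev_obtain: assumes "c \<in> C" obtains b where "b \<in> C" "c = \<sigma> b"
  using bij assms by (auto simp: bij_betw_def)

lemma upper_X: "c \<in> C \<Longrightarrow> upper (\<rho> c) j = Some MarkX \<longleftrightarrow> j = \<kappa> c"
  unfolding upper_def using row_eq by (auto split: if_splits)

lemma upper_O:
  assumes "c \<in> C"
  shows "upper (\<rho> c) j = Some MarkO \<longleftrightarrow> j = \<kappa> (\<sigma> c)"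
proof -
  have X: "(\<exists>d\<in>C. \<rho> d = \<rho> c \<and> \<kappa> d = j) \<longleftrightarrow> j = \<kappa> c"
    and O: "(\<exists>d\<in>C. \<rho> d = \<rho> c \<and> \<kappa> (\<sigma> d) = j) \<longleftrightarrow> j = \<kappa> (\<sigma> c)" using row_eq assms by auto
  have "\<kappa> (\<sigma> c) \<noteq> \<kappa> c" using col_eq[OF next_in[OF assms] assms] next_ne[OF assms] by simp
  then show ?thesis unfolding upper_def X O by auto
qed

lemma upper_mark: "c \<in> C \<Longrightarrow> upper (\<rho> c) j = Some s \<longleftrightarrow> j = (case s of MarkX \<Rightarrow> \<kappa> c | MarkO \<Rightarrow> \<kappa> (\<sigma> c))"
  using upper_X upper_O by (cases s) auto

lemma upper_nonempty:
  assumes "c \<in> C"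
  shows "upper (\<rho> c) j \<noteq> None \<longleftrightarrow> j = \<kappa> c \<or> j = \<kappa> (\<sigma> c)"
proof -
  have "upper (\<rho> c) j \<noteq> None \<longleftrightarrow> upper (\<rho> c) j = Some MarkX \<or> upper (\<rho> c) j = Some MarkO"
    by (metis mark.exhaust not_None_eq)
  then show ?thesis using upper_X[OF assms] upper_O[OF assms] by simp
qed

lemma map_swap_mark: "map_option swap_mark v = Some s \<longleftrightarrow> v = Some (swap_mark s)"
  by (cases s; cases v) (auto elim: swap_mark.elims)

lemma swap_swap: "map_option swap_mark (map_option swap_mark v) = v"
proof (cases v)
  case (Some s)
  then show ?thesis by (cases s) auto
qed simp

lemma row_unique:
  assumes "i < 2 * n"
  shows "\<exists>!j. j < 2 * n \<and> upper i j = Some s"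
proof -
  obtain c where c: "c \<in> C" "i = \<rho> c" using row_obtain[OF assms] .
  show ?thesis unfolding c(2) upper_mark[OF c(1)]
    using col_less[OF c(1)] col_less[OF next_in[OF c(1)]] by (auto split: mark.split)
qed

text \<open>The marks of column \<open>\<kappa> c\<close> are in the row of \<open>c\<close> and in
  that of its predecessor. By \<open>alternating\<close> these rows belong to different
  halves.\<close>

lemma col_unique:
  assumes "j < 2 * n"
  shows "\<exists>!i. i < n \<and> upper i j \<noteq> None" "\<exists>!i. n \<le> i \<and> i < 2 * n \<and> upper i j \<noteq> None"
proof -
  obtain c where c: "c \<in> C" "j = \<kappa> c" using col_obtain[OF assms] .
  obtain b where b: "b \<in> C" "c = \<sigma> b" using prev_obtain[OF c(1)] .
  have ne: "upper i j \<noteq> None \<longleftrightarrow> i = \<rho> c \<or> i = \<rho> b" if i: "i < 2 * n" for i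
  proof -
    obtain d where d: "d \<in> C" "i = \<rho> d" using row_obtain[OF i] .
    show ?thesis unfolding d(2) upper_nonempty[OF d(1)] c(2) row_eq[OF d(1) c(1)] row_eq[OF d(1) b(1)]
      using col_eq[OF c(1) d(1)] col_eq[OF c(1) next_in[OF d(1)]] next_inj[OF b(1) d(1)] b(2) by auto
  qed
  have alt: "\<rho> c < n \<longleftrightarrow> \<not> \<rho> b < n" using alternating[OF b(1)] b(2) by simp
  have lt: "\<rho> c < 2 * n" "\<rho> b < 2 * n" using row_less c b by auto
  have "i < n \<and> upper i j \<noteq> None \<longleftrightarrow> i = (if \<rho> c < n then \<rho> c else \<rho> b)" for i
    using ne[of i] alt by auto
  then show "\<exists>!i. i < n \<and> upper i j \<noteq> None" by simp
  have "n \<le> i \<and> i < 2 * n \<and> upper i j \<noteq> None \<longleftrightarrow> i = (if \<rho> c < n then \<rho> b else \<rho> c)" for i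
    using ne[of i] alt lt by auto
  then show "\<exists>!i. n \<le> i \<and> i < 2 * n \<and> upper i j \<noteq> None" by simp
qed

lemma half_grid_upper: "half_grid_diagram n upper"
  unfolding half_grid_diagram_def using row_unique col_unique(1) by auto

lemma half_grid_lower: "half_grid_diagram n lower"
  unfolding half_grid_diagram_def
proof (intro conjI allI impI)
  fix i s assume "i < n"
  then show "\<exists>!j. j < 2 * n \<and> lower i j = Some s"
    unfolding lower_def map_swap_mark by (intro row_unique) auto
next
  fix j assume "j < 2 * n"
  then obtain i where i: "n \<le> i" "i < 2 * n" "upper i j \<noteq> None"
    and u: "\<And>k. n \<le> k \<Longrightarrow> k < 2 * n \<Longrightarrow> upper k j \<noteq> None \<Longrightarrow> k = i"
    using col_unique(2) by metis
  show "\<exists>!i. i < n \<and> lower i j \<noteq> None"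
  proof (rule ex1I)
    show "2 * n - 1 - i < n \<and> lower (2 * n - 1 - i) j \<noteq> None" using i by (auto simp: lower_def)
    fix k assume k: "k < n \<and> lower k j \<noteq> None"
    then have "2 * n - 1 - k = i" by (intro u) (auto simp: lower_def)
    then show "k = 2 * n - 1 - i" using k by auto
  qed
qed

text \<open>The mark \<open>s\<close> occurs in a column of \<open>lower\<close> if and only if the
  opposite mark is in the lower half of the diagram, which by \<open>alternating\<close> means that
  \<open>s\<close> is in the upper half.\<close>

lemma upper_lower_compatible: "compatible n upper lower"
  unfolding compatible_def
proof (intro allI impI)
  fix j s assume "j < 2 * n"
  then obtain c where c: "c \<in> C" "j = \<kappa> c" by (rule col_obtain)
  obtain b where b: "b \<in> C" "c = \<sigma> b" using prev_obtain[OF c(1)] .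
  define r where "r t = (case t of MarkX \<Rightarrow> \<rho> c | MarkO \<Rightarrow> \<rho> b)" for t
  have r: "upper i j = Some t \<longleftrightarrow> i = r t" if i: "i < 2 * n" for i t
  proof -
    obtain d where d: "d \<in> C" "i = \<rho> d" using row_obtain[OF i] .
    show ?thesis unfolding d(2) upper_mark[OF d(1)] c(2) r_def
      using col_eq[OF c(1) d(1)] col_eq[OF c(1) next_in[OF d(1)]] next_inj[OF b(1) d(1)] b(2)
        row_eq[OF d(1) c(1)] row_eq[OF d(1) b(1)] by (cases t) auto
  qed
  have lt: "r t < 2 * n" for t using row_less c(1) b(1) by (cases t) (auto simp: r_def)
  have alt: "r (swap_mark s) < n \<longleftrightarrow> \<not> r s < n" using alternating[OF b(1)] b(2) by (cases s) (auto simp: r_def)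
  have "(\<exists>i<n. upper i j = Some s) \<longleftrightarrow> r s < n" using r by auto
  moreover have "(\<exists>i<n. lower i j = Some s) \<longleftrightarrow> n \<le> r (swap_mark s)"
  proof
    assume "\<exists>i<n. lower i j = Some s"
    then obtain i where "i < n" "upper (2 * n - 1 - i) j = Some (swap_mark s)"
      unfolding lower_def map_swap_mark by blast
    then have "2 * n - 1 - i = r (swap_mark s)" using r[of "2 * n - 1 - i"] by fastforce
    then show "n \<le> r (swap_mark s)" using \<open>i < n\<close> by auto
  next
    assume "n \<le> r (swap_mark s)"
    then have "2 * n - 1 - r (swap_mark s) < n" "2 * n - 1 - (2 * n - 1 - r (swap_mark s)) = r (swap_mark s)"
      using lt[of "swap_mark s"] by auto
    then show "\<exists>i<n. lower i j = Some s" unfolding lower_def map_swap_mark using r[OF lt] by metis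
  qed
  ultimately show "(\<exists>i<n. upper i j = Some s) \<longleftrightarrow> (\<exists>i<n. lower i j = Some s)" using alt by auto
qed

abbreviation "S \<equiv> stack n upper lower"

lemma stack_eq:
  assumes "i < 2 * n"
  shows "S i j = upper i j"
proof (cases "i < n")
  case False
  then have "2 * n - 1 - (n - 1 - (i - n)) = i" using assms by auto
  then show ?thesis using False by (simp add: stack_def neg_bar_def lower_def swap_swap)
qed (simp add: stack_def)

lemma mark_col_stack:
  assumes "c \<in> C"
  shows "mark_col (2 * n) S MarkX (\<rho> c) = \<kappa> c" "mark_col (2 * n) S MarkO (\<rho> c) = \<kappa> (\<sigma> c)"
  unfolding mark_col_def stack_eq[OF row_less[OF assms]] upper_X[OF assms] upper_O[OF assms]
  using col_less[OF assms] col_less[OF next_in[OF assms]] by auto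

lemma next_row_stack:
  assumes c: "c \<in> C"
  shows "next_row (2 * n) S (\<rho> c) = \<rho> (\<sigma> c)"
proof -
  have "i < 2 * n \<and> S i (\<kappa> (\<sigma> c)) = Some MarkX \<longleftrightarrow> i = \<rho> (\<sigma> c)" for i
  proof (cases "i < 2 * n")
    case True
    then obtain d where d: "d \<in> C" "i = \<rho> d" by (rule row_obtain)
    show ?thesis using True stack_eq[OF True] upper_X[OF d(1)] col_eq[OF next_in[OF c] d(1)] row_eq[OF d(1) next_in[OF c]] d(2)
      by auto
  next
    case False
    then show ?thesis using row_less[OF next_in[OF c]] by auto
  qed
  then show ?thesis unfolding next_row_def mark_col_stack[OF c] mark_row_def by simp
qed

lemma funpow_in: "c \<in> C \<Longrightarrow> (\<sigma> ^^ k) c \<in> C"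
  by (induction k) (auto intro: next_in)

lemma funpow_next_row: "c \<in> C \<Longrightarrow> (next_row (2 * n) S ^^ k) (\<rho> c) = \<rho> ((\<sigma> ^^ k) c)"
  by (induction k) (auto simp: next_row_stack funpow_in)

abbreviation "Z \<equiv> comb \<sigma> C (\<lambda>c. real (\<kappa> c)) (\<lambda>c. - real (\<rho> c))"

text \<open>The list starts with edge 2, the row, because \<open>grid_component\<close> starts at an
  \<open>X\<close> at height 1, while the numbering of edges starts with the spine. This shift is
  the rotation by two in \<open>component_edges_rotate\<close>.\<close>

definition row_edges :: "'c \<Rightarrow> ('c \<times> nat) list" where
  "row_edges d = [(d, 2), (d, 3), (\<sigma> d, 0), (\<sigma> d, 1)]"

definition component_edges :: "'c \<Rightarrow> ('c \<times> nat) list" where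
  "component_edges c = concat (map row_edges (orbit_list \<sigma> c))"

lemma comb_vertices:
  assumes "d \<in> C"
  shows "row_vertices (2 * n) S (\<rho> d) = map Z (row_edges d)"
  using bij assms unfolding row_vertices_def mark_col_stack[OF assms] next_row_stack[OF assms]
  by (simp add: row_edges_def grid_point_def comb_def quad_def bij_betw_def inv_into_f_f)

lemma component_edges_rotate:
  assumes c: "c \<in> C"
  shows "component_edges c = rotate 2 (sub_list (\<lambda>_. 4) (orbit_list \<sigma> c))"
proof -
  let ?s = "sub_list (\<lambda>_::'c. 4::nat)"
  have s4: "?s (x # xs) = [(x, 0), (x, 1), (x, 2), (x, 3)] @ ?s xs" for x and xs :: "'c list"
    by (simp add: sub_list_Cons upt_conv_Cons)
  have gen: "concat (map row_edges (x # xs)) = drop 2 (?s (x # xs)) @ [(y, 0), (y, 1)]"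
    if "map \<sigma> (x # xs) = xs @ [y]" for x xs y
    using that
  proof (induction xs arbitrary: x)
    case Nil
    then show ?case using s4[of x "[]"] by (simp add: row_edges_def sub_list_def)
  next
    case (Cons z zs)
    then have "concat (map row_edges (z # zs)) = drop 2 (?s (z # zs)) @ [(y, 0), (y, 1)]" by simp
    then show ?case using Cons.prems s4[of x "z # zs"] s4[of z zs] by (simp add: row_edges_def[abs_def])
  qed
  note cyc = cycle_list_orbit_list[OF finite_C bij c]
  obtain xs where xs: "orbit_list \<sigma> c = c # xs" using cyc by (cases "orbit_list \<sigma> c") (auto simp: cycle_list_def)
  have "map \<sigma> (c # xs) = xs @ [c]" using cyc(1) by (simp add: cycle_list_def xs)
  from gen[OF this] show ?thesis unfolding component_edges_def xs s4 by (simp add: numeral_2_eq_2 numeral_3_eq_3)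
qed

lemma component_edges_cycle:
  assumes c: "c \<in> C"
  shows "cycle_list (quad_next \<sigma>) (component_edges c)"
proof -
  let ?s = "sub_list (\<lambda>_. 4) (orbit_list \<sigma> c)"
  let ?k = "2 mod length ?s"
  have "cycle_list (quad_next \<sigma>) (take ?k ?s @ drop ?k ?s)"
    using cycle_list_sub_list[OF cycle_list_orbit_list(1)[OF finite_C bij c]] by simp
  then show ?thesis unfolding component_edges_rotate[OF c] rotate_drop_take by (rule cycle_list_rotate)
qed

lemma hd_component_edges: "c \<in> C \<Longrightarrow> hd (component_edges c) = (c, 2)"
  using cycle_list_orbit_list[OF finite_C bij, of c]
  by (cases "orbit_list \<sigma> c") (auto simp: component_edges_def row_edges_def cycle_list_def)

lemma set_component_edges: "c \<in> C \<Longrightarrow> set (component_edges c) = quad_index (set (orbit_list \<sigma> c))"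
  by (simp add: component_edges_rotate set_sub_list)

lemma grid_component_eq:
  assumes c: "c \<in> C"
  shows "grid_component (2 * n) S (\<rho> c) = polyline (map Z (component_edges c) @ [Z (hd (component_edges c))])"
proof -
  have "row_period (2 * n) S (\<rho> c) = (LEAST p. p > 0 \<and> (\<sigma> ^^ p) c = c)"
    unfolding row_period_def funpow_next_row[OF c] row_eq[OF funpow_in[OF c] c] ..
  moreover have "row_vertices (2 * n) S ((next_row (2 * n) S ^^ k) (\<rho> c)) = map Z (row_edges ((\<sigma> ^^ k) c))" for k
    unfolding funpow_next_row[OF c] by (rule comb_vertices[OF funpow_in[OF c]])
  moreover have "grid_point (\<rho> c) (mark_col (2 * n) S MarkX (\<rho> c)) 1 = Z (c, 2)"
    unfolding mark_col_stack[OF c] by (simp add: grid_point_def comb_def quad_def)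
  ultimately show ?thesis unfolding grid_component_def hd_component_edges[OF c]
    by (simp add: component_edges_def orbit_list_def map_concat o_def)
qed

lemma orbit_share:
  assumes "c \<in> C" "d \<in> C" "set (orbit_list \<sigma> c) \<inter> set (orbit_list \<sigma> d) \<noteq> {}"
  shows "set (orbit_list \<sigma> c) = set (orbit_list \<sigma> d)"
  using cycle_lists_sharing[OF cycle_list_orbit_list(1)[OF finite_C bij assms(1)]
      cycle_list_orbit_list(1)[OF finite_C bij assms(2)] assms(3)] by (metis set_append sup_commute)

lemma orbit_self: "c \<in> C \<Longrightarrow> c \<in> set (orbit_list \<sigma> c)"
  using cycle_list_orbit_list[OF finite_C bij, of c] by (metis cycle_list_def list.set_sel(1))

lemma orbit_funpow: "c \<in> C \<Longrightarrow> (\<sigma> ^^ k) c \<in> set (orbit_list \<sigma> c)"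
proof (induction k)
  case (Suc k)
  then show ?case using cycle_list_set[OF cycle_list_orbit_list(1)[OF finite_C bij Suc.prems]] by auto
qed (simp add: orbit_self)

text \<open>Starting each component at its least row picks one index from each cycle of the
  permutation; these representatives form \<open>R\<close>.\<close>

lemma presents_grid_link: "presents (quad_index C) (quad_next \<sigma>) Z (grid_link (2 * n) S)"
proof -
  define R where "R = {c \<in> C. \<forall>k. \<rho> c \<le> \<rho> ((\<sigma> ^^ k) c)}"
  have RC: "c \<in> C" if "c \<in> R" for c using that by (simp add: R_def)
  have min: "\<rho> c \<le> \<rho> d" if "c \<in> R" "d \<in> set (orbit_list \<sigma> c)" for c d
    using that by (auto simp: R_def orbit_list_def)
  define g where "g c = grid_component (2 * n) S (\<rho> c)" for c
  have link: "grid_link (2 * n) S = g ` R"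
  proof (rule set_eqI, rule iffI)
    fix \<gamma> assume "\<gamma> \<in> grid_link (2 * n) S"
    then obtain i where i: "\<gamma> = grid_component (2 * n) S i" "i < 2 * n" "\<forall>k. i \<le> (next_row (2 * n) S ^^ k) i"
      unfolding grid_link_def by blast
    obtain c where c: "c \<in> C" "i = \<rho> c" using row_obtain[OF i(2)] .
    have "c \<in> R" using i(3) c funpow_next_row[OF c(1)] by (simp add: R_def)
    then show "\<gamma> \<in> g ` R" using i(1) c(2) by (simp add: g_def)
  next
    fix \<gamma> assume "\<gamma> \<in> g ` R"
    then obtain c where c: "c \<in> R" "\<gamma> = grid_component (2 * n) S (\<rho> c)" by (auto simp: g_def)
    then show "\<gamma> \<in> grid_link (2 * n) S" unfolding grid_link_def
      using funpow_next_row[OF RC[OF c(1)]] row_less[OF RC[OF c(1)]] by (auto simp: R_def)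
  qed
  have disj: "disjnt (set (component_edges c)) (set (component_edges d))" if "c \<in> R" "d \<in> R" "c \<noteq> d" for c d
  proof (rule ccontr)
    assume "\<not> ?thesis"
    then have "set (orbit_list \<sigma> c) \<inter> set (orbit_list \<sigma> d) \<noteq> {}"
      using RC that by (auto simp: set_component_edges sub_index_def disjnt_iff)
    then have "set (orbit_list \<sigma> c) = set (orbit_list \<sigma> d)" using orbit_share RC that by blast
    then have "\<rho> c = \<rho> d" using min[OF that(1)] min[OF that(2)] orbit_self RC that by (metis order_antisym)
    then show False using row_eq RC that by blast
  qed
  have cover: "\<exists>c\<in>R. d \<in> set (orbit_list \<sigma> c)" if d: "d \<in> C" for d
  proof -
    obtain k where k: "\<And>j. \<rho> ((\<sigma> ^^ k) d) \<le> \<rho> ((\<sigma> ^^ j) d)"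
      using ex_has_least_nat[of "\<lambda>_. True" 0 "\<lambda>k. \<rho> ((\<sigma> ^^ k) d)"] by blast
    define c where "c = (\<sigma> ^^ k) d"
    have cC: "c \<in> C" unfolding c_def by (rule funpow_in[OF d])
    have "\<rho> c \<le> \<rho> ((\<sigma> ^^ j) c)" for j using k[of "j + k"] by (simp add: c_def funpow_add)
    then have "c \<in> R" using cC by (simp add: R_def)
    moreover have "c \<in> set (orbit_list \<sigma> d)" unfolding c_def by (rule orbit_funpow[OF d])
    then have "set (orbit_list \<sigma> c) = set (orbit_list \<sigma> d)" using orbit_share[OF cC d] orbit_self[OF cC] by blast
    ultimately show ?thesis using orbit_self[OF d] by blast
  qed
  have tr: "traverses (quad_next \<sigma>) Z (g c) (component_edges c) 0 1" if "c \<in> R" for c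
    unfolding g_def grid_component_eq[OF RC[OF that]]
    by (rule traverses_polyline_cycle[OF component_edges_cycle[OF RC[OF that]]])
  \<comment> \<open>A presentation assigns edge lists to curves, so the index has to be recovered
    from the curve. This is unambiguous because the curves start in different columns, which proves
    \<open>inj\<close>.\<close>
  define rep where "rep \<gamma> = (SOME c. c \<in> R \<and> g c = \<gamma>)" for \<gamma>
  have rep: "rep \<gamma> \<in> R \<and> g (rep \<gamma>) = \<gamma>" if "\<gamma> \<in> g ` R" for \<gamma>
    unfolding rep_def by (rule someI_ex) (use that in blast)
  have inj: "inj_on g R"
  proof (rule inj_onI, rule ccontr)
    fix c d assume cd: "c \<in> R" "d \<in> R" "g c = g d" "c \<noteq> d"
    have "g c 0 = Z (c, 2)" "g d 0 = Z (d, 2)"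
      using tr[OF cd(1)] tr[OF cd(2)] hd_component_edges[OF RC[OF cd(1)]] hd_component_edges[OF RC[OF cd(2)]]
        component_edges_cycle[OF RC[OF cd(1)]] component_edges_cycle[OF RC[OF cd(2)]]
      by (metis cycle_list_def list.collapse traverses_start)+
    then have "\<kappa> c = \<kappa> d" using cd(3) by (simp add: comb_def quad_def vec_eq_iff forall_3)
    then show False using col_eq RC cd by blast
  qed
  show ?thesis unfolding presents_def link
  proof (intro exI[of _ "\<lambda>\<gamma>. component_edges (rep \<gamma>)"] conjI ballI)
    fix \<gamma> assume \<gamma>: "\<gamma> \<in> g ` R"
    show "cycle_list (quad_next \<sigma>) (component_edges (rep \<gamma>))" using component_edges_cycle RC rep[OF \<gamma>] by blast
    show "traverses (quad_next \<sigma>) Z \<gamma> (component_edges (rep \<gamma>)) 0 1" using tr rep[OF \<gamma>] by metis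
  next
    have "rep (g c) = c" if "c \<in> R" for c using rep[of "g c"] inj that by (auto simp: inj_on_def)
    then have "(\<Union>\<gamma>\<in>g ` R. set (component_edges (rep \<gamma>))) = (\<Union>c\<in>R. set (component_edges c))" by simp
    also have "\<dots> = (\<Union>c\<in>R. quad_index (set (orbit_list \<sigma> c)))" using set_component_edges RC by simp
    also have "\<dots> = quad_index (\<Union>c\<in>R. set (orbit_list \<sigma> c))" by (auto simp: sub_index_def)
    also have "(\<Union>c\<in>R. set (orbit_list \<sigma> c)) = C"
    proof (rule set_eqI, rule iffI)
      fix d assume "d \<in> (\<Union>c\<in>R. set (orbit_list \<sigma> c))"
      then show "d \<in> C" using funpow_in RC by (auto simp: orbit_list_def)
    qed (use cover in blast)
    finally show "(\<Union>\<gamma>\<in>g ` R. set (component_edges (rep \<gamma>))) = quad_index C" .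
  next
    show "pairwise (\<lambda>\<gamma> \<delta>. disjnt (set (component_edges (rep \<gamma>))) (set (component_edges (rep \<delta>)))) (g ` R)"
      unfolding pairwise_def using rep disj by metis
  qed
qed

end

section \<open>Integer coordinates by rank\<close>

definition rank_of :: "'c set \<Rightarrow> ('c \<Rightarrow> real) \<Rightarrow> 'c \<Rightarrow> nat" where
  "rank_of C f c = card {d \<in> C. f d < f c}"

lemma rank_of_less:
  assumes "finite C" "c \<in> C" "f c < f d"
  shows "rank_of C f c < rank_of C f d"
  unfolding rank_of_def by (rule psubset_card_mono) (use assms in force)+

lemma bij_betw_rank_of:
  assumes C: "finite C" and f: "inj_on f C"
  shows "bij_betw (rank_of C f) C {..<card C}"
proof -
  have "inj_on (rank_of C f) C"
  proof (rule inj_onI, rule ccontr)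
    fix c d assume cd: "c \<in> C" "d \<in> C" "rank_of C f c = rank_of C f d" "c \<noteq> d"
    then have "f c < f d \<or> f d < f c" using f by (metis inj_onD linorder_neqE)
    then show False using rank_of_less[OF C cd(1), of f d] rank_of_less[OF C cd(2), of f c] cd(3) by auto
  qed
  moreover have "rank_of C f ` C \<subseteq> {..<card C}"
    unfolding rank_of_def using C by (auto intro!: psubset_card_mono)
  ultimately show ?thesis using card_subset_eq[of "{..<card C}" "rank_of C f ` C"]
    by (simp add: bij_betw_def card_image)
qed

lemma presents_isotopic:
  assumes iso: "isotopic_poly I \<sigma> w v" and K: "presents I \<sigma> v K" and Q: "presents I \<sigma> w Q"
  shows "isotopic_links S3 (link_in_S3 K) (link_in_S3 Q)"
proof -
  obtain H where H: "cs_isotopy H" "\<forall>i\<in>I. \<forall>s\<in>{0..1}. H 1 (pt \<sigma> w i s) = pt \<sigma> v i s"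
    using iso unfolding isotopic_poly_def by blast
  have "\<exists>f. bij_betw f K Q \<and> (\<forall>\<gamma>\<in>K. same_oriented_curve \<gamma> (H 1 \<circ> f \<gamma>))"
    by (rule presents_match[OF K Q]) (use H(2) in blast)
  then obtain f where "bij_betw f K Q" "\<And>\<gamma>. \<gamma> \<in> K \<Longrightarrow> same_oriented_curve \<gamma> (H 1 \<circ> f \<gamma>)" by blast
  then show ?thesis by (rule isotopic_links_S3_of_cs_isotopy[OF H(1)])
qed

text \<open>The permutation exchanges the indices of the two signs, so there are \<open>n\<close> of
  each; ranked by decreasing \<open>Y\<close>, those of sign 1 fill exactly the upper
  \<open>n\<close> rows.\<close>

lemma comb_half_grid:
  fixes x Y sg :: "'c \<Rightarrow> real"
  assumes C: "finite C" "bij_betw \<sigma> C C" "C \<noteq> {}" and x: "inj_on x C" and Y: "inj_on Y C"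
    and sg: "\<And>c. c \<in> C \<Longrightarrow> sg c = 1 \<or> sg c = -1" "\<And>c. c \<in> C \<Longrightarrow> sg (\<sigma> c) = - sg c"
    and pos: "\<And>c. c \<in> C \<Longrightarrow> Y c > 0 \<longleftrightarrow> sg c = 1"
  shows "\<exists>n Hp Hm w. n > 0 \<and> half_grid_diagram n Hp \<and> half_grid_diagram n Hm \<and> compatible n Hp Hm \<and>
    isotopic_poly (quad_index C) (quad_next \<sigma>) (comb \<sigma> C x Y) w \<and>
    presents (quad_index C) (quad_next \<sigma>) w (grid_link (2 * n) (stack n Hp Hm))"
proof -
  define U D where "U = {c \<in> C. sg c = 1}" and "D = {c \<in> C. sg c = -1}"
  define n where "n = card U"
  have fin: "finite U" "finite D" using C(1) by (auto simp: U_def D_def)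
  have nx: "\<sigma> c \<in> C" if "c \<in> C" for c using C(2) that by (auto simp: bij_betw_def)
  have inj: "inj_on \<sigma> X" if "X \<subseteq> C" for X using C(2) that by (auto simp: bij_betw_def inj_on_def)
  have "\<sigma> ` U \<subseteq> D" "\<sigma> ` D \<subseteq> U" using nx sg(2) by (auto simp: U_def D_def)
  then have "card U \<le> card D" "card D \<le> card U"
    using card_inj_on_le[OF inj[of U] _ fin(2)] card_inj_on_le[OF inj[of D] _ fin(1)] by (auto simp: U_def D_def)
  moreover have UD: "C = U \<union> D" "U \<inter> D = {}" using sg(1) by (auto simp: U_def D_def)
  ultimately have card: "card C = 2 * n" using card_Un_disjoint[OF fin UD(2)] by (simp add: n_def)
  have n: "n > 0" using card C(1,3) by (metis card_0_eq gr0I mult_0_right)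
  \<comment> \<open>The minus sign turns the order around, because rows are numbered from top to
    bottom.\<close>
  define \<kappa> \<rho> where "\<kappa> = rank_of C x" and "\<rho> = rank_of C (\<lambda>c. - Y c)"
  have \<rho>: "\<rho> c < n \<longleftrightarrow> sg c = 1" if c: "c \<in> C" for c
  proof
    assume "sg c = 1"
    then have "0 < Y c" using c pos by simp
    then have "{d \<in> C. Y c < Y d} \<subset> U" using c pos \<open>sg c = 1\<close> by (auto simp: U_def dest: less_trans)
    then show "\<rho> c < n" unfolding \<rho>_def rank_of_def n_def using psubset_card_mono[OF fin(1)] by simp
  next
    assume lt: "\<rho> c < n"
    show "sg c = 1"
    proof (rule ccontr)
      assume "sg c \<noteq> 1"
      then have "U \<subseteq> {d \<in> C. - Y d < - Y c}" using c pos by (auto simp: U_def) (smt (verit))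
      then have "n \<le> \<rho> c" unfolding \<rho>_def rank_of_def n_def by (rule card_mono[rotated]) (use C(1) in simp)
      then show False using lt by simp
    qed
  qed
  interpret comb_diagram C \<sigma> n \<kappa> \<rho>
  proof
    show "bij_betw \<kappa> C {..<2 * n}" unfolding \<kappa>_def card[symmetric] by (rule bij_betw_rank_of[OF C(1) x])
    show "bij_betw \<rho> C {..<2 * n}" unfolding \<rho>_def card[symmetric]
      by (rule bij_betw_rank_of[OF C(1)]) (use Y in \<open>auto simp: inj_on_def\<close>)
    show "\<rho> (\<sigma> c) < n \<longleftrightarrow> \<not> \<rho> c < n" if "c \<in> C" for c using \<rho> nx sg that by force
  qed (use C in auto)
  have "isotopic_poly (quad_index C) (quad_next \<sigma>) (comb \<sigma> C x Y) (comb \<sigma> C (\<lambda>c. real (\<kappa> c)) (\<lambda>c. - real (\<rho> c)))"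
  proof (rule isotopic_comb_rescale[OF C(1,2) next_ne x _ Y])
    show "real (\<kappa> c) < real (\<kappa> d)" if "c \<in> C" "x c < x d" for c d
      using rank_of_less[OF C(1) that(1), of x d] that by (simp add: \<kappa>_def)
    show "- real (\<rho> c) < - real (\<rho> d)" if "d \<in> C" "Y c < Y d" for c d
      using rank_of_less[OF C(1) that(1), of "\<lambda>c. - Y c" c] that by (simp add: \<rho>_def)
  qed
  then show ?thesis
    using n half_grid_upper half_grid_lower upper_lower_compatible presents_grid_link by blast
qed

theorem theorem1p10:
  fixes L :: "(real \<Rightarrow> (real^3) \<times> real) set"
  assumes "tame_link_S3 L"
  shows "\<exists>n Hp Hm. n > 0 \<and> half_grid_diagram n Hp \<and> half_grid_diagram n Hm \<and>
           compatible n Hp Hm \<and> isotopic_links S3 (half_grid_link n Hp Hm) L"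
proof -
  obtain P where P: "polygonal_link P" "isotopic_links S3 (link_in_S3 P) L"
    using assms unfolding tame_link_S3_def by blast
  obtain I :: "((real \<Rightarrow> real^3) \<times> nat) set" and \<sigma> v
    where v: "simple_poly I \<sigma> v" and pres: "presents I \<sigma> v P" and ne: "I \<noteq> {}"
    using polygonal_link_presentation[OF P(1)] by blast
  have nx: "\<sigma> i \<in> I" if "i \<in> I" for i by (rule simple_poly_next_in[OF v that])
  obtain N k l A sg where N: "N > 0" and kl: "subdivision (sub_index (\<lambda>_. N) I) k l"
    and lev: "levelled (sub_index k (sub_index (\<lambda>_. N) I)) (sub_next k (sub_next (\<lambda>_. N) \<sigma>)) A sg"
    and iso1: "isotopic_poly (quad_index (sub_index k (sub_index (\<lambda>_. N) I))) (quad_next (sub_next k (sub_next (\<lambda>_. N) \<sigma>)))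
      (quarters (sub_next k (sub_next (\<lambda>_. N) \<sigma>))
        (sub_vertex l (sub_next (\<lambda>_. N) \<sigma>) (sub_vertex (\<lambda>_ j. real j / real N) \<sigma> v)))
      (staircase (sub_next k (sub_next (\<lambda>_. N) \<sigma>)) A)"
    using levelled_presentation[OF v] by blast
  define C0 \<sigma>0 where "C0 = sub_index (\<lambda>_. N) I" and "\<sigma>0 = sub_next (\<lambda>_. N) \<sigma>"
  define C \<sigma>1 where "C = sub_index k C0" and "\<sigma>1 = sub_next k \<sigma>0"
  define u0 where "u0 = sub_vertex (\<lambda>_ j. real j / real N) \<sigma> v"
  define u1 where "u1 = sub_vertex l \<sigma>0 u0"
  note lev = lev[folded C0_def \<sigma>0_def, folded C_def \<sigma>1_def]
  note iso1 = iso1[folded C0_def \<sigma>0_def u0_def, folded C_def \<sigma>1_def u1_def]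
  have uniform: "subdivision X (\<lambda>_. m) (\<lambda>_ j. real j / real m)" if "m > 0" for X :: "'z set" and m
    using that by (auto simp: subdivision_def divide_strict_right_mono)
  have nx0: "\<sigma>0 i \<in> C0" if "i \<in> C0" for i
    using that nx N by (auto simp: \<sigma>0_def C0_def sub_next_def sub_index_def split: prod.splits if_splits)
  have C: "finite C" "bij_betw \<sigma>1 C C" using lev by (auto simp: levelled_def)
  have nx1: "\<sigma>1 c \<in> C" if "c \<in> C" for c using C(2) that by (auto simp: bij_betw_def)
  \<comment> \<open>Subdividing leaves the curves in \<open>P\<close> unchanged; three subdivisions
    lead to the index set on which the isotopy is defined.\<close>
  have "presents C0 \<sigma>0 u0 P" unfolding C0_def \<sigma>0_def u0_def
    by (rule presents_subdivision[OF pres uniform[OF N] nx])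
  then have "presents C \<sigma>1 u1 P" unfolding C_def \<sigma>1_def u1_def
    by (rule presents_subdivision[OF _ kl[folded C0_def] nx0])
  then have presP: "presents (quad_index C) (quad_next \<sigma>1) (quarters \<sigma>1 u1) P"
    by (rule presents_subdivision[OF _ uniform[of 4, simplified] nx1])
  have sg: "sg c = 1 \<or> sg c = -1" "sg (\<sigma>1 c) = - sg c" if "c \<in> C" for c
    using lev that by (auto simp: levelled_def)
  obtain i where i: "i \<in> I" using ne by blast
  then have "(i, 0) \<in> C0" using N by (simp add: C0_def sub_index_def)
  then have "((i, 0), 0) \<in> C" using kl by (auto simp: C_def C0_def sub_index_def subdivision_def)
  then have Cne: "C \<noteq> {}" by blast
  obtain x Y where xY: "inj_on x C" "inj_on Y C" "\<forall>c\<in>C. Y c > 0 \<longleftrightarrow> sg c = 1"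
    and iso2: "isotopic_poly (quad_index C) (quad_next \<sigma>1) (staircase \<sigma>1 A) (comb \<sigma>1 C x Y)"
    using levelled_isotopic_comb[OF lev] by blast
  have "\<exists>n Hp Hm w. n > 0 \<and> half_grid_diagram n Hp \<and> half_grid_diagram n Hm \<and> compatible n Hp Hm \<and>
    isotopic_poly (quad_index C) (quad_next \<sigma>1) (comb \<sigma>1 C x Y) w \<and>
    presents (quad_index C) (quad_next \<sigma>1) w (grid_link (2 * n) (stack n Hp Hm))"
    by (rule comb_half_grid[where sg = sg]) (use C Cne xY sg in auto)
  then obtain n Hp Hm w where n: "n > 0" "half_grid_diagram n Hp" "half_grid_diagram n Hm" "compatible n Hp Hm"
    and iso3: "isotopic_poly (quad_index C) (quad_next \<sigma>1) (comb \<sigma>1 C x Y) w"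
    and presG: "presents (quad_index C) (quad_next \<sigma>1) w (grid_link (2 * n) (stack n Hp Hm))" by blast
  note iso = isotopic_poly_trans[OF isotopic_poly_trans[OF iso1 iso2] iso3]
  have "isotopic_links S3 (half_grid_link n Hp Hm) (link_in_S3 P)"
    unfolding half_grid_link_def by (rule presents_isotopic[OF iso presG presP])
  then have "isotopic_links S3 (half_grid_link n Hp Hm) L"
  proof (rule isotopic_links_trans[OF _ P(2)])
    fix \<gamma> assume "\<gamma> \<in> half_grid_link n Hp Hm"
    then obtain \<delta> where "\<delta> \<in> grid_link (2 * n) (stack n Hp Hm)" "\<gamma> = to_S3 \<circ> \<delta>"
      by (auto simp: half_grid_link_def link_in_S3_def)
    then show "\<gamma> 1 = \<gamma> 0" using presents_closed[OF presG, of \<delta>] by simp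
  qed
  then show ?thesis using n by blast
qed

end
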